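(* Let $\mathcal{G}=(B,\psi,A)$ be a quantum graph. Then there is an isomorphism of categories $$\mathrm{Rep}_{\mathrm{fin}}(C(\mathrm{Qut}(\mathcal{G})))\cong \mathrm{QAut}(\mathcal{G}),$$ where $\mathrm{Rep}_{\mathrm{fin}}(C(\mathrm{Qut}(\mathcal{G})))$ is the category of finite-dimensional (unital) $*$-representations of the $C^*$-algebra $C(\mathrm{Qut}(\mathcal{G}))$ with intertwining operators as morphisms, and $\mathrm{QAut}(\mathcal{G})$ is the category of quantum automorphisms of $\mathcal{G}$.
   Context: Quantum graphs: let $B$ be a finite-dimensional unital $C^*$-algebra with multiplication map $m:B\otimes B\to B$ and $\psi$ a faithful state on $B$; $L^2(B,\psi)$ is $B$ with inner product $\langle x|y\rangle_\psi=\psi(x^*y)$; $m^\dagger$ is the Hilbert adjoint of $m$ (for $\psi\otimes\psi$ and $\psi$). $(B,\psi)$ is a quantum set if $\psi$ is a $\delta$-form for some $\delta>0$, i.e. $mm^\dagger=\delta^2\mathrm{id}_B$. A quantum graph $(B,\psi,A)$ is a quantum set with a linear operator $A:B\to B$ such that $m(A\otimes A)m^\dagger=\delta^2A$. Quantum automorphisms: a quantum automorphism of $\mathcal{G}$ is a pair $(H,P)$ of a finite-dimensional Hilbert space $H$ (possibly zero) and a linear operator $P:B\otimes H\to H\otimes B$ such that: writing $P(b\otimes h)=\sum_k P^k(b)h\otimes e_k$ for a basis $\{e_k\}$ of $B$ and setting $\tilde P(b)=\sum_k e_k\otimes P^k(b)\in B\otimes B(H)$, the map $\tilde P:B\to B\otimes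 B(H)$ is a unital $*$-homomorphism (equivalently, $P$ is a quantum function); $(\mathrm{id}_H\otimes\psi)P=\psi\otimes \mathrm{id}_H$ and $(P\otimes\mathrm{id}_B)(\mathrm{id}_B\otimes P)(m^\dagger\otimes\mathrm{id}_H)=(\mathrm{id}_H\otimes m^\dagger)P$; and $P(A\otimes\mathrm{id}_H)=(\mathrm{id}_H\otimes A)P$. Morphisms $(H,P)\to(H',P')$ in $\mathrm{QAut}(\mathcal{G})$ are the intertwiners, i.e. linear maps $f:H\to H'$ with $(f\otimes\mathrm{id}_B)P=P'(\mathrm{id}_B\otimes f)$. Quantum automorphism group algebra: fix an orthonormal basis $\{e_i\}_{i=1}^n$ of $L^2(B,\psi)$. $C(\mathrm{Qut}(\mathcal{G}))$ is the universal unital $C^*$-algebra generated by the coefficients $u_i^k$ of a unitary matrix $u=(u_i^k)_{k,i}\in M_n(C(\mathrm{Qut}(\mathcal{G})))$ such that $\rho:B\to B\otimes C(\mathrm{Qut}(\mathcal{G}))$, $\rho(e_i)=\sum_k e_k\otimes u_i^k$, is a unital $*$-homomorphism satisfying $\rho A=(A\otimes\mathrm{id})\rho$. *)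

theory Defs
  imports Complex_Main "HOL-Algebra.Module" "HOL-Library.FuncSet"
begin

section \<open>Complex vector spaces, \<open>*\<close>-algebras and Hilbert spaces on carrier sets\<close>

text \<open>
  Complex vector spaces are HOL-Algebra modules over \<^term>\<open>complex_module\<close>; as usual there, the
  fields \<^const>\<open>mult\<close> and \<^const>\<open>one\<close> are part of the record but play no role for a mere vector
  space. Carriers are subsets of a type, so that the zero algebra and the zero Hilbert space are
  included, and so that one can speak of the collection of all finite-dimensional Hilbert spaces.
\<close>

definition complex_module :: "(complex, complex) module" where
  "complex_module = \<lparr>carrier = UNIV, mult = (*), one = 1, zero = 0, add = (+), smult = (*)\<rparr>"

abbreviation complex_vector_space :: "(complex, 'v, 'x) module_scheme \<Rightarrow> bool" where
  "complex_vector_space V \<equiv> Module.module complex_module V"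

definition clinear ::
  "(complex, 'v, 'x) module_scheme \<Rightarrow> (complex, 'w, 'y) module_scheme \<Rightarrow> ('v \<Rightarrow> 'w) \<Rightarrow> bool" where
  "clinear V W f \<longleftrightarrow>
     f \<in> carrier V \<rightarrow> carrier W \<and>
     (\<forall>x\<in>carrier V. \<forall>y\<in>carrier V. f (x \<oplus>\<^bsub>V\<^esub> y) = f x \<oplus>\<^bsub>W\<^esub> f y) \<and>
     (\<forall>c. \<forall>x\<in>carrier V. f (c \<odot>\<^bsub>V\<^esub> x) = c \<odot>\<^bsub>W\<^esub> f x)"

text \<open>Maps that are compared by equality are taken to be extensional.\<close>

definition linear_maps ::
  "(complex, 'v, 'x) module_scheme \<Rightarrow> (complex, 'w, 'y) module_scheme \<Rightarrow> ('v \<Rightarrow> 'w) set" where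
  "linear_maps V W = {f \<in> extensional (carrier V). clinear V W f}"

definition vector_basis ::
  "(complex, 'v, 'x) module_scheme \<Rightarrow> nat \<Rightarrow> (nat \<Rightarrow> 'v) \<Rightarrow> bool" where
  "vector_basis V n e \<longleftrightarrow>
     (\<forall>i<n. e i \<in> carrier V) \<and>
     (\<forall>v\<in>carrier V. \<exists>!a. a \<in> extensional {..<n} \<and>
        v = (\<Oplus>\<^bsub>V\<^esub>i\<in>{..<n}. a i \<odot>\<^bsub>V\<^esub> e i))"

definition finite_dimensional :: "(complex, 'v, 'x) module_scheme \<Rightarrow> bool" where
  "finite_dimensional V \<longleftrightarrow> (\<exists>n e. vector_basis V n e)"

record 'a star_algebra = "(complex, 'a) module" +
  star :: "'a \<Rightarrow> 'a"

record 'a cstar_algebra = "'a star_algebra" +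
  cnorm :: "'a \<Rightarrow> real"

record 'h hilbert = "(complex, 'h) module" +
  cinner :: "'h \<Rightarrow> 'h \<Rightarrow> complex"

locale unital_star_algebra = ring A + Module.module complex_module A
  for A :: "('a, 'x) star_algebra_scheme" (structure) +
  assumes smult_mult_left:
      "\<lbrakk>x \<in> carrier A; y \<in> carrier A\<rbrakk> \<Longrightarrow> (c \<odot> x) \<otimes> y = c \<odot> (x \<otimes> y)"
    and smult_mult_right:
      "\<lbrakk>x \<in> carrier A; y \<in> carrier A\<rbrakk> \<Longrightarrow> x \<otimes> (c \<odot> y) = c \<odot> (x \<otimes> y)"
    and star_closed: "x \<in> carrier A \<Longrightarrow> star A x \<in> carrier A"
    and star_star: "x \<in> carrier A \<Longrightarrow> star A (star A x) = x"
    and star_add: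
      "\<lbrakk>x \<in> carrier A; y \<in> carrier A\<rbrakk> \<Longrightarrow> star A (x \<oplus> y) = star A x \<oplus> star A y"
    and star_smult: "x \<in> carrier A \<Longrightarrow> star A (c \<odot> x) = cnj c \<odot> star A x"
    and star_mult:
      "\<lbrakk>x \<in> carrier A; y \<in> carrier A\<rbrakk> \<Longrightarrow> star A (x \<otimes> y) = star A y \<otimes> star A x"

locale unital_cstar_algebra = unital_star_algebra A
  for A :: "('a, 'x) cstar_algebra_scheme" (structure) +
  assumes cnorm_nonneg: "x \<in> carrier A \<Longrightarrow> 0 \<le> cnorm A x"
    and cnorm_eq_zero: "x \<in> carrier A \<Longrightarrow> cnorm A x = 0 \<longleftrightarrow> x = \<zero>"
    and cnorm_triangle:
      "\<lbrakk>x \<in> carrier A; y \<in> carrier A\<rbrakk> \<Longrightarrow> cnorm A (x \<oplus> y) \<le> cnorm A x + cnorm A y"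
    and cnorm_smult: "x \<in> carrier A \<Longrightarrow> cnorm A (c \<odot> x) = cmod c * cnorm A x"
    and cnorm_mult:
      "\<lbrakk>x \<in> carrier A; y \<in> carrier A\<rbrakk> \<Longrightarrow> cnorm A (x \<otimes> y) \<le> cnorm A x * cnorm A y"
    and cstar_identity: "x \<in> carrier A \<Longrightarrow> cnorm A (star A x \<otimes> x) = (cnorm A x)\<^sup>2"
    and complete:
      "\<lbrakk>\<And>k. s k \<in> carrier A;
        \<forall>\<epsilon>>0. \<exists>N::nat. \<forall>j\<ge>N. \<forall>k\<ge>N. cnorm A (s j \<ominus> s k) < \<epsilon>\<rbrakk>
       \<Longrightarrow> \<exists>l\<in>carrier A. (\<lambda>k. cnorm A (s k \<ominus> l)) \<longlonglongrightarrow> 0"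

definition star_hom ::
  "('a, 'x) star_algebra_scheme \<Rightarrow> ('b, 'y) star_algebra_scheme \<Rightarrow> ('a \<Rightarrow> 'b) set" where
  "star_hom A B =
     {f \<in> ring_hom A B \<inter> extensional (carrier A).
        (\<forall>c. \<forall>x\<in>carrier A. f (c \<odot>\<^bsub>A\<^esub> x) = c \<odot>\<^bsub>B\<^esub> f x) \<and>
        (\<forall>x\<in>carrier A. f (star A x) = star B (f x))}"

text \<open>\<open>A\<close> is generated by \<open>S\<close> as a unital \<open>C\<^sup>*\<close>-algebra.\<close>

definition cstar_generated_by :: "('a, 'x) cstar_algebra_scheme \<Rightarrow> 'a set \<Rightarrow> bool" where
  "cstar_generated_by A S \<longleftrightarrow>
     S \<subseteq> carrier A \<and>
     (\<forall>T. S \<subseteq> T \<and> T \<subseteq> carrier A \<and> \<one>\<^bsub>A\<^esub> \<in> T \<and>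
        (\<forall>x\<in>T. \<forall>y\<in>T. x \<oplus>\<^bsub>A\<^esub> y \<in> T \<and> x \<otimes>\<^bsub>A\<^esub> y \<in> T) \<and>
        (\<forall>c. \<forall>x\<in>T. c \<odot>\<^bsub>A\<^esub> x \<in> T) \<and>
        (\<forall>x\<in>T. star A x \<in> T) \<and>
        (\<forall>s. \<forall>l\<in>carrier A. (\<forall>k::nat. s k \<in> T) \<and>
            (\<lambda>k. cnorm A (s k \<ominus>\<^bsub>A\<^esub> l)) \<longlonglongrightarrow> 0 \<longrightarrow> l \<in> T)
        \<longrightarrow> T = carrier A)"

text \<open>Inner products are linear in the second argument; completeness is automatic here.\<close>

locale fd_hilbert_space = Module.module complex_module H
  for H :: "('h, 'x) hilbert_scheme" (structure) +
  assumes finite_dim: "finite_dimensional H"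
    and cinner_add_right:
      "\<lbrakk>x \<in> carrier H; y \<in> carrier H; z \<in> carrier H\<rbrakk>
       \<Longrightarrow> cinner H x (y \<oplus> z) = cinner H x y + cinner H x z"
    and cinner_smult_right:
      "\<lbrakk>x \<in> carrier H; y \<in> carrier H\<rbrakk> \<Longrightarrow> cinner H x (c \<odot> y) = c * cinner H x y"
    and cinner_commute:
      "\<lbrakk>x \<in> carrier H; y \<in> carrier H\<rbrakk> \<Longrightarrow> cinner H y x = cnj (cinner H x y)"
    and cinner_nonneg: "x \<in> carrier H \<Longrightarrow> 0 \<le> Re (cinner H x x)"
    and cinner_definite: "\<lbrakk>x \<in> carrier H; cinner H x x = 0\<rbrakk> \<Longrightarrow> x = \<zero>"

definition orthonormal_basis :: "('h, 'x) hilbert_scheme \<Rightarrow> nat \<Rightarrow> (nat \<Rightarrow> 'h) \<Rightarrow> bool" where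
  "orthonormal_basis H n e \<longleftrightarrow>
     vector_basis H n e \<and>
     (\<forall>i<n. \<forall>j<n. cinner H (e i) (e j) = (if i = j then 1 else 0))"

definition adjoint ::
  "('h, 'x) hilbert_scheme \<Rightarrow> ('k, 'y) hilbert_scheme \<Rightarrow> ('h \<Rightarrow> 'k) \<Rightarrow> 'k \<Rightarrow> 'h" where
  "adjoint H K T =
     (\<lambda>y\<in>carrier K. THE x. x \<in> carrier H \<and>
        (\<forall>z\<in>carrier H. cinner H z x = cinner K (T z) y))"

definition operators :: "('h, 'x) hilbert_scheme \<Rightarrow> ('h \<Rightarrow> 'h) cstar_algebra" where
  "operators H =
     \<lparr>carrier = linear_maps H H,
      mult = (\<lambda>S T. compose (carrier H) S T),
      one = (\<lambda>x\<in>carrier H. x),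
      zero = (\<lambda>x\<in>carrier H. \<zero>\<^bsub>H\<^esub>),
      add = (\<lambda>S T. \<lambda>x\<in>carrier H. S x \<oplus>\<^bsub>H\<^esub> T x),
      smult = (\<lambda>c T. \<lambda>x\<in>carrier H. c \<odot>\<^bsub>H\<^esub> T x),
      star = (\<lambda>T. adjoint H H T),
      cnorm = (\<lambda>T. Sup {sqrt (Re (cinner H (T x) (T x))) |x.
                          x \<in> carrier H \<and> Re (cinner H x x) \<le> 1})\<rparr>"


section \<open>Algebraic tensor products\<close>

text \<open>
  \<open>V \<otimes>\<^sub>T W\<close> is the quotient of the free vector space on \<open>V \<times> W\<close> (finitely supported functions) by
  the subspace spanned by the bilinearity relations; its elements are the cosets.
\<close>

definition point_mass :: "'p \<Rightarrow> 'p \<Rightarrow> complex" where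
  "point_mass q = (\<lambda>p. if p = q then 1 else 0)"

definition free_space ::
  "(complex, 'v, 'x) module_scheme \<Rightarrow> (complex, 'w, 'y) module_scheme \<Rightarrow> ('v \<times> 'w \<Rightarrow> complex) set"
  where
  "free_space V W = {f. finite {p. f p \<noteq> 0} \<and> {p. f p \<noteq> 0} \<subseteq> carrier V \<times> carrier W}"

inductive_set bilinear_relations ::
  "(complex, 'v, 'x) module_scheme \<Rightarrow> (complex, 'w, 'y) module_scheme \<Rightarrow> ('v \<times> 'w \<Rightarrow> complex) set"
  for V W where
  rel_zero: "(\<lambda>p. 0) \<in> bilinear_relations V W"
| rel_add: "\<lbrakk>f \<in> bilinear_relations V W; g \<in> bilinear_relations V W\<rbrakk>
    \<Longrightarrow> (\<lambda>p. f p + g p) \<in> bilinear_relations V W"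
| rel_smult: "f \<in> bilinear_relations V W \<Longrightarrow> (\<lambda>p. c * f p) \<in> bilinear_relations V W"
| add_left: "\<lbrakk>x \<in> carrier V; y \<in> carrier V; w \<in> carrier W\<rbrakk> \<Longrightarrow>
    (\<lambda>p. point_mass (x \<oplus>\<^bsub>V\<^esub> y, w) p - point_mass (x, w) p - point_mass (y, w) p)
      \<in> bilinear_relations V W"
| add_right: "\<lbrakk>v \<in> carrier V; x \<in> carrier W; y \<in> carrier W\<rbrakk> \<Longrightarrow>
    (\<lambda>p. point_mass (v, x \<oplus>\<^bsub>W\<^esub> y) p - point_mass (v, x) p - point_mass (v, y) p)
      \<in> bilinear_relations V W"
| smult_left: "\<lbrakk>v \<in> carrier V; w \<in> carrier W\<rbrakk> \<Longrightarrow>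
    (\<lambda>p. point_mass (c \<odot>\<^bsub>V\<^esub> v, w) p - c * point_mass (v, w) p) \<in> bilinear_relations V W"
| smult_right: "\<lbrakk>v \<in> carrier V; w \<in> carrier W\<rbrakk> \<Longrightarrow>
    (\<lambda>p. point_mass (v, c \<odot>\<^bsub>W\<^esub> w) p - c * point_mass (v, w) p) \<in> bilinear_relations V W"

type_synonym ('v, 'w) tens = "('v \<times> 'w \<Rightarrow> complex) set"

definition tensor_class ::
  "(complex, 'v, 'x) module_scheme \<Rightarrow> (complex, 'w, 'y) module_scheme \<Rightarrow>
    ('v \<times> 'w \<Rightarrow> complex) \<Rightarrow> ('v, 'w) tens" where
  "tensor_class V W f = {g. (\<lambda>p. g p - f p) \<in> bilinear_relations V W}"

definition tensor_rep :: "('v, 'w) tens \<Rightarrow> 'v \<times> 'w \<Rightarrow> complex" where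
  "tensor_rep t = (SOME f. f \<in> t)"

definition tensor_space ::
  "(complex, 'v, 'x) module_scheme \<Rightarrow> (complex, 'w, 'y) module_scheme \<Rightarrow>
    (complex, ('v, 'w) tens) module" (infixr \<open>\<otimes>\<^sub>T\<close> 75) where
  "V \<otimes>\<^sub>T W =
     \<lparr>carrier = tensor_class V W ` free_space V W,
      mult = undefined,
      one = undefined,
      zero = tensor_class V W (\<lambda>p. 0),
      add = (\<lambda>s t. tensor_class V W (\<lambda>p. tensor_rep s p + tensor_rep t p)),
      smult = (\<lambda>c t. tensor_class V W (\<lambda>p. c * tensor_rep t p))\<rparr>"

definition simple_tensor ::
  "(complex, 'v, 'x) module_scheme \<Rightarrow> (complex, 'w, 'y) module_scheme \<Rightarrow> 'v \<Rightarrow> 'w \<Rightarrow> ('v, 'w) tens"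
  where
  "simple_tensor V W v w = tensor_class V W (point_mass (v, w))"

text \<open>
  The linear map \<open>V \<otimes> W \<rightarrow> Z\<close>, \<open>v \<otimes> w \<mapsto> \<beta> v w\<close> induced by a bilinear map \<open>\<beta>\<close>; for bilinear \<open>\<beta>\<close>
  the value does not depend on the chosen representative.
\<close>

definition tensor_lift ::
  "(complex, 'z, 'x) module_scheme \<Rightarrow> ('v \<Rightarrow> 'w \<Rightarrow> 'z) \<Rightarrow> ('v, 'w) tens \<Rightarrow> 'z" where
  "tensor_lift Z \<beta> t =
     (\<Oplus>\<^bsub>Z\<^esub>p\<in>{p. tensor_rep t p \<noteq> 0}. tensor_rep t p \<odot>\<^bsub>Z\<^esub> \<beta> (fst p) (snd p))"

text \<open>\<open>f \<otimes> g\<close>, for maps \<open>f\<close> into \<open>V'\<close> and \<open>g\<close> into \<open>W'\<close>.\<close>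

definition tensor_map ::
  "(complex, 'v2, 'x) module_scheme \<Rightarrow> (complex, 'w2, 'y) module_scheme \<Rightarrow>
    ('v \<Rightarrow> 'v2) \<Rightarrow> ('w \<Rightarrow> 'w2) \<Rightarrow> ('v, 'w) tens \<Rightarrow> ('v2, 'w2) tens" where
  "tensor_map V' W' f g = tensor_lift (V' \<otimes>\<^sub>T W') (\<lambda>v w. simple_tensor V' W' (f v) (g w))"

text \<open>The canonical isomorphism \<open>(U \<otimes> V) \<otimes> W \<rightarrow> U \<otimes> (V \<otimes> W)\<close> and its inverse.\<close>

definition tensor_assoc ::
  "(complex, 'u, 'x) module_scheme \<Rightarrow> (complex, 'v, 'y) module_scheme \<Rightarrow>
    (complex, 'w, 'z) module_scheme \<Rightarrow> (('u, 'v) tens, 'w) tens \<Rightarrow> ('u, ('v, 'w) tens) tens" where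
  "tensor_assoc U V W =
     tensor_lift (U \<otimes>\<^sub>T (V \<otimes>\<^sub>T W)) (\<lambda>s w.
       tensor_lift (U \<otimes>\<^sub>T (V \<otimes>\<^sub>T W)) (\<lambda>u v.
         simple_tensor U (V \<otimes>\<^sub>T W) u (simple_tensor V W v w)) s)"

definition tensor_assoc_inv ::
  "(complex, 'u, 'x) module_scheme \<Rightarrow> (complex, 'v, 'y) module_scheme \<Rightarrow>
    (complex, 'w, 'z) module_scheme \<Rightarrow> ('u, ('v, 'w) tens) tens \<Rightarrow> (('u, 'v) tens, 'w) tens" where
  "tensor_assoc_inv U V W =
     tensor_lift ((U \<otimes>\<^sub>T V) \<otimes>\<^sub>T W) (\<lambda>u s.
       tensor_lift ((U \<otimes>\<^sub>T V) \<otimes>\<^sub>T W) (\<lambda>v w.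
         simple_tensor (U \<otimes>\<^sub>T V) W (simple_tensor U V u v) w) s)"

text \<open>
  The tensor product of \<open>*\<close>-algebras. It is only used with a finite-dimensional first factor, in
  which case the algebraic tensor product of \<open>C\<^sup>*\<close>-algebras is already complete.
\<close>

definition tensor_algebra ::
  "('a, 'x) star_algebra_scheme \<Rightarrow> ('b, 'y) star_algebra_scheme \<Rightarrow> ('a, 'b) tens star_algebra" where
  "tensor_algebra A B =
     \<lparr>carrier = carrier (A \<otimes>\<^sub>T B),
      mult = (\<lambda>s t. tensor_lift (A \<otimes>\<^sub>T B) (\<lambda>a b.
                tensor_lift (A \<otimes>\<^sub>T B) (\<lambda>a' b'.
                  simple_tensor A B (a \<otimes>\<^bsub>A\<^esub> a') (b \<otimes>\<^bsub>B\<^esub> b')) t) s),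
      one = simple_tensor A B \<one>\<^bsub>A\<^esub> \<one>\<^bsub>B\<^esub>,
      zero = \<zero>\<^bsub>A \<otimes>\<^sub>T B\<^esub>,
      add = add (A \<otimes>\<^sub>T B),
      smult = smult (A \<otimes>\<^sub>T B),
      star = (\<lambda>t. \<Oplus>\<^bsub>A \<otimes>\<^sub>T B\<^esub>p\<in>{p. tensor_rep t p \<noteq> 0}.
                cnj (tensor_rep t p) \<odot>\<^bsub>A \<otimes>\<^sub>T B\<^esub>
                  simple_tensor A B (star A (fst p)) (star B (snd p)))\<rparr>"

text \<open>The inner product with \<open>\<langle>v \<otimes> w, v' \<otimes> w'\<rangle> = \<langle>v, v'\<rangle> \<langle>w, w'\<rangle>\<close>.\<close>

definition tensor_hilbert ::
  "('h, 'x) hilbert_scheme \<Rightarrow> ('k, 'y) hilbert_scheme \<Rightarrow> ('h, 'k) tens hilbert" where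
  "tensor_hilbert H K =
     \<lparr>carrier = carrier (H \<otimes>\<^sub>T K),
      mult = undefined,
      one = undefined,
      zero = \<zero>\<^bsub>H \<otimes>\<^sub>T K\<^esub>,
      add = add (H \<otimes>\<^sub>T K),
      smult = smult (H \<otimes>\<^sub>T K),
      cinner = (\<lambda>s t. \<Sum>p\<in>{p. tensor_rep s p \<noteq> 0}. \<Sum>q\<in>{q. tensor_rep t q \<noteq> 0}.
                  cnj (tensor_rep s p) * tensor_rep t q *
                  (cinner H (fst p) (fst q) * cinner K (snd p) (snd q)))\<rparr>"


section \<open>Quantum graphs\<close>

definition faithful_state :: "'b cstar_algebra \<Rightarrow> ('b \<Rightarrow> complex) \<Rightarrow> bool" where
  "faithful_state B \<psi> \<longleftrightarrow>
     clinear B complex_module \<psi> \<and> \<psi> \<one>\<^bsub>B\<^esub> = 1 \<and>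
     (\<forall>x\<in>carrier B. \<psi> (star B x \<otimes>\<^bsub>B\<^esub> x) \<in> \<real> \<and> 0 \<le> Re (\<psi> (star B x \<otimes>\<^bsub>B\<^esub> x))) \<and>
     (\<forall>x\<in>carrier B. \<psi> (star B x \<otimes>\<^bsub>B\<^esub> x) = 0 \<longrightarrow> x = \<zero>\<^bsub>B\<^esub>)"

definition L2 :: "'b cstar_algebra \<Rightarrow> ('b \<Rightarrow> complex) \<Rightarrow> 'b hilbert" where
  "L2 B \<psi> =
     \<lparr>carrier = carrier B, mult = mult B, one = one B, zero = zero B, add = add B, smult = smult B,
      cinner = (\<lambda>x y. \<psi> (star B x \<otimes>\<^bsub>B\<^esub> y))\<rparr>"

definition mult_map :: "'b cstar_algebra \<Rightarrow> ('b, 'b) tens \<Rightarrow> 'b" where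
  "mult_map B = tensor_lift B (\<lambda>x y. x \<otimes>\<^bsub>B\<^esub> y)"

text \<open>The adjoint \<open>m\<^sup>\<dagger>\<close> of the multiplication map.\<close>

definition comult :: "'b cstar_algebra \<Rightarrow> ('b \<Rightarrow> complex) \<Rightarrow> 'b \<Rightarrow> ('b, 'b) tens" where
  "comult B \<psi> = adjoint (tensor_hilbert (L2 B \<psi>) (L2 B \<psi>)) (L2 B \<psi>) (mult_map B)"

definition delta_form :: "'b cstar_algebra \<Rightarrow> ('b \<Rightarrow> complex) \<Rightarrow> real \<Rightarrow> bool" where
  "delta_form B \<psi> \<delta> \<longleftrightarrow>
     0 < \<delta> \<and>
     (\<forall>x\<in>carrier B. mult_map B (comult B \<psi> x) = complex_of_real (\<delta>\<^sup>2) \<odot>\<^bsub>B\<^esub> x)"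

definition quantum_set :: "'b cstar_algebra \<Rightarrow> ('b \<Rightarrow> complex) \<Rightarrow> real \<Rightarrow> bool" where
  "quantum_set B \<psi> \<delta> \<longleftrightarrow>
     unital_cstar_algebra B \<and> finite_dimensional B \<and> faithful_state B \<psi> \<and> delta_form B \<psi> \<delta>"

definition quantum_graph ::
  "'b cstar_algebra \<Rightarrow> ('b \<Rightarrow> complex) \<Rightarrow> ('b \<Rightarrow> 'b) \<Rightarrow> bool" where
  "quantum_graph B \<psi> A \<longleftrightarrow>
     clinear B B A \<and>
     (\<exists>\<delta>. quantum_set B \<psi> \<delta> \<and>
        (\<forall>x\<in>carrier B. mult_map B (tensor_map B B A A (comult B \<psi> x)) =
            complex_of_real (\<delta>\<^sup>2) \<odot>\<^bsub>B\<^esub> A x))"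


section \<open>Categories\<close>

record ('o, 'm) category =
  Obj :: "'o set"
  Arr :: "'o \<Rightarrow> 'o \<Rightarrow> 'm set"
  Comp :: "'o \<Rightarrow> 'o \<Rightarrow> 'o \<Rightarrow> 'm \<Rightarrow> 'm \<Rightarrow> 'm"
  Ident :: "'o \<Rightarrow> 'm"

text \<open>\<open>Comp C X Y Z g f\<close> is the composite of \<open>f : X \<rightarrow> Y\<close> and \<open>g : Y \<rightarrow> Z\<close>.\<close>

definition is_category :: "('o, 'm) category \<Rightarrow> bool" where
  "is_category C \<longleftrightarrow>
     (\<forall>X\<in>Obj C. Ident C X \<in> Arr C X X) \<and>
     (\<forall>X\<in>Obj C. \<forall>Y\<in>Obj C. \<forall>Z\<in>Obj C. \<forall>f\<in>Arr C X Y. \<forall>g\<in>Arr C Y Z.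
        Comp C X Y Z g f \<in> Arr C X Z) \<and>
     (\<forall>X\<in>Obj C. \<forall>Y\<in>Obj C. \<forall>f\<in>Arr C X Y.
        Comp C X X Y f (Ident C X) = f \<and> Comp C X Y Y (Ident C Y) f = f) \<and>
     (\<forall>W\<in>Obj C. \<forall>X\<in>Obj C. \<forall>Y\<in>Obj C. \<forall>Z\<in>Obj C.
        \<forall>f\<in>Arr C W X. \<forall>g\<in>Arr C X Y. \<forall>h\<in>Arr C Y Z.
        Comp C W X Z (Comp C X Y Z h g) f = Comp C W Y Z h (Comp C W X Y g f))"

definition is_functor ::
  "('o, 'm) category \<Rightarrow> ('p, 'n) category \<Rightarrow> ('o \<Rightarrow> 'p) \<Rightarrow> ('o \<Rightarrow> 'o \<Rightarrow> 'm \<Rightarrow> 'n) \<Rightarrow> bool" where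
  "is_functor C D F\<^sub>o F\<^sub>m \<longleftrightarrow>
     F\<^sub>o \<in> Obj C \<rightarrow> Obj D \<and>
     (\<forall>X\<in>Obj C. \<forall>Y\<in>Obj C. F\<^sub>m X Y \<in> Arr C X Y \<rightarrow> Arr D (F\<^sub>o X) (F\<^sub>o Y)) \<and>
     (\<forall>X\<in>Obj C. F\<^sub>m X X (Ident C X) = Ident D (F\<^sub>o X)) \<and>
     (\<forall>X\<in>Obj C. \<forall>Y\<in>Obj C. \<forall>Z\<in>Obj C. \<forall>f\<in>Arr C X Y. \<forall>g\<in>Arr C Y Z.
        F\<^sub>m X Z (Comp C X Y Z g f) =
          Comp D (F\<^sub>o X) (F\<^sub>o Y) (F\<^sub>o Z) (F\<^sub>m Y Z g) (F\<^sub>m X Y f))"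

definition isomorphic_categories :: "('o, 'm) category \<Rightarrow> ('p, 'n) category \<Rightarrow> bool" where
  "isomorphic_categories C D \<longleftrightarrow>
     is_category C \<and> is_category D \<and>
     (\<exists>F\<^sub>o F\<^sub>m. is_functor C D F\<^sub>o F\<^sub>m \<and> bij_betw F\<^sub>o (Obj C) (Obj D) \<and>
        (\<forall>X\<in>Obj C. \<forall>Y\<in>Obj C. bij_betw (F\<^sub>m X Y) (Arr C X Y) (Arr D (F\<^sub>o X) (F\<^sub>o Y))))"


section \<open>Quantum automorphisms\<close>

text \<open>
  For a basis \<open>e\<close> of \<open>B\<close> write \<open>P (b \<otimes> h) = \<Sum>\<^sub>k P\<^sup>k(b) h \<otimes> e\<^sub>k\<close>; then
  \<open>b \<mapsto> \<Sum>\<^sub>k e\<^sub>k \<otimes> P\<^sup>k(b) \<in> B \<otimes> B(H)\<close> does not depend on \<open>e\<close>.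
\<close>

definition quantum_function ::
  "'b cstar_algebra \<Rightarrow> 'h hilbert \<Rightarrow> (('b, 'h) tens \<Rightarrow> ('h, 'b) tens) \<Rightarrow> bool" where
  "quantum_function B H P \<longleftrightarrow>
     (\<exists>n e (p :: nat \<Rightarrow> 'b \<Rightarrow> 'h \<Rightarrow> 'h).
        vector_basis B n e \<and>
        (\<forall>k<n. \<forall>b\<in>carrier B. p k b \<in> carrier (operators H)) \<and>
        (\<forall>b\<in>carrier B. \<forall>h\<in>carrier H.
           P (simple_tensor B H b h) =
             (\<Oplus>\<^bsub>H \<otimes>\<^sub>T B\<^esub>k\<in>{..<n}. simple_tensor H B (p k b h) (e k))) \<and>
        (\<lambda>b\<in>carrier B. \<Oplus>\<^bsub>B \<otimes>\<^sub>T operators H\<^esub>k\<in>{..<n}.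
             simple_tensor B (operators H) (e k) (p k b))
          \<in> star_hom B (tensor_algebra B (operators H)))"

text \<open>The identity \<open>(id \<otimes> \<psi>) P = \<psi> \<otimes> id\<close> uses \<open>H \<otimes> \<complex> = H = \<complex> \<otimes> H\<close>.\<close>

definition preserves_counit ::
  "'b cstar_algebra \<Rightarrow> ('b \<Rightarrow> complex) \<Rightarrow> 'h hilbert \<Rightarrow> (('b, 'h) tens \<Rightarrow> ('h, 'b) tens) \<Rightarrow> bool" where
  "preserves_counit B \<psi> H P \<longleftrightarrow>
     (\<forall>t\<in>carrier (B \<otimes>\<^sub>T H).
        tensor_lift H (\<lambda>h b. \<psi> b \<odot>\<^bsub>H\<^esub> h) (P t) = tensor_lift H (\<lambda>b h. \<psi> b \<odot>\<^bsub>H\<^esub> h) t)"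

text \<open>\<open>(P \<otimes> id) (id \<otimes> P) (m\<^sup>\<dagger> \<otimes> id) = (id \<otimes> m\<^sup>\<dagger>) P\<close>, with associators made explicit.\<close>

definition preserves_comult ::
  "'b cstar_algebra \<Rightarrow> ('b \<Rightarrow> complex) \<Rightarrow> 'h hilbert \<Rightarrow> (('b, 'h) tens \<Rightarrow> ('h, 'b) tens) \<Rightarrow> bool" where
  "preserves_comult B \<psi> H P \<longleftrightarrow>
     (\<forall>t\<in>carrier (B \<otimes>\<^sub>T H).
        tensor_assoc H B B
          (tensor_map (H \<otimes>\<^sub>T B) B P (\<lambda>b. b)
            (tensor_assoc_inv B H B
              (tensor_map B (H \<otimes>\<^sub>T B) (\<lambda>b. b) P
                (tensor_assoc B B H
                  (tensor_map (B \<otimes>\<^sub>T B) H (comult B \<psi>) (\<lambda>h. h) t)))))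
        = tensor_map H (B \<otimes>\<^sub>T B) (\<lambda>h. h) (comult B \<psi>) (P t))"

definition quantum_automorphism ::
  "'b cstar_algebra \<Rightarrow> ('b \<Rightarrow> complex) \<Rightarrow> ('b \<Rightarrow> 'b) \<Rightarrow> 'h hilbert \<Rightarrow>
    (('b, 'h) tens \<Rightarrow> ('h, 'b) tens) \<Rightarrow> bool" where
  "quantum_automorphism B \<psi> A H P \<longleftrightarrow>
     fd_hilbert_space H \<and> P \<in> linear_maps (B \<otimes>\<^sub>T H) (H \<otimes>\<^sub>T B) \<and>
     quantum_function B H P \<and> preserves_counit B \<psi> H P \<and> preserves_comult B \<psi> H P \<and>
     (\<forall>t\<in>carrier (B \<otimes>\<^sub>T H).
        P (tensor_map B H A (\<lambda>h. h) t) = tensor_map H B (\<lambda>h. h) A (P t))"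

definition QAut ::
  "'b cstar_algebra \<Rightarrow> ('b \<Rightarrow> complex) \<Rightarrow> ('b \<Rightarrow> 'b) \<Rightarrow>
    ('h hilbert \<times> (('b, 'h) tens \<Rightarrow> ('h, 'b) tens), 'h \<Rightarrow> 'h) category" where
  "QAut B \<psi> A =
     \<lparr>Obj = {(H, P). quantum_automorphism B \<psi> A H P},
      Arr = (\<lambda>(H, P) (H', P'). {f \<in> linear_maps H H'.
               \<forall>t\<in>carrier (B \<otimes>\<^sub>T H).
                 tensor_map H' B f (\<lambda>b. b) (P t) = P' (tensor_map B H' (\<lambda>b. b) f t)}),
      Comp = (\<lambda>X Y Z g f. compose (carrier (fst X)) g f),
      Ident = (\<lambda>X. \<lambda>x\<in>carrier (fst X). x)\<rparr>"


section \<open>The quantum automorphism group algebra and its representations\<close>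

text \<open>
  A matrix is a function \<open>v\<close> with \<open>v k i\<close> the entry \<open>v\<^sub>i\<^sup>k\<close> in row \<open>k\<close> and column \<open>i\<close>.
  \<open>coaction\<close> is the linear map \<open>\<rho> : B \<rightarrow> B \<otimes> D\<close> with \<open>\<rho> e\<^sub>i = \<Sum>\<^sub>k e\<^sub>k \<otimes> v\<^sub>i\<^sup>k\<close>, for an orthonormal
  basis \<open>e\<close> of \<open>L\<^sup>2(B, \<psi>)\<close>.
\<close>

definition coaction ::
  "'b cstar_algebra \<Rightarrow> ('b \<Rightarrow> complex) \<Rightarrow> nat \<Rightarrow> (nat \<Rightarrow> 'b) \<Rightarrow> 'd cstar_algebra \<Rightarrow>
    (nat \<Rightarrow> nat \<Rightarrow> 'd) \<Rightarrow> 'b \<Rightarrow> ('b, 'd) tens" where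
  "coaction B \<psi> n e D v =
     (\<lambda>b\<in>carrier B. \<Oplus>\<^bsub>B \<otimes>\<^sub>T D\<^esub>i\<in>{..<n}. cinner (L2 B \<psi>) (e i) b \<odot>\<^bsub>B \<otimes>\<^sub>T D\<^esub>
        (\<Oplus>\<^bsub>B \<otimes>\<^sub>T D\<^esub>k\<in>{..<n}. simple_tensor B D (e k) (v k i)))"

definition unitary_matrix :: "'d cstar_algebra \<Rightarrow> nat \<Rightarrow> (nat \<Rightarrow> nat \<Rightarrow> 'd) \<Rightarrow> bool" where
  "unitary_matrix D n v \<longleftrightarrow>
     (\<forall>k<n. \<forall>i<n. v k i \<in> carrier D) \<and>
     (\<forall>i<n. \<forall>j<n. (\<Oplus>\<^bsub>D\<^esub>k\<in>{..<n}. star D (v k i) \<otimes>\<^bsub>D\<^esub> v k j) =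
        (if i = j then \<one>\<^bsub>D\<^esub> else \<zero>\<^bsub>D\<^esub>)) \<and>
     (\<forall>k<n. \<forall>l<n. (\<Oplus>\<^bsub>D\<^esub>i\<in>{..<n}. v k i \<otimes>\<^bsub>D\<^esub> star D (v l i)) =
        (if k = l then \<one>\<^bsub>D\<^esub> else \<zero>\<^bsub>D\<^esub>))"

definition Qut_relations ::
  "'b cstar_algebra \<Rightarrow> ('b \<Rightarrow> complex) \<Rightarrow> ('b \<Rightarrow> 'b) \<Rightarrow> nat \<Rightarrow> (nat \<Rightarrow> 'b) \<Rightarrow>
    'd cstar_algebra \<Rightarrow> (nat \<Rightarrow> nat \<Rightarrow> 'd) \<Rightarrow> bool" where
  "Qut_relations B \<psi> A n e D v \<longleftrightarrow>
     unitary_matrix D n v \<and>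
     coaction B \<psi> n e D v \<in> star_hom B (tensor_algebra B D) \<and>
     (\<forall>b\<in>carrier B. coaction B \<psi> n e D v (A b) =
        tensor_map B D A (\<lambda>d. d) (coaction B \<psi> n e D v b))"

text \<open>
  \<open>C\<close> with generators \<open>u k i\<close> is the universal unital \<open>C\<^sup>*\<close>-algebra subject to these relations,
  i.e. (a copy of) \<open>C(Qut(B, \<psi>, A))\<close>. In the universal property, test algebras \<open>D\<close> have carriers
  in the type \<^typ>\<open>nat \<Rightarrow> complex\<close>. This is no restriction: only the unital \<open>C\<^sup>*\<close>-subalgebra
  generated by the finitely many \<open>v k i\<close> matters, which is separable, hence has at most the
  cardinality of the continuum and is isomorphic to one carried by a subset of that type.
\<close>

definition is_Qut_algebra ::
  "'b cstar_algebra \<Rightarrow> ('b \<Rightarrow> complex) \<Rightarrow> ('b \<Rightarrow> 'b) \<Rightarrow> nat \<Rightarrow> (nat \<Rightarrow> 'b) \<Rightarrow>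
    'c cstar_algebra \<Rightarrow> (nat \<Rightarrow> nat \<Rightarrow> 'c) \<Rightarrow> bool" where
  "is_Qut_algebra B \<psi> A n e C u \<longleftrightarrow>
     unital_cstar_algebra C \<and>
     Qut_relations B \<psi> A n e C u \<and>
     cstar_generated_by C {u k i |k i. k < n \<and> i < n} \<and>
     (\<forall>(D :: (nat \<Rightarrow> complex) cstar_algebra) v.
        unital_cstar_algebra D \<and> Qut_relations B \<psi> A n e D v \<longrightarrow>
        (\<exists>!\<phi>. \<phi> \<in> star_hom C D \<and> (\<forall>k<n. \<forall>i<n. \<phi> (u k i) = v k i)))"

definition Rep_fin ::
  "'c cstar_algebra \<Rightarrow> ('h hilbert \<times> ('c \<Rightarrow> 'h \<Rightarrow> 'h), 'h \<Rightarrow> 'h) category" where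
  "Rep_fin C =
     \<lparr>Obj = {(H, \<pi>). fd_hilbert_space H \<and> \<pi> \<in> star_hom C (operators H)},
      Arr = (\<lambda>(H, \<pi>) (H', \<pi>'). {f \<in> linear_maps H H'.
               \<forall>c\<in>carrier C. \<forall>h\<in>carrier H. f (\<pi> c h) = \<pi>' c (f h)}),
      Comp = (\<lambda>X Y Z g f. compose (carrier (fst X)) g f),
      Ident = (\<lambda>X. \<lambda>x\<in>carrier (fst X). x)\<rparr>"

end

theory Submission
  imports Defs "HOL-Library.Nat_Bijection"
begin

text \<open>
  A finite-dimensional representation \<open>\<pi>\<close> of \<open>C(Qut(G))\<close> on \<open>H\<close> gives the linear map
  \<open>P (b \<otimes> h) = \<Sum>\<^sub>k \<rho>\<^sub>k(b) h \<otimes> e\<^sub>k\<close> with \<open>\<rho>\<^sub>k(b) = \<Sum>\<^sub>i \<langle>e\<^sub>i, b\<rangle> \<pi>(u\<^sub>i\<^sup>k)\<close>, and the functor is the identity on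
  intertwiners. Three things have to be seen: \<open>P\<close> is a quantum automorphism precisely when the matrix
  \<open>\<rho>\<^sub>k(e\<^sub>i)\<close> satisfies the defining relations of \<open>C(Qut(G))\<close> in the algebra of operators; such matrices
  correspond to representations; and both sides have the same intertwiners.

  The first point is settled in coordinates. A tensor in \<open>B \<otimes> D\<close> is the same as its family of slices
  along the basis \<open>e\<close>, so that every condition on \<open>P\<close> and on the coaction becomes a system of equations
  between the coefficients \<open>\<rho>\<^sub>k(b)\<close> (\<open>star_hom_iff_slices\<close>, \<open>quantum_function_iff\<close>,
  \<open>commutes_with_A_iff\<close>, \<open>preserves_counit_iff\<close>, \<open>preserves_comult_iff\<close>). The homomorphism property and
  the compatibility with \<open>A\<close> give the same equations on both sides. What remains is to compare the
  unitarity of \<open>u\<close> with the compatibility of \<open>P\<close> with \<open>\<psi>\<close> and \<open>m\<^sup>\<dagger>\<close>. For a unital \<open>*\<close>-homomorphism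
  \<open>\<rho>\<close> one has \<open>(\<psi> \<otimes> id) \<rho>(x\<^sup>*y) = \<Sum>\<^sub>k \<rho>\<^sub>k(x)\<^sup>* \<rho>\<^sub>k(y)\<close>, so that preserving \<open>\<psi>\<close> means that the columns
  of \<open>u\<close> are orthonormal. Given this, orthonormality of the rows yields the comultiplication identity
  by moving \<open>\<langle>e\<^sub>i e\<^sub>j, b\<rangle> 1 = \<Sum>\<^sub>m \<rho>\<^sub>m(e\<^sub>i e\<^sub>j)\<^sup>* \<rho>\<^sub>m(b)\<close> into it; conversely, the comultiplication
  identity at \<open>b = 1\<close> is orthonormality of the rows up to an invertible matrix (\<open>unitary_iff\<close>). This is pure algebra and holds
  over any unital \<open>*\<close>-algebra \<open>D\<close>.

  The other two points are applications of the universal property. It concerns algebras with carriers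
  in \<open>nat \<Rightarrow> complex\<close>, into which matrix entries encode operators and pairs of operators. It is applied
  to the \<open>C\<^sup>*\<close>-algebra of all pairs \<open>(S, S')\<close> of operators such that a fixed linear map \<open>f\<close>
  intertwines \<open>S\<close> with \<open>S'\<close> and \<open>S\<^sup>*\<close> with \<open>S'\<^sup>*\<close>. For \<open>f = id\<close> this is the algebra of operators, and
  representations correspond to matrices that satisfy the relations (\<open>representation_exists\<close>,
  \<open>representation_unique\<close>). For an intertwiner \<open>f\<close> of the generating matrices, the \<open>*\<close>-relations express
  the adjoints of generators linearly in the generators, so that the pairs of generators lie in that
  algebra. Hence all pairs \<open>(\<pi>(c), \<pi>'(c))\<close> do, and \<open>f\<close> intertwines the representations
  (\<open>intertwines_all\<close>).
\<close>

section \<open>Linear algebra on carrier sets\<close>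

lemma complex_module_simps [simp]:
  "carrier complex_module = UNIV" "mult complex_module = (*)" "one complex_module = 1"
  "zero complex_module = 0" "add complex_module = (+)" "smult complex_module = (*)"
  by (simp_all add: complex_module_def)

lemma cring_complex_module: "cring complex_module"
proof (intro cringI abelian_groupI comm_monoidI)
  fix x :: complex
  show "\<exists>y\<in>carrier complex_module. y \<oplus>\<^bsub>complex_module\<^esub> x = \<zero>\<^bsub>complex_module\<^esub>"
    by (rule bexI[of _ "- x"]) auto
qed (auto simp: algebra_simps)

lemma complex_vector_space_complex_module: "complex_vector_space complex_module"
  using cring_complex_module
  by (intro moduleI) (auto simp: algebra_simps cring_def ring_def)

locale complex_space = Module.module complex_module V
  for V :: "(complex, 'v, 'x) module_scheme" (structure)

lemma complex_space_complex_module [simp]: "complex_space complex_module"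
  using complex_vector_space_complex_module by (simp add: complex_space_def)

lemma complex_spaceI:
  fixes V (structure)
  assumes "abelian_group V"
    and "\<And>a x. x \<in> carrier V \<Longrightarrow> a \<odot> x \<in> carrier V"
    and "\<And>a b x. x \<in> carrier V \<Longrightarrow> (a + b) \<odot> x = (a \<odot> x) \<oplus> (b \<odot> x)"
    and "\<And>a x y. x \<in> carrier V \<Longrightarrow> y \<in> carrier V \<Longrightarrow> a \<odot> (x \<oplus> y) = (a \<odot> x) \<oplus> (a \<odot> y)"
    and "\<And>a b x. x \<in> carrier V \<Longrightarrow> (a * b) \<odot> x = a \<odot> (b \<odot> x)"
    and "\<And>x. x \<in> carrier V \<Longrightarrow> 1 \<odot> x = x"
  shows "complex_space V"
  unfolding complex_space_def using assms
  by (intro moduleI cring_complex_module) auto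

context complex_space
begin

lemma smult_in [simp, intro]: "x \<in> carrier V \<Longrightarrow> c \<odot> x \<in> carrier V"
  by simp

lemma smult_plus: "x \<in> carrier V \<Longrightarrow> (a + b) \<odot> x = (a \<odot> x) \<oplus> (b \<odot> x)"
  using smult_l_distr[of a b x] by simp

lemma smult_add:
  "x \<in> carrier V \<Longrightarrow> y \<in> carrier V \<Longrightarrow> a \<odot> (x \<oplus> y) = (a \<odot> x) \<oplus> (a \<odot> y)"
  using smult_r_distr[of a x y] by simp

lemma smult_smult: "x \<in> carrier V \<Longrightarrow> a \<odot> (b \<odot> x) = (a * b) \<odot> x"
  using smult_assoc1[of a b x] by simp

lemma one_smult [simp]: "x \<in> carrier V \<Longrightarrow> 1 \<odot> x = x"
  using smult_one by simp

lemma zero_smult [simp]: "x \<in> carrier V \<Longrightarrow> 0 \<odot> x = \<zero>"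
  using smult_l_null by simp

lemma smult_zero [simp]: "c \<odot> \<zero> = \<zero>"
  using smult_r_null[of c] by simp

lemma uminus_eq_smult: "x \<in> carrier V \<Longrightarrow> \<ominus> x = (-1) \<odot> x"
  using smult_plus[of x "-1" 1] by (intro minus_equality) auto

lemma minus_eq_smult: "x \<in> carrier V \<Longrightarrow> y \<in> carrier V \<Longrightarrow> x \<ominus> y = x \<oplus> (-1) \<odot> y"
  by (simp add: a_minus_def uminus_eq_smult)

lemma smult_finsum:
  "f \<in> S \<rightarrow> carrier V \<Longrightarrow> c \<odot> (\<Oplus>i\<in>S. f i) = (\<Oplus>i\<in>S. c \<odot> f i)"
  by (induction S rule: infinite_finite_induct)
     (auto simp: Pi_def smult_add finsum_infinite finsum_empty finsum_insert)

lemma sum_smult: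
  "x \<in> carrier V \<Longrightarrow> (\<Sum>i\<in>S. c i) \<odot> x = (\<Oplus>i\<in>S. c i \<odot> x)"
  by (induction S rule: infinite_finite_induct)
     (auto simp: Pi_def smult_plus finsum_infinite finsum_empty finsum_insert)

lemma finsum_swap:
  assumes "finite S" "finite T" "\<And>i j. i \<in> S \<Longrightarrow> j \<in> T \<Longrightarrow> f i j \<in> carrier V"
  shows "(\<Oplus>i\<in>S. \<Oplus>j\<in>T. f i j) = (\<Oplus>j\<in>T. \<Oplus>i\<in>S. f i j)"
  using assms(1,3)
proof (induction S rule: finite_induct)
  case empty
  then show ?case by (simp add: finsum_zero)
next
  case (insert x F)
  have "(\<Oplus>i\<in>insert x F. \<Oplus>j\<in>T. f i j) = (\<Oplus>j\<in>T. f x j) \<oplus> (\<Oplus>j\<in>T. \<Oplus>i\<in>F. f i j)"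
    using insert by (subst finsum_insert) (auto simp: Pi_def)
  also have "\<dots> = (\<Oplus>j\<in>T. f x j \<oplus> (\<Oplus>i\<in>F. f i j))"
    using insert by (subst finsum_addf) (auto simp: Pi_def)
  also have "\<dots> = (\<Oplus>j\<in>T. \<Oplus>i\<in>insert x F. f i j)"
    using insert by (intro finsum_cong') (auto simp: Pi_def)
  finally show ?case .
qed

lemma finsum_delta:
  assumes "finite S" "j \<in> S" "f \<in> S \<rightarrow> carrier V"
  shows "(\<Oplus>i\<in>S. (if i = j then 1 else 0) \<odot> f i) = f j"
proof -
  have "(\<Oplus>i\<in>S. (if i = j then 1 else 0) \<odot> f i) = (\<Oplus>i\<in>S. if j = i then f i else \<zero>)"
    using assms by (intro finsum_cong') (auto simp: Pi_def)
  then show ?thesis using finsum_singleton[OF assms(2,1,3)] by simp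
qed

lemma finsum_delta':
  assumes "finite S" "j \<in> S" "f \<in> S \<rightarrow> carrier V"
  shows "(\<Oplus>i\<in>S. (if j = i then 1 else 0) \<odot> f i) = f j"
  using finsum_delta[OF assms] by (simp add: eq_commute)

text \<open>
  In an algebra the ring structure brings its own facts on finite sums under the same names. The
  names below always refer to sums of vectors.
\<close>

lemmas vsum_cong = finsum_cong'
lemmas vsum_closed = finsum_closed

lemma finsum_comb:
  assumes "finite S" "finite T" "\<And>j. j \<in> T \<Longrightarrow> z j \<in> carrier V"
  shows "(\<Oplus>i\<in>S. c i \<odot> (\<Oplus>j\<in>T. d i j \<odot> z j)) = (\<Oplus>j\<in>T. (\<Sum>i\<in>S. c i * d i j) \<odot> z j)"
proof -
  have "(\<Oplus>i\<in>S. c i \<odot> (\<Oplus>j\<in>T. d i j \<odot> z j)) = (\<Oplus>i\<in>S. \<Oplus>j\<in>T. (c i * d i j) \<odot> z j)"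
    using assms by (intro vsum_cong) (auto simp: smult_finsum smult_smult Pi_def intro!: vsum_closed vsum_cong)
  also have "\<dots> = (\<Oplus>j\<in>T. \<Oplus>i\<in>S. (c i * d i j) \<odot> z j)"
    using assms by (intro finsum_swap) auto
  also have "\<dots> = (\<Oplus>j\<in>T. (\<Sum>i\<in>S. c i * d i j) \<odot> z j)"
    using assms by (intro vsum_cong) (auto simp: sum_smult)
  finally show ?thesis .
qed

lemma finsum_comb2:
  assumes "finite S" "finite T" "finite U" "\<And>j k. j \<in> T \<Longrightarrow> k \<in> U \<Longrightarrow> z j k \<in> carrier V"
  shows "(\<Oplus>i\<in>S. c i \<odot> (\<Oplus>j\<in>T. \<Oplus>k\<in>U. d i j k \<odot> z j k)) =
    (\<Oplus>j\<in>T. \<Oplus>k\<in>U. (\<Sum>i\<in>S. c i * d i j k) \<odot> z j k)"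
proof -
  have "(\<Oplus>i\<in>S. c i \<odot> (\<Oplus>j\<in>T. \<Oplus>k\<in>U. d i j k \<odot> z j k)) =
      (\<Oplus>i\<in>S. \<Oplus>j\<in>T. c i \<odot> (\<Oplus>k\<in>U. d i j k \<odot> z j k))"
    using assms by (intro vsum_cong) (auto simp: smult_finsum Pi_def intro!: vsum_closed)
  also have "\<dots> = (\<Oplus>j\<in>T. \<Oplus>i\<in>S. c i \<odot> (\<Oplus>k\<in>U. d i j k \<odot> z j k))"
    using assms by (intro finsum_swap) (auto intro!: vsum_closed)
  also have "\<dots> = (\<Oplus>j\<in>T. \<Oplus>k\<in>U. (\<Sum>i\<in>S. c i * d i j k) \<odot> z j k)"
    using assms by (intro vsum_cong finsum_comb) (auto intro!: vsum_closed)
  finally show ?thesis .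
qed

end

lemma finsum_complex_module [simp]: "finsum complex_module f S = sum f S"
proof -
  interpret complex_space complex_module by simp
  show ?thesis
    by (induction S rule: infinite_finite_induct)
       (auto simp: finsum_infinite finsum_empty finsum_insert)
qed

text \<open>
  Sums see only the additive structure, so they agree in \<open>B\<close> and \<open>L\<^sup>2(B, \<psi>)\<close>, and in a space and its
  conjugate.
\<close>

lemma finsum_cong_add_monoid:
  assumes "carrier V = carrier W" "zero V = zero W" "add V = add W"
  shows "finsum V f S = finsum W f S"
  using assms by (simp add: finsum_def finprod_def)

definition cbilinear ::
  "(complex, 'v, 'x) module_scheme \<Rightarrow> (complex, 'w, 'y) module_scheme \<Rightarrow>
    (complex, 'z, 'u) module_scheme \<Rightarrow> ('v \<Rightarrow> 'w \<Rightarrow> 'z) \<Rightarrow> bool" where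
  "cbilinear V W Z \<beta> \<longleftrightarrow>
     (\<forall>v\<in>carrier V. clinear W Z (\<beta> v)) \<and> (\<forall>w\<in>carrier W. clinear V Z (\<lambda>v. \<beta> v w))"

lemma clinearI:
  assumes "\<And>x. x \<in> carrier V \<Longrightarrow> f x \<in> carrier W"
    and "\<And>x y. x \<in> carrier V \<Longrightarrow> y \<in> carrier V \<Longrightarrow> f (x \<oplus>\<^bsub>V\<^esub> y) = f x \<oplus>\<^bsub>W\<^esub> f y"
    and "\<And>c x. x \<in> carrier V \<Longrightarrow> f (c \<odot>\<^bsub>V\<^esub> x) = c \<odot>\<^bsub>W\<^esub> f x"
  shows "clinear V W f"
  using assms by (auto simp: clinear_def)

lemma clinear_in: "clinear V W f \<Longrightarrow> x \<in> carrier V \<Longrightarrow> f x \<in> carrier W"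
  and clinear_add: "clinear V W f \<Longrightarrow> x \<in> carrier V \<Longrightarrow> y \<in> carrier V \<Longrightarrow>
        f (x \<oplus>\<^bsub>V\<^esub> y) = f x \<oplus>\<^bsub>W\<^esub> f y"
  and clinear_smult: "clinear V W f \<Longrightarrow> x \<in> carrier V \<Longrightarrow> f (c \<odot>\<^bsub>V\<^esub> x) = c \<odot>\<^bsub>W\<^esub> f x"
  by (auto simp: clinear_def)

lemma clinear_id: "clinear V V (\<lambda>x. x)"
  by (auto simp: clinear_def)

lemma clinear_compose: "clinear U V f \<Longrightarrow> clinear V W g \<Longrightarrow> clinear U W (\<lambda>x. g (f x))"
  by (auto simp: clinear_def Pi_def)

lemma clinear_cong:
  assumes "clinear V W f" "\<And>x. x \<in> carrier V \<Longrightarrow> f x = g x" "complex_space V"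
  shows "clinear V W g"
proof -
  interpret complex_space V by fact
  show ?thesis using assms(1) by (auto simp: clinear_def Pi_def simp flip: assms(2))
qed

lemma clinear_zero:
  assumes "complex_space V" "complex_space W" "clinear V W f"
  shows "f \<zero>\<^bsub>V\<^esub> = \<zero>\<^bsub>W\<^esub>"
proof -
  interpret V: complex_space V by fact
  interpret W: complex_space W by fact
  have "f \<zero>\<^bsub>V\<^esub> = f (0 \<odot>\<^bsub>V\<^esub> \<zero>\<^bsub>V\<^esub>)" by simp
  also have "\<dots> = \<zero>\<^bsub>W\<^esub>"
    using clinear_in[OF assms(3) V.zero_closed] by (subst clinear_smult[OF assms(3)]) auto
  finally show ?thesis .
qed

lemma clinear_finsum:
  assumes "complex_space V" "complex_space W" "clinear V W f" "g \<in> S \<rightarrow> carrier V"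
  shows "f (\<Oplus>\<^bsub>V\<^esub>i\<in>S. g i) = (\<Oplus>\<^bsub>W\<^esub>i\<in>S. f (g i))"
proof -
  interpret V: complex_space V by fact
  interpret W: complex_space W by fact
  note z = clinear_zero[OF assms(1-3)]
  show ?thesis using assms(4)
    by (induction S rule: infinite_finite_induct)
       (auto simp: z Pi_def clinear_add[OF assms(3)] clinear_in[OF assms(3)] V.finsum_infinite
         W.finsum_infinite V.finsum_insert W.finsum_insert)
qed

lemma clinear_const_zero:
  assumes "complex_space W"
  shows "clinear V W (\<lambda>_. \<zero>\<^bsub>W\<^esub>)"
proof -
  interpret W: complex_space W by fact
  show ?thesis by (auto simp: clinear_def)
qed

lemma clinear_plus:
  assumes "complex_space W" "clinear V W f" "clinear V W g"
  shows "clinear V W (\<lambda>x. f x \<oplus>\<^bsub>W\<^esub> g x)"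
proof -
  interpret W: complex_space W by fact
  show ?thesis using assms(2,3) unfolding clinear_def
    by (auto simp: Pi_def W.smult_add W.a_ac)
qed

lemma clinear_scaled:
  assumes "complex_space W" "clinear V W f"
  shows "clinear V W (\<lambda>x. c \<odot>\<^bsub>W\<^esub> f x)"
proof -
  interpret W: complex_space W by fact
  show ?thesis using assms(2) unfolding clinear_def
    by (auto simp: Pi_def W.smult_add W.smult_smult mult.commute)
qed

lemma clinear_coeff_smult:
  assumes "complex_space W" "clinear V complex_module f" "w \<in> carrier W"
  shows "clinear V W (\<lambda>x. f x \<odot>\<^bsub>W\<^esub> w)"
proof -
  interpret W: complex_space W by fact
  show ?thesis using assms(2,3) unfolding clinear_def
    by (auto simp: W.smult_plus W.smult_smult)
qed

lemma clinear_finsum_fun: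
  assumes "complex_space V" "complex_space W" "\<And>i. i \<in> S \<Longrightarrow> clinear V W (f i)"
  shows "clinear V W (\<lambda>x. \<Oplus>\<^bsub>W\<^esub>i\<in>S. f i x)"
proof -
  interpret V: complex_space V by fact
  interpret W: complex_space W by fact
  have *: "f i x \<in> carrier W" if "i \<in> S" "x \<in> carrier V" for i x
    using that by (intro clinear_in[OF assms(3)])
  show ?thesis
  proof (rule clinearI)
    fix x y assume xy: "x \<in> carrier V" "y \<in> carrier V"
    have "(\<Oplus>\<^bsub>W\<^esub>i\<in>S. f i (x \<oplus>\<^bsub>V\<^esub> y)) = (\<Oplus>\<^bsub>W\<^esub>i\<in>S. f i x \<oplus>\<^bsub>W\<^esub> f i y)"
      using * xy by (intro W.finsum_cong') (auto simp: clinear_add[OF assms(3)])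
    also have "\<dots> = (\<Oplus>\<^bsub>W\<^esub>i\<in>S. f i x) \<oplus>\<^bsub>W\<^esub> (\<Oplus>\<^bsub>W\<^esub>i\<in>S. f i y)"
      using * xy by (intro W.finsum_addf) auto
    finally show "(\<Oplus>\<^bsub>W\<^esub>i\<in>S. f i (x \<oplus>\<^bsub>V\<^esub> y)) = (\<Oplus>\<^bsub>W\<^esub>i\<in>S. f i x) \<oplus>\<^bsub>W\<^esub> (\<Oplus>\<^bsub>W\<^esub>i\<in>S. f i y)" .
  next
    fix c x assume x: "x \<in> carrier V"
    have "(\<Oplus>\<^bsub>W\<^esub>i\<in>S. f i (c \<odot>\<^bsub>V\<^esub> x)) = (\<Oplus>\<^bsub>W\<^esub>i\<in>S. c \<odot>\<^bsub>W\<^esub> f i x)"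
      using * x by (intro W.finsum_cong') (auto simp: clinear_smult[OF assms(3)])
    also have "\<dots> = c \<odot>\<^bsub>W\<^esub> (\<Oplus>\<^bsub>W\<^esub>i\<in>S. f i x)"
      using * x by (intro W.smult_finsum[symmetric]) auto
    finally show "(\<Oplus>\<^bsub>W\<^esub>i\<in>S. f i (c \<odot>\<^bsub>V\<^esub> x)) = c \<odot>\<^bsub>W\<^esub> (\<Oplus>\<^bsub>W\<^esub>i\<in>S. f i x)" .
  qed (use * in auto)
qed

lemma cbilinearI:
  assumes "\<And>v. v \<in> carrier V \<Longrightarrow> clinear W Z (\<beta> v)"
    and "\<And>w. w \<in> carrier W \<Longrightarrow> clinear V Z (\<lambda>v. \<beta> v w)"
  shows "cbilinear V W Z \<beta>"
  using assms by (auto simp: cbilinear_def)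

lemma cbilinearD:
  assumes "cbilinear V W Z \<beta>"
  shows "v \<in> carrier V \<Longrightarrow> clinear W Z (\<beta> v)" "w \<in> carrier W \<Longrightarrow> clinear V Z (\<lambda>v. \<beta> v w)"
  using assms by (auto simp: cbilinear_def)

lemma cbilinear_compose:
  assumes "cbilinear V W Z \<beta>" "clinear V' V f" "clinear W' W g"
  shows "cbilinear V' W' Z (\<lambda>v w. \<beta> (f v) (g w))"
  using assms by (auto simp: cbilinear_def intro!: clinear_compose[of W' W g Z "\<beta> _"]
      clinear_compose[of V' V f Z "\<lambda>v. \<beta> v _"] intro: clinear_in)

lemma clinear_after_cbilinear:
  assumes "cbilinear V W Z \<beta>" "clinear Z Z' f"
  shows "cbilinear V W Z' (\<lambda>v w. f (\<beta> v w))"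
  using assms by (auto simp: cbilinear_def intro: clinear_compose)

lemma cbilinear_smult:
  assumes "complex_space W"
  shows "cbilinear complex_module W W (\<lambda>c w. c \<odot>\<^bsub>W\<^esub> w)"
proof -
  interpret W: complex_space W by fact
  show ?thesis
    by (auto simp: cbilinear_def clinear_def W.smult_plus W.smult_add W.smult_smult mult.commute)
qed

lemma cbilinear_flip: "cbilinear V W Z \<beta> \<Longrightarrow> cbilinear W V Z (\<lambda>w v. \<beta> v w)"
  by (auto simp: cbilinear_def)

text \<open>
  A basis together with its coordinate functionals. In an inner product space the coordinates with
  respect to an orthonormal basis are the inner products with the basis vectors.
\<close>

definition coordinates ::
  "(complex, 'v, 'x) module_scheme \<Rightarrow> nat \<Rightarrow> (nat \<Rightarrow> 'v) \<Rightarrow> (nat \<Rightarrow> 'v \<Rightarrow> complex) \<Rightarrow> bool" where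
  "coordinates V n e co \<longleftrightarrow>
     (\<forall>i<n. e i \<in> carrier V \<and> clinear V complex_module (co i)) \<and>
     (\<forall>i<n. \<forall>j<n. co i (e j) = (if i = j then 1 else 0)) \<and>
     (\<forall>v\<in>carrier V. v = (\<Oplus>\<^bsub>V\<^esub>i\<in>{..<n}. co i v \<odot>\<^bsub>V\<^esub> e i))"

lemma coordinatesD:
  assumes "coordinates V n e co"
  shows "i < n \<Longrightarrow> e i \<in> carrier V"
    and "i < n \<Longrightarrow> clinear V complex_module (co i)"
    and "i < n \<Longrightarrow> j < n \<Longrightarrow> co i (e j) = (if i = j then 1 else 0)"
    and "v \<in> carrier V \<Longrightarrow> (\<Oplus>\<^bsub>V\<^esub>i\<in>{..<n}. co i v \<odot>\<^bsub>V\<^esub> e i) = v"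
  using assms by (auto simp: coordinates_def)

lemma coordinates_eqI:
  assumes "coordinates V n e co" "complex_space V" "v \<in> carrier V" "w \<in> carrier V"
    and "\<And>i. i < n \<Longrightarrow> co i v = co i w"
  shows "v = w"
proof -
  interpret complex_space V by fact
  have "v = (\<Oplus>\<^bsub>V\<^esub>i\<in>{..<n}. co i v \<odot>\<^bsub>V\<^esub> e i)" using assms coordinatesD by metis
  also have "\<dots> = (\<Oplus>\<^bsub>V\<^esub>i\<in>{..<n}. co i w \<odot>\<^bsub>V\<^esub> e i)"
    using coordinatesD(1)[OF assms(1)] by (intro finsum_cong') (auto simp: assms(5))
  also have "\<dots> = w" using assms coordinatesD by metis
  finally show ?thesis .
qed

lemma clinear_expand:
  assumes "coordinates V n e co" "complex_space V" "complex_space W" "clinear V W f"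
    and "v \<in> carrier V"
  shows "f v = (\<Oplus>\<^bsub>W\<^esub>i\<in>{..<n}. co i v \<odot>\<^bsub>W\<^esub> f (e i))"
proof -
  interpret V: complex_space V by fact
  interpret W: complex_space W by fact
  note e = coordinatesD(1)[OF assms(1)]
  have "f v = f (\<Oplus>\<^bsub>V\<^esub>i\<in>{..<n}. co i v \<odot>\<^bsub>V\<^esub> e i)"
    using coordinatesD(4)[OF assms(1,5)] by simp
  also have "\<dots> = (\<Oplus>\<^bsub>W\<^esub>i\<in>{..<n}. f (co i v \<odot>\<^bsub>V\<^esub> e i))"
    using e by (intro clinear_finsum assms) auto
  also have "\<dots> = (\<Oplus>\<^bsub>W\<^esub>i\<in>{..<n}. co i v \<odot>\<^bsub>W\<^esub> f (e i))"
    using e clinear_in[OF assms(4)]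
    by (intro W.finsum_cong') (auto simp: clinear_smult[OF assms(4)])
  finally show ?thesis .
qed

lemma cbilinear_expand:
  assumes V: "complex_space V" and co: "coordinates V n e co"
    and F: "cbilinear V V complex_module F" and x: "x \<in> carrier V" and y: "y \<in> carrier V"
  shows "F x y = (\<Sum>i<n. \<Sum>j<n. co i x * co j y * F (e i) (e j))"
proof -
  note ex = clinear_expand[OF co V complex_space_complex_module]
  note ei = coordinatesD(1)[OF co]
  have "F x y = (\<Sum>i<n. co i x * F (e i) y)"
    using ex[OF cbilinearD(2)[OF F y] x] by simp
  also have "\<dots> = (\<Sum>i<n. \<Sum>j<n. co i x * co j y * F (e i) (e j))"
    using ex[OF cbilinearD(1)[OF F ei] y] by (intro sum.cong) (simp_all add: sum_distrib_left mult.assoc)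
  finally show ?thesis .
qed

section \<open>Algebraic tensor products\<close>

locale tensor_factors = V: complex_space V + W: complex_space W
  for V :: "(complex, 'v, 'x) module_scheme" and W :: "(complex, 'w, 'y) module_scheme"
begin

lemma free_space_zero: "(\<lambda>p. 0) \<in> free_space V W"
  by (auto simp: free_space_def)

lemma free_space_add:
  assumes "f \<in> free_space V W" "g \<in> free_space V W"
  shows "(\<lambda>p. f p + g p) \<in> free_space V W"
proof -
  have "{p. f p + g p \<noteq> 0} \<subseteq> {p. f p \<noteq> 0} \<union> {p. g p \<noteq> 0}" by auto
  with assms show ?thesis
    by (auto simp: free_space_def intro: finite_subset)
qed

lemma free_space_smult:
  assumes "f \<in> free_space V W"
  shows "(\<lambda>p. c * f p) \<in> free_space V W"
proof -
  have "{p. c * f p \<noteq> 0} \<subseteq> {p. f p \<noteq> 0}" by auto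
  with assms show ?thesis
    by (auto simp: free_space_def intro: finite_subset)
qed

lemma free_space_point_mass:
  "v \<in> carrier V \<Longrightarrow> w \<in> carrier W \<Longrightarrow> point_mass (v, w) \<in> free_space V W"
  by (auto simp: free_space_def point_mass_def)

lemma free_space_diff:
  assumes "f \<in> free_space V W" "g \<in> free_space V W"
  shows "(\<lambda>p. f p - g p) \<in> free_space V W"
  using free_space_add[OF assms(1) free_space_smult[OF assms(2), of "-1"]] by simp

lemma bilinear_relations_diff:
  assumes "f \<in> bilinear_relations V W" "g \<in> bilinear_relations V W"
  shows "(\<lambda>p. f p - g p) \<in> bilinear_relations V W"
  using rel_add[OF assms(1) rel_smult[OF assms(2), of "-1"]] by simp

lemma bilinear_relations_subset: "f \<in> bilinear_relations V W \<Longrightarrow> f \<in> free_space V W"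
  by (induction rule: bilinear_relations.induct)
     (auto intro!: free_space_zero free_space_add free_space_smult free_space_diff
        free_space_point_mass)

lemma tensor_class_eqI:
  assumes "(\<lambda>p. f p - g p) \<in> bilinear_relations V W"
  shows "tensor_class V W f = tensor_class V W g"
proof -
  have "(\<lambda>p. h p - g p) \<in> bilinear_relations V W \<longleftrightarrow> (\<lambda>p. h p - f p) \<in> bilinear_relations V W" for h
    using rel_add[of "\<lambda>p. h p - f p" V W, OF _ assms]
      bilinear_relations_diff[of "\<lambda>p. h p - g p", OF _ assms] by auto
  then show ?thesis by (simp add: tensor_class_def)
qed

text \<open>
  The operations on tensors are defined through chosen representatives. That the choice does not
  matter rests on this fact.
\<close>

lemma tensor_rep_class:
  "(\<lambda>p. tensor_rep (tensor_class V W f) p - f p) \<in> bilinear_relations V W"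
proof -
  have "f \<in> tensor_class V W f"
    using rel_zero by (auto simp: tensor_class_def)
  then have "tensor_rep (tensor_class V W f) \<in> tensor_class V W f"
    unfolding tensor_rep_def by (rule someI[of "\<lambda>g. g \<in> tensor_class V W f"])
  then show ?thesis by (simp add: tensor_class_def)
qed

lemma tensor_rep_free:
  assumes "f \<in> free_space V W"
  shows "tensor_rep (tensor_class V W f) \<in> free_space V W"
  using free_space_add[OF bilinear_relations_subset[OF tensor_rep_class[of f]] assms] by simp

lemma tensor_space_simps:
  "carrier (V \<otimes>\<^sub>T W) = tensor_class V W ` free_space V W"
  "\<zero>\<^bsub>V \<otimes>\<^sub>T W\<^esub> = tensor_class V W (\<lambda>p. 0)"
  by (simp_all add: tensor_space_def)

lemma tensor_class_add:
  "tensor_class V W f \<oplus>\<^bsub>V \<otimes>\<^sub>T W\<^esub> tensor_class V W g = tensor_class V W (\<lambda>p. f p + g p)"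
proof -
  have "(\<lambda>p. (tensor_rep (tensor_class V W f) p + tensor_rep (tensor_class V W g) p) - (f p + g p))
    \<in> bilinear_relations V W"
    using rel_add[OF tensor_rep_class[of f] tensor_rep_class[of g]] by (simp add: algebra_simps)
  then show ?thesis
    by (simp add: tensor_space_def tensor_class_eqI)
qed

lemma tensor_class_smult:
  "c \<odot>\<^bsub>V \<otimes>\<^sub>T W\<^esub> tensor_class V W f = tensor_class V W (\<lambda>p. c * f p)"
proof -
  have "(\<lambda>p. c * tensor_rep (tensor_class V W f) p - c * f p) \<in> bilinear_relations V W"
    using rel_smult[OF tensor_rep_class[of f], of c] by (simp add: algebra_simps)
  then show ?thesis
    by (simp add: tensor_space_def tensor_class_eqI)
qed

sublocale T: complex_space "V \<otimes>\<^sub>T W"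
proof (rule complex_spaceI)
  show "abelian_group (V \<otimes>\<^sub>T W)"
  proof (rule abelian_groupI)
    fix x assume "x \<in> carrier (V \<otimes>\<^sub>T W)"
    then obtain f where f: "x = tensor_class V W f" "f \<in> free_space V W"
      by (auto simp: tensor_space_simps)
    show "\<exists>y\<in>carrier (V \<otimes>\<^sub>T W). y \<oplus>\<^bsub>V \<otimes>\<^sub>T W\<^esub> x = \<zero>\<^bsub>V \<otimes>\<^sub>T W\<^esub>"
      using free_space_smult[OF f(2), of "-1"]
      by (intro bexI[of _ "tensor_class V W (\<lambda>p. (-1) * f p)"])
         (auto simp: f tensor_class_add tensor_space_simps)
  qed (auto simp: tensor_space_simps tensor_class_add add_ac
      intro!: free_space_zero free_space_add)
qed (auto simp: tensor_space_simps tensor_class_add tensor_class_smult algebra_simps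
    intro!: free_space_zero free_space_add free_space_smult)

lemma simple_tensor_in [simp, intro]:
  "v \<in> carrier V \<Longrightarrow> w \<in> carrier W \<Longrightarrow> simple_tensor V W v w \<in> carrier (V \<otimes>\<^sub>T W)"
  by (auto simp: simple_tensor_def tensor_space_simps intro!: free_space_point_mass)

lemma cbilinear_simple_tensor: "cbilinear V W (V \<otimes>\<^sub>T W) (simple_tensor V W)"
proof (intro cbilinearI clinearI)
  fix v w w' assume "v \<in> carrier V" "w \<in> carrier W" "w' \<in> carrier W"
  then show "simple_tensor V W v (w \<oplus>\<^bsub>W\<^esub> w') =
      simple_tensor V W v w \<oplus>\<^bsub>V \<otimes>\<^sub>T W\<^esub> simple_tensor V W v w'"
    using add_right[of v V w W w']
    by (auto simp: simple_tensor_def tensor_class_add diff_diff_eq intro!: tensor_class_eqI)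
next
  fix v v' w assume "v \<in> carrier V" "v' \<in> carrier V" "w \<in> carrier W"
  then show "simple_tensor V W (v \<oplus>\<^bsub>V\<^esub> v') w =
      simple_tensor V W v w \<oplus>\<^bsub>V \<otimes>\<^sub>T W\<^esub> simple_tensor V W v' w"
    using add_left[of v V v' w W]
    by (auto simp: simple_tensor_def tensor_class_add diff_diff_eq intro!: tensor_class_eqI)
next
  fix v w c assume "v \<in> carrier V" "w \<in> carrier W"
  then show "simple_tensor V W v (c \<odot>\<^bsub>W\<^esub> w) = c \<odot>\<^bsub>V \<otimes>\<^sub>T W\<^esub> simple_tensor V W v w"
    using smult_right[of v V w W c]
    by (auto simp: simple_tensor_def tensor_class_smult intro!: tensor_class_eqI)
next
  fix v w c assume "v \<in> carrier V" "w \<in> carrier W"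
  then show "simple_tensor V W (c \<odot>\<^bsub>V\<^esub> v) w = c \<odot>\<^bsub>V \<otimes>\<^sub>T W\<^esub> simple_tensor V W v w"
    using smult_left[of v V w W c]
    by (auto simp: simple_tensor_def tensor_class_smult intro!: tensor_class_eqI)
qed auto

lemmas simple_tensor_linear =
  cbilinearD(1)[OF cbilinear_simple_tensor] cbilinearD(2)[OF cbilinear_simple_tensor]

text \<open>
  Sums of simple tensors suffice, because a scalar can be absorbed into one of the factors. The
  induction runs over the support of a representative.
\<close>

lemma tensor_induct [consumes 1, case_names simple add]:
  assumes "t \<in> carrier (V \<otimes>\<^sub>T W)"
    and simple: "\<And>v w. v \<in> carrier V \<Longrightarrow> w \<in> carrier W \<Longrightarrow> P (simple_tensor V W v w)"
    and add: "\<And>s t. s \<in> carrier (V \<otimes>\<^sub>T W) \<Longrightarrow> t \<in> carrier (V \<otimes>\<^sub>T W) \<Longrightarrow> P s \<Longrightarrow> P t \<Longrightarrow>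
      P (s \<oplus>\<^bsub>V \<otimes>\<^sub>T W\<^esub> t)"
  shows "P t"
proof -
  obtain f where f: "t = tensor_class V W f" "f \<in> free_space V W"
    using assms(1) by (auto simp: tensor_space_simps)
  have "finite S \<Longrightarrow> {p. f p \<noteq> 0} = S \<Longrightarrow> f \<in> free_space V W \<Longrightarrow> P (tensor_class V W f)" for S f
  proof (induction S arbitrary: f rule: finite_induct)
    case empty
    then have "f = (\<lambda>p. 0)" by auto
    moreover have "tensor_class V W (\<lambda>p. 0) = simple_tensor V W \<zero>\<^bsub>V\<^esub> \<zero>\<^bsub>W\<^esub>"
      using clinear_zero[OF _ _ simple_tensor_linear(1)[of "\<zero>\<^bsub>V\<^esub>"]] V.complex_space_axioms
        W.complex_space_axioms T.complex_space_axioms by (simp add: tensor_space_simps)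
    ultimately show ?case using simple by simp
  next
    case (insert q S)
    obtain v w where q: "q = (v, w)" by (cases q)
    have vw: "v \<in> carrier V" "w \<in> carrier W"
      using insert.prems q by (auto simp: free_space_def)
    define g where "g = f(q := 0)"
    have g: "{p. g p \<noteq> 0} = S" using insert.hyps insert.prems by (auto simp: g_def)
    with insert.prems insert.hyps have gf: "g \<in> free_space V W" by (auto simp: free_space_def)
    have "f = (\<lambda>p. g p + f q * point_mass q p)"
      by (auto simp: g_def point_mass_def)
    then have "tensor_class V W f = tensor_class V W g \<oplus>\<^bsub>V \<otimes>\<^sub>T W\<^esub>
        (f q \<odot>\<^bsub>V \<otimes>\<^sub>T W\<^esub> tensor_class V W (point_mass q))"
      by (metis tensor_class_add tensor_class_smult)
    also have "f q \<odot>\<^bsub>V \<otimes>\<^sub>T W\<^esub> tensor_class V W (point_mass q) =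
        simple_tensor V W v (f q \<odot>\<^bsub>W\<^esub> w)"
      using vw by (simp add: q clinear_smult[OF simple_tensor_linear(1)] simple_tensor_def[symmetric])
    finally show ?case
      using vw gf insert.IH[OF g gf] by (auto intro!: add simple simp: tensor_space_simps(1))
  qed
  then show ?thesis using f by (auto simp: free_space_def)
qed

lemma clinear_tensor_eqI:
  assumes "clinear (V \<otimes>\<^sub>T W) Z f" "clinear (V \<otimes>\<^sub>T W) Z g" "t \<in> carrier (V \<otimes>\<^sub>T W)"
    and "\<And>v w. v \<in> carrier V \<Longrightarrow> w \<in> carrier W \<Longrightarrow> f (simple_tensor V W v w) = g (simple_tensor V W v w)"
  shows "f t = g t"
  using assms(3)
  by (induction rule: tensor_induct)
     (simp_all add: assms(4) clinear_add[OF assms(1)] clinear_add[OF assms(2)])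

end

text \<open>The linear extension of \<open>\<beta>\<close> to the free vector space, from which \<^const>\<open>tensor_lift\<close> descends.\<close>

definition free_lift ::
  "(complex, 'z, 'x) module_scheme \<Rightarrow> ('v \<Rightarrow> 'w \<Rightarrow> 'z) \<Rightarrow> ('v \<times> 'w \<Rightarrow> complex) \<Rightarrow> 'z" where
  "free_lift Z \<beta> f = (\<Oplus>\<^bsub>Z\<^esub>p\<in>{p. f p \<noteq> 0}. f p \<odot>\<^bsub>Z\<^esub> \<beta> (fst p) (snd p))"

lemma tensor_lift_eq: "tensor_lift Z \<beta> t = free_lift Z \<beta> (tensor_rep t)"
  by (simp add: tensor_lift_def free_lift_def)

locale tensor_target = tensor_factors V W + Z: complex_space Z
  for V :: "(complex, 'v, 'x) module_scheme" and W :: "(complex, 'w, 'y) module_scheme"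
    and Z :: "(complex, 'z, 'u) module_scheme" +
  fixes \<beta> :: "'v \<Rightarrow> 'w \<Rightarrow> 'z"
  assumes bilinear: "cbilinear V W Z \<beta>"
begin

lemma beta_in: "v \<in> carrier V \<Longrightarrow> w \<in> carrier W \<Longrightarrow> \<beta> v w \<in> carrier Z"
  using bilinear by (auto simp: cbilinear_def intro: clinear_in)

lemma free_lift_superset:
  assumes "finite S" "{p. f p \<noteq> 0} \<subseteq> S" "S \<subseteq> carrier V \<times> carrier W"
  shows "free_lift Z \<beta> f = (\<Oplus>\<^bsub>Z\<^esub>p\<in>S. f p \<odot>\<^bsub>Z\<^esub> \<beta> (fst p) (snd p))"
  unfolding free_lift_def using assms
  by (intro Z.add.finprod_mono_neutral_cong_left) (auto simp: beta_in Z.smult_in)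

lemma free_lift_add:
  assumes "f \<in> free_space V W" "g \<in> free_space V W"
  shows "free_lift Z \<beta> (\<lambda>p. f p + g p) = free_lift Z \<beta> f \<oplus>\<^bsub>Z\<^esub> free_lift Z \<beta> g"
proof -
  define S where "S = {p. f p \<noteq> 0} \<union> {p. g p \<noteq> 0}"
  have S: "finite S" "S \<subseteq> carrier V \<times> carrier W"
    using assms by (auto simp: S_def free_space_def)
  have b: "\<beta> (fst p) (snd p) \<in> carrier Z" if "p \<in> S" for p
    using that S by (auto intro!: beta_in)
  have "free_lift Z \<beta> (\<lambda>p. f p + g p) = (\<Oplus>\<^bsub>Z\<^esub>p\<in>S. (f p + g p) \<odot>\<^bsub>Z\<^esub> \<beta> (fst p) (snd p))"
    by (intro free_lift_superset S) (auto simp: S_def)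
  also have "\<dots> = (\<Oplus>\<^bsub>Z\<^esub>p\<in>S. f p \<odot>\<^bsub>Z\<^esub> \<beta> (fst p) (snd p) \<oplus>\<^bsub>Z\<^esub> g p \<odot>\<^bsub>Z\<^esub> \<beta> (fst p) (snd p))"
    by (intro Z.finsum_cong') (auto simp: b Z.smult_plus Z.smult_in)
  also have "\<dots> = (\<Oplus>\<^bsub>Z\<^esub>p\<in>S. f p \<odot>\<^bsub>Z\<^esub> \<beta> (fst p) (snd p)) \<oplus>\<^bsub>Z\<^esub>
      (\<Oplus>\<^bsub>Z\<^esub>p\<in>S. g p \<odot>\<^bsub>Z\<^esub> \<beta> (fst p) (snd p))"
    by (intro Z.finsum_addf) (auto simp: b)
  also have "\<dots> = free_lift Z \<beta> f \<oplus>\<^bsub>Z\<^esub> free_lift Z \<beta> g"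
    by (subst (1 2) free_lift_superset[OF S(1) _ S(2)]) (auto simp: S_def)
  finally show ?thesis .
qed

lemma free_lift_smult:
  assumes "f \<in> free_space V W"
  shows "free_lift Z \<beta> (\<lambda>p. c * f p) = c \<odot>\<^bsub>Z\<^esub> free_lift Z \<beta> f"
proof -
  define S where "S = {p. f p \<noteq> 0}"
  have S: "finite S" "S \<subseteq> carrier V \<times> carrier W"
    using assms by (auto simp: S_def free_space_def)
  have b: "\<beta> (fst p) (snd p) \<in> carrier Z" if "p \<in> S" for p
    using that S by (auto intro!: beta_in)
  have "free_lift Z \<beta> (\<lambda>p. c * f p) = (\<Oplus>\<^bsub>Z\<^esub>p\<in>S. (c * f p) \<odot>\<^bsub>Z\<^esub> \<beta> (fst p) (snd p))"
    by (intro free_lift_superset S) (auto simp: S_def)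
  also have "\<dots> = (\<Oplus>\<^bsub>Z\<^esub>p\<in>S. c \<odot>\<^bsub>Z\<^esub> (f p \<odot>\<^bsub>Z\<^esub> \<beta> (fst p) (snd p)))"
    by (intro Z.finsum_cong') (auto simp: b Z.smult_smult Z.smult_in)
  also have "\<dots> = c \<odot>\<^bsub>Z\<^esub> free_lift Z \<beta> f"
    unfolding free_lift_def S_def[symmetric] by (intro Z.smult_finsum[symmetric]) (auto simp: b)
  finally show ?thesis .
qed

lemma free_lift_in: "f \<in> free_space V W \<Longrightarrow> free_lift Z \<beta> f \<in> carrier Z"
  unfolding free_lift_def by (intro Z.finsum_closed) (auto simp: free_space_def intro!: Z.smult_in beta_in)

lemma free_lift_point_mass:
  assumes "v \<in> carrier V" "w \<in> carrier W"
  shows "free_lift Z \<beta> (point_mass (v, w)) = \<beta> v w"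
  using assms beta_in
  by (subst free_lift_superset[of "{(v, w)}"]) (auto simp: point_mass_def)

lemma free_lift_diff:
  assumes "f \<in> free_space V W" "g \<in> free_space V W"
  shows "free_lift Z \<beta> (\<lambda>p. f p - g p) = free_lift Z \<beta> f \<oplus>\<^bsub>Z\<^esub> ((-1) \<odot>\<^bsub>Z\<^esub> free_lift Z \<beta> g)"
  using free_lift_add[OF assms(1) free_space_smult[OF assms(2), of "-1"]]
    free_lift_smult[OF assms(2), of "-1"] by simp

lemma cancel: "x \<in> carrier Z \<Longrightarrow> x \<oplus>\<^bsub>Z\<^esub> ((-1) \<odot>\<^bsub>Z\<^esub> x) = \<zero>\<^bsub>Z\<^esub>"
  by (metis Z.uminus_eq_smult Z.r_neg)

lemma cancel2:
  "x \<in> carrier Z \<Longrightarrow> y \<in> carrier Z \<Longrightarrow>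
    x \<oplus>\<^bsub>Z\<^esub> y \<oplus>\<^bsub>Z\<^esub> ((-1) \<odot>\<^bsub>Z\<^esub> x) \<oplus>\<^bsub>Z\<^esub> ((-1) \<odot>\<^bsub>Z\<^esub> y) = \<zero>\<^bsub>Z\<^esub>"
  using cancel[of "x \<oplus>\<^bsub>Z\<^esub> y"] by (simp add: Z.smult_add Z.a_assoc)

lemma beta_linear:
  "v \<in> carrier V \<Longrightarrow> clinear W Z (\<beta> v)" "w \<in> carrier W \<Longrightarrow> clinear V Z (\<lambda>v. \<beta> v w)"
  using bilinear by (auto simp: cbilinear_def)

text \<open>
  Bilinearity of \<open>\<beta>\<close> kills each of the generating relations, so that the lift is well defined on the
  quotient.
\<close>

lemma free_lift_relation:
  assumes "f \<in> bilinear_relations V W"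
  shows "free_lift Z \<beta> f = \<zero>\<^bsub>Z\<^esub>"
  using assms
proof (induction rule: bilinear_relations.induct)
  case rel_zero
  then show ?case by (simp add: free_lift_def)
next
  case (rel_add f g)
  then show ?case by (simp add: free_lift_add bilinear_relations_subset)
next
  case (rel_smult f c)
  then show ?case by (simp add: free_lift_smult bilinear_relations_subset)
next
  case (add_left x y w)
  then show ?case
    by (simp add: free_lift_diff free_space_diff free_space_point_mass free_lift_point_mass
        clinear_add[OF beta_linear(2)] cancel2 beta_in)
next
  case (add_right v x y)
  then show ?case
    by (simp add: free_lift_diff free_space_diff free_space_point_mass free_lift_point_mass
        clinear_add[OF beta_linear(1)] cancel2 beta_in)
next
  case (smult_left v w c)
  then show ?case
    by (simp add: free_lift_diff free_lift_smult free_space_smult free_space_point_mass free_lift_point_mass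
        clinear_smult[OF beta_linear(2)] cancel beta_in)
next
  case (smult_right v w c)
  then show ?case
    by (simp add: free_lift_diff free_lift_smult free_space_smult free_space_point_mass free_lift_point_mass
        clinear_smult[OF beta_linear(1)] cancel beta_in)
qed

lemma tensor_lift_class:
  assumes "f \<in> free_space V W"
  shows "tensor_lift Z \<beta> (tensor_class V W f) = free_lift Z \<beta> f"
proof -
  let ?r = "tensor_rep (tensor_class V W f)"
  have "free_lift Z \<beta> (\<lambda>p. (?r p - f p) + f p) = free_lift Z \<beta> (\<lambda>p. ?r p - f p) \<oplus>\<^bsub>Z\<^esub> free_lift Z \<beta> f"
    by (intro free_lift_add assms bilinear_relations_subset tensor_rep_class)
  also have "\<dots> = free_lift Z \<beta> f"
    using free_lift_relation[OF tensor_rep_class[of f]] free_lift_in[OF assms] by simp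
  finally show ?thesis by (simp add: tensor_lift_eq)
qed

lemma tensor_lift_simple:
  "v \<in> carrier V \<Longrightarrow> w \<in> carrier W \<Longrightarrow> tensor_lift Z \<beta> (simple_tensor V W v w) = \<beta> v w"
  by (simp add: simple_tensor_def tensor_lift_class free_space_point_mass free_lift_point_mass)

lemma clinear_tensor_lift: "clinear (V \<otimes>\<^sub>T W) Z (tensor_lift Z \<beta>)"
  by (rule clinearI)
     (auto simp: tensor_space_simps tensor_class_add tensor_class_smult tensor_lift_class
        free_lift_in free_space_add free_space_smult free_lift_add free_lift_smult)

end

lemma complex_space_tensor:
  assumes "complex_space V" "complex_space W"
  shows "complex_space (V \<otimes>\<^sub>T W)"
proof -
  interpret V: complex_space V by fact
  interpret W: complex_space W by fact
  interpret tensor_factors V W ..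
  show ?thesis by (rule T.complex_space_axioms)
qed

lemma
  assumes "complex_space V" "complex_space W" "complex_space Z" "cbilinear V W Z \<beta>"
  shows tensor_lift_simple:
      "v \<in> carrier V \<Longrightarrow> w \<in> carrier W \<Longrightarrow> tensor_lift Z \<beta> (simple_tensor V W v w) = \<beta> v w"
    and clinear_tensor_lift: "clinear (V \<otimes>\<^sub>T W) Z (tensor_lift Z \<beta>)"
proof -
  interpret V: complex_space V by fact
  interpret W: complex_space W by fact
  interpret Z: complex_space Z by fact
  interpret tensor_target V W Z \<beta> by standard fact
  show "v \<in> carrier V \<Longrightarrow> w \<in> carrier W \<Longrightarrow> tensor_lift Z \<beta> (simple_tensor V W v w) = \<beta> v w"
    by (rule tensor_lift_simple)
  show "clinear (V \<otimes>\<^sub>T W) Z (tensor_lift Z \<beta>)" by (rule clinear_tensor_lift)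
qed

lemma cbilinear_simple_tensor:
  assumes "complex_space V" "complex_space W"
  shows "cbilinear V W (V \<otimes>\<^sub>T W) (simple_tensor V W)"
proof -
  interpret V: complex_space V by fact
  interpret W: complex_space W by fact
  interpret tensor_factors V W ..
  show ?thesis by (rule cbilinear_simple_tensor)
qed

lemma clinear_tensor_eqI:
  assumes "complex_space V" "complex_space W"
    and "clinear (V \<otimes>\<^sub>T W) Z f" "clinear (V \<otimes>\<^sub>T W) Z g" "t \<in> carrier (V \<otimes>\<^sub>T W)"
    and "\<And>v w. v \<in> carrier V \<Longrightarrow> w \<in> carrier W \<Longrightarrow> f (simple_tensor V W v w) = g (simple_tensor V W v w)"
  shows "f t = g t"
proof -
  interpret V: complex_space V by fact
  interpret W: complex_space W by fact
  interpret tensor_factors V W ..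
  show ?thesis using clinear_tensor_eqI assms(3-) by blast
qed

lemma simple_tensor_in [intro]:
  assumes "complex_space V" "complex_space W" "v \<in> carrier V" "w \<in> carrier W"
  shows "simple_tensor V W v w \<in> carrier (V \<otimes>\<^sub>T W)"
  using cbilinear_simple_tensor[OF assms(1,2)] assms(3,4)
  by (auto simp: cbilinear_def clinear_def)

lemmas simple_tensor_linear =
  cbilinearD(1)[OF cbilinear_simple_tensor] cbilinearD(2)[OF cbilinear_simple_tensor]

lemma bilinear_relations_mono:
  assumes "carrier V = carrier V'" "add V = add V'" "smult V = smult V'"
    and "carrier W = carrier W'" "add W = add W'" "smult W = smult W'"
    and "f \<in> bilinear_relations V W"
  shows "f \<in> bilinear_relations V' W'"
  using assms(7) assms(1-6)
  by (induction rule: bilinear_relations.induct) (auto intro: bilinear_relations.intros)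

text \<open>
  Only the linear structure of the factors enters, so that \<open>L\<^sup>2(B, \<psi>) \<otimes> L\<^sup>2(B, \<psi>)\<close> and \<open>B \<otimes> B\<close> are the
  same space.
\<close>

lemma tensor_space_cong:
  assumes "carrier V = carrier V'" "add V = add V'" "smult V = smult V'"
    and "carrier W = carrier W'" "add W = add W'" "smult W = smult W'"
  shows "V \<otimes>\<^sub>T W = V' \<otimes>\<^sub>T W'"
proof -
  have "bilinear_relations V W = bilinear_relations V' W'"
    using bilinear_relations_mono[OF assms] bilinear_relations_mono[OF assms[symmetric]] by blast
  then have "tensor_class V W = tensor_class V' W'"
    by (simp add: tensor_class_def fun_eq_iff)
  moreover have "free_space V W = free_space V' W'"
    using assms by (simp add: free_space_def)
  ultimately show ?thesis by (simp add: tensor_space_def)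
qed

lemma tensor_rep_support:
  assumes "complex_space V" "complex_space W" "t \<in> carrier (V \<otimes>\<^sub>T W)" "tensor_rep t p \<noteq> 0"
  shows "fst p \<in> carrier V" "snd p \<in> carrier W"
proof -
  interpret V: complex_space V by fact
  interpret W: complex_space W by fact
  interpret tensor_factors V W ..
  have "tensor_rep t \<in> free_space V W"
    using assms(3) tensor_rep_free by (auto simp: tensor_space_simps)
  then show "fst p \<in> carrier V" "snd p \<in> carrier W"
    using assms(4) by (auto simp: free_space_def)
qed

text \<open>
  Every tensor in a space with coordinates on the left is uniquely \<open>\<Sum>\<^sub>k e\<^sub>k \<otimes> t\<^sub>k\<close>;
  \<open>lslice W (co k)\<close> extracts \<open>t\<^sub>k\<close>. Together, the slices are linear coordinates in which all the
  tensor constructions below become explicit. \<open>rslice\<close> does the same for coordinates on the right.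
\<close>

definition lslice ::
  "(complex, 'w, 'y) module_scheme \<Rightarrow> ('v \<Rightarrow> complex) \<Rightarrow> ('v, 'w) tens \<Rightarrow> 'w" where
  "lslice W \<kappa> = tensor_lift W (\<lambda>v w. \<kappa> v \<odot>\<^bsub>W\<^esub> w)"

definition rslice ::
  "(complex, 'v, 'x) module_scheme \<Rightarrow> ('w \<Rightarrow> complex) \<Rightarrow> ('v, 'w) tens \<Rightarrow> 'v" where
  "rslice V \<kappa> = tensor_lift V (\<lambda>v w. \<kappa> w \<odot>\<^bsub>V\<^esub> v)"

lemma cbilinear_lslice:
  assumes "complex_space W" "clinear V complex_module \<kappa>"
  shows "cbilinear V W W (\<lambda>v w. \<kappa> v \<odot>\<^bsub>W\<^esub> w)"
  using cbilinear_compose[OF cbilinear_smult[OF assms(1)] assms(2) clinear_id] .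

lemma
  assumes "complex_space V" "complex_space W" "clinear V complex_module \<kappa>"
  shows clinear_lslice: "clinear (V \<otimes>\<^sub>T W) W (lslice W \<kappa>)"
    and lslice_simple: "v \<in> carrier V \<Longrightarrow> w \<in> carrier W \<Longrightarrow>
      lslice W \<kappa> (simple_tensor V W v w) = \<kappa> v \<odot>\<^bsub>W\<^esub> w"
  unfolding lslice_def
  using clinear_tensor_lift[OF assms(1,2,2) cbilinear_lslice[OF assms(2,3)]]
    tensor_lift_simple[OF assms(1,2,2) cbilinear_lslice[OF assms(2,3)]] by auto

lemma
  assumes "complex_space V" "complex_space W" "clinear W complex_module \<kappa>"
  shows clinear_rslice: "clinear (V \<otimes>\<^sub>T W) V (rslice V \<kappa>)"
    and rslice_simple: "v \<in> carrier V \<Longrightarrow> w \<in> carrier W \<Longrightarrow>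
      rslice V \<kappa> (simple_tensor V W v w) = \<kappa> w \<odot>\<^bsub>V\<^esub> v"
  unfolding rslice_def
  using clinear_tensor_lift[OF assms(1,2,1) cbilinear_flip[OF cbilinear_lslice[OF assms(1,3)]]]
    tensor_lift_simple[OF assms(1,2,1) cbilinear_flip[OF cbilinear_lslice[OF assms(1,3)]]] by auto

lemma lslice_expand:
  assumes V: "complex_space V" and W: "complex_space W" and co: "coordinates V n e co"
    and t: "t \<in> carrier (V \<otimes>\<^sub>T W)"
  shows "t = (\<Oplus>\<^bsub>V \<otimes>\<^sub>T W\<^esub>k\<in>{..<n}. simple_tensor V W (e k) (lslice W (co k) t))"
proof -
  interpret V: complex_space V by fact
  interpret W: complex_space W by fact
  interpret tensor_factors V W ..
  note e = coordinatesD(1)[OF co] and c = coordinatesD(2)[OF co]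
  show ?thesis
  proof (rule clinear_tensor_eqI[OF clinear_id _ t])
    show "clinear (V \<otimes>\<^sub>T W) (V \<otimes>\<^sub>T W)
        (\<lambda>t. \<Oplus>\<^bsub>V \<otimes>\<^sub>T W\<^esub>k\<in>{..<n}. simple_tensor V W (e k) (lslice W (co k) t))"
      using e c by (intro clinear_finsum_fun T.complex_space_axioms
          clinear_compose[OF clinear_lslice simple_tensor_linear(1)] V W) auto
  next
    fix v w assume vw: "v \<in> carrier V" "w \<in> carrier W"
    have "simple_tensor V W v w = (\<Oplus>\<^bsub>V \<otimes>\<^sub>T W\<^esub>k\<in>{..<n}. co k v \<odot>\<^bsub>V \<otimes>\<^sub>T W\<^esub> simple_tensor V W (e k) w)"
      using vw by (intro clinear_expand[OF co V T.complex_space_axioms simple_tensor_linear(2)])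
    also have "\<dots> = (\<Oplus>\<^bsub>V \<otimes>\<^sub>T W\<^esub>k\<in>{..<n}. simple_tensor V W (e k)
        (lslice W (co k) (simple_tensor V W v w)))"
      using vw e c by (intro T.finsum_cong')
        (auto simp: lslice_simple[OF V W] clinear_smult[OF simple_tensor_linear(1)])
    finally show "simple_tensor V W v w = \<dots>" .
  qed
qed

lemma rslice_expand:
  assumes V: "complex_space V" and W: "complex_space W" and co: "coordinates W n e co"
    and t: "t \<in> carrier (V \<otimes>\<^sub>T W)"
  shows "t = (\<Oplus>\<^bsub>V \<otimes>\<^sub>T W\<^esub>k\<in>{..<n}. simple_tensor V W (rslice V (co k) t) (e k))"
proof -
  interpret V: complex_space V by fact
  interpret W: complex_space W by fact
  interpret tensor_factors V W ..
  note e = coordinatesD(1)[OF co] and c = coordinatesD(2)[OF co]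
  show ?thesis
  proof (rule clinear_tensor_eqI[OF clinear_id _ t])
    show "clinear (V \<otimes>\<^sub>T W) (V \<otimes>\<^sub>T W)
        (\<lambda>t. \<Oplus>\<^bsub>V \<otimes>\<^sub>T W\<^esub>k\<in>{..<n}. simple_tensor V W (rslice V (co k) t) (e k))"
      using e c by (intro clinear_finsum_fun T.complex_space_axioms
          clinear_compose[OF clinear_rslice simple_tensor_linear(2)] V W) auto
  next
    fix v w assume vw: "v \<in> carrier V" "w \<in> carrier W"
    have "simple_tensor V W v w = (\<Oplus>\<^bsub>V \<otimes>\<^sub>T W\<^esub>k\<in>{..<n}. co k w \<odot>\<^bsub>V \<otimes>\<^sub>T W\<^esub> simple_tensor V W v (e k))"
      using vw by (intro clinear_expand[OF co W T.complex_space_axioms simple_tensor_linear(1)])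
    also have "\<dots> = (\<Oplus>\<^bsub>V \<otimes>\<^sub>T W\<^esub>k\<in>{..<n}. simple_tensor V W
        (rslice V (co k) (simple_tensor V W v w)) (e k))"
      using vw e c by (intro T.finsum_cong')
        (auto simp: rslice_simple[OF V W] clinear_smult[OF simple_tensor_linear(2)])
    finally show "simple_tensor V W v w = \<dots>" .
  qed
qed

lemma lslice_eqI:
  assumes "complex_space V" "complex_space W" "coordinates V n e co"
    and "s \<in> carrier (V \<otimes>\<^sub>T W)" "t \<in> carrier (V \<otimes>\<^sub>T W)"
    and eq: "\<And>k. k < n \<Longrightarrow> lslice W (co k) s = lslice W (co k) t"
  shows "s = t"
proof -
  interpret T: complex_space "V \<otimes>\<^sub>T W" by (intro complex_space_tensor assms)
  have "(\<Oplus>\<^bsub>V \<otimes>\<^sub>T W\<^esub>k\<in>{..<n}. simple_tensor V W (e k) (lslice W (co k) s)) =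
      (\<Oplus>\<^bsub>V \<otimes>\<^sub>T W\<^esub>k\<in>{..<n}. simple_tensor V W (e k) (lslice W (co k) t))"
    using assms(4,5) by (intro T.finsum_cong')
      (simp_all add: eq simple_tensor_in[OF assms(1,2)] coordinatesD(1,2)[OF assms(3)]
        clinear_in[OF clinear_lslice[OF assms(1,2)]])
  then show ?thesis
    by (rule box_equals[OF _ lslice_expand[OF assms(1-4), symmetric]
          lslice_expand[OF assms(1-3,5), symmetric]])
qed

lemma rslice_eqI:
  assumes "complex_space V" "complex_space W" "coordinates W n e co"
    and "s \<in> carrier (V \<otimes>\<^sub>T W)" "t \<in> carrier (V \<otimes>\<^sub>T W)"
    and eq: "\<And>k. k < n \<Longrightarrow> rslice V (co k) s = rslice V (co k) t"
  shows "s = t"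
proof -
  interpret T: complex_space "V \<otimes>\<^sub>T W" by (intro complex_space_tensor assms)
  have "(\<Oplus>\<^bsub>V \<otimes>\<^sub>T W\<^esub>k\<in>{..<n}. simple_tensor V W (rslice V (co k) s) (e k)) =
      (\<Oplus>\<^bsub>V \<otimes>\<^sub>T W\<^esub>k\<in>{..<n}. simple_tensor V W (rslice V (co k) t) (e k))"
    using assms(4,5) by (intro T.finsum_cong')
      (simp_all add: eq simple_tensor_in[OF assms(1,2)] coordinatesD(1,2)[OF assms(3)]
        clinear_in[OF clinear_rslice[OF assms(1,2)]])
  then show ?thesis
    by (rule box_equals[OF _ rslice_expand[OF assms(1-4), symmetric]
          rslice_expand[OF assms(1-3,5), symmetric]])
qed

lemma lslice_finsum_simple:
  assumes V: "complex_space V" and W: "complex_space W" and co: "clinear V complex_module \<kappa>"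
    and ef: "\<And>i. i \<in> S \<Longrightarrow> f i \<in> carrier V" "\<And>i. i \<in> S \<Longrightarrow> g i \<in> carrier W"
  shows "lslice W \<kappa> (\<Oplus>\<^bsub>V \<otimes>\<^sub>T W\<^esub>i\<in>S. simple_tensor V W (f i) (g i)) = (\<Oplus>\<^bsub>W\<^esub>i\<in>S. \<kappa> (f i) \<odot>\<^bsub>W\<^esub> g i)"
proof -
  interpret W: complex_space W by fact
  show ?thesis
    using ef by (subst clinear_finsum[OF complex_space_tensor[OF V W] W clinear_lslice[OF V W co]])
      (auto simp: simple_tensor_in V W lslice_simple[OF V W co] intro!: W.finsum_cong')
qed

lemma rslice_finsum_simple:
  assumes V: "complex_space V" and W: "complex_space W" and co: "clinear W complex_module \<kappa>"
    and ef: "\<And>i. i \<in> S \<Longrightarrow> f i \<in> carrier V" "\<And>i. i \<in> S \<Longrightarrow> g i \<in> carrier W"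
  shows "rslice V \<kappa> (\<Oplus>\<^bsub>V \<otimes>\<^sub>T W\<^esub>i\<in>S. simple_tensor V W (f i) (g i)) = (\<Oplus>\<^bsub>V\<^esub>i\<in>S. \<kappa> (g i) \<odot>\<^bsub>V\<^esub> f i)"
proof -
  interpret V: complex_space V by fact
  show ?thesis
    using ef by (subst clinear_finsum[OF complex_space_tensor[OF V W] V clinear_rslice[OF V W co]])
      (auto simp: simple_tensor_in V W rslice_simple[OF V W co] intro!: V.finsum_cong')
qed

lemma
  assumes V: "complex_space V" and W: "complex_space W" and V': "complex_space V'"
    and W': "complex_space W'" and f: "clinear V V' f" and g: "clinear W W' g"
  shows clinear_tensor_map: "clinear (V \<otimes>\<^sub>T W) (V' \<otimes>\<^sub>T W') (tensor_map V' W' f g)"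
    and tensor_map_simple: "v \<in> carrier V \<Longrightarrow> w \<in> carrier W \<Longrightarrow>
      tensor_map V' W' f g (simple_tensor V W v w) = simple_tensor V' W' (f v) (g w)"
proof -
  note b = cbilinear_compose[OF cbilinear_simple_tensor[OF V' W'] f g]
  note T = complex_space_tensor[OF V' W']
  show "clinear (V \<otimes>\<^sub>T W) (V' \<otimes>\<^sub>T W') (tensor_map V' W' f g)"
    unfolding tensor_map_def by (rule clinear_tensor_lift[OF V W T b])
  show "v \<in> carrier V \<Longrightarrow> w \<in> carrier W \<Longrightarrow>
      tensor_map V' W' f g (simple_tensor V W v w) = simple_tensor V' W' (f v) (g w)"
    unfolding tensor_map_def by (rule tensor_lift_simple[OF V W T b])
qed

text \<open>
  The associators are nested lifts. The inner lift depends linearly on the remaining factor, which is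
  checked on simple tensors, so that the outer lift is again one of a bilinear map.
\<close>

lemma
  assumes U: "complex_space U" and V: "complex_space V" and W: "complex_space W"
  shows clinear_tensor_assoc:
      "clinear ((U \<otimes>\<^sub>T V) \<otimes>\<^sub>T W) (U \<otimes>\<^sub>T (V \<otimes>\<^sub>T W)) (tensor_assoc U V W)"
    and tensor_assoc_simple: "u \<in> carrier U \<Longrightarrow> v \<in> carrier V \<Longrightarrow> w \<in> carrier W \<Longrightarrow>
      tensor_assoc U V W (simple_tensor (U \<otimes>\<^sub>T V) W (simple_tensor U V u v) w) =
        simple_tensor U (V \<otimes>\<^sub>T W) u (simple_tensor V W v w)"
proof -
  let ?Z = "U \<otimes>\<^sub>T (V \<otimes>\<^sub>T W)"
  note UV = complex_space_tensor[OF U V] and VW = complex_space_tensor[OF V W]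
  note Z = complex_space_tensor[OF U VW]
  let ?\<gamma> = "\<lambda>w u v. simple_tensor U (V \<otimes>\<^sub>T W) u (simple_tensor V W v w)"
  have g: "cbilinear U V ?Z (?\<gamma> w)" if "w \<in> carrier W" for w
    by (intro cbilinear_compose[OF cbilinear_simple_tensor[OF U VW] clinear_id
          simple_tensor_linear(2)[OF V W]] that)
  let ?\<beta> = "\<lambda>s w. tensor_lift ?Z (?\<gamma> w) s"
  have lin: "clinear W ?Z (\<lambda>w. ?\<gamma> w u v)" if "u \<in> carrier U" "v \<in> carrier V" for u v
    by (intro clinear_compose[OF simple_tensor_linear(1)[OF V W] simple_tensor_linear(1)[OF U VW]] that)
  interpret W: complex_space W by fact
  interpret Z: complex_space ?Z by fact
  have b: "cbilinear (U \<otimes>\<^sub>T V) W ?Z ?\<beta>"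
  proof (intro cbilinearI clinearI)
    fix s assume s: "s \<in> carrier (U \<otimes>\<^sub>T V)"
    fix x y assume xy: "x \<in> carrier W" "y \<in> carrier W"
    show "?\<beta> s (x \<oplus>\<^bsub>W\<^esub> y) = ?\<beta> s x \<oplus>\<^bsub>?Z\<^esub> ?\<beta> s y"
      using xy
      by (intro clinear_tensor_eqI[OF U V _ _ s, where Z = ?Z and f = "\<lambda>s. ?\<beta> s (x \<oplus>\<^bsub>W\<^esub> y)"
            and g = "\<lambda>s. ?\<beta> s x \<oplus>\<^bsub>?Z\<^esub> ?\<beta> s y"] clinear_tensor_lift[OF U V Z g] clinear_plus[OF Z] W.a_closed)
        (simp_all add: tensor_lift_simple[OF U V Z g] clinear_add[OF lin])
  next
    fix s assume s: "s \<in> carrier (U \<otimes>\<^sub>T V)"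
    fix x c assume xy: "x \<in> carrier W"
    show "?\<beta> s (c \<odot>\<^bsub>W\<^esub> x) = c \<odot>\<^bsub>?Z\<^esub> ?\<beta> s x"
      using xy
      by (intro clinear_tensor_eqI[OF U V _ _ s, where Z = ?Z and f = "\<lambda>s. ?\<beta> s (c \<odot>\<^bsub>W\<^esub> x)"
            and g = "\<lambda>s. c \<odot>\<^bsub>?Z\<^esub> ?\<beta> s x"] clinear_tensor_lift[OF U V Z g] clinear_scaled[OF Z] W.smult_in)
        (simp_all add: tensor_lift_simple[OF U V Z g] clinear_smult[OF lin])
  qed (simp_all add: clinear_in[OF clinear_tensor_lift[OF U V Z g]]
      clinear_add[OF clinear_tensor_lift[OF U V Z g]] clinear_smult[OF clinear_tensor_lift[OF U V Z g]])
  show "clinear ((U \<otimes>\<^sub>T V) \<otimes>\<^sub>T W) (U \<otimes>\<^sub>T (V \<otimes>\<^sub>T W)) (tensor_assoc U V W)"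
    unfolding tensor_assoc_def by (rule clinear_tensor_lift[OF UV W Z b])
  show "tensor_assoc U V W (simple_tensor (U \<otimes>\<^sub>T V) W (simple_tensor U V u v) w) =
        simple_tensor U (V \<otimes>\<^sub>T W) u (simple_tensor V W v w)"
    if "u \<in> carrier U" "v \<in> carrier V" "w \<in> carrier W"
    unfolding tensor_assoc_def using that
    by (simp add: tensor_lift_simple[OF UV W Z b] tensor_lift_simple[OF U V Z g]
        simple_tensor_in[OF U V])
qed

lemma
  assumes U: "complex_space U" and V: "complex_space V" and W: "complex_space W"
  shows clinear_tensor_assoc_inv:
      "clinear (U \<otimes>\<^sub>T (V \<otimes>\<^sub>T W)) ((U \<otimes>\<^sub>T V) \<otimes>\<^sub>T W) (tensor_assoc_inv U V W)"
    and tensor_assoc_inv_simple: "u \<in> carrier U \<Longrightarrow> v \<in> carrier V \<Longrightarrow> w \<in> carrier W \<Longrightarrow>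
      tensor_assoc_inv U V W (simple_tensor U (V \<otimes>\<^sub>T W) u (simple_tensor V W v w)) =
        simple_tensor (U \<otimes>\<^sub>T V) W (simple_tensor U V u v) w"
proof -
  let ?Z = "(U \<otimes>\<^sub>T V) \<otimes>\<^sub>T W"
  note UV = complex_space_tensor[OF U V] and VW = complex_space_tensor[OF V W]
  note Z = complex_space_tensor[OF UV W]
  let ?\<gamma> = "\<lambda>u v w. simple_tensor (U \<otimes>\<^sub>T V) W (simple_tensor U V u v) w"
  have g: "cbilinear V W ?Z (?\<gamma> u)" if "u \<in> carrier U" for u
    by (intro cbilinear_compose[OF cbilinear_simple_tensor[OF UV W]
          simple_tensor_linear(1)[OF U V] clinear_id] that)
  let ?\<beta> = "\<lambda>u s. tensor_lift ?Z (?\<gamma> u) s"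
  have lin: "clinear U ?Z (\<lambda>u. ?\<gamma> u v w)" if "w \<in> carrier W" "v \<in> carrier V" for v w
    by (intro clinear_compose[OF simple_tensor_linear(2)[OF U V] simple_tensor_linear(2)[OF UV W]] that)
  interpret U: complex_space U by fact
  interpret Z: complex_space ?Z by fact
  have b: "cbilinear U (V \<otimes>\<^sub>T W) ?Z ?\<beta>"
  proof (intro cbilinearI clinearI)
    fix s assume s: "s \<in> carrier (V \<otimes>\<^sub>T W)"
    fix x y assume xy: "x \<in> carrier U" "y \<in> carrier U"
    show "?\<beta> (x \<oplus>\<^bsub>U\<^esub> y) s = ?\<beta> x s \<oplus>\<^bsub>?Z\<^esub> ?\<beta> y s"
      using xy
      by (intro clinear_tensor_eqI[OF V W _ _ s, where Z = ?Z and f = "\<lambda>s. ?\<beta> (x \<oplus>\<^bsub>U\<^esub> y) s"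
            and g = "\<lambda>s. ?\<beta> x s \<oplus>\<^bsub>?Z\<^esub> ?\<beta> y s"] clinear_tensor_lift[OF V W Z g] clinear_plus[OF Z] U.a_closed)
        (simp_all add: tensor_lift_simple[OF V W Z g] clinear_add[OF lin])
  next
    fix s assume s: "s \<in> carrier (V \<otimes>\<^sub>T W)"
    fix x c assume xy: "x \<in> carrier U"
    show "?\<beta> (c \<odot>\<^bsub>U\<^esub> x) s = c \<odot>\<^bsub>?Z\<^esub> ?\<beta> x s"
      using xy
      by (intro clinear_tensor_eqI[OF V W _ _ s, where Z = ?Z and f = "\<lambda>s. ?\<beta> (c \<odot>\<^bsub>U\<^esub> x) s"
            and g = "\<lambda>s. c \<odot>\<^bsub>?Z\<^esub> ?\<beta> x s"] clinear_tensor_lift[OF V W Z g] clinear_scaled[OF Z] U.smult_in)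
        (simp_all add: tensor_lift_simple[OF V W Z g] clinear_smult[OF lin])
  qed (simp_all add: clinear_in[OF clinear_tensor_lift[OF V W Z g]]
      clinear_add[OF clinear_tensor_lift[OF V W Z g]] clinear_smult[OF clinear_tensor_lift[OF V W Z g]])
  show "clinear (U \<otimes>\<^sub>T (V \<otimes>\<^sub>T W)) ((U \<otimes>\<^sub>T V) \<otimes>\<^sub>T W) (tensor_assoc_inv U V W)"
    unfolding tensor_assoc_inv_def by (rule clinear_tensor_lift[OF U VW Z b])
  show "tensor_assoc_inv U V W (simple_tensor U (V \<otimes>\<^sub>T W) u (simple_tensor V W v w)) =
        simple_tensor (U \<otimes>\<^sub>T V) W (simple_tensor U V u v) w"
    if "u \<in> carrier U" "v \<in> carrier V" "w \<in> carrier W"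
    unfolding tensor_assoc_inv_def using that
    by (simp add: tensor_lift_simple[OF U VW Z b] tensor_lift_simple[OF V W Z g]
        simple_tensor_in[OF V W])
qed

section \<open>Tensor products of \<open>*\<close>-algebras in coordinates\<close>

sublocale unital_star_algebra \<subseteq> complex_space A ..

context unital_star_algebra
begin

lemma ring: "ring A"
  by (rule unital_star_algebra.axioms) (rule unital_star_algebra_axioms)

lemmas distribs = ring.ring_simprules(13,23)[OF ring]
lemmas zero_in [simp] = ring.ring_simprules(2)[OF ring]
lemmas unit_in [simp] = ring.ring_simprules(6)[OF ring]
lemmas mult_in [simp] = ring.ring_simprules(5)[OF ring]
lemmas mult_assoc = ring.ring_simprules(11)[OF ring]

lemma cbilinear_mult: "cbilinear A A A (\<otimes>)"
  by (intro cbilinearI clinearI) (auto simp: distribs smult_mult_left smult_mult_right)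

lemmas mult_linear = cbilinearD(1)[OF cbilinear_mult] cbilinearD(2)[OF cbilinear_mult]

lemma finsum_mult_left:
  "f \<in> S \<rightarrow> carrier A \<Longrightarrow> y \<in> carrier A \<Longrightarrow> (\<Oplus>i\<in>S. f i) \<otimes> y = (\<Oplus>i\<in>S. f i \<otimes> y)"
  by (rule clinear_finsum[OF complex_space_axioms complex_space_axioms mult_linear(2)])

lemma finsum_mult_right:
  "f \<in> S \<rightarrow> carrier A \<Longrightarrow> y \<in> carrier A \<Longrightarrow> y \<otimes> (\<Oplus>i\<in>S. f i) = (\<Oplus>i\<in>S. y \<otimes> f i)"
  by (rule clinear_finsum[OF complex_space_axioms complex_space_axioms mult_linear(1)])

lemma star_zero [simp]: "star A \<zero> = \<zero>"
  using star_smult[OF zero_in, of 0] star_closed[OF zero_in] by simp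

lemma star_one [simp]: "star A \<one> = \<one>"
  using star_mult[of \<one> "star A \<one>"] star_closed[OF unit_in] star_star[OF unit_in] by simp

lemma star_finsum:
  "f \<in> S \<rightarrow> carrier A \<Longrightarrow> star A (\<Oplus>i\<in>S. f i) = (\<Oplus>i\<in>S. star A (f i))"
  by (induction S rule: infinite_finite_induct)
     (auto simp: Pi_def star_add star_closed finsum_infinite finsum_empty finsum_insert)

end

text \<open>
  The conjugate vector space. An antilinear map is a linear map into it, so that the involution on a
  tensor product is again a lift.
\<close>

definition conj_space :: "(complex, 'z, 'u) module_scheme \<Rightarrow> (complex, 'z, 'u) module_scheme" where
  "conj_space Z = Z\<lparr>smult := \<lambda>c z. cnj c \<odot>\<^bsub>Z\<^esub> z\<rparr>"

lemma conj_space_simps [simp]: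
  "carrier (conj_space Z) = carrier Z" "\<zero>\<^bsub>conj_space Z\<^esub> = \<zero>\<^bsub>Z\<^esub>"
  "add (conj_space Z) = add Z" "c \<odot>\<^bsub>conj_space Z\<^esub> z = cnj c \<odot>\<^bsub>Z\<^esub> z"
  by (simp_all add: conj_space_def)

lemma finsum_conj_space [simp]: "finsum (conj_space Z) f S = finsum Z f S"
  by (rule finsum_cong_add_monoid) auto

lemma complex_space_conj_space:
  assumes "complex_space Z"
  shows "complex_space (conj_space Z)"
proof -
  interpret Z: complex_space Z by fact
  show ?thesis
  proof (rule complex_spaceI)
    show "abelian_group (conj_space Z)"
      by (rule abelian_groupI)
        (auto simp: Z.a_ac intro!: bexI[of _ "\<ominus>\<^bsub>Z\<^esub> _"] Z.l_neg)
  qed (auto simp: Z.smult_plus Z.smult_add Z.smult_smult)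
qed

text \<open>The product of a tensor product of algebras is a nested lift of this kind.\<close>

lemma
  assumes V: "complex_space V" and W: "complex_space W" and V': "complex_space V'"
    and W': "complex_space W'" and Z: "complex_space Z"
    and \<beta>1: "\<And>v' w'. v' \<in> carrier V' \<Longrightarrow> w' \<in> carrier W' \<Longrightarrow> cbilinear V W Z (\<lambda>v w. \<beta> v w v' w')"
    and \<beta>2: "\<And>v w. v \<in> carrier V \<Longrightarrow> w \<in> carrier W \<Longrightarrow> cbilinear V' W' Z (\<beta> v w)"
  defines "m \<equiv> \<lambda>s t. tensor_lift Z (\<lambda>v w. tensor_lift Z (\<lambda>v' w'. \<beta> v w v' w') t) s"
  shows cbilinear_double_lift: "cbilinear (V \<otimes>\<^sub>T W) (V' \<otimes>\<^sub>T W') Z m"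
    and double_lift_simple: "v \<in> carrier V \<Longrightarrow> w \<in> carrier W \<Longrightarrow> v' \<in> carrier V' \<Longrightarrow> w' \<in> carrier W' \<Longrightarrow>
      m (simple_tensor V W v w) (simple_tensor V' W' v' w') = \<beta> v w v' w'"
proof -
  interpret V: complex_space V by fact
  interpret W: complex_space W by fact
  interpret Z: complex_space Z by fact
  let ?T' = "V' \<otimes>\<^sub>T W'"
  interpret T': complex_space ?T' by (intro complex_space_tensor V' W')
  let ?i = "\<lambda>v w. tensor_lift Z (\<beta> v w)"
  note lin = clinear_tensor_lift[OF V' W' Z \<beta>2] and simp = tensor_lift_simple[OF V' W' Z \<beta>2]
  note b1 = cbilinearD(1)[OF \<beta>1] and b2 = cbilinearD(2)[OF \<beta>1]
  have inner: "cbilinear V W Z (\<lambda>v w. ?i v w t)" if t: "t \<in> carrier ?T'" for t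
  proof (intro cbilinearI clinearI)
    fix v x y assume [simp]: "v \<in> carrier V" "x \<in> carrier W" "y \<in> carrier W"
    show "?i v (x \<oplus>\<^bsub>W\<^esub> y) t = ?i v x t \<oplus>\<^bsub>Z\<^esub> ?i v y t"
      by (intro clinear_tensor_eqI[OF V' W' _ _ t, where Z = Z and f = "?i v (x \<oplus>\<^bsub>W\<^esub> y)"
            and g = "\<lambda>t. ?i v x t \<oplus>\<^bsub>Z\<^esub> ?i v y t"] lin clinear_plus[OF Z])
        (simp_all add: simp clinear_add[OF b1])
  next
    fix v x c assume [simp]: "v \<in> carrier V" "x \<in> carrier W"
    show "?i v (c \<odot>\<^bsub>W\<^esub> x) t = c \<odot>\<^bsub>Z\<^esub> ?i v x t"
      by (intro clinear_tensor_eqI[OF V' W' _ _ t, where Z = Z and f = "?i v (c \<odot>\<^bsub>W\<^esub> x)"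
            and g = "\<lambda>t. c \<odot>\<^bsub>Z\<^esub> ?i v x t"] lin clinear_scaled[OF Z])
        (simp_all add: simp clinear_smult[OF b1])
  next
    fix v x y assume [simp]: "v \<in> carrier W" "x \<in> carrier V" "y \<in> carrier V"
    show "?i (x \<oplus>\<^bsub>V\<^esub> y) v t = ?i x v t \<oplus>\<^bsub>Z\<^esub> ?i y v t"
      by (intro clinear_tensor_eqI[OF V' W' _ _ t, where Z = Z and f = "?i (x \<oplus>\<^bsub>V\<^esub> y) v"
            and g = "\<lambda>t. ?i x v t \<oplus>\<^bsub>Z\<^esub> ?i y v t"] lin clinear_plus[OF Z])
        (simp_all add: simp clinear_add[OF b2])
  next
    fix v x c assume [simp]: "v \<in> carrier W" "x \<in> carrier V"
    show "?i (c \<odot>\<^bsub>V\<^esub> x) v t = c \<odot>\<^bsub>Z\<^esub> ?i x v t"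
      by (intro clinear_tensor_eqI[OF V' W' _ _ t, where Z = Z and f = "?i (c \<odot>\<^bsub>V\<^esub> x) v"
            and g = "\<lambda>t. c \<odot>\<^bsub>Z\<^esub> ?i x v t"] lin clinear_scaled[OF Z])
        (simp_all add: simp clinear_smult[OF b2])
  qed (use t in \<open>simp_all add: clinear_in[OF lin]\<close>)
  note out = clinear_tensor_lift[OF V W Z inner] and osimp = tensor_lift_simple[OF V W Z inner]
  let ?o = "\<lambda>s t. tensor_lift Z (\<lambda>v w. ?i v w t) s"
  have "cbilinear (V \<otimes>\<^sub>T W) ?T' Z ?o"
  proof (intro cbilinearI clinearI)
    fix s x y assume s: "s \<in> carrier (V \<otimes>\<^sub>T W)" and [simp]: "x \<in> carrier ?T'" "y \<in> carrier ?T'"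
    show "?o s (x \<oplus>\<^bsub>?T'\<^esub> y) = ?o s x \<oplus>\<^bsub>Z\<^esub> ?o s y"
      by (intro clinear_tensor_eqI[OF V W _ _ s, where Z = Z and f = "\<lambda>s. ?o s (x \<oplus>\<^bsub>?T'\<^esub> y)"
            and g = "\<lambda>s. ?o s x \<oplus>\<^bsub>Z\<^esub> ?o s y"] out clinear_plus[OF Z])
        (simp_all add: osimp clinear_add[OF lin])
  next
    fix s x c assume s: "s \<in> carrier (V \<otimes>\<^sub>T W)" and [simp]: "x \<in> carrier ?T'"
    show "?o s (c \<odot>\<^bsub>?T'\<^esub> x) = c \<odot>\<^bsub>Z\<^esub> ?o s x"
      by (intro clinear_tensor_eqI[OF V W _ _ s, where Z = Z and f = "\<lambda>s. ?o s (c \<odot>\<^bsub>?T'\<^esub> x)"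
            and g = "\<lambda>s. c \<odot>\<^bsub>Z\<^esub> ?o s x"] out clinear_scaled[OF Z])
        (simp_all add: osimp clinear_smult[OF lin])
  qed (simp_all add: clinear_in[OF out] clinear_add[OF out] clinear_smult[OF out])
  then show "cbilinear (V \<otimes>\<^sub>T W) ?T' Z m" by (simp add: m_def)
  show "m (simple_tensor V W v w) (simple_tensor V' W' v' w') = \<beta> v w v' w'"
    if "v \<in> carrier V" "w \<in> carrier W" "v' \<in> carrier V'" "w' \<in> carrier W'"
    using that by (simp add: m_def osimp simp simple_tensor_in[OF V' W'])
qed

locale coordinate_tensor_algebra = A: unital_star_algebra A + D: unital_star_algebra D
  for A :: "('a, 'x) star_algebra_scheme" and D :: "('d, 'y) star_algebra_scheme" +
  fixes n :: nat and e :: "nat \<Rightarrow> 'a" and co :: "nat \<Rightarrow> 'a \<Rightarrow> complex"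
  assumes coords: "coordinates A n e co"
begin

sublocale tensor_factors A D ..

abbreviation TA where "TA \<equiv> tensor_algebra A D"
abbreviation slice where "slice l \<equiv> lslice D (co l)"

lemma TA_simps [simp]:
  "carrier TA = carrier (A \<otimes>\<^sub>T D)" "\<one>\<^bsub>TA\<^esub> = simple_tensor A D \<one>\<^bsub>A\<^esub> \<one>\<^bsub>D\<^esub>"
  "\<zero>\<^bsub>TA\<^esub> = \<zero>\<^bsub>A \<otimes>\<^sub>T D\<^esub>" "add TA = add (A \<otimes>\<^sub>T D)" "smult TA = smult (A \<otimes>\<^sub>T D)"
  by (simp_all add: tensor_algebra_def)

lemmas spaces = A.complex_space_axioms D.complex_space_axioms T.complex_space_axioms

lemma e_in [simp]: "i < n \<Longrightarrow> e i \<in> carrier A"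
  using coordinatesD(1)[OF coords] .

lemma co_linear: "i < n \<Longrightarrow> clinear A complex_module (co i)"
  using coordinatesD(2)[OF coords] .

lemma slice_linear: "l < n \<Longrightarrow> clinear (A \<otimes>\<^sub>T D) D (slice l)"
  by (intro clinear_lslice spaces co_linear)

lemma slice_in [simp]: "l < n \<Longrightarrow> t \<in> carrier (A \<otimes>\<^sub>T D) \<Longrightarrow> slice l t \<in> carrier D"
  using clinear_in[OF slice_linear] .

lemma slice_eqI:
  "s \<in> carrier (A \<otimes>\<^sub>T D) \<Longrightarrow> t \<in> carrier (A \<otimes>\<^sub>T D) \<Longrightarrow> (\<And>l. l < n \<Longrightarrow> slice l s = slice l t) \<Longrightarrow> s = t"
  using lslice_eqI[OF spaces(1,2) coords] by blast

lemma slice_expand: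
  "t \<in> carrier (A \<otimes>\<^sub>T D) \<Longrightarrow> (\<Oplus>\<^bsub>A \<otimes>\<^sub>T D\<^esub>k\<in>{..<n}. simple_tensor A D (e k) (slice k t)) = t"
  using lslice_expand[OF spaces(1,2) coords] by simp

lemma slice_simple:
  "l < n \<Longrightarrow> x \<in> carrier A \<Longrightarrow> d \<in> carrier D \<Longrightarrow> slice l (simple_tensor A D x d) = co l x \<odot>\<^bsub>D\<^esub> d"
  by (intro lslice_simple spaces co_linear)

lemma slice_finsum_simple:
  "l < n \<Longrightarrow> f \<in> S \<rightarrow> carrier A \<Longrightarrow> g \<in> S \<rightarrow> carrier D \<Longrightarrow>
    slice l (\<Oplus>\<^bsub>A \<otimes>\<^sub>T D\<^esub>i\<in>S. simple_tensor A D (f i) (g i)) = (\<Oplus>\<^bsub>D\<^esub>i\<in>S. co l (f i) \<odot>\<^bsub>D\<^esub> g i)"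
  by (intro lslice_finsum_simple spaces co_linear) auto

lemma TA_mult_eq: "s \<otimes>\<^bsub>TA\<^esub> t = tensor_lift (A \<otimes>\<^sub>T D) (\<lambda>a b. tensor_lift (A \<otimes>\<^sub>T D)
    (\<lambda>a' b'. simple_tensor A D (a \<otimes>\<^bsub>A\<^esub> a') (b \<otimes>\<^bsub>D\<^esub> b')) t) s"
  by (simp add: tensor_algebra_def)

lemma
  shows cbilinear_TA_mult: "cbilinear (A \<otimes>\<^sub>T D) (A \<otimes>\<^sub>T D) (A \<otimes>\<^sub>T D) (\<lambda>s t. s \<otimes>\<^bsub>TA\<^esub> t)"
    and TA_mult_simple: "a \<in> carrier A \<Longrightarrow> d \<in> carrier D \<Longrightarrow> a' \<in> carrier A \<Longrightarrow> d' \<in> carrier D \<Longrightarrow>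
      simple_tensor A D a d \<otimes>\<^bsub>TA\<^esub> simple_tensor A D a' d' =
        simple_tensor A D (a \<otimes>\<^bsub>A\<^esub> a') (d \<otimes>\<^bsub>D\<^esub> d')"
  unfolding TA_mult_eq
  by (intro cbilinear_double_lift double_lift_simple spaces
        cbilinear_compose[OF cbilinear_simple_tensor] A.mult_linear D.mult_linear; assumption)+

lemma TA_mult_closed:
  "s \<in> carrier (A \<otimes>\<^sub>T D) \<Longrightarrow> t \<in> carrier (A \<otimes>\<^sub>T D) \<Longrightarrow> s \<otimes>\<^bsub>TA\<^esub> t \<in> carrier (A \<otimes>\<^sub>T D)"
  using clinear_in[OF cbilinearD(1)[OF cbilinear_TA_mult]] .

text \<open>
  The scalars are the structure constants of \<open>A\<close> in the basis \<open>e\<close>.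
\<close>

lemma slice_mult:
  assumes l: "l < n" and s: "s \<in> carrier (A \<otimes>\<^sub>T D)" and t: "t \<in> carrier (A \<otimes>\<^sub>T D)"
  shows "slice l (s \<otimes>\<^bsub>TA\<^esub> t) =
    (\<Oplus>\<^bsub>D\<^esub>a\<in>{..<n}. \<Oplus>\<^bsub>D\<^esub>b\<in>{..<n}. co l (e a \<otimes>\<^bsub>A\<^esub> e b) \<odot>\<^bsub>D\<^esub> (slice a s \<otimes>\<^bsub>D\<^esub> slice b t))"
proof -
  let ?f = "\<lambda>s a. simple_tensor A D (e a) (slice a s)"
  note m1 = clinear_finsum[OF spaces(3,3) cbilinearD(1)[OF cbilinear_TA_mult]]
    and m2 = clinear_finsum[OF spaces(3,3) cbilinearD(2)[OF cbilinear_TA_mult]]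
  have "s \<otimes>\<^bsub>TA\<^esub> t = (\<Oplus>\<^bsub>A \<otimes>\<^sub>T D\<^esub>a\<in>{..<n}. ?f s a) \<otimes>\<^bsub>TA\<^esub> (\<Oplus>\<^bsub>A \<otimes>\<^sub>T D\<^esub>b\<in>{..<n}. ?f t b)"
    using slice_expand s t by simp
  also have "\<dots> = (\<Oplus>\<^bsub>A \<otimes>\<^sub>T D\<^esub>a\<in>{..<n}. ?f s a \<otimes>\<^bsub>TA\<^esub> (\<Oplus>\<^bsub>A \<otimes>\<^sub>T D\<^esub>b\<in>{..<n}. ?f t b))"
    using s t by (intro m2) auto
  also have "\<dots> = (\<Oplus>\<^bsub>A \<otimes>\<^sub>T D\<^esub>a\<in>{..<n}. \<Oplus>\<^bsub>A \<otimes>\<^sub>T D\<^esub>b\<in>{..<n}. ?f s a \<otimes>\<^bsub>TA\<^esub> ?f t b)"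
    using s t by (intro T.finsum_cong' m1) (auto intro!: T.finsum_closed TA_mult_closed)
  also have "\<dots> = (\<Oplus>\<^bsub>A \<otimes>\<^sub>T D\<^esub>a\<in>{..<n}. \<Oplus>\<^bsub>A \<otimes>\<^sub>T D\<^esub>b\<in>{..<n}.
      simple_tensor A D (e a \<otimes>\<^bsub>A\<^esub> e b) (slice a s \<otimes>\<^bsub>D\<^esub> slice b t))"
    using s t by (intro T.finsum_cong') (auto simp: TA_mult_simple intro!: T.finsum_closed)
  finally have "slice l (s \<otimes>\<^bsub>TA\<^esub> t) = slice l \<dots>" by simp
  also have "\<dots> = (\<Oplus>\<^bsub>D\<^esub>a\<in>{..<n}. slice l (\<Oplus>\<^bsub>A \<otimes>\<^sub>T D\<^esub>b\<in>{..<n}.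
      simple_tensor A D (e a \<otimes>\<^bsub>A\<^esub> e b) (slice a s \<otimes>\<^bsub>D\<^esub> slice b t)))"
    using s t by (intro clinear_finsum[OF spaces(3,2) slice_linear[OF l]]) (auto intro!: T.finsum_closed)
  also have "\<dots> = (\<Oplus>\<^bsub>D\<^esub>a\<in>{..<n}. \<Oplus>\<^bsub>D\<^esub>b\<in>{..<n}. co l (e a \<otimes>\<^bsub>A\<^esub> e b) \<odot>\<^bsub>D\<^esub> (slice a s \<otimes>\<^bsub>D\<^esub> slice b t))"
    using s t l by (intro D.finsum_cong' slice_finsum_simple) (auto intro!: D.finsum_closed)
  finally show ?thesis .
qed

lemma TA_star_eq:
  "star TA t = tensor_lift (conj_space (A \<otimes>\<^sub>T D)) (\<lambda>a d. simple_tensor A D (star A a) (star D d)) t"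
  by (simp add: tensor_algebra_def tensor_lift_def)

lemma
  shows TA_star_antilinear: "clinear (A \<otimes>\<^sub>T D) (conj_space (A \<otimes>\<^sub>T D)) (star TA)"
    and TA_star_simple: "a \<in> carrier A \<Longrightarrow> d \<in> carrier D \<Longrightarrow>
      star TA (simple_tensor A D a d) = simple_tensor A D (star A a) (star D d)"
proof -
  note c = complex_space_conj_space[OF spaces(3)]
  have b: "cbilinear A D (conj_space (A \<otimes>\<^sub>T D)) (\<lambda>a d. simple_tensor A D (star A a) (star D d))"
    by (intro cbilinearI clinearI)
      (simp_all add: A.star_closed D.star_closed A.star_add D.star_add A.star_smult D.star_smult
        clinear_add[OF simple_tensor_linear(1)] clinear_add[OF simple_tensor_linear(2)]
        clinear_smult[OF simple_tensor_linear(1)] clinear_smult[OF simple_tensor_linear(2)])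
  show "clinear (A \<otimes>\<^sub>T D) (conj_space (A \<otimes>\<^sub>T D)) (star TA)"
    using clinear_tensor_lift[OF spaces(1,2) c b] by (simp add: TA_star_eq[abs_def])
  show "a \<in> carrier A \<Longrightarrow> d \<in> carrier D \<Longrightarrow>
      star TA (simple_tensor A D a d) = simple_tensor A D (star A a) (star D d)"
    using tensor_lift_simple[OF spaces(1,2) c b] by (simp add: TA_star_eq)
qed

lemma slice_star:
  assumes l: "l < n" and t: "t \<in> carrier (A \<otimes>\<^sub>T D)"
  shows "slice l (star TA t) = (\<Oplus>\<^bsub>D\<^esub>a\<in>{..<n}. co l (star A (e a)) \<odot>\<^bsub>D\<^esub> star D (slice a t))"
proof -
  have "star TA t = star TA (\<Oplus>\<^bsub>A \<otimes>\<^sub>T D\<^esub>a\<in>{..<n}. simple_tensor A D (e a) (slice a t))"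
    using slice_expand t by simp
  also have "\<dots> = (\<Oplus>\<^bsub>A \<otimes>\<^sub>T D\<^esub>a\<in>{..<n}. star TA (simple_tensor A D (e a) (slice a t)))"
    using t by (subst clinear_finsum[OF spaces(3) complex_space_conj_space TA_star_antilinear])
      (auto simp: spaces)
  also have "\<dots> = (\<Oplus>\<^bsub>A \<otimes>\<^sub>T D\<^esub>a\<in>{..<n}. simple_tensor A D (star A (e a)) (star D (slice a t)))"
    using t by (intro T.finsum_cong') (auto simp: TA_star_simple A.star_closed D.star_closed)
  finally have "slice l (star TA t) = slice l \<dots>" by simp
  also have "\<dots> = (\<Oplus>\<^bsub>D\<^esub>a\<in>{..<n}. co l (star A (e a)) \<odot>\<^bsub>D\<^esub> star D (slice a t))"
    using t l by (intro slice_finsum_simple) (auto simp: A.star_closed D.star_closed)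
  finally show ?thesis .
qed

lemma TA_star_closed: "t \<in> carrier (A \<otimes>\<^sub>T D) \<Longrightarrow> star TA t \<in> carrier (A \<otimes>\<^sub>T D)"
  using clinear_in[OF TA_star_antilinear] by simp

lemma slice_tensor_map:
  assumes l: "l < n" and f: "clinear A A f" and t: "t \<in> carrier (A \<otimes>\<^sub>T D)"
  shows "slice l (tensor_map A D f (\<lambda>d. d) t) = (\<Oplus>\<^bsub>D\<^esub>a\<in>{..<n}. co l (f (e a)) \<odot>\<^bsub>D\<^esub> slice a t)"
proof -
  note [simp] = clinear_in[OF f]
  note m = spaces(1,2,1,2) f clinear_id
  have "tensor_map A D f (\<lambda>d. d) t =
      tensor_map A D f (\<lambda>d. d) (\<Oplus>\<^bsub>A \<otimes>\<^sub>T D\<^esub>a\<in>{..<n}. simple_tensor A D (e a) (slice a t))"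
    using slice_expand t by simp
  also have "\<dots> = (\<Oplus>\<^bsub>A \<otimes>\<^sub>T D\<^esub>a\<in>{..<n}. tensor_map A D f (\<lambda>d. d) (simple_tensor A D (e a) (slice a t)))"
    using t by (intro clinear_finsum[OF spaces(3,3)] clinear_tensor_map[OF m]) auto
  also have "\<dots> = (\<Oplus>\<^bsub>A \<otimes>\<^sub>T D\<^esub>a\<in>{..<n}. simple_tensor A D (f (e a)) (slice a t))"
    using t by (intro T.finsum_cong') (auto simp: tensor_map_simple[OF m])
  finally have "slice l (tensor_map A D f (\<lambda>d. d) t) = slice l \<dots>" by simp
  also have "\<dots> = (\<Oplus>\<^bsub>D\<^esub>a\<in>{..<n}. co l (f (e a)) \<odot>\<^bsub>D\<^esub> slice a t)"
    using t l by (intro slice_finsum_simple) auto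
  finally show ?thesis .
qed

end

text \<open>
  The family of coefficient maps \<open>\<rho>\<^sub>k : A \<rightarrow> D\<close> of a linear map \<open>A \<rightarrow> A \<otimes> D\<close>, together with the
  equations that make \<open>b \<mapsto> \<Sum>\<^sub>k e\<^sub>k \<otimes> \<rho>\<^sub>k(b)\<close> a unital \<open>*\<close>-homomorphism.
\<close>

definition hom_coefficients ::
  "('a, 'x) star_algebra_scheme \<Rightarrow> ('d, 'y) star_algebra_scheme \<Rightarrow> nat \<Rightarrow> (nat \<Rightarrow> 'a) \<Rightarrow>
    (nat \<Rightarrow> 'a \<Rightarrow> complex) \<Rightarrow> (nat \<Rightarrow> 'a \<Rightarrow> 'd) \<Rightarrow> bool" where
  "hom_coefficients A D n e co \<rho> \<longleftrightarrow>
     (\<forall>l<n. clinear A D (\<rho> l)) \<and>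
     (\<forall>l<n. \<forall>x\<in>carrier A. \<forall>y\<in>carrier A. \<rho> l (x \<otimes>\<^bsub>A\<^esub> y) =
        (\<Oplus>\<^bsub>D\<^esub>a\<in>{..<n}. \<Oplus>\<^bsub>D\<^esub>b\<in>{..<n}. co l (e a \<otimes>\<^bsub>A\<^esub> e b) \<odot>\<^bsub>D\<^esub> (\<rho> a x \<otimes>\<^bsub>D\<^esub> \<rho> b y))) \<and>
     (\<forall>l<n. \<rho> l \<one>\<^bsub>A\<^esub> = co l \<one>\<^bsub>A\<^esub> \<odot>\<^bsub>D\<^esub> \<one>\<^bsub>D\<^esub>) \<and>
     (\<forall>l<n. \<forall>x\<in>carrier A. \<rho> l (star A x) =
        (\<Oplus>\<^bsub>D\<^esub>a\<in>{..<n}. co l (star A (e a)) \<odot>\<^bsub>D\<^esub> star D (\<rho> a x)))"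

lemma hom_coefficientsD:
  assumes "hom_coefficients A D n e co \<rho>" "l < n"
  shows "clinear A D (\<rho> l)"
    and "x \<in> carrier A \<Longrightarrow> y \<in> carrier A \<Longrightarrow> \<rho> l (x \<otimes>\<^bsub>A\<^esub> y) =
        (\<Oplus>\<^bsub>D\<^esub>a\<in>{..<n}. \<Oplus>\<^bsub>D\<^esub>b\<in>{..<n}. co l (e a \<otimes>\<^bsub>A\<^esub> e b) \<odot>\<^bsub>D\<^esub> (\<rho> a x \<otimes>\<^bsub>D\<^esub> \<rho> b y))"
    and "\<rho> l \<one>\<^bsub>A\<^esub> = co l \<one>\<^bsub>A\<^esub> \<odot>\<^bsub>D\<^esub> \<one>\<^bsub>D\<^esub>"
    and "x \<in> carrier A \<Longrightarrow> \<rho> l (star A x) =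
        (\<Oplus>\<^bsub>D\<^esub>a\<in>{..<n}. co l (star A (e a)) \<odot>\<^bsub>D\<^esub> star D (\<rho> a x))"
  using assms by (auto simp: hom_coefficients_def)

context coordinate_tensor_algebra
begin

text \<open>
  Slices separate tensors and turn the operations of the tensor product algebra into the expressions of
  \<^const>\<open>hom_coefficients\<close>, so each homomorphism law may be checked slice by slice.
\<close>

lemma star_hom_iff_slices:
  assumes r: "r \<in> extensional (carrier A)" "\<And>x. x \<in> carrier A \<Longrightarrow> r x \<in> carrier (A \<otimes>\<^sub>T D)"
  shows "r \<in> star_hom A TA \<longleftrightarrow> hom_coefficients A D n e co (\<lambda>l x. slice l (r x))"
proof
  assume h: "r \<in> star_hom A TA"
  then have lin: "clinear A (A \<otimes>\<^sub>T D) r"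
    using r by (auto simp: star_hom_def ring_hom_def clinear_def)
  show "hom_coefficients A D n e co (\<lambda>l x. slice l (r x))"
    unfolding hom_coefficients_def
    using h r clinear_compose[OF lin slice_linear]
    by (auto simp: star_hom_def ring_hom_def slice_mult slice_star slice_simple)
next
  assume h: "hom_coefficients A D n e co (\<lambda>l x. slice l (r x))"
  note hD = hom_coefficientsD[OF h]
  have "r (x \<oplus>\<^bsub>A\<^esub> y) = r x \<oplus>\<^bsub>A \<otimes>\<^sub>T D\<^esub> r y" if "x \<in> carrier A" "y \<in> carrier A" for x y
    using that r(2) clinear_add[OF hD(1) that] clinear_add[OF slice_linear, of _ "r x" "r y"]
    by (intro slice_eqI) simp_all
  moreover have "r (c \<odot>\<^bsub>A\<^esub> x) = c \<odot>\<^bsub>A \<otimes>\<^sub>T D\<^esub> r x" if "x \<in> carrier A" for x c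
    using that r(2) clinear_smult[OF hD(1) that] clinear_smult[OF slice_linear, of _ "r x"]
    by (intro slice_eqI) simp_all
  moreover have "r (x \<otimes>\<^bsub>A\<^esub> y) = r x \<otimes>\<^bsub>TA\<^esub> r y" if "x \<in> carrier A" "y \<in> carrier A" for x y
    using that r(2) hD(2)[OF _ that] slice_mult[of _ "r x" "r y"]
    by (intro slice_eqI TA_mult_closed) simp_all
  moreover have "r \<one>\<^bsub>A\<^esub> = simple_tensor A D \<one>\<^bsub>A\<^esub> \<one>\<^bsub>D\<^esub>"
    using r(2) hD(3) by (intro slice_eqI) (simp_all add: slice_simple)
  moreover have "r (star A x) = star TA (r x)" if "x \<in> carrier A" for x
    using that r(2) hD(4)[OF _ that] slice_star[of _ "r x"]
    by (intro slice_eqI TA_star_closed) (simp_all add: A.star_closed)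
  ultimately show "r \<in> star_hom A TA"
    using r by (auto simp: star_hom_def ring_hom_def)
qed

lemma slice_coefficients:
  assumes "l < n" "\<And>k. k < n \<Longrightarrow> d k \<in> carrier D"
  shows "slice l (\<Oplus>\<^bsub>A \<otimes>\<^sub>T D\<^esub>k\<in>{..<n}. simple_tensor A D (e k) (d k)) = d l"
proof -
  have "slice l (\<Oplus>\<^bsub>A \<otimes>\<^sub>T D\<^esub>k\<in>{..<n}. simple_tensor A D (e k) (d k)) =
      (\<Oplus>\<^bsub>D\<^esub>k\<in>{..<n}. co l (e k) \<odot>\<^bsub>D\<^esub> d k)"
    using assms by (simp add: slice_finsum_simple)
  also have "\<dots> = (\<Oplus>\<^bsub>D\<^esub>k\<in>{..<n}. (if l = k then 1 else 0) \<odot>\<^bsub>D\<^esub> d k)"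
    using assms by (intro D.finsum_cong') (auto simp: coordinatesD(3)[OF coords])
  also have "\<dots> = d l" using assms by (intro D.finsum_delta') auto
  finally show ?thesis .
qed

lemma star_hom_finsum_iff:
  assumes \<rho>: "\<And>k x. k < n \<Longrightarrow> x \<in> carrier A \<Longrightarrow> \<rho> k x \<in> carrier D"
    and r: "r = (\<lambda>x\<in>carrier A. \<Oplus>\<^bsub>A \<otimes>\<^sub>T D\<^esub>k\<in>{..<n}. simple_tensor A D (e k) (\<rho> k x))"
  shows "r \<in> star_hom A TA \<longleftrightarrow> hom_coefficients A D n e co \<rho>"
proof -
  have s: "slice l (r x) = \<rho> l x" if "l < n" "x \<in> carrier A" for l x
    using that \<rho> by (simp add: r slice_coefficients)
  have "hom_coefficients A D n e co (\<lambda>l x. slice l (r x)) \<longleftrightarrow> hom_coefficients A D n e co \<rho>"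
  proof -
    have "clinear A D (\<lambda>x. slice l (r x)) \<longleftrightarrow> clinear A D (\<rho> l)" if "l < n" for l
      using s[OF that] clinear_cong[OF _ _ spaces(1)] by metis
    moreover have "(\<Oplus>\<^bsub>D\<^esub>a\<in>{..<n}. \<Oplus>\<^bsub>D\<^esub>b\<in>{..<n}. co l (e a \<otimes>\<^bsub>A\<^esub> e b) \<odot>\<^bsub>D\<^esub> (slice a (r x) \<otimes>\<^bsub>D\<^esub> slice b (r y))) =
       (\<Oplus>\<^bsub>D\<^esub>a\<in>{..<n}. \<Oplus>\<^bsub>D\<^esub>b\<in>{..<n}. co l (e a \<otimes>\<^bsub>A\<^esub> e b) \<odot>\<^bsub>D\<^esub> (\<rho> a x \<otimes>\<^bsub>D\<^esub> \<rho> b y))"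
      if "x \<in> carrier A" "y \<in> carrier A" for l x y
      using that \<rho> by (intro D.finsum_cong') (auto simp: s intro!: D.finsum_closed)
    moreover have "(\<Oplus>\<^bsub>D\<^esub>a\<in>{..<n}. co l (star A (e a)) \<odot>\<^bsub>D\<^esub> star D (slice a (r x))) =
       (\<Oplus>\<^bsub>D\<^esub>a\<in>{..<n}. co l (star A (e a)) \<odot>\<^bsub>D\<^esub> star D (\<rho> a x))"
      if "x \<in> carrier A" for l x
      using that \<rho> by (intro D.finsum_cong') (auto simp: s D.star_closed)
    ultimately show ?thesis
      unfolding hom_coefficients_def by (simp add: s A.star_closed)
  qed
  moreover have "r \<in> extensional (carrier A)" by (simp add: r)
  moreover have "r x \<in> carrier (A \<otimes>\<^sub>T D)" if "x \<in> carrier A" for x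
    using that \<rho> by (auto simp: r intro!: T.finsum_closed)
  ultimately show ?thesis using star_hom_iff_slices by simp
qed

lemma hom_coefficients_cong:
  assumes "hom_coefficients A D n e co \<rho>"
    and eq: "\<And>l x. l < n \<Longrightarrow> x \<in> carrier A \<Longrightarrow> \<rho>' l x = \<rho> l x"
  shows "hom_coefficients A D n e co \<rho>'"
proof -
  let ?r = "\<lambda>\<rho>. \<lambda>x\<in>carrier A. \<Oplus>\<^bsub>A \<otimes>\<^sub>T D\<^esub>k\<in>{..<n}. simple_tensor A D (e k) (\<rho> k x)"
  have \<rho>: "\<rho> l x \<in> carrier D" if "l < n" "x \<in> carrier A" for l x
    using clinear_in[OF hom_coefficientsD(1)[OF assms(1) that(1)] that(2)] .
  have "?r \<rho>' = ?r \<rho>"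
    using \<rho> by (intro restrict_ext T.vsum_cong) (auto simp: eq)
  moreover have "?r \<rho> \<in> star_hom A TA"
    using star_hom_finsum_iff[of \<rho>, OF \<rho> refl] assms(1) by simp
  ultimately have "?r \<rho>' \<in> star_hom A TA" by simp
  then show ?thesis
    using star_hom_finsum_iff[of \<rho>', OF _ refl] \<rho> by (simp add: eq)
qed

end

section \<open>Finite-dimensional Hilbert spaces\<close>

sublocale fd_hilbert_space \<subseteq> complex_space H ..

lemma fd_hilbert_space_complex_space [intro]: "fd_hilbert_space H \<Longrightarrow> complex_space H"
  by (rule complex_space.intro) (rule fd_hilbert_space.axioms)

context fd_hilbert_space
begin

lemma cinner_linear: "x \<in> carrier H \<Longrightarrow> clinear H complex_module (cinner H x)"
  by (rule clinearI) (auto simp: cinner_add_right cinner_smult_right)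

lemma cinner_add_left:
  "x \<in> carrier H \<Longrightarrow> y \<in> carrier H \<Longrightarrow> z \<in> carrier H \<Longrightarrow>
    cinner H (x \<oplus> y) z = cinner H x z + cinner H y z"
  using cinner_commute[of z "x \<oplus> y"] cinner_commute[of z x] cinner_commute[of z y]
    cinner_add_right[of z x y] by simp

lemma cinner_smult_left:
  "x \<in> carrier H \<Longrightarrow> y \<in> carrier H \<Longrightarrow> cinner H (c \<odot> x) y = cnj c * cinner H x y"
  using cinner_commute[of y "c \<odot> x"] cinner_commute[of y x] cinner_smult_right[of y x c] by simp

lemma cinner_zero [simp]:
  "x \<in> carrier H \<Longrightarrow> cinner H x \<zero> = 0" "x \<in> carrier H \<Longrightarrow> cinner H \<zero> x = 0"
  using cinner_smult_right[of x \<zero> 0] cinner_smult_left[of \<zero> x 0] by simp_all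

lemma cinner_finsum_right:
  "x \<in> carrier H \<Longrightarrow> f \<in> S \<rightarrow> carrier H \<Longrightarrow> cinner H x (\<Oplus>i\<in>S. f i) = (\<Sum>i\<in>S. cinner H x (f i))"
  using clinear_finsum[OF complex_space_axioms complex_space_complex_module cinner_linear] by simp

lemma cinner_finsum_left:
  "x \<in> carrier H \<Longrightarrow> f \<in> S \<rightarrow> carrier H \<Longrightarrow> cinner H (\<Oplus>i\<in>S. f i) x = (\<Sum>i\<in>S. cinner H (f i) x)"
  by (induction S rule: infinite_finite_induct)
     (auto simp: Pi_def cinner_add_left finsum_infinite finsum_empty finsum_insert)

lemma cinner_self: "x \<in> carrier H \<Longrightarrow> cinner H x x = complex_of_real (Re (cinner H x x))"
  using cinner_commute[of x x] by (simp add: complex_eq_iff)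

lemma cinner_eqI:
  assumes "x \<in> carrier H" "y \<in> carrier H" "\<And>z. z \<in> carrier H \<Longrightarrow> cinner H z x = cinner H z y"
  shows "x = y"
proof -
  let ?d = "x \<oplus> ((-1) \<odot> y)"
  have "cinner H ?d ?d = cinner H ?d x - cinner H ?d y"
    using assms(1,2) by (simp add: cinner_add_right cinner_smult_right)
  also have "\<dots> = 0" using assms by simp
  finally have "?d = \<zero>" using assms(1,2) cinner_definite by simp
  then have "x \<oplus> ((-1) \<odot> y) \<oplus> y = y" using assms(1,2) by simp
  moreover have "((-1) \<odot> y) \<oplus> y = \<zero>"
    using smult_plus[of y "-1" 1] assms(2) by simp
  ultimately show ?thesis using assms(1,2) by (simp add: a_assoc)
qed

text \<open>
  Gram-Schmidt, where vectors that depend on their predecessors are skipped. The last conjunct says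
  that each \<open>v\<^sub>i\<close> lies in the span of the orthonormal vectors.
\<close>

lemma Gram_Schmidt:
  fixes m :: nat and v :: "nat \<Rightarrow> 'h"
  assumes "\<forall>i<m. v i \<in> carrier H"
  shows "\<exists>(d::nat) f. (\<forall>i<d. f i \<in> carrier H) \<and>
    (\<forall>i<d. \<forall>j<d. cinner H (f i) (f j) = (if i = j then 1 else 0)) \<and>
    (\<forall>i<m. (\<Oplus>k\<in>{..<d}. cinner H (f k) (v i) \<odot> f k) = v i)"
  using assms
proof (induction m)
  case 0
  show ?case by (rule exI[of _ 0]) auto
next
  case (Suc m)
  then have prems: "\<forall>i<m. v i \<in> carrier H" by simp
  obtain d :: nat and f where f0: "\<forall>i<d. f i \<in> carrier H"
      "\<forall>i<d. \<forall>j<d. cinner H (f i) (f j) = (if i = j then 1 else 0)"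
      "\<forall>i<m. (\<Oplus>k\<in>{..<d}. cinner H (f k) (v i) \<odot> f k) = v i"
    using Suc.IH[OF prems] by (elim exE conjE)
  then have f: "i < d \<Longrightarrow> f i \<in> carrier H"
    and on: "i < d \<Longrightarrow> j < d \<Longrightarrow> cinner H (f i) (f j) = (if i = j then 1 else 0)"
    and ex: "i < m \<Longrightarrow> (\<Oplus>k\<in>{..<d}. cinner H (f k) (v i) \<odot> f k) = v i" for i j
    by blast+
  have v: "v m \<in> carrier H" using Suc.prems by simp
  \<comment> \<open>The projection of the new vector to the span of the old ones, and the orthogonal remainder.\<close>
  define p where "p = (\<Oplus>k\<in>{..<d}. cinner H (f k) (v m) \<odot> f k)"
  have p: "p \<in> carrier H" using f by (auto simp: p_def intro!: finsum_closed)
  define r where "r = v m \<oplus> ((-1) \<odot> p)"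
  have r: "r \<in> carrier H" using v p by (simp add: r_def)
  have vm: "v m = p \<oplus> r"
  proof -
    have "p \<oplus> r = v m \<oplus> (p \<oplus> ((-1) \<odot> p))"
      using v p by (simp add: r_def a_lcomm)
    also have "p \<oplus> ((-1) \<odot> p) = \<zero>" using smult_plus[of p 1 "-1"] p by simp
    finally show ?thesis using v by simp
  qed
  show ?case
  proof (cases "r = \<zero>")
    case True
    then have "p = v m" using vm p by simp
    then show ?thesis using f on ex by (intro exI[of _ d] exI[of _ f]) (auto simp: less_Suc_eq p_def)
  next
    case False
    define s where "s = sqrt (Re (cinner H r r))"
    have rr: "cinner H r r = of_real s * of_real s" and s: "s > 0"
    proof -
      have "cinner H r r \<noteq> 0" using cinner_definite[OF r] False by auto
      then have "Re (cinner H r r) > 0"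
        using cinner_self[OF r] cinner_nonneg[OF r] by (metis less_eq_real_def of_real_0)
      then show "s > 0" by (simp add: s_def)
      show "cinner H r r = of_real s * of_real s"
        using cinner_self[OF r] cinner_nonneg[OF r] by (simp add: s_def flip: of_real_mult)
    qed
    define g where "g = of_real (1 / s) \<odot> r"
    have g: "g \<in> carrier H" using r by (simp add: g_def)
    have fp: "cinner H (f i) p = cinner H (f i) (v m)" if "i < d" for i
    proof -
      have "cinner H (f i) p = (\<Sum>k<d. cinner H (f k) (v m) * cinner H (f i) (f k))"
        using that f v unfolding p_def by (subst cinner_finsum_right) (auto simp: cinner_smult_right)
      also have "\<dots> = (\<Sum>k<d. if i = k then cinner H (f k) (v m) else 0)"
        using that by (intro sum.cong) (auto simp: on)
      also have "\<dots> = cinner H (f i) (v m)" using that by simp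
      finally show ?thesis .
    qed
    have fr: "cinner H (f i) r = 0" if "i < d" for i
      using that f v p fp by (simp add: r_def cinner_add_right cinner_smult_right)
    have rf: "cinner H r (f i) = 0" if "i < d" for i
      using cinner_commute[OF f r, of i] fr that by simp
    have r_span: "cinner H r (\<Oplus>k\<in>{..<d}. c k \<odot> f k) = 0" for c
      using f r rf by (subst cinner_finsum_right) (auto simp: cinner_smult_right)
    have rp: "cinner H r p = 0" using r_span by (simp add: p_def)
    have gg: "cinner H g g = 1"
      using r s by (simp add: g_def cinner_smult_left cinner_smult_right rr)
    let ?f = "f(d := g)"
    have "\<forall>i<Suc d. ?f i \<in> carrier H" using f g by (auto simp: less_Suc_eq)
    moreover have "\<forall>i<Suc d. \<forall>j<Suc d. cinner H (?f i) (?f j) = (if i = j then 1 else 0)"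
      using gg f r by (auto simp: less_Suc_eq on g_def cinner_smult_left cinner_smult_right fr rf)
    moreover have "(\<Oplus>k\<in>{..<Suc d}. cinner H (?f k) (v i) \<odot> ?f k) = v i" if i: "i < Suc m" for i
    proof -
      have vi: "v i \<in> carrier H" using Suc.prems i by simp
      have "(\<Oplus>k\<in>{..<d}. cinner H (?f k) (v i) \<odot> ?f k) = (\<Oplus>k\<in>{..<d}. cinner H (f k) (v i) \<odot> f k)"
        using f by (intro finsum_cong') auto
      then have split: "(\<Oplus>k\<in>{..<Suc d}. cinner H (?f k) (v i) \<odot> ?f k) =
          (cinner H g (v i) \<odot> g) \<oplus> (\<Oplus>k\<in>{..<d}. cinner H (f k) (v i) \<odot> f k)"
        using f g by (simp add: lessThan_Suc finsum_insert Pi_def)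
      show ?thesis
      proof (cases "i = m")
        case True
        have "cinner H r (v m) = of_real s * of_real s"
          using rp r p by (subst vm) (simp add: cinner_add_right rr)
        then have "cinner H g (v m) \<odot> g = r"
          using s r v by (simp add: g_def cinner_smult_left smult_smult)
        then have "(\<Oplus>k\<in>{..<Suc d}. cinner H (?f k) (v i) \<odot> ?f k) = r \<oplus> p"
          using split True by (simp add: p_def)
        also have "\<dots> = v i" using vm True p r by (simp add: a_comm)
        finally show ?thesis .
      next
        case False
        then have e: "(\<Oplus>k\<in>{..<d}. cinner H (f k) (v i) \<odot> f k) = v i" using ex i by simp
        have "cinner H r (v i) = 0" using r_span[of "\<lambda>k. cinner H (f k) (v i)"] by (simp add: e)
        then have "cinner H g (v i) \<odot> g = \<zero>"
          using g r vi by (simp add: g_def cinner_smult_left)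
        then show ?thesis using split e vi by simp
      qed
    qed
    ultimately show ?thesis by blast
  qed
qed

lemma ex_orthonormal_coordinates:
  "\<exists>d f. coordinates H d f (\<lambda>i. cinner H (f i))"
proof -
  obtain n v where v: "vector_basis H n v" using finite_dim by (auto simp: finite_dimensional_def)
  then have vi: "\<forall>i<n. v i \<in> carrier H" by (simp add: vector_basis_def)
  obtain d :: nat and f where f0: "\<forall>i<d. f i \<in> carrier H"
      "\<forall>i<d. \<forall>j<d. cinner H (f i) (f j) = (if i = j then 1 else 0)"
      "\<forall>i<n. (\<Oplus>k\<in>{..<d}. cinner H (f k) (v i) \<odot> f k) = v i"
    using Gram_Schmidt[of n v, OF vi] by (elim exE conjE)
  then have f: "i < d \<Longrightarrow> f i \<in> carrier H"
    and on: "i < d \<Longrightarrow> j < d \<Longrightarrow> cinner H (f i) (f j) = (if i = j then 1 else 0)"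
    and ex: "i < n \<Longrightarrow> (\<Oplus>k\<in>{..<d}. cinner H (f k) (v i) \<odot> f k) = v i" for i j
    by blast+
  let ?E = "\<lambda>x. \<Oplus>k\<in>{..<d}. cinner H (f k) x \<odot> f k"
  have lin: "clinear H H ?E"
    using f by (intro clinear_finsum_fun clinear_coeff_smult cinner_linear complex_space_axioms) auto
  have "x = ?E x" if x: "x \<in> carrier H" for x
  proof -
    obtain a where a: "x = (\<Oplus>i\<in>{..<n}. a i \<odot> v i)"
      using v x by (auto simp: vector_basis_def)
    have "?E x = (\<Oplus>i\<in>{..<n}. ?E (a i \<odot> v i))"
      unfolding a using vi by (intro clinear_finsum[OF complex_space_axioms complex_space_axioms lin]) auto
    also have "\<dots> = x"
      unfolding a using vi by (intro finsum_cong') (auto simp: clinear_smult[OF lin] ex)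
    finally show ?thesis by simp
  qed
  then have "coordinates H d f (\<lambda>i. cinner H (f i))"
    using f on by (auto simp: coordinates_def cinner_linear)
  then show ?thesis by blast
qed

definition vnorm :: "'h \<Rightarrow> real" where
  "vnorm x = sqrt (Re (cinner H x x))"

lemma vnorm_nonneg: "x \<in> carrier H \<Longrightarrow> 0 \<le> vnorm x"
  by (simp add: vnorm_def cinner_nonneg)

lemma vnorm_square: "x \<in> carrier H \<Longrightarrow> (vnorm x)\<^sup>2 = Re (cinner H x x)"
  by (simp add: vnorm_def cinner_nonneg)

lemma cinner_vnorm: "x \<in> carrier H \<Longrightarrow> cinner H x x = complex_of_real ((vnorm x)\<^sup>2)"
  using cinner_self[of x] by (simp add: vnorm_square)

lemma vnorm_zero_iff: "x \<in> carrier H \<Longrightarrow> vnorm x = 0 \<longleftrightarrow> x = \<zero>"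
proof -
  assume x: "x \<in> carrier H"
  have "vnorm \<zero> = 0" by (simp add: vnorm_def)
  moreover have "x = \<zero>" if "vnorm x = 0"
    using cinner_definite[OF x] cinner_vnorm[OF x] that by simp
  ultimately show "vnorm x = 0 \<longleftrightarrow> x = \<zero>" by auto
qed

lemma Cauchy_Schwarz:
  assumes x: "x \<in> carrier H" and y: "y \<in> carrier H"
  shows "cmod (cinner H x y) \<le> vnorm x * vnorm y"
proof (cases "y = \<zero>")
  case True
  then show ?thesis using x by (simp add: vnorm_def)
next
  case False
  then have ny: "vnorm y > 0" using vnorm_zero_iff[OF y] vnorm_nonneg[OF y] by simp
  \<comment> \<open>The inequality is the positivity of \<open>\<langle>z, z\<rangle>\<close> for the part \<open>z\<close> of \<open>x\<close> orthogonal to \<open>y\<close>.\<close>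
  define c where "c = cinner H y x / (vnorm y)\<^sup>2"
  let ?z = "x \<oplus> ((- c) \<odot> y)"
  have xy: "cinner H x y = cnj (cinner H y x)" using cinner_commute[OF y x] .
  have "cinner H ?z ?z = cinner H x x - c * cinner H x y - cnj c * cinner H y x
      + cnj c * c * cinner H y y"
    using x y by (simp add: cinner_add_left cinner_add_right cinner_smult_left cinner_smult_right
        algebra_simps)
  also have "\<dots> = cinner H x x - (cinner H y x * cnj (cinner H y x)) / (vnorm y)\<^sup>2"
    using ny by (simp add: xy c_def cinner_vnorm[OF y] field_simps power2_eq_square)
  also have "cinner H y x * cnj (cinner H y x) = complex_of_real ((cmod (cinner H x y))\<^sup>2)"
    using complex_norm_square[of "cinner H y x"] by (simp add: xy)
  also have "cinner H x x - complex_of_real ((cmod (cinner H x y))\<^sup>2) / (vnorm y)\<^sup>2 =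
      complex_of_real ((vnorm x)\<^sup>2 - (cmod (cinner H x y))\<^sup>2 / (vnorm y)\<^sup>2)"
    using cinner_vnorm[OF x] by simp
  finally have "0 \<le> (vnorm x)\<^sup>2 - (cmod (cinner H x y))\<^sup>2 / (vnorm y)\<^sup>2"
    using cinner_nonneg[of ?z] x y by simp
  then have "(cmod (cinner H x y))\<^sup>2 \<le> (vnorm x * vnorm y)\<^sup>2"
    using ny by (simp add: field_simps power_mult_distrib)
  then show ?thesis
    using vnorm_nonneg[OF x] ny by (simp add: power2_le_iff_abs_le)
qed

lemma vnorm_smult: "x \<in> carrier H \<Longrightarrow> vnorm (c \<odot> x) = cmod c * vnorm x"
proof -
  assume x: "x \<in> carrier H"
  have "cinner H (c \<odot> x) (c \<odot> x) = complex_of_real ((cmod c)\<^sup>2 * (vnorm x)\<^sup>2)"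
    using x complex_norm_square[of c]
    by (simp add: cinner_smult_left cinner_smult_right cinner_vnorm[OF x] mult_ac)
  then have "vnorm (c \<odot> x) = sqrt ((cmod c * vnorm x)\<^sup>2)"
    by (simp add: vnorm_def power_mult_distrib)
  then show ?thesis using vnorm_nonneg[OF x] by simp
qed

lemma vnorm_triangle:
  assumes x: "x \<in> carrier H" and y: "y \<in> carrier H"
  shows "vnorm (x \<oplus> y) \<le> vnorm x + vnorm y"
proof -
  have "(vnorm (x \<oplus> y))\<^sup>2 = (vnorm x)\<^sup>2 + (vnorm y)\<^sup>2 + 2 * Re (cinner H x y)"
    using x y cinner_commute[OF x y] by (simp add: vnorm_square cinner_add_left cinner_add_right)
  also have "\<dots> \<le> (vnorm x)\<^sup>2 + (vnorm y)\<^sup>2 + 2 * (vnorm x * vnorm y)"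
    using Cauchy_Schwarz[OF x y] complex_Re_le_cmod[of "cinner H x y"] by simp
  also have "\<dots> = (vnorm x + vnorm y)\<^sup>2" by (simp add: power2_sum)
  finally show ?thesis
    using vnorm_nonneg x y by (simp add: power2_le_iff_abs_le vnorm_nonneg)
qed

lemma vnorm_finsum:
  "f \<in> S \<rightarrow> carrier H \<Longrightarrow> vnorm (\<Oplus>i\<in>S. f i) \<le> (\<Sum>i\<in>S. vnorm (f i))"
proof (induction S rule: infinite_finite_induct)
  case (insert x F)
  then have "vnorm (\<Oplus>i\<in>insert x F. f i) \<le> vnorm (f x) + vnorm (\<Oplus>i\<in>F. f i)"
    by (simp add: finsum_insert vnorm_triangle Pi_def)
  with insert show ?case by simp
qed (auto simp: finsum_infinite finsum_empty vnorm_def)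

lemma vnorm_le_sum:
  assumes f: "coordinates H d f (\<lambda>i. cinner H (f i))" and x: "x \<in> carrier H"
  shows "vnorm x \<le> (\<Sum>i<d. cmod (cinner H (f i) x))"
proof -
  note fi = coordinatesD(1)[OF f]
  have 1: "vnorm (f i) = 1" if "i < d" for i
    using coordinatesD(3)[OF f that that] by (simp add: vnorm_def)
  have "vnorm x = vnorm (\<Oplus>i\<in>{..<d}. cinner H (f i) x \<odot> f i)"
    using coordinatesD(4)[OF f x] by simp
  also have "\<dots> \<le> (\<Sum>i<d. vnorm (cinner H (f i) x \<odot> f i))"
    using fi by (intro vnorm_finsum) auto
  also have "\<dots> = (\<Sum>i<d. cmod (cinner H (f i) x))"
    using fi by (intro sum.cong) (auto simp: vnorm_smult 1)
  finally show ?thesis .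
qed

end

section \<open>The \<open>C\<^sup>*\<close>-algebra of operators\<close>

lemma operators_simps [simp]:
  "carrier (operators H) = linear_maps H H"
  "S \<otimes>\<^bsub>operators H\<^esub> T = compose (carrier H) S T"
  "\<one>\<^bsub>operators H\<^esub> = (\<lambda>x\<in>carrier H. x)"
  "\<zero>\<^bsub>operators H\<^esub> = (\<lambda>x\<in>carrier H. \<zero>\<^bsub>H\<^esub>)"
  "S \<oplus>\<^bsub>operators H\<^esub> T = (\<lambda>x\<in>carrier H. S x \<oplus>\<^bsub>H\<^esub> T x)"
  "c \<odot>\<^bsub>operators H\<^esub> T = (\<lambda>x\<in>carrier H. c \<odot>\<^bsub>H\<^esub> T x)"
  "star (operators H) T = adjoint H H T"
  by (simp_all add: operators_def)

lemma linear_mapsD: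
  assumes "T \<in> linear_maps V W"
  shows "clinear V W T" "x \<in> carrier V \<Longrightarrow> T x \<in> carrier W"
  using assms by (auto simp: linear_maps_def clinear_def)

lemma linear_maps_eqI:
  assumes "S \<in> linear_maps V W" "T \<in> linear_maps V W" "\<And>x. x \<in> carrier V \<Longrightarrow> S x = T x"
  shows "S = T"
  using assms by (auto simp: linear_maps_def intro: extensionalityI)

lemma linear_maps_eq_iff:
  "S \<in> linear_maps V W \<Longrightarrow> T \<in> linear_maps V W \<Longrightarrow> S = T \<longleftrightarrow> (\<forall>x\<in>carrier V. S x = T x)"
  using linear_maps_eqI[of S V W T] by auto

lemma linear_maps_restrict:
  assumes "clinear V W f" "complex_space V"
  shows "(\<lambda>x\<in>carrier V. f x) \<in> linear_maps V W"
proof -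
  interpret complex_space V by fact
  show ?thesis using clinear_cong[OF assms(1) _ assms(2)] by (auto simp: linear_maps_def)
qed

context fd_hilbert_space
begin

lemma adjoint_ex1:
  assumes T: "clinear H H T" and y: "y \<in> carrier H"
  shows "\<exists>!x. x \<in> carrier H \<and> (\<forall>z\<in>carrier H. cinner H z x = cinner H (T z) y)"
proof (rule ex_ex1I)
  obtain d f where f: "coordinates H d f (\<lambda>i. cinner H (f i))"
    using ex_orthonormal_coordinates by blast
  note fi = coordinatesD(1)[OF f] and Tin = clinear_in[OF T]
  \<comment> \<open>The adjoint in an orthonormal basis: \<open>\<langle>f\<^sub>i, T\<^sup>* y\<rangle> = \<langle>T f\<^sub>i, y\<rangle>\<close>.\<close>
  let ?x = "\<Oplus>i\<in>{..<d}. cinner H (T (f i)) y \<odot> f i"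
  have "cinner H z ?x = cinner H (T z) y" if z: "z \<in> carrier H" for z
  proof -
    have "cinner H (T z) y = cinner H (\<Oplus>i\<in>{..<d}. cinner H (f i) z \<odot> T (f i)) y"
      using clinear_expand[OF f complex_space_axioms complex_space_axioms T z] by simp
    also have "\<dots> = (\<Sum>i<d. cnj (cinner H (f i) z) * cinner H (T (f i)) y)"
      using fi y Tin by (subst cinner_finsum_left) (auto simp: cinner_smult_left)
    also have "\<dots> = (\<Sum>i<d. cinner H (T (f i)) y * cinner H z (f i))"
      using fi z by (intro sum.cong) (auto simp: mult.commute cinner_commute[of "f _" z])
    also have "\<dots> = cinner H z ?x"
      using fi z by (subst cinner_finsum_right) (auto simp: cinner_smult_right)
    finally show ?thesis by simp
  qed
  moreover have "?x \<in> carrier H" using fi by (auto intro!: finsum_closed)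
  ultimately show "\<exists>x. x \<in> carrier H \<and> (\<forall>z\<in>carrier H. cinner H z x = cinner H (T z) y)" by blast
qed (auto intro: cinner_eqI)

lemma
  assumes T: "T \<in> linear_maps H H"
  shows adjoint_in: "y \<in> carrier H \<Longrightarrow> adjoint H H T y \<in> carrier H"
    and cinner_adjoint: "y \<in> carrier H \<Longrightarrow> z \<in> carrier H \<Longrightarrow>
      cinner H z (adjoint H H T y) = cinner H (T z) y"
proof -
  have "y \<in> carrier H \<Longrightarrow> adjoint H H T y \<in> carrier H \<and>
      (\<forall>z\<in>carrier H. cinner H z (adjoint H H T y) = cinner H (T z) y)"
    using theI'[OF adjoint_ex1[OF linear_mapsD(1)[OF T]]] by (simp add: adjoint_def)
  then show "y \<in> carrier H \<Longrightarrow> adjoint H H T y \<in> carrier H"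
    and "y \<in> carrier H \<Longrightarrow> z \<in> carrier H \<Longrightarrow> cinner H z (adjoint H H T y) = cinner H (T z) y"
    by auto
qed

lemma adjoint_linear:
  assumes T: "T \<in> linear_maps H H"
  shows "adjoint H H T \<in> linear_maps H H"
proof -
  note [simp] = linear_mapsD(2)[OF T] adjoint_in[OF T] cinner_adjoint[OF T]
  have "clinear H H (adjoint H H T)"
    by (intro clinearI cinner_eqI) (auto simp: cinner_add_right cinner_smult_right)
  moreover have "adjoint H H T \<in> extensional (carrier H)" by (simp add: adjoint_def)
  ultimately show ?thesis by (simp add: linear_maps_def)
qed

lemma adjoint_eqI:
  assumes "T \<in> linear_maps H H" "S \<in> linear_maps H H"
    and "\<And>y z. y \<in> carrier H \<Longrightarrow> z \<in> carrier H \<Longrightarrow> cinner H z (S y) = cinner H (T z) y"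
  shows "adjoint H H T = S"
  using assms linear_mapsD(2)[OF assms(2)] adjoint_in[OF assms(1)]
  by (intro linear_maps_eqI[OF adjoint_linear[OF assms(1)] assms(2)] cinner_eqI)
    (auto simp: cinner_adjoint)

lemma cinner_adjoint_left:
  assumes T: "T \<in> linear_maps H H" and "y \<in> carrier H" "z \<in> carrier H"
  shows "cinner H (adjoint H H T y) z = cinner H y (T z)"
proof -
  have "cinner H (adjoint H H T y) z = cnj (cinner H (T z) y)"
    using cinner_commute[of z "adjoint H H T y"] cinner_adjoint[OF T assms(2,3)] assms adjoint_in[OF T]
    by simp
  also have "\<dots> = cinner H y (T z)"
    using cinner_commute[of "T z" y] assms linear_mapsD(2)[OF T] by simp
  finally show ?thesis .
qed

lemma op_add_in:
  "S \<in> linear_maps H H \<Longrightarrow> T \<in> linear_maps H H \<Longrightarrow> (\<lambda>x\<in>carrier H. S x \<oplus> T x) \<in> linear_maps H H"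
  by (rule linear_maps_restrict[OF clinear_plus[OF complex_space_axioms] complex_space_axioms])
    (simp_all add: linear_mapsD(1))

lemma op_smult_in: "T \<in> linear_maps H H \<Longrightarrow> (\<lambda>x\<in>carrier H. c \<odot> T x) \<in> linear_maps H H"
  by (rule linear_maps_restrict[OF clinear_scaled[OF complex_space_axioms] complex_space_axioms])
    (simp add: linear_mapsD(1))

lemma op_compose_in:
  "S \<in> linear_maps H H \<Longrightarrow> T \<in> linear_maps H H \<Longrightarrow> compose (carrier H) S T \<in> linear_maps H H"
  unfolding compose_def
  by (rule linear_maps_restrict[OF clinear_compose[of H H T H S] complex_space_axioms])
    (simp_all add: linear_mapsD(1))

lemma op_zero_in: "(\<lambda>x\<in>carrier H. \<zero>) \<in> linear_maps H H"
  by (rule linear_maps_restrict[OF clinear_const_zero[OF complex_space_axioms] complex_space_axioms])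

lemma op_one_in: "(\<lambda>x\<in>carrier H. x) \<in> linear_maps H H"
  by (rule linear_maps_restrict[OF clinear_id complex_space_axioms])

lemma unital_star_algebra_operators: "unital_star_algebra (operators H)"
proof -
  note [simp] = op_add_in op_smult_in op_compose_in op_compose_in[unfolded compose_def] op_zero_in op_one_in linear_mapsD(2)
    clinear_add[OF linear_mapsD(1)] clinear_smult[OF linear_mapsD(1)] adjoint_linear adjoint_in
    cinner_adjoint cinner_adjoint_left
  have [simp]: "restrict T (carrier H) = T" if "T \<in> linear_maps H H" for T
    using that by (auto simp: linear_maps_def extensional_restrict)
  note [cong] = restrict_cong
  have ab: "abelian_group (operators H)"
  proof (rule abelian_groupI)
    fix x assume "x \<in> carrier (operators H)"
    then have x: "x \<in> linear_maps H H" by simp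
    have "(-1) \<odot> z \<oplus> z = \<zero>" if "z \<in> carrier H" for z
      using smult_plus[of z "-1" 1] that by simp
    then have "(\<lambda>z\<in>carrier H. (-1) \<odot> x z) \<oplus>\<^bsub>operators H\<^esub> x = \<zero>\<^bsub>operators H\<^esub>"
      using x by (auto simp: fun_eq_iff)
    then show "\<exists>y\<in>carrier (operators H). y \<oplus>\<^bsub>operators H\<^esub> x = \<zero>\<^bsub>operators H\<^esub>"
      using op_smult_in[OF x, of "-1"]
      by (intro bexI[of _ "\<lambda>z\<in>carrier H. (-1) \<odot> x z"]) (simp_all only: operators_simps)
  qed (auto simp: a_ac)
  have cs: "complex_space (operators H)"
    by (rule complex_spaceI[OF ab])
      (auto simp: smult_plus smult_add smult_smult)
  have mon: "monoid (operators H)"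
    by (rule monoidI) (auto simp: compose_def)
  have rng: "ring (operators H)"
    by (rule ringI[OF ab mon]) (auto simp: compose_def)
  show ?thesis
  proof (intro unital_star_algebra.intro unital_star_algebra_axioms.intro rng
        cs[unfolded complex_space_def])
    fix x c assume x: "x \<in> carrier (operators H)"
    then show "star (operators H) (star (operators H) x) = x"
      by (auto intro!: adjoint_eqI)
    from x show "star (operators H) (c \<odot>\<^bsub>operators H\<^esub> x) = cnj c \<odot>\<^bsub>operators H\<^esub> star (operators H) x"
      by (auto intro!: adjoint_eqI simp: cinner_smult_left cinner_smult_right)
    fix y assume y: "y \<in> carrier (operators H)"
    from x y show "star (operators H) (x \<oplus>\<^bsub>operators H\<^esub> y) =
        star (operators H) x \<oplus>\<^bsub>operators H\<^esub> star (operators H) y"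
      by (auto intro!: adjoint_eqI simp: cinner_add_left cinner_add_right)
    from x y show "star (operators H) (x \<otimes>\<^bsub>operators H\<^esub> y) =
        star (operators H) y \<otimes>\<^bsub>operators H\<^esub> star (operators H) x"
      by (auto intro!: adjoint_eqI simp: compose_eq)
  qed (auto simp: compose_def)
qed

lemma cnorm_operators: "cnorm (operators H) T = Sup {vnorm (T x) |x. x \<in> carrier H \<and> Re (cinner H x x) \<le> 1}"
  by (simp add: operators_def vnorm_def)

lemma vnorm_le_1: "x \<in> carrier H \<Longrightarrow> Re (cinner H x x) \<le> 1 \<longleftrightarrow> vnorm x \<le> 1"
  by (simp add: vnorm_def)

end

text \<open>
  In an orthonormal basis \<open>f\<close> of the domain, \<open>\<Sum>\<^sub>i \<parallel>T f\<^sub>i\<parallel>\<close> is a bound, since every coordinate of \<open>x\<close> is at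
  most \<open>\<parallel>x\<parallel>\<close>.
\<close>

lemma clinear_bounded:
  assumes "fd_hilbert_space H" "fd_hilbert_space K" and T: "clinear H K T"
  shows "\<exists>M\<ge>0. \<forall>x\<in>carrier H. fd_hilbert_space.vnorm K (T x) \<le> M * fd_hilbert_space.vnorm H x"
proof -
  interpret H: fd_hilbert_space H by fact
  interpret K: fd_hilbert_space K by fact
  obtain d f where f: "coordinates H d f (\<lambda>i. cinner H (f i))"
    using H.ex_orthonormal_coordinates by blast
  note fi = coordinatesD(1)[OF f] and Tin = clinear_in[OF T]
  have 1: "H.vnorm (f i) = 1" if "i < d" for i
    using coordinatesD(3)[OF f that that] by (simp add: H.vnorm_def)
  let ?M = "\<Sum>i<d. K.vnorm (T (f i))"
  have "K.vnorm (T x) \<le> ?M * H.vnorm x" if x: "x \<in> carrier H" for x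
  proof -
    have "K.vnorm (T x) = K.vnorm (\<Oplus>\<^bsub>K\<^esub>i\<in>{..<d}. cinner H (f i) x \<odot>\<^bsub>K\<^esub> T (f i))"
      using clinear_expand[OF f H.complex_space_axioms K.complex_space_axioms T x] by simp
    also have "\<dots> \<le> (\<Sum>i<d. K.vnorm (cinner H (f i) x \<odot>\<^bsub>K\<^esub> T (f i)))"
      using fi Tin by (intro K.vnorm_finsum) auto
    also have "\<dots> \<le> (\<Sum>i<d. H.vnorm x * K.vnorm (T (f i)))"
    proof (rule sum_mono)
      fix i assume i: "i \<in> {..<d}"
      then have "cmod (cinner H (f i) x) \<le> H.vnorm x"
        using H.Cauchy_Schwarz[OF fi x, of i] 1[of i] by simp
      then show "K.vnorm (cinner H (f i) x \<odot>\<^bsub>K\<^esub> T (f i)) \<le> H.vnorm x * K.vnorm (T (f i))"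
        using i fi Tin by (simp add: K.vnorm_smult mult_right_mono K.vnorm_nonneg)
    qed
    finally show ?thesis by (simp add: sum_distrib_left mult.commute)
  qed
  moreover have "0 \<le> ?M" using fi Tin by (intro sum_nonneg K.vnorm_nonneg) auto
  ultimately show ?thesis by blast
qed

context fd_hilbert_space
begin

text \<open>
  By \<open>clinear_bounded\<close> the operator norm is the supremum of a bounded set of reals; on an unbounded set
  \<^const>\<open>Sup\<close> would have an unspecified value.
\<close>

lemma
  assumes T: "T \<in> linear_maps H H"
  shows op_norm_nonneg: "0 \<le> cnorm (operators H) T"
    and op_norm_bound: "x \<in> carrier H \<Longrightarrow> vnorm (T x) \<le> cnorm (operators H) T * vnorm x"
    and op_norm_least: "(\<And>x. x \<in> carrier H \<Longrightarrow> vnorm (T x) \<le> K * vnorm x) \<Longrightarrow> 0 \<le> K \<Longrightarrow>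
      cnorm (operators H) T \<le> K"
proof -
  let ?S = "{vnorm (T x) |x. x \<in> carrier H \<and> Re (cinner H x x) \<le> 1}"
  note Tin = linear_mapsD(2)[OF T]
  obtain K where K: "K \<ge> 0" "\<And>x. x \<in> carrier H \<Longrightarrow> vnorm (T x) \<le> K * vnorm x"
    using clinear_bounded[OF fd_hilbert_space_axioms fd_hilbert_space_axioms linear_mapsD(1)[OF T]]
    by blast
  have bdd: "bdd_above ?S"
  proof (rule bdd_aboveI)
    fix y assume "y \<in> ?S"
    then obtain x where x: "y = vnorm (T x)" "x \<in> carrier H" "vnorm x \<le> 1"
      by (auto simp: vnorm_le_1)
    have "y \<le> K * vnorm x" using K(2)[OF x(2)] x(1) by simp
    also have "\<dots> \<le> K * 1" using x(3) K(1) by (intro mult_left_mono)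
    finally show "y \<le> K" by simp
  qed
  have upper: "vnorm (T x) \<le> cnorm (operators H) T" if "x \<in> carrier H" "vnorm x \<le> 1" for x
    unfolding cnorm_operators using that by (intro cSup_upper bdd) (auto simp: vnorm_le_1)
  have z: "T \<zero> = \<zero>" "vnorm \<zero> = 0"
    using clinear_zero[OF complex_space_axioms complex_space_axioms linear_mapsD(1)[OF T]]
    by (simp_all add: vnorm_def)
  show nonneg: "0 \<le> cnorm (operators H) T" using upper[of \<zero>] z by simp
  show "vnorm (T x) \<le> cnorm (operators H) T * vnorm x" if x: "x \<in> carrier H"
  proof (cases "x = \<zero>")
    case True
    then show ?thesis using z by simp
  next
    case False
    then have p: "vnorm x > 0" using vnorm_zero_iff[OF x] vnorm_nonneg[OF x] by simp
    let ?y = "complex_of_real (1 / vnorm x) \<odot> x"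
    have y: "?y \<in> carrier H" "vnorm ?y = 1" using x p by (simp_all add: vnorm_smult norm_divide)
    have "vnorm (T ?y) = vnorm (T x) / vnorm x"
      using x p Tin[OF x] by (simp add: clinear_smult[OF linear_mapsD(1)[OF T]] vnorm_smult norm_divide)
    then have "vnorm (T x) / vnorm x \<le> cnorm (operators H) T" using upper[of ?y] y by simp
    then show ?thesis using p by (simp add: field_simps)
  qed
  show "cnorm (operators H) T \<le> K"
    if K: "\<And>x. x \<in> carrier H \<Longrightarrow> vnorm (T x) \<le> K * vnorm x" "0 \<le> K" for K
    unfolding cnorm_operators
  proof (rule cSup_least)
    show "?S \<noteq> {}" using z by (auto intro!: exI[of _ \<zero>])
    fix y assume "y \<in> ?S"
    then obtain x where x: "y = vnorm (T x)" "x \<in> carrier H" "vnorm x \<le> 1"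
      by (auto simp: vnorm_le_1)
    have "y \<le> K * vnorm x" using K(1)[OF x(2)] x(1) by simp
    also have "\<dots> \<le> K * 1" using x(3) K(2) by (intro mult_left_mono)
    finally show "y \<le> K" by simp
  qed
qed

lemma op_norm_adjoint_le:
  assumes T: "T \<in> linear_maps H H"
  shows "cnorm (operators H) (adjoint H H T) \<le> cnorm (operators H) T"
proof (rule op_norm_least[OF adjoint_linear[OF T] _ op_norm_nonneg[OF T]])
  fix x assume x: "x \<in> carrier H"
  let ?y = "adjoint H H T x"
  have y: "?y \<in> carrier H" using adjoint_in[OF T x] .
  have "(vnorm ?y)\<^sup>2 = Re (cinner H (T ?y) x)"
    using cinner_adjoint[OF T x y] by (simp add: vnorm_square[OF y])
  also have "\<dots> \<le> vnorm (T ?y) * vnorm x"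
    using Cauchy_Schwarz[OF linear_mapsD(2)[OF T y] x] complex_Re_le_cmod order_trans by blast
  also have "\<dots> \<le> cnorm (operators H) T * vnorm ?y * vnorm x"
    by (intro mult_right_mono op_norm_bound[OF T y] vnorm_nonneg x)
  finally have "vnorm ?y * vnorm ?y \<le> vnorm ?y * (cnorm (operators H) T * vnorm x)"
    by (simp add: power2_eq_square mult_ac)
  then show "vnorm ?y \<le> cnorm (operators H) T * vnorm x"
    using vnorm_nonneg[OF y] vnorm_nonneg[OF x] op_norm_nonneg[OF T]
    by (cases "vnorm ?y = 0") (auto simp: mult_le_cancel_left_pos)
qed

lemma op_norm_mult_le:
  assumes S: "S \<in> linear_maps H H" and T: "T \<in> linear_maps H H"
  shows "cnorm (operators H) (compose (carrier H) S T) \<le> cnorm (operators H) S * cnorm (operators H) T"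
proof (rule op_norm_least[OF op_compose_in[OF S T]])
  fix x assume x: "x \<in> carrier H"
  have "vnorm (S (T x)) \<le> cnorm (operators H) S * vnorm (T x)"
    by (intro op_norm_bound S linear_mapsD(2)[OF T] x)
  also have "\<dots> \<le> cnorm (operators H) S * (cnorm (operators H) T * vnorm x)"
    by (intro mult_left_mono op_norm_bound T x op_norm_nonneg S)
  finally show "vnorm (compose (carrier H) S T x) \<le>
      cnorm (operators H) S * cnorm (operators H) T * vnorm x"
    using x by (simp add: compose_eq mult_ac)
qed (intro mult_nonneg_nonneg op_norm_nonneg S T)

lemma op_norm_cstar:
  assumes T: "T \<in> linear_maps H H"
  shows "cnorm (operators H) (compose (carrier H) (adjoint H H T) T) = (cnorm (operators H) T)\<^sup>2"
proof (rule antisym)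
  let ?N = "cnorm (operators H)" and ?S = "compose (carrier H) (adjoint H H T) T"
  note adj = adjoint_linear[OF T] and S = op_compose_in[OF adjoint_linear[OF T] T]
  have "?N ?S \<le> ?N (adjoint H H T) * ?N T" by (rule op_norm_mult_le[OF adj T])
  also have "\<dots> \<le> ?N T * ?N T"
    by (intro mult_right_mono op_norm_adjoint_le op_norm_nonneg T)
  finally show "?N ?S \<le> (?N T)\<^sup>2" by (simp add: power2_eq_square)
  have "?N T \<le> sqrt (?N ?S)"
  proof (rule op_norm_least[OF T])
    fix x assume x: "x \<in> carrier H"
    have Tx: "T x \<in> carrier H" using linear_mapsD(2)[OF T x] .
    \<comment> \<open>\<open>\<parallel>T x\<parallel>\<^sup>2 = \<langle>x, T\<^sup>* T x\<rangle>\<close>\<close>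
    have "(vnorm (T x))\<^sup>2 = Re (cinner H x (?S x))"
      using x Tx cinner_adjoint[OF T Tx x] by (simp add: vnorm_square compose_eq)
    also have "\<dots> \<le> vnorm x * vnorm (?S x)"
      using Cauchy_Schwarz[OF x linear_mapsD(2)[OF S x]] complex_Re_le_cmod order_trans by blast
    also have "\<dots> \<le> vnorm x * (?N ?S * vnorm x)"
      by (intro mult_left_mono op_norm_bound[OF S x] vnorm_nonneg x)
    also have "\<dots> = (sqrt (?N ?S) * vnorm x)\<^sup>2"
      using op_norm_nonneg[OF S] by (simp add: power_mult_distrib power2_eq_square mult_ac)
    finally show "vnorm (T x) \<le> sqrt (?N ?S) * vnorm x"
      by (rule power2_le_imp_le) (simp add: op_norm_nonneg[OF S] vnorm_nonneg[OF x])
  qed (use op_norm_nonneg[OF S] in simp)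
  then have "(?N T)\<^sup>2 \<le> (sqrt (?N ?S))\<^sup>2" by (intro power_mono op_norm_nonneg T)
  then show "(?N T)\<^sup>2 \<le> ?N ?S" using op_norm_nonneg[OF S] by simp
qed

text \<open>
  Together with the next lemma: convergence in norm is convergence of the matrix entries, which gives
  completeness.
\<close>

lemma op_norm_le_entries:
  assumes f: "coordinates H d f (\<lambda>i. cinner H (f i))" and T: "T \<in> linear_maps H H"
  shows "cnorm (operators H) T \<le> (\<Sum>j<d. \<Sum>i<d. cmod (cinner H (f i) (T (f j))))"
proof (rule op_norm_least[OF T])
  note fi = coordinatesD(1)[OF f] and Tin = linear_mapsD(2)[OF T]
  have 1: "vnorm (f i) = 1" if "i < d" for i
    using coordinatesD(3)[OF f that that] by (simp add: vnorm_def)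
  fix x assume x: "x \<in> carrier H"
  have "vnorm (T x) = vnorm (\<Oplus>j\<in>{..<d}. cinner H (f j) x \<odot> T (f j))"
    using clinear_expand[OF f complex_space_axioms complex_space_axioms linear_mapsD(1)[OF T] x]
    by simp
  also have "\<dots> \<le> (\<Sum>j<d. vnorm (cinner H (f j) x \<odot> T (f j)))"
    using fi Tin by (intro vnorm_finsum) auto
  also have "\<dots> \<le> (\<Sum>j<d. vnorm x * (\<Sum>i<d. cmod (cinner H (f i) (T (f j)))))"
  proof (rule sum_mono)
    fix j assume j: "j \<in> {..<d}"
    then have "cmod (cinner H (f j) x) \<le> vnorm x"
      using Cauchy_Schwarz[OF fi x, of j] 1[of j] by simp
    then show "vnorm (cinner H (f j) x \<odot> T (f j)) \<le> vnorm x * (\<Sum>i<d. cmod (cinner H (f i) (T (f j))))"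
      using j fi Tin x by (simp add: vnorm_smult mult_mono vnorm_nonneg vnorm_le_sum[OF f])
  qed
  finally show "vnorm (T x) \<le> (\<Sum>j<d. \<Sum>i<d. cmod (cinner H (f i) (T (f j)))) * vnorm x"
    by (simp add: sum_distrib_left mult.commute)
qed (intro sum_nonneg norm_ge_zero)

lemma op_entry_le_norm:
  assumes f: "coordinates H d f (\<lambda>i. cinner H (f i))" and T: "T \<in> linear_maps H H"
    and "i < d" "j < d"
  shows "cmod (cinner H (f i) (T (f j))) \<le> cnorm (operators H) T"
proof -
  note fi = coordinatesD(1)[OF f]
  have 1: "vnorm (f i) = 1" if "i < d" for i
    using coordinatesD(3)[OF f that that] by (simp add: vnorm_def)
  have "cmod (cinner H (f i) (T (f j))) \<le> vnorm (f i) * vnorm (T (f j))"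
    using assms fi linear_mapsD(2)[OF T] by (intro Cauchy_Schwarz) auto
  also have "\<dots> \<le> cnorm (operators H) T"
    using op_norm_bound[OF T fi, of j] 1 assms by simp
  finally show ?thesis .
qed

theorem unital_cstar_algebra_operators: "unital_cstar_algebra (operators H)"
proof -
  interpret O: unital_star_algebra "operators H" by (rule unital_star_algebra_operators)
  let ?N = "cnorm (operators H)"
  note [simp] = op_add_in op_smult_in op_zero_in linear_mapsD(2) op_norm_nonneg
  have z: "vnorm \<zero> = 0" by (simp add: vnorm_def)
  show ?thesis
  proof (intro unital_cstar_algebra.intro unital_star_algebra_operators
      unital_cstar_algebra_axioms.intro)
    fix x assume "x \<in> carrier (operators H)"
    then have x: "x \<in> linear_maps H H" by simp
    show "0 \<le> ?N x" using x by simp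
    show "?N x = 0 \<longleftrightarrow> x = \<zero>\<^bsub>operators H\<^esub>"
    proof
      assume 0: "?N x = 0"
      have "x y = \<zero>" if "y \<in> carrier H" for y
        using op_norm_bound[OF x that] vnorm_nonneg[of "x y"] vnorm_zero_iff[of "x y"] that x 0 by simp
      then show "x = \<zero>\<^bsub>operators H\<^esub>"
        using x by (auto intro!: linear_maps_eqI[of _ H H])
    next
      assume "x = \<zero>\<^bsub>operators H\<^esub>"
      then have "?N x \<le> 0" by (intro op_norm_least[OF x]) (auto simp: z)
      then show "?N x = 0" using op_norm_nonneg[OF x] by simp
    qed
    show "?N (star (operators H) x \<otimes>\<^bsub>operators H\<^esub> x) = (?N x)\<^sup>2"
      using op_norm_cstar[OF x] by simp
    have le: "?N (c \<odot>\<^bsub>operators H\<^esub> y) \<le> cmod c * ?N y" if y: "y \<in> linear_maps H H" for c y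
    proof -
      have "vnorm (c \<odot> y z) \<le> cmod c * ?N y * vnorm z" if "z \<in> carrier H" for z
        using mult_left_mono[OF op_norm_bound[OF y that], of "cmod c"] that y
        by (simp add: vnorm_smult mult_ac)
      then show ?thesis
        using y op_norm_nonneg[OF y] by (simp, intro op_norm_least) auto
    qed
    show "?N (c \<odot>\<^bsub>operators H\<^esub> x) = cmod c * ?N x" for c
    proof (cases "c = 0")
      case True
      have "0 \<le> ?N (c \<odot>\<^bsub>operators H\<^esub> x)" using x by simp
      then show ?thesis using le[OF x, of c] True by simp
    next
      case False
      have "x = (1 / c) \<odot>\<^bsub>operators H\<^esub> (c \<odot>\<^bsub>operators H\<^esub> x)"
        using O.smult_smult[of x "1 / c" c] O.one_smult[of x] x False by simp
      then have "?N x \<le> cmod (1 / c) * ?N (c \<odot>\<^bsub>operators H\<^esub> x)"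
        using le[of "c \<odot>\<^bsub>operators H\<^esub> x" "1 / c"] x by simp
      then have "cmod c * ?N x \<le> ?N (c \<odot>\<^bsub>operators H\<^esub> x)"
        using False by (simp add: norm_divide field_simps)
      then show ?thesis using le[OF x, of c] by simp
    qed
    fix y assume "y \<in> carrier (operators H)"
    then have y: "y \<in> linear_maps H H" by simp
    show "?N (x \<otimes>\<^bsub>operators H\<^esub> y) \<le> ?N x * ?N y" using op_norm_mult_le[OF x y] by simp
    have "vnorm (x z \<oplus> y z) \<le> (?N x + ?N y) * vnorm z" if "z \<in> carrier H" for z
      using vnorm_triangle[of "x z" "y z"] op_norm_bound[OF x that] op_norm_bound[OF y that] that x y
      by (simp add: algebra_simps)
    then show "?N (x \<oplus>\<^bsub>operators H\<^esub> y) \<le> ?N x + ?N y"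
      using x y op_norm_nonneg[OF x] op_norm_nonneg[OF y] by (simp, intro op_norm_least) auto
  next
    fix s :: "nat \<Rightarrow> 'h \<Rightarrow> 'h"
    assume s: "\<And>k. s k \<in> carrier (operators H)"
      and cauchy: "\<forall>\<epsilon>>0. \<exists>N. \<forall>j\<ge>N. \<forall>k\<ge>N. ?N (s j \<ominus>\<^bsub>operators H\<^esub> s k) < \<epsilon>"
    obtain d f where f: "coordinates H d f (\<lambda>i. cinner H (f i))"
      using ex_orthonormal_coordinates by blast
    note fi = coordinatesD(1)[OF f]
    have sl: "s k \<in> linear_maps H H" for k using s by simp
    let ?m = "\<lambda>T i j. cinner H (f i) (T (f j))"
    have diff: "?m (S \<ominus>\<^bsub>operators H\<^esub> T) i j = ?m S i j - ?m T i j"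
      if "S \<in> linear_maps H H" "T \<in> linear_maps H H" "i < d" "j < d" for S T i j
      using that fi by (simp add: O.minus_eq_smult cinner_add_right cinner_smult_right)
    have diff_in: "S \<ominus>\<^bsub>operators H\<^esub> T \<in> linear_maps H H"
      if "S \<in> linear_maps H H" "T \<in> linear_maps H H" for S T
      using op_add_in[OF that(1) op_smult_in[OF that(2), of "-1"]] O.minus_eq_smult[of S T] that by simp
    have "convergent (\<lambda>k. ?m (s k) i j)" if ij: "i < d" "j < d" for i j
    proof (rule Cauchy_convergent, rule metric_CauchyI)
      fix r :: real assume "0 < r"
      then obtain N where N: "\<And>p q. p \<ge> N \<Longrightarrow> q \<ge> N \<Longrightarrow> ?N (s p \<ominus>\<^bsub>operators H\<^esub> s q) < r"
        using cauchy by blast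
      have "dist (?m (s p) i j) (?m (s q) i j) < r" if "p \<ge> N" "q \<ge> N" for p q
        using op_entry_le_norm[OF f diff_in[OF sl sl] ij, of p q] N[OF that] diff[OF sl sl ij, of p q]
        by (simp add: dist_norm)
      then show "\<exists>M. \<forall>m\<ge>M. \<forall>n\<ge>M. dist (?m (s m) i j) (?m (s n) i j) < r" by blast
    qed
    then have "\<exists>l. (\<lambda>k. ?m (s k) i j) \<longlonglongrightarrow> l" if "i < d" "j < d" for i j
      using that by (simp add: convergent_def)
    then obtain l where l: "\<And>i j. i < d \<Longrightarrow> j < d \<Longrightarrow> (\<lambda>k. ?m (s k) i j) \<longlonglongrightarrow> l i j"
      by metis
    \<comment> \<open>The operator whose matrix consists of the limits of the entries.\<close>
    define L where "L = (\<lambda>x\<in>carrier H. \<Oplus>j\<in>{..<d}. cinner H (f j) x \<odot> (\<Oplus>i\<in>{..<d}. l i j \<odot> f i))"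
    have w: "(\<Oplus>i\<in>{..<d}. l i j \<odot> f i) \<in> carrier H" for j using fi by (auto intro!: finsum_closed)
    have L: "L \<in> linear_maps H H"
      unfolding L_def using fi w
      by (intro linear_maps_restrict clinear_finsum_fun clinear_coeff_smult cinner_linear
          complex_space_axioms) auto
    have mL: "?m L i j = l i j" if ij: "i < d" "j < d" for i j
    proof -
      have "L (f j) = (\<Oplus>k\<in>{..<d}. (if k = j then 1 else 0) \<odot> (\<Oplus>i\<in>{..<d}. l i k \<odot> f i))"
        unfolding L_def using fi ij w
        by (simp, intro finsum_cong') (auto simp: coordinatesD(3)[OF f])
      also have "\<dots> = (\<Oplus>i\<in>{..<d}. l i j \<odot> f i)"
        using ij w by (intro finsum_delta) auto
      finally have "?m L i j = (\<Sum>k<d. cinner H (f i) (l k j \<odot> f k))"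
        using fi ij by (simp add: cinner_finsum_right Pi_def)
      also have "\<dots> = (\<Sum>k<d. if i = k then l k j else 0)"
        using fi ij by (intro sum.cong) (auto simp: cinner_smult_right coordinatesD(3)[OF f])
      also have "\<dots> = l i j" using ij by simp
      finally show ?thesis .
    qed
    have "(\<lambda>k. \<Sum>j<d. \<Sum>i<d. cmod (?m (s k) i j - l i j)) \<longlonglongrightarrow> (\<Sum>j<d. \<Sum>i<d. cmod (l i j - l i j))"
      by (intro tendsto_sum tendsto_norm tendsto_diff l tendsto_const) auto
    then have lim: "(\<lambda>k. \<Sum>j<d. \<Sum>i<d. cmod (?m (s k) i j - l i j)) \<longlonglongrightarrow> 0" by simp
    have bound: "?N (s k \<ominus>\<^bsub>operators H\<^esub> L) \<le> (\<Sum>j<d. \<Sum>i<d. cmod (?m (s k) i j - l i j))" for k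
    proof -
      have "(\<Sum>j<d. \<Sum>i<d. cmod (?m (s k \<ominus>\<^bsub>operators H\<^esub> L) i j)) =
          (\<Sum>j<d. \<Sum>i<d. cmod (?m (s k) i j - l i j))"
        by (intro sum.cong) (auto simp: diff[OF sl L] mL)
      then show ?thesis using op_norm_le_entries[OF f diff_in[OF sl L], of k] by simp
    qed
    have "(\<lambda>k. ?N (s k \<ominus>\<^bsub>operators H\<^esub> L)) \<longlonglongrightarrow> 0"
      by (rule tendsto_sandwich[OF _ _ tendsto_const lim])
        (auto intro!: eventuallyI bound op_norm_nonneg diff_in sl L)
    then show "\<exists>l\<in>carrier (operators H). (\<lambda>k. ?N (s k \<ominus>\<^bsub>operators H\<^esub> l)) \<longlonglongrightarrow> 0"
      using L by auto
  qed
qed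

end

lemma (in fd_hilbert_space) finsum_operators_apply:
  assumes "T \<in> S \<rightarrow> linear_maps H H" "x \<in> carrier H"
  shows "(\<Oplus>\<^bsub>operators H\<^esub>i\<in>S. T i) x = (\<Oplus>\<^bsub>H\<^esub>i\<in>S. T i x)"
proof -
  interpret O: unital_star_algebra "operators H" by (rule unital_star_algebra_operators)
  have "clinear (operators H) H (\<lambda>T. T x)"
    using assms(2) linear_mapsD(2) by (intro clinearI) auto
  from clinear_finsum[OF O.complex_space_axioms complex_space_axioms this, of T S] assms(1)
  show ?thesis by simp
qed

section \<open>Morphisms and encoded subdirect products of \<open>C\<^sup>*\<close>-algebras\<close>

text \<open>
  In contrast to \<^const>\<open>star_hom\<close>, extensionality is not demanded, so that these maps can be composed as
  functions.
\<close>

definition star_morphism ::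
  "('a, 'x) star_algebra_scheme \<Rightarrow> ('b, 'y) star_algebra_scheme \<Rightarrow> ('a \<Rightarrow> 'b) \<Rightarrow> bool" where
  "star_morphism A B \<phi> \<longleftrightarrow> clinear A B \<phi> \<and> \<phi> \<one>\<^bsub>A\<^esub> = \<one>\<^bsub>B\<^esub> \<and>
     (\<forall>x\<in>carrier A. \<forall>y\<in>carrier A. \<phi> (x \<otimes>\<^bsub>A\<^esub> y) = \<phi> x \<otimes>\<^bsub>B\<^esub> \<phi> y) \<and>
     (\<forall>x\<in>carrier A. \<phi> (star A x) = star B (\<phi> x))"

lemma star_hom_iff:
  "\<phi> \<in> star_hom A B \<longleftrightarrow> \<phi> \<in> extensional (carrier A) \<and> star_morphism A B \<phi>"
  by (auto simp: star_hom_def star_morphism_def ring_hom_def clinear_def)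

lemma star_morphism_restrict:
  assumes "unital_star_algebra A" "star_morphism A B \<phi>"
  shows "restrict \<phi> (carrier A) \<in> star_hom A B"
proof -
  interpret unital_star_algebra A by fact
  have "clinear A B (restrict \<phi> (carrier A))"
    by (rule clinear_cong[of A B \<phi>]) (use assms(2) in \<open>auto simp: star_morphism_def complex_space_axioms\<close>)
  with assms(2) show ?thesis
    by (auto simp: star_hom_iff star_morphism_def star_closed)
qed

lemma star_morphism_compose:
  assumes "star_morphism A B \<phi>" "star_morphism B C \<chi>"
  shows "star_morphism A C (\<lambda>x. \<chi> (\<phi> x))"
proof -
  have "clinear A B \<phi>" using assms(1) by (simp add: star_morphism_def)
  note [simp] = clinear_in[OF this]
  show ?thesis using assms clinear_compose[of A B \<phi> C \<chi>]
    by (auto simp: star_morphism_def)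
qed

lemma star_morphism_finsum:
  assumes "complex_space D" "complex_space D'" "star_morphism D D' \<phi>" "f \<in> S \<rightarrow> carrier D"
    and "\<And>i. i \<in> S \<Longrightarrow> \<phi> (f i) = f' i"
  shows "\<phi> (\<Oplus>\<^bsub>D\<^esub>i\<in>S. f i) = (\<Oplus>\<^bsub>D'\<^esub>i\<in>S. f' i)"
proof -
  interpret D': complex_space D' by fact
  have lin: "clinear D D' \<phi>" using assms(3) by (simp add: star_morphism_def)
  have f': "f' i \<in> carrier D'" if "i \<in> S" for i
    using clinear_in[OF lin, of "f i"] assms(4,5) that by (auto simp: Pi_iff)
  have "\<phi> (\<Oplus>\<^bsub>D\<^esub>i\<in>S. f i) = (\<Oplus>\<^bsub>D'\<^esub>i\<in>S. \<phi> (f i))"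
    by (rule clinear_finsum[OF assms(1,2) lin assms(4)])
  also have "\<dots> = (\<Oplus>\<^bsub>D'\<^esub>i\<in>S. f' i)"
    using f' by (intro D'.vsum_cong) (auto simp: assms(5))
  finally show ?thesis .
qed

text \<open>
  A \<open>*\<close>-subalgebra \<open>S\<close> of \<open>D\<^sub>1 \<times> D\<^sub>2\<close>, closed in the maximum norm, transported along an injection
  \<open>g\<close> into another type. These are the algebras to which the universal property is applied: the
  transport moves them to the type of the test algebras, and membership in \<open>S\<close> records a relation
  between two representations.
\<close>

locale encoded_subdirect = D1: unital_cstar_algebra D1 + D2: unital_cstar_algebra D2
  for D1 :: "'a cstar_algebra" and D2 :: "'b cstar_algebra" +
  fixes S :: "('a \<times> 'b) set" and g :: "'a \<times> 'b \<Rightarrow> 'e"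
  assumes inj: "inj_on g S"
    and subset: "(a, b) \<in> S \<Longrightarrow> a \<in> carrier D1" "(a, b) \<in> S \<Longrightarrow> b \<in> carrier D2"
    and one_mem: "(\<one>\<^bsub>D1\<^esub>, \<one>\<^bsub>D2\<^esub>) \<in> S"
    and add_mem: "(a, b) \<in> S \<Longrightarrow> (a', b') \<in> S \<Longrightarrow> (a \<oplus>\<^bsub>D1\<^esub> a', b \<oplus>\<^bsub>D2\<^esub> b') \<in> S"
    and mult_mem: "(a, b) \<in> S \<Longrightarrow> (a', b') \<in> S \<Longrightarrow> (a \<otimes>\<^bsub>D1\<^esub> a', b \<otimes>\<^bsub>D2\<^esub> b') \<in> S"
    and smult_mem: "(a, b) \<in> S \<Longrightarrow> (c \<odot>\<^bsub>D1\<^esub> a, c \<odot>\<^bsub>D2\<^esub> b) \<in> S"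
    and star_mem: "(a, b) \<in> S \<Longrightarrow> (star D1 a, star D2 b) \<in> S"
    and limit_mem: "(\<And>k. s k \<in> S) \<Longrightarrow> l \<in> carrier D1 \<Longrightarrow> l' \<in> carrier D2 \<Longrightarrow>
      (\<lambda>k::nat. cnorm D1 (fst (s k) \<ominus>\<^bsub>D1\<^esub> l)) \<longlonglongrightarrow> 0 \<Longrightarrow>
      (\<lambda>k. cnorm D2 (snd (s k) \<ominus>\<^bsub>D2\<^esub> l')) \<longlonglongrightarrow> 0 \<Longrightarrow> (l, l') \<in> S"
begin

abbreviation dec where "dec \<equiv> inv_into S g"

definition E :: "'e cstar_algebra" where
  "E = \<lparr>carrier = g ` S,
     mult = (\<lambda>x y. g (fst (dec x) \<otimes>\<^bsub>D1\<^esub> fst (dec y), snd (dec x) \<otimes>\<^bsub>D2\<^esub> snd (dec y))),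
     one = g (\<one>\<^bsub>D1\<^esub>, \<one>\<^bsub>D2\<^esub>),
     zero = g (\<zero>\<^bsub>D1\<^esub>, \<zero>\<^bsub>D2\<^esub>),
     add = (\<lambda>x y. g (fst (dec x) \<oplus>\<^bsub>D1\<^esub> fst (dec y), snd (dec x) \<oplus>\<^bsub>D2\<^esub> snd (dec y))),
     smult = (\<lambda>c x. g (c \<odot>\<^bsub>D1\<^esub> fst (dec x), c \<odot>\<^bsub>D2\<^esub> snd (dec x))),
     star = (\<lambda>x. g (star D1 (fst (dec x)), star D2 (snd (dec x)))),
     cnorm = (\<lambda>x. max (cnorm D1 (fst (dec x))) (cnorm D2 (snd (dec x))))\<rparr>"

lemma zero_mem: "(\<zero>\<^bsub>D1\<^esub>, \<zero>\<^bsub>D2\<^esub>) \<in> S"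
  using smult_mem[OF one_mem, of 0] by simp

lemma E_simps [simp]:
  "carrier E = g ` S" "\<one>\<^bsub>E\<^esub> = g (\<one>\<^bsub>D1\<^esub>, \<one>\<^bsub>D2\<^esub>)" "\<zero>\<^bsub>E\<^esub> = g (\<zero>\<^bsub>D1\<^esub>, \<zero>\<^bsub>D2\<^esub>)"
  "(a, b) \<in> S \<Longrightarrow> (a', b') \<in> S \<Longrightarrow> g (a, b) \<otimes>\<^bsub>E\<^esub> g (a', b') = g (a \<otimes>\<^bsub>D1\<^esub> a', b \<otimes>\<^bsub>D2\<^esub> b')"
  "(a, b) \<in> S \<Longrightarrow> (a', b') \<in> S \<Longrightarrow> g (a, b) \<oplus>\<^bsub>E\<^esub> g (a', b') = g (a \<oplus>\<^bsub>D1\<^esub> a', b \<oplus>\<^bsub>D2\<^esub> b')"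
  "(a, b) \<in> S \<Longrightarrow> c \<odot>\<^bsub>E\<^esub> g (a, b) = g (c \<odot>\<^bsub>D1\<^esub> a, c \<odot>\<^bsub>D2\<^esub> b)"
  "(a, b) \<in> S \<Longrightarrow> star E (g (a, b)) = g (star D1 a, star D2 b)"
  "(a, b) \<in> S \<Longrightarrow> cnorm E (g (a, b)) = max (cnorm D1 a) (cnorm D2 b)"
  by (simp_all add: E_def inv_into_f_f[OF inj])

lemma g_eq: "(a, b) \<in> S \<Longrightarrow> (a', b') \<in> S \<Longrightarrow> g (a, b) = g (a', b') \<longleftrightarrow> a = a' \<and> b = b'"
  using inj by (simp add: inj_on_eq_iff)

lemma g_in: "p \<in> S \<Longrightarrow> g p \<in> g ` S"
  by blast

lemmas members [simp] = one_mem zero_mem add_mem mult_mem smult_mem star_mem g_in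

lemma unital_star_algebra_E: "unital_star_algebra E"
proof -
  note [simp] = subset
  note r1 = ring.ring_simprules[OF D1.ring] and r2 = ring.ring_simprules[OF D2.ring]
  have ab: "abelian_group E"
  proof (rule abelian_groupI)
    fix x assume "x \<in> carrier E"
    then obtain a b where p: "(a, b) \<in> S" "x = g (a, b)" by auto
    have "((-1) \<odot>\<^bsub>D1\<^esub> a) \<oplus>\<^bsub>D1\<^esub> a = \<zero>\<^bsub>D1\<^esub>" "((-1) \<odot>\<^bsub>D2\<^esub> b) \<oplus>\<^bsub>D2\<^esub> b = \<zero>\<^bsub>D2\<^esub>"
      using D1.smult_plus[of a "-1" 1] D2.smult_plus[of b "-1" 1] subset[OF p(1)] by simp_all
    then show "\<exists>y\<in>carrier E. y \<oplus>\<^bsub>E\<^esub> x = \<zero>\<^bsub>E\<^esub>"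
      using p by (intro bexI[of _ "g ((-1) \<odot>\<^bsub>D1\<^esub> a, (-1) \<odot>\<^bsub>D2\<^esub> b)"]) simp_all
  qed (auto simp: r1 r2)
  have cs: "complex_space E"
    by (rule complex_spaceI[OF ab])
      (auto simp: D1.smult_plus D2.smult_plus D1.smult_add D2.smult_add D1.smult_smult D2.smult_smult)
  have r_one: "x \<otimes>\<^bsub>D1\<^esub> \<one>\<^bsub>D1\<^esub> = x" if "x \<in> carrier D1" for x
    using D1.ring that by (simp add: ring_def monoid.r_one)
  have r_one': "x \<otimes>\<^bsub>D2\<^esub> \<one>\<^bsub>D2\<^esub> = x" if "x \<in> carrier D2" for x
    using D2.ring that by (simp add: ring_def monoid.r_one)
  have mon: "monoid E"
    by (rule monoidI) (auto simp: r1 r2 r_one r_one')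
  have rng: "ring E"
    by (rule ringI[OF ab mon]) (auto simp: r1 r2)
  show ?thesis
    by (intro unital_star_algebra.intro unital_star_algebra_axioms.intro rng
        cs[unfolded complex_space_def])
      (auto simp: D1.smult_mult_left D2.smult_mult_left D1.smult_mult_right D2.smult_mult_right
        D1.star_add D2.star_add D1.star_smult D2.star_smult D1.star_mult D2.star_mult
        D1.star_star D2.star_star)
qed

lemma E_minus:
  assumes "(a, b) \<in> S" "(a', b') \<in> S"
  shows "g (a, b) \<ominus>\<^bsub>E\<^esub> g (a', b') = g (a \<ominus>\<^bsub>D1\<^esub> a', b \<ominus>\<^bsub>D2\<^esub> b')"
    and "(a \<ominus>\<^bsub>D1\<^esub> a', b \<ominus>\<^bsub>D2\<^esub> b') \<in> S"
proof -
  interpret E: unital_star_algebra E by (rule unital_star_algebra_E)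
  have m: "a \<ominus>\<^bsub>D1\<^esub> a' = a \<oplus>\<^bsub>D1\<^esub> ((-1) \<odot>\<^bsub>D1\<^esub> a')" "b \<ominus>\<^bsub>D2\<^esub> b' = b \<oplus>\<^bsub>D2\<^esub> ((-1) \<odot>\<^bsub>D2\<^esub> b')"
    using assms subset by (auto intro!: D1.minus_eq_smult D2.minus_eq_smult)
  show "g (a, b) \<ominus>\<^bsub>E\<^esub> g (a', b') = g (a \<ominus>\<^bsub>D1\<^esub> a', b \<ominus>\<^bsub>D2\<^esub> b')"
    using assms E.minus_eq_smult[of "g (a, b)" "g (a', b')"] by (simp add: m)
  show "(a \<ominus>\<^bsub>D1\<^esub> a', b \<ominus>\<^bsub>D2\<^esub> b') \<in> S"
    using assms add_mem[OF assms(1) smult_mem[OF assms(2), of "-1"]] by (simp add: m)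
qed

lemma unital_cstar_algebra_E: "unital_cstar_algebra E"
proof (intro unital_cstar_algebra.intro unital_star_algebra_E unital_cstar_algebra_axioms.intro)
  fix x assume "x \<in> carrier E"
  then obtain a b where p: "(a, b) \<in> S" "x = g (a, b)" by auto
  note ab [simp] = subset[OF p(1)]
  have n: "0 \<le> cnorm D1 a" "0 \<le> cnorm D2 b"
    using D1.cnorm_nonneg D2.cnorm_nonneg by simp_all
  show "0 \<le> cnorm E x" using p n by simp
  show "cnorm E x = 0 \<longleftrightarrow> x = \<zero>\<^bsub>E\<^esub>"
    using p n D1.cnorm_eq_zero[of a] D2.cnorm_eq_zero[of b] by (auto simp: g_eq max_def)
  show "cnorm E (c \<odot>\<^bsub>E\<^esub> x) = cmod c * cnorm E x" for c
    using p by (simp add: D1.cnorm_smult D2.cnorm_smult max_mult_distrib_left)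
  show "cnorm E (star E x \<otimes>\<^bsub>E\<^esub> x) = (cnorm E x)\<^sup>2"
    using p n by (auto simp: D1.cstar_identity D2.cstar_identity max_def power2_le_iff_abs_le)
  fix y assume "y \<in> carrier E"
  then obtain a' b' where q: "(a', b') \<in> S" "y = g (a', b')" by auto
  note ab' [simp] = subset[OF q(1)]
  have n': "0 \<le> cnorm D1 a'" "0 \<le> cnorm D2 b'"
    using D1.cnorm_nonneg D2.cnorm_nonneg by simp_all
  show "cnorm E (x \<oplus>\<^bsub>E\<^esub> y) \<le> cnorm E x + cnorm E y"
    using p q D1.cnorm_triangle[OF ab(1) ab'(1)] D2.cnorm_triangle[OF ab(2) ab'(2)]
    by (simp add: max_def)
  have "cnorm D1 (a \<otimes>\<^bsub>D1\<^esub> a') \<le> cnorm E x * cnorm E y"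
    using p q n n' by (intro order_trans[OF D1.cnorm_mult] mult_mono) auto
  moreover have "cnorm D2 (b \<otimes>\<^bsub>D2\<^esub> b') \<le> cnorm E x * cnorm E y"
    using p q n n' by (intro order_trans[OF D2.cnorm_mult] mult_mono) auto
  ultimately show "cnorm E (x \<otimes>\<^bsub>E\<^esub> y) \<le> cnorm E x * cnorm E y"
    using p q by simp
next
  fix t :: "nat \<Rightarrow> 'e"
  assume t: "\<And>k. t k \<in> carrier E"
    and cauchy: "\<forall>\<epsilon>>0. \<exists>N. \<forall>j\<ge>N. \<forall>k\<ge>N. cnorm E (t j \<ominus>\<^bsub>E\<^esub> t k) < \<epsilon>"
  define s where "s k = dec (t k)" for k
  have s0: "s k \<in> S" "t k = g (s k)" for k
    using t[of k] by (auto simp: s_def inv_into_f_f[OF inj])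
  then have s: "(fst (s k), snd (s k)) \<in> S" "t k = g (fst (s k), snd (s k))" for k by simp_all
  have nrm: "cnorm E (t j \<ominus>\<^bsub>E\<^esub> t k) =
      max (cnorm D1 (fst (s j) \<ominus>\<^bsub>D1\<^esub> fst (s k))) (cnorm D2 (snd (s j) \<ominus>\<^bsub>D2\<^esub> snd (s k)))" for j k
    using E_minus[OF s(1) s(1), of j k] by (simp add: s(2))
  have "\<forall>\<epsilon>>0. \<exists>N. \<forall>j\<ge>N. \<forall>k\<ge>N. cnorm D1 (fst (s j) \<ominus>\<^bsub>D1\<^esub> fst (s k)) < \<epsilon>"
    "\<forall>\<epsilon>>0. \<exists>N. \<forall>j\<ge>N. \<forall>k\<ge>N. cnorm D2 (snd (s j) \<ominus>\<^bsub>D2\<^esub> snd (s k)) < \<epsilon>"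
    using cauchy unfolding nrm max_less_iff_conj by meson+
  note cauchy' = this
  obtain l where l: "l \<in> carrier D1" "(\<lambda>k. cnorm D1 (fst (s k) \<ominus>\<^bsub>D1\<^esub> l)) \<longlonglongrightarrow> 0"
    using D1.complete[of "\<lambda>k. fst (s k)"] subset(1)[OF s(1)] cauchy'(1) by auto
  obtain l' where l': "l' \<in> carrier D2" "(\<lambda>k. cnorm D2 (snd (s k) \<ominus>\<^bsub>D2\<^esub> l')) \<longlonglongrightarrow> 0"
    using D2.complete[of "\<lambda>k. snd (s k)"] subset(2)[OF s(1)] cauchy'(2) by auto
  have mem: "(l, l') \<in> S" using limit_mem[OF s0(1) l(1) l'(1) l(2) l'(2)] .
  have "(\<lambda>k. max (cnorm D1 (fst (s k) \<ominus>\<^bsub>D1\<^esub> l)) (cnorm D2 (snd (s k) \<ominus>\<^bsub>D2\<^esub> l'))) \<longlonglongrightarrow> max 0 0"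
    by (intro tendsto_max l l')
  moreover have "cnorm E (t k \<ominus>\<^bsub>E\<^esub> g (l, l')) =
      max (cnorm D1 (fst (s k) \<ominus>\<^bsub>D1\<^esub> l)) (cnorm D2 (snd (s k) \<ominus>\<^bsub>D2\<^esub> l'))" for k
    using E_minus[OF s(1) mem, of k] by (simp add: s(2))
  ultimately show "\<exists>l\<in>carrier E. (\<lambda>k. cnorm E (t k \<ominus>\<^bsub>E\<^esub> l)) \<longlonglongrightarrow> 0"
    using mem by (intro bexI[of _ "g (l, l')"]) auto
qed

lemma star_morphism_projections:
  "star_morphism E D1 (\<lambda>x. fst (dec x))" "star_morphism E D2 (\<lambda>x. snd (dec x))"
  by (auto simp: star_morphism_def clinear_def inv_into_f_f[OF inj] subset)

lemma E_eqI:
  "x \<in> carrier E \<Longrightarrow> y \<in> carrier E \<Longrightarrow> fst (dec x) = fst (dec y) \<Longrightarrow> snd (dec x) = snd (dec y) \<Longrightarrow> x = y"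
  by (auto simp: inv_into_f_f[OF inj] g_eq)

lemma dec_mem: "x \<in> carrier E \<Longrightarrow> dec x \<in> S"
  by (auto simp: inv_into_f_f[OF inj])

end

lemma (in encoded_subdirect) pair_star_hom:
  assumes C: "unital_star_algebra C" and \<phi>: "\<phi>1 \<in> star_hom C D1" "\<phi>2 \<in> star_hom C D2"
    and S: "\<And>c. c \<in> carrier C \<Longrightarrow> (\<phi>1 c, \<phi>2 c) \<in> S"
  shows "(\<lambda>c\<in>carrier C. g (\<phi>1 c, \<phi>2 c)) \<in> star_hom C E"
proof (rule star_morphism_restrict[OF C])
  show "star_morphism C E (\<lambda>c. g (\<phi>1 c, \<phi>2 c))"
    using \<phi> S unfolding star_hom_iff star_morphism_def clinear_def by auto
qed

text \<open>Operators on a finite-dimensional space are coded by their matrix entries.\<close>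

lemma (in fd_hilbert_space) operators_embed:
  "\<exists>g :: ('h \<Rightarrow> 'h) \<Rightarrow> nat \<Rightarrow> complex. inj_on g (carrier (operators H))"
proof -
  obtain d f where f: "coordinates H d f (\<lambda>i. cinner H (f i))"
    using ex_orthonormal_coordinates by blast
  define g where "g T m = (case prod_decode m of (i, j) \<Rightarrow>
      if i < d \<and> j < d then cinner H (f i) (T (f j)) else 0)" for T m
  have "inj_on g (linear_maps H H)"
  proof (rule inj_onI)
    fix S T assume S: "S \<in> linear_maps H H" and T: "T \<in> linear_maps H H" and eq: "g S = g T"
    have e: "S (f j) = T (f j)" if j: "j < d" for j
    proof (rule coordinates_eqI[OF f complex_space_axioms])
      fix i assume "i < d"
      then show "cinner H (f i) (S (f j)) = cinner H (f i) (T (f j))"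
        using fun_cong[OF eq, of "prod_encode (i, j)"] j by (simp add: g_def)
    qed (use j coordinatesD(1)[OF f] linear_mapsD(2)[OF S] linear_mapsD(2)[OF T] in simp_all)
    show "S = T"
    proof (rule linear_maps_eqI[OF S T])
      fix x assume x: "x \<in> carrier H"
      note c = clinear_expand[OF f complex_space_axioms complex_space_axioms]
      have "S x = (\<Oplus>i\<in>{..<d}. cinner H (f i) x \<odot> S (f i))"
        by (rule c[OF linear_mapsD(1)[OF S] x])
      also have "\<dots> = (\<Oplus>i\<in>{..<d}. cinner H (f i) x \<odot> T (f i))"
        using coordinatesD(1)[OF f] linear_mapsD(2)[OF T] by (intro finsum_cong') (auto simp: e)
      also have "\<dots> = T x" by (rule c[OF linear_mapsD(1)[OF T] x, symmetric])
      finally show "S x = T x" .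
    qed
  qed
  then show ?thesis by auto
qed

text \<open>Two sequences are coded by interleaving them.\<close>

lemma pair_embed:
  fixes g :: "'a \<Rightarrow> nat \<Rightarrow> complex" and g' :: "'b \<Rightarrow> nat \<Rightarrow> complex"
  assumes "inj_on g X" "inj_on g' Y"
  shows "\<exists>k :: 'a \<times> 'b \<Rightarrow> nat \<Rightarrow> complex. inj_on k (X \<times> Y)"
proof -
  define k where "k p m = (if even m then g (fst p) (m div 2) else g' (snd p) (m div 2))" for p m
  have "g (fst p) = g (fst q)" "g' (snd p) = g' (snd q)" if "k p = k q" for p q
  proof -
    show "g (fst p) = g (fst q)"
    proof
      fix m show "g (fst p) m = g (fst q) m"
        using fun_cong[OF that, of "2 * m"] by (simp add: k_def)
    qed
    show "g' (snd p) = g' (snd q)"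
    proof
      fix m show "g' (snd p) m = g' (snd q) m"
        using fun_cong[OF that, of "Suc (2 * m)"] by (simp add: k_def)
    qed
  qed
  then have kD: "g (fst p) = g (fst q)" "g' (snd p) = g' (snd q)" if "k p = k q" for p q
    using that by blast+
  have "inj_on k (X \<times> Y)"
  proof (rule inj_onI)
    fix p q assume "p \<in> X \<times> Y" "q \<in> X \<times> Y" and eq: "k p = k q"
    then show "p = q"
      using inj_onD[OF assms(1) kD(1)[OF eq]] inj_onD[OF assms(2) kD(2)[OF eq]]
      by (simp add: mem_Times_iff prod_eq_iff)
  qed
  then show ?thesis by blast
qed

text \<open>
  The condition on the adjoints makes this set closed under adjoints; in general it does not follow
  from \<open>f S = S' f\<close>.
\<close>

definition intertwining_pairs ::
  "'h hilbert \<Rightarrow> 'h hilbert \<Rightarrow> ('h \<Rightarrow> 'h) \<Rightarrow> (('h \<Rightarrow> 'h) \<times> ('h \<Rightarrow> 'h)) set" where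
  "intertwining_pairs H K f = {(S, S'). S \<in> linear_maps H H \<and> S' \<in> linear_maps K K \<and>
     (\<forall>x\<in>carrier H. f (S x) = S' (f x) \<and> f (adjoint H H S x) = adjoint K K S' (f x))}"

text \<open>\<open>f\<close> is bounded, so both sides depend continuously on the operators.\<close>

lemma intertwining_limit:
  fixes H K :: "'h hilbert"
  assumes H: "fd_hilbert_space H" and K: "fd_hilbert_space K" and f: "clinear H K f"
    and s: "\<And>k. s k \<in> linear_maps H H" and s': "\<And>k. s' k \<in> linear_maps K K"
    and l: "l \<in> linear_maps H H" and l': "l' \<in> linear_maps K K"
    and lim: "(\<lambda>k::nat. cnorm (operators H) (s k \<ominus>\<^bsub>operators H\<^esub> l)) \<longlonglongrightarrow> 0"
    and lim': "(\<lambda>k. cnorm (operators K) (s' k \<ominus>\<^bsub>operators K\<^esub> l')) \<longlonglongrightarrow> 0"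
    and tw: "\<And>k. f (s k x) = s' k (f x)" and x: "x \<in> carrier H"
  shows "f (l x) = l' (f x)"
proof -
  interpret H: fd_hilbert_space H by fact
  interpret K: fd_hilbert_space K by fact
  interpret OH: unital_star_algebra "operators H" by (rule H.unital_star_algebra_operators)
  interpret OK: unital_star_algebra "operators K" by (rule K.unital_star_algebra_operators)
  obtain M where M: "M \<ge> 0" "\<And>x. x \<in> carrier H \<Longrightarrow> K.vnorm (f x) \<le> M * H.vnorm x"
    using clinear_bounded[OF H K f] by blast
  note fin [simp] = clinear_in[OF f] and [simp] = linear_mapsD(2)[OF s] linear_mapsD(2)[OF s']
    linear_mapsD(2)[OF l] linear_mapsD(2)[OF l'] x
  let ?n = "\<lambda>k. cnorm (operators H) (s k \<ominus>\<^bsub>operators H\<^esub> l)"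
    and ?n' = "\<lambda>k. cnorm (operators K) (s' k \<ominus>\<^bsub>operators K\<^esub> l')"
  let ?d = "f (l x) \<oplus>\<^bsub>K\<^esub> ((-1) \<odot>\<^bsub>K\<^esub> l' (f x))"
  have dH: "s k \<ominus>\<^bsub>operators H\<^esub> l \<in> linear_maps H H"
      "(s k \<ominus>\<^bsub>operators H\<^esub> l) x = s k x \<oplus>\<^bsub>H\<^esub> ((-1) \<odot>\<^bsub>H\<^esub> l x)" for k
    using OH.minus_eq_smult[of "s k" l] s l H.op_add_in[OF s H.op_smult_in[OF l, of "-1"], of k]
    by simp_all
  have dK: "s' k \<ominus>\<^bsub>operators K\<^esub> l' \<in> linear_maps K K"
      "(s' k \<ominus>\<^bsub>operators K\<^esub> l') (f x) = s' k (f x) \<oplus>\<^bsub>K\<^esub> ((-1) \<odot>\<^bsub>K\<^esub> l' (f x))" for k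
    using OK.minus_eq_smult[of "s' k" l'] s' l' K.op_add_in[OF s' K.op_smult_in[OF l', of "-1"], of k]
    by simp_all
  have bound: "K.vnorm ?d \<le> ?n' k * K.vnorm (f x) + M * (?n k * H.vnorm x)" for k
  proof -
    let ?a = "(s' k \<ominus>\<^bsub>operators K\<^esub> l') (f x)" and ?b = "f ((s k \<ominus>\<^bsub>operators H\<^esub> l) x)"
    have ain: "?a \<in> carrier K" and bin: "?b \<in> carrier K" by (simp_all add: dK dH)
    have b: "?b = s' k (f x) \<oplus>\<^bsub>K\<^esub> ((-1) \<odot>\<^bsub>K\<^esub> f (l x))"
      by (simp add: dH clinear_add[OF f] clinear_smult[OF f] tw)
    have z: "((-1) \<odot>\<^bsub>K\<^esub> y) \<oplus>\<^bsub>K\<^esub> y = \<zero>\<^bsub>K\<^esub>" if "y \<in> carrier K" for y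
      using K.smult_plus[of y "-1" 1] that by simp
    have "?a \<oplus>\<^bsub>K\<^esub> ((-1) \<odot>\<^bsub>K\<^esub> ?b) = (((-1) \<odot>\<^bsub>K\<^esub> s' k (f x)) \<oplus>\<^bsub>K\<^esub> s' k (f x)) \<oplus>\<^bsub>K\<^esub> ?d"
      by (simp add: dK b K.smult_add K.smult_smult K.a_ac)
    then have "?d = ?a \<oplus>\<^bsub>K\<^esub> ((-1) \<odot>\<^bsub>K\<^esub> ?b)" by (simp add: z)
    then have "K.vnorm ?d \<le> K.vnorm ?a + K.vnorm ?b"
      using K.vnorm_triangle[of ?a "(-1) \<odot>\<^bsub>K\<^esub> ?b"] ain bin by (simp add: K.vnorm_smult)
    also have "\<dots> \<le> ?n' k * K.vnorm (f x) + M * (?n k * H.vnorm x)"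
    proof (rule add_mono)
      show "K.vnorm ?a \<le> ?n' k * K.vnorm (f x)" by (intro K.op_norm_bound dK fin x)
      have "K.vnorm ?b \<le> M * H.vnorm ((s k \<ominus>\<^bsub>operators H\<^esub> l) x)"
        by (intro M linear_mapsD(2)[OF dH(1)] x)
      also have "\<dots> \<le> M * (?n k * H.vnorm x)"
        by (intro mult_left_mono H.op_norm_bound dH x M)
      finally show "K.vnorm ?b \<le> M * (?n k * H.vnorm x)" .
    qed
    finally show ?thesis .
  qed
  have "(\<lambda>k. ?n' k * K.vnorm (f x) + M * (?n k * H.vnorm x)) \<longlonglongrightarrow> 0 * K.vnorm (f x) + M * (0 * H.vnorm x)"
    by (intro tendsto_add tendsto_mult tendsto_const lim lim')
  then have "K.vnorm ?d \<le> 0"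
    by (intro LIMSEQ_le_const[of _ 0]) (auto intro: bound)
  then have "?d = \<zero>\<^bsub>K\<^esub>"
    using K.vnorm_nonneg[of ?d] K.vnorm_zero_iff[of ?d] by simp
  then have "?d \<oplus>\<^bsub>K\<^esub> l' (f x) = l' (f x)" by simp
  moreover have "((-1) \<odot>\<^bsub>K\<^esub> l' (f x)) \<oplus>\<^bsub>K\<^esub> l' (f x) = \<zero>\<^bsub>K\<^esub>"
    using K.smult_plus[of "l' (f x)" "-1" 1] by simp
  ultimately show ?thesis by (simp add: K.a_assoc)
qed

text \<open>
  For closedness, \<open>intertwining_limit\<close> is applied to the operators and to their adjoints; the latter
  converge as well because taking adjoints does not increase the norm.
\<close>

lemma encoded_subdirect_intertwining:
  fixes H K :: "'h hilbert"
  assumes H: "fd_hilbert_space H" and K: "fd_hilbert_space K" and f: "clinear H K f"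
    and inj: "inj_on g (carrier (operators H) \<times> carrier (operators K))"
  shows "encoded_subdirect (operators H) (operators K) (intertwining_pairs H K f) g"
proof -
  interpret H: fd_hilbert_space H by fact
  interpret K: fd_hilbert_space K by fact
  interpret OH: unital_cstar_algebra "operators H" by (rule H.unital_cstar_algebra_operators)
  interpret OK: unital_cstar_algebra "operators K" by (rule K.unital_cstar_algebra_operators)
  note fin [simp] = clinear_in[OF f]
  let ?S = "intertwining_pairs H K f"
  have mem: "(S, S') \<in> ?S \<longleftrightarrow> S \<in> linear_maps H H \<and> S' \<in> linear_maps K K \<and>
      (\<forall>x\<in>carrier H. f (S x) = S' (f x) \<and>
        f (star (operators H) S x) = star (operators K) S' (f x))" for S S'
    by (simp add: intertwining_pairs_def)
  note sH = OH.star_one OH.star_add OH.star_smult OH.star_mult OH.star_star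
    and sK = OK.star_one OK.star_add OK.star_smult OK.star_mult OK.star_star
  have [simp]: "adjoint H H S x \<in> carrier H" if "S \<in> linear_maps H H" "x \<in> carrier H" for S x
    using that H.adjoint_in by simp
  have [simp]: "adjoint K K S x \<in> carrier K" if "S \<in> linear_maps K K" "x \<in> carrier K" for S x
    using that K.adjoint_in by simp
  show ?thesis
  proof (intro encoded_subdirect.intro encoded_subdirect_axioms.intro
      H.unital_cstar_algebra_operators K.unital_cstar_algebra_operators)
    show "inj_on g ?S"
      by (rule inj_on_subset[OF inj]) (auto simp: intertwining_pairs_def)
  next
    fix S S' assume "(S, S') \<in> ?S"
    then show "S \<in> carrier (operators H)" "S' \<in> carrier (operators K)"
      by (auto simp: intertwining_pairs_def)
  next
    show "(\<one>\<^bsub>operators H\<^esub>, \<one>\<^bsub>operators K\<^esub>) \<in> ?S"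
      unfolding mem OH.star_one OK.star_one using H.op_one_in K.op_one_in by simp
  next
    fix S S' T T' assume p: "(S, S') \<in> ?S" and q: "(T, T') \<in> ?S"
    have S1 [simp]: "S \<in> linear_maps H H" "S' \<in> linear_maps K K"
      "x \<in> carrier H \<Longrightarrow> f (S x) = S' (f x)"
      "x \<in> carrier H \<Longrightarrow> f (adjoint H H S x) = adjoint K K S' (f x)" for x
      using p by (auto simp: mem)
    have T1 [simp]: "T \<in> linear_maps H H" "T' \<in> linear_maps K K"
      "x \<in> carrier H \<Longrightarrow> f (T x) = T' (f x)"
      "x \<in> carrier H \<Longrightarrow> f (adjoint H H T x) = adjoint K K T' (f x)" for x
      using q by (auto simp: mem)
    note [simp] = linear_mapsD(2)[OF S1(1)] linear_mapsD(2)[OF S1(2)]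
      linear_mapsD(2)[OF T1(1)] linear_mapsD(2)[OF T1(2)] clinear_add[OF f] clinear_smult[OF f]
    have c: "S \<in> carrier (operators H)" "S' \<in> carrier (operators K)"
      "T \<in> carrier (operators H)" "T' \<in> carrier (operators K)" by simp_all
    note st = OH.star_add[OF c(1,3)] OK.star_add[OF c(2,4)] OH.star_mult[OF c(1,3)]
      OK.star_mult[OF c(2,4)] OH.star_smult[OF c(1)] OK.star_smult[OF c(2)]
      OH.star_star[OF c(1)] OK.star_star[OF c(2)]
    show "(S \<oplus>\<^bsub>operators H\<^esub> T, S' \<oplus>\<^bsub>operators K\<^esub> T') \<in> ?S"
      unfolding mem st using H.op_add_in K.op_add_in by simp
    show "(S \<otimes>\<^bsub>operators H\<^esub> T, S' \<otimes>\<^bsub>operators K\<^esub> T') \<in> ?S"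
      unfolding mem st using H.op_compose_in K.op_compose_in
      by (simp add: compose_eq)
    show "(a \<odot>\<^bsub>operators H\<^esub> S, a \<odot>\<^bsub>operators K\<^esub> S') \<in> ?S" for a
      unfolding mem st using H.op_smult_in K.op_smult_in by simp
    show "(star (operators H) S, star (operators K) S') \<in> ?S"
      unfolding mem st using H.adjoint_linear K.adjoint_linear by simp
  next
    fix s l l'
    assume s: "\<And>k::nat. s k \<in> ?S" and l: "l \<in> carrier (operators H)" and l': "l' \<in> carrier (operators K)"
      and lim: "(\<lambda>k. cnorm (operators H) (fst (s k) \<ominus>\<^bsub>operators H\<^esub> l)) \<longlonglongrightarrow> 0"
      and lim': "(\<lambda>k. cnorm (operators K) (snd (s k) \<ominus>\<^bsub>operators K\<^esub> l')) \<longlonglongrightarrow> 0"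
    have sm: "fst (s k) \<in> linear_maps H H" "snd (s k) \<in> linear_maps K K"
      "x \<in> carrier H \<Longrightarrow> f (fst (s k) x) = snd (s k) (f x)"
      "x \<in> carrier H \<Longrightarrow> f (adjoint H H (fst (s k)) x) = adjoint K K (snd (s k)) (f x)" for k x
      using s[of k] by (auto simp: intertwining_pairs_def)
    have ll: "l \<in> linear_maps H H" "l' \<in> linear_maps K K" using l l' by simp_all
    have lim_star: "(\<lambda>k. cnorm (operators H) (adjoint H H (fst (s k)) \<ominus>\<^bsub>operators H\<^esub> adjoint H H l)) \<longlonglongrightarrow> 0"
    proof (rule tendsto_sandwich[OF _ _ tendsto_const lim]; intro always_eventually allI)
      fix k
      have i: "fst (s k) \<ominus>\<^bsub>operators H\<^esub> l \<in> linear_maps H H"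
        using OH.minus_eq_smult[of "fst (s k)" l] sm(1)[of k] ll
          H.op_add_in[OF sm(1) H.op_smult_in[OF ll(1), of "-1"], of k] by simp
      have a: "adjoint H H (fst (s k) \<ominus>\<^bsub>operators H\<^esub> l) =
          adjoint H H (fst (s k)) \<ominus>\<^bsub>operators H\<^esub> adjoint H H l"
        using OH.star_add[of "fst (s k)" "(-1) \<odot>\<^bsub>operators H\<^esub> l"] OH.star_smult[of l "-1"]
          OH.minus_eq_smult[of "fst (s k)" l] sm(1)[of k] ll H.op_smult_in[OF ll(1), of "-1"]
          OH.minus_eq_smult[of "adjoint H H (fst (s k))" "adjoint H H l"] H.adjoint_linear by simp
      show "cnorm (operators H) (adjoint H H (fst (s k)) \<ominus>\<^bsub>operators H\<^esub> adjoint H H l)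
          \<le> cnorm (operators H) (fst (s k) \<ominus>\<^bsub>operators H\<^esub> l)"
        using H.op_norm_adjoint_le[OF i] by (simp add: a)
      show "0 \<le> cnorm (operators H) (adjoint H H (fst (s k)) \<ominus>\<^bsub>operators H\<^esub> adjoint H H l)"
        using H.op_norm_nonneg[OF H.adjoint_linear[OF i]] by (simp add: a)
    qed
    have lim_star': "(\<lambda>k. cnorm (operators K) (adjoint K K (snd (s k)) \<ominus>\<^bsub>operators K\<^esub> adjoint K K l')) \<longlonglongrightarrow> 0"
    proof (rule tendsto_sandwich[OF _ _ tendsto_const lim']; intro always_eventually allI)
      fix k
      have i: "snd (s k) \<ominus>\<^bsub>operators K\<^esub> l' \<in> linear_maps K K"
        using OK.minus_eq_smult[of "snd (s k)" l'] sm(2)[of k] ll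
          K.op_add_in[OF sm(2) K.op_smult_in[OF ll(2), of "-1"], of k] by simp
      have a: "adjoint K K (snd (s k) \<ominus>\<^bsub>operators K\<^esub> l') =
          adjoint K K (snd (s k)) \<ominus>\<^bsub>operators K\<^esub> adjoint K K l'"
        using OK.star_add[of "snd (s k)" "(-1) \<odot>\<^bsub>operators K\<^esub> l'"] OK.star_smult[of l' "-1"]
          OK.minus_eq_smult[of "snd (s k)" l'] sm(2)[of k] ll K.op_smult_in[OF ll(2), of "-1"]
          OK.minus_eq_smult[of "adjoint K K (snd (s k))" "adjoint K K l'"] K.adjoint_linear by simp
      show "cnorm (operators K) (adjoint K K (snd (s k)) \<ominus>\<^bsub>operators K\<^esub> adjoint K K l')
          \<le> cnorm (operators K) (snd (s k) \<ominus>\<^bsub>operators K\<^esub> l')"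
        using K.op_norm_adjoint_le[OF i] by (simp add: a)
      show "0 \<le> cnorm (operators K) (adjoint K K (snd (s k)) \<ominus>\<^bsub>operators K\<^esub> adjoint K K l')"
        using K.op_norm_nonneg[OF K.adjoint_linear[OF i]] by (simp add: a)
    qed
    have "f (l x) = l' (f x)" "f (adjoint H H l x) = adjoint K K l' (f x)" if x: "x \<in> carrier H" for x
      using intertwining_limit[OF H K f sm(1,2) ll lim lim' sm(3)[OF x] x]
        intertwining_limit[OF H K f H.adjoint_linear[OF sm(1)] K.adjoint_linear[OF sm(2)]
          H.adjoint_linear[OF ll(1)] K.adjoint_linear[OF ll(2)] lim_star lim_star' sm(4)[OF x] x]
      by auto
    then show "(l, l') \<in> ?S" using ll by (simp add: intertwining_pairs_def)
  qed
qed

section \<open>Quantum graphs in an orthonormal basis\<close>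

locale quantum_graph_basis =
  fixes B :: "'b cstar_algebra" and \<psi> :: "'b \<Rightarrow> complex" and A :: "'b \<Rightarrow> 'b"
    and n :: nat and e :: "nat \<Rightarrow> 'b"
  assumes quantum_graph: "quantum_graph B \<psi> A"
    and onb: "orthonormal_basis (L2 B \<psi>) n e"
begin

lemma unital_cstar_algebra_B: "unital_cstar_algebra B"
  using quantum_graph by (auto simp: quantum_graph_def quantum_set_def)

sublocale B: unital_cstar_algebra B by (rule unital_cstar_algebra_B)

lemma psi_linear: "clinear B complex_module \<psi>" and psi_one: "\<psi> \<one>\<^bsub>B\<^esub> = 1"
  using quantum_graph by (auto simp: quantum_graph_def quantum_set_def faithful_state_def)

lemma A_linear: "clinear B B A"
  using quantum_graph by (auto simp: quantum_graph_def)

lemma L2_simps [simp]: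
  "carrier (L2 B \<psi>) = carrier B" "add (L2 B \<psi>) = add B" "smult (L2 B \<psi>) = smult B"
  "zero (L2 B \<psi>) = zero B" "cinner (L2 B \<psi>) x y = \<psi> (star B x \<otimes>\<^bsub>B\<^esub> y)"
  by (simp_all add: L2_def)

lemma finsum_L2 [simp]: "finsum (L2 B \<psi>) f S = finsum B f S"
  by (rule finsum_cong_add_monoid) simp_all

lemma tensor_L2 [simp]: "L2 B \<psi> \<otimes>\<^sub>T L2 B \<psi> = B \<otimes>\<^sub>T B"
  by (rule tensor_space_cong) simp_all

definition inner :: "'b \<Rightarrow> 'b \<Rightarrow> complex" where
  "inner x y = \<psi> (star B x \<otimes>\<^bsub>B\<^esub> y)"

definition co :: "nat \<Rightarrow> 'b \<Rightarrow> complex" where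
  "co i = inner (e i)"

lemma inner_linear: "x \<in> carrier B \<Longrightarrow> clinear B complex_module (inner x)"
  unfolding inner_def
  by (intro clinear_compose[OF B.mult_linear(1) psi_linear] B.star_closed)

lemma inner_add_left: "x \<in> carrier B \<Longrightarrow> y \<in> carrier B \<Longrightarrow> z \<in> carrier B \<Longrightarrow>
    inner (x \<oplus>\<^bsub>B\<^esub> y) z = inner x z + inner y z"
  by (simp add: inner_def B.star_add B.star_closed B.distribs clinear_add[OF psi_linear])

lemma inner_smult_left: "x \<in> carrier B \<Longrightarrow> z \<in> carrier B \<Longrightarrow>
    inner (c \<odot>\<^bsub>B\<^esub> x) z = cnj c * inner x z"
  by (simp add: inner_def B.star_smult B.star_closed B.smult_mult_left clinear_smult[OF psi_linear])

lemma cnj_inner_linear: "z \<in> carrier B \<Longrightarrow> clinear B complex_module (\<lambda>x. cnj (inner x z))"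
  by (rule clinearI) (simp_all add: inner_add_left inner_smult_left)

lemma e_in [simp]: "i < n \<Longrightarrow> e i \<in> carrier B"
  using onb by (simp add: orthonormal_basis_def vector_basis_def)

lemma co_e [simp]: "i < n \<Longrightarrow> j < n \<Longrightarrow> co i (e j) = (if i = j then 1 else 0)"
  using onb by (simp add: orthonormal_basis_def co_def inner_def)

lemma co_linear: "i < n \<Longrightarrow> clinear B complex_module (co i)"
  by (simp add: co_def inner_linear)

lemma coords: "coordinates B n e co"
proof -
  have "v = (\<Oplus>\<^bsub>B\<^esub>i\<in>{..<n}. co i v \<odot>\<^bsub>B\<^esub> e i)" if v: "v \<in> carrier B" for v
  proof -
    obtain a where a: "v = (\<Oplus>\<^bsub>B\<^esub>i\<in>{..<n}. a i \<odot>\<^bsub>B\<^esub> e i)"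
      using onb v by (auto simp: orthonormal_basis_def vector_basis_def)
    have "co j v = a j" if j: "j < n" for j
    proof -
      have "co j v = (\<Sum>i<n. co j (a i \<odot>\<^bsub>B\<^esub> e i))"
        unfolding a
        by (subst clinear_finsum[OF B.complex_space_axioms complex_space_complex_module co_linear[OF j]])
          auto
      also have "\<dots> = (\<Sum>i<n. if j = i then a i else 0)"
        using j by (intro sum.cong) (auto simp: clinear_smult[OF co_linear])
      finally show ?thesis using j by simp
    qed
    then have "(\<Oplus>\<^bsub>B\<^esub>i\<in>{..<n}. co i v \<odot>\<^bsub>B\<^esub> e i) = (\<Oplus>\<^bsub>B\<^esub>i\<in>{..<n}. a i \<odot>\<^bsub>B\<^esub> e i)"
      by (intro B.vsum_cong) auto
    then show ?thesis using a by simp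
  qed
  then show ?thesis by (simp add: coordinates_def co_linear)
qed

lemmas B_space = B.complex_space_axioms

lemma co_expand: "x \<in> carrier B \<Longrightarrow> (\<Oplus>\<^bsub>B\<^esub>i\<in>{..<n}. co i x \<odot>\<^bsub>B\<^esub> e i) = x"
  using coordinatesD(4)[OF coords] .

lemma functional_expand:
  "clinear B complex_module \<kappa> \<Longrightarrow> x \<in> carrier B \<Longrightarrow> (\<Sum>i<n. \<kappa> (e i) * co i x) = \<kappa> x"
  using clinear_expand[OF coords B_space complex_space_complex_module, of \<kappa> x]
  by (simp add: mult.commute)

lemma inner_expand:
  assumes "x \<in> carrier B" "y \<in> carrier B"
  shows "inner x y = (\<Sum>i<n. cnj (co i x) * co i y)"
proof -
  have "cnj (inner x y) = (\<Sum>i<n. co i x * cnj (inner (e i) y))"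
    using clinear_expand[OF coords B_space complex_space_complex_module cnj_inner_linear[OF assms(2)]
        assms(1)] by simp
  then have "inner x y = cnj (\<Sum>i<n. co i x * cnj (inner (e i) y))"
    by (metis complex_cnj_cnj)
  then show ?thesis by (simp add: co_def)
qed

text \<open>The coordinates of a tensor in \<open>B \<otimes> B\<close> with respect to the basis \<open>e\<^sub>i \<otimes> e\<^sub>j\<close>.\<close>

definition co2 :: "nat \<Rightarrow> nat \<Rightarrow> ('b, 'b) tens \<Rightarrow> complex" where
  "co2 i j = tensor_lift complex_module (\<lambda>x y. co i x * co j y)"

lemma cbilinear_co2: "i < n \<Longrightarrow> j < n \<Longrightarrow> cbilinear B B complex_module (\<lambda>x y. co i x * co j y)"
  using cbilinear_compose[OF cbilinear_smult[OF complex_space_complex_module] co_linear co_linear]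
  by simp

lemma co2_linear: "i < n \<Longrightarrow> j < n \<Longrightarrow> clinear (B \<otimes>\<^sub>T B) complex_module (co2 i j)"
  unfolding co2_def
  by (intro clinear_tensor_lift B_space complex_space_complex_module cbilinear_co2)

lemma co2_simple: "i < n \<Longrightarrow> j < n \<Longrightarrow> x \<in> carrier B \<Longrightarrow> y \<in> carrier B \<Longrightarrow>
    co2 i j (simple_tensor B B x y) = co i x * co j y"
  unfolding co2_def
  by (intro tensor_lift_simple B_space complex_space_complex_module cbilinear_co2)

lemma co2_slice:
  assumes "i < n" "j < n" "t \<in> carrier (B \<otimes>\<^sub>T B)"
  shows "co2 i j t = co j (lslice B (co i) t)"
proof (rule clinear_tensor_eqI[OF B_space B_space co2_linear[OF assms(1,2)] _ assms(3)])
  show "clinear (B \<otimes>\<^sub>T B) complex_module (\<lambda>t. co j (lslice B (co i) t))"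
    by (intro clinear_compose[OF clinear_lslice[OF B_space B_space co_linear] co_linear] assms)
qed (simp_all add: assms co2_simple lslice_simple[OF B_space B_space co_linear]
    clinear_smult[OF co_linear])

lemma co2_eqI:
  assumes "s \<in> carrier (B \<otimes>\<^sub>T B)" "t \<in> carrier (B \<otimes>\<^sub>T B)"
    and "\<And>i j. i < n \<Longrightarrow> j < n \<Longrightarrow> co2 i j s = co2 i j t"
  shows "s = t"
proof (rule lslice_eqI[OF B_space B_space coords assms(1,2)])
  fix k assume k: "k < n"
  note l = clinear_lslice[OF B_space B_space co_linear[OF k]]
  show "lslice B (co k) s = lslice B (co k) t"
    using assms k
    by (intro coordinates_eqI[OF coords B_space] clinear_in[OF l]) (simp_all flip: co2_slice)
qed

text \<open>
  The \<open>e\<^sub>i \<otimes> e\<^sub>j\<close> are orthonormal. Expanding both inner products in the basis \<open>e\<close> and regrouping the sum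
  over the representatives produces the coordinates of the two tensors.
\<close>

lemma tensor_inner:
  assumes s: "s \<in> carrier (B \<otimes>\<^sub>T B)" and t: "t \<in> carrier (B \<otimes>\<^sub>T B)"
  shows "cinner (tensor_hilbert (L2 B \<psi>) (L2 B \<psi>)) s t = (\<Sum>i<n. \<Sum>j<n. cnj (co2 i j s) * co2 i j t)"
proof -
  let ?S = "{p. tensor_rep s p \<noteq> 0}" and ?T = "{p. tensor_rep t p \<noteq> 0}"
  let ?s = "tensor_rep s" and ?t = "tensor_rep t"
  note sup = tensor_rep_support[OF B_space B_space]
  have k: "co2 i j r = (\<Sum>p | tensor_rep r p \<noteq> 0. tensor_rep r p * (co i (fst p) * co j (snd p)))" for i j r
    by (simp add: co2_def tensor_lift_def)
  have "cinner (tensor_hilbert (L2 B \<psi>) (L2 B \<psi>)) s t =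
      (\<Sum>p\<in>?S. \<Sum>q\<in>?T. cnj (?s p) * ?t q * (inner (fst p) (fst q) * inner (snd p) (snd q)))"
    by (simp add: tensor_hilbert_def inner_def)
  also have "\<dots> = (\<Sum>p\<in>?S. \<Sum>q\<in>?T. \<Sum>i<n. \<Sum>j<n.
      cnj (?s p * (co i (fst p) * co j (snd p))) * (?t q * (co i (fst q) * co j (snd q))))"
  proof (intro sum.cong refl)
    fix p q assume "p \<in> ?S" "q \<in> ?T"
    then have pq: "fst p \<in> carrier B" "snd p \<in> carrier B" "fst q \<in> carrier B" "snd q \<in> carrier B"
      using sup[OF s] sup[OF t] by simp_all
    have "inner (fst p) (fst q) * inner (snd p) (snd q) = (\<Sum>i<n. \<Sum>j<n.
        (cnj (co i (fst p)) * co i (fst q)) * (cnj (co j (snd p)) * co j (snd q)))"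
      using pq by (simp only: inner_expand sum_product)
    then show "cnj (?s p) * ?t q * (inner (fst p) (fst q) * inner (snd p) (snd q)) = (\<Sum>i<n. \<Sum>j<n.
        cnj (?s p * (co i (fst p) * co j (snd p))) * (?t q * (co i (fst q) * co j (snd q))))"
      by (simp add: sum_distrib_left mult_ac)
  qed
  also have "\<dots> = (\<Sum>i<n. \<Sum>j<n. \<Sum>p\<in>?S. \<Sum>q\<in>?T.
      cnj (?s p * (co i (fst p) * co j (snd p))) * (?t q * (co i (fst q) * co j (snd q))))"
    by (simp add: sum.swap[of _ "{..<n}" ?T] sum.swap[of _ "{..<n}" ?S])
  also have "\<dots> = (\<Sum>i<n. \<Sum>j<n. cnj (co2 i j s) * co2 i j t)"
    by (simp add: k sum_product cnj_sum)
  finally show ?thesis .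
qed

lemma mult_map_linear: "clinear (B \<otimes>\<^sub>T B) B (mult_map B)"
  and mult_map_simple: "x \<in> carrier B \<Longrightarrow> y \<in> carrier B \<Longrightarrow>
    mult_map B (simple_tensor B B x y) = x \<otimes>\<^bsub>B\<^esub> y"
  unfolding mult_map_def
  by (intro clinear_tensor_lift tensor_lift_simple B_space B.cbilinear_mult; assumption)+

text \<open>The matrix entries \<open>\<langle>e\<^sub>i e\<^sub>j, b\<rangle>\<close> of \<open>m\<^sup>\<dagger>\<close>.\<close>

definition dco :: "nat \<Rightarrow> nat \<Rightarrow> 'b \<Rightarrow> complex" where
  "dco i j = inner (e i \<otimes>\<^bsub>B\<^esub> e j)"

lemma dco_linear: "i < n \<Longrightarrow> j < n \<Longrightarrow> clinear B complex_module (dco i j)"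
  by (simp add: dco_def inner_linear)

lemma inner_mult_map:
  assumes b: "b \<in> carrier B" and z: "z \<in> carrier (B \<otimes>\<^sub>T B)"
  shows "inner (mult_map B z) b = (\<Sum>i<n. \<Sum>j<n. cnj (co2 i j z) * dco i j b)"
  using z
proof (induction rule: tensor_factors.tensor_induct[OF tensor_factors.intro[OF B_space B_space],
      consumes 1, case_names simple add])
  case (simple x y)
  have "cbilinear B B complex_module (\<lambda>x y. cnj (inner (x \<otimes>\<^bsub>B\<^esub> y) b))"
    using clinear_after_cbilinear[OF B.cbilinear_mult cnj_inner_linear[OF b]] .
  then have "cnj (inner (x \<otimes>\<^bsub>B\<^esub> y) b) = (\<Sum>i<n. \<Sum>j<n. co i x * co j y * cnj (dco i j b))"
    unfolding dco_def using cbilinear_expand[OF B_space coords _ simple] by blast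
  then have "inner (x \<otimes>\<^bsub>B\<^esub> y) b = cnj (\<Sum>i<n. \<Sum>j<n. co i x * co j y * cnj (dco i j b))"
    by (metis complex_cnj_cnj)
  then show ?case using simple by (simp add: mult_map_simple co2_simple)
next
  case (add s t)
  then show ?case
    by (simp add: clinear_add[OF mult_map_linear] clinear_in[OF mult_map_linear] inner_add_left b
        clinear_add[OF co2_linear] sum.distrib algebra_simps)
qed

lemma
  fixes d :: "nat \<Rightarrow> nat \<Rightarrow> complex"
  defines "x \<equiv> \<Oplus>\<^bsub>B \<otimes>\<^sub>T B\<^esub>k\<in>{..<n}. \<Oplus>\<^bsub>B \<otimes>\<^sub>T B\<^esub>l\<in>{..<n}. d k l \<odot>\<^bsub>B \<otimes>\<^sub>T B\<^esub> simple_tensor B B (e k) (e l)"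
  shows double_sum_in: "x \<in> carrier (B \<otimes>\<^sub>T B)"
    and co2_double_sum: "i < n \<Longrightarrow> j < n \<Longrightarrow> co2 i j x = d i j"
proof -
  interpret T: complex_space "B \<otimes>\<^sub>T B" by (intro complex_space_tensor B_space)
  note st = simple_tensor_in[OF B_space B_space]
  have inn: "(\<Oplus>\<^bsub>B \<otimes>\<^sub>T B\<^esub>l\<in>{..<n}. d k l \<odot>\<^bsub>B \<otimes>\<^sub>T B\<^esub> simple_tensor B B (e k) (e l)) \<in> carrier (B \<otimes>\<^sub>T B)"
    if "k < n" for k using that st by (auto intro!: T.finsum_closed)
  show "co2 i j x = d i j" if ij: "i < n" "j < n"
  proof -
    note lin = clinear_finsum[OF T.complex_space_axioms complex_space_complex_module co2_linear[OF ij]]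
    have "co2 i j x = (\<Sum>k<n. co2 i j (\<Oplus>\<^bsub>B \<otimes>\<^sub>T B\<^esub>l\<in>{..<n}. d k l \<odot>\<^bsub>B \<otimes>\<^sub>T B\<^esub> simple_tensor B B (e k) (e l)))"
      unfolding x_def using inn by (subst lin) auto
    also have "\<dots> = (\<Sum>k<n. \<Sum>l<n. co2 i j (d k l \<odot>\<^bsub>B \<otimes>\<^sub>T B\<^esub> simple_tensor B B (e k) (e l)))"
      using st by (intro sum.cong) (auto simp: lin)
    also have "\<dots> = (\<Sum>k<n. \<Sum>l<n. if j = l then if i = k then d k l else 0 else 0)"
      using ij st by (intro sum.cong) (auto simp: clinear_smult[OF co2_linear] co2_simple)
    also have "\<dots> = d i j" using ij by simp
    finally show ?thesis .
  qed
  show "x \<in> carrier (B \<otimes>\<^sub>T B)" unfolding x_def using inn by (auto intro!: T.finsum_closed)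
qed

lemma co2_expand:
  assumes "t \<in> carrier (B \<otimes>\<^sub>T B)"
  shows "(\<Oplus>\<^bsub>B \<otimes>\<^sub>T B\<^esub>k\<in>{..<n}. \<Oplus>\<^bsub>B \<otimes>\<^sub>T B\<^esub>l\<in>{..<n}. co2 k l t \<odot>\<^bsub>B \<otimes>\<^sub>T B\<^esub> simple_tensor B B (e k) (e l)) = t"
  by (intro co2_eqI double_sum_in assms co2_double_sum)

text \<open>
  The tensor with coordinates \<open>\<langle>e\<^sub>i e\<^sub>j, b\<rangle>\<close> has the property that defines \<open>m\<^sup>\<dagger> b\<close>, and testing the
  property on \<open>e\<^sub>i \<otimes> e\<^sub>j\<close> shows that it determines all coordinates.
\<close>

lemma
  assumes b: "b \<in> carrier B"
  shows comult_in: "comult B \<psi> b \<in> carrier (B \<otimes>\<^sub>T B)"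
    and co2_comult: "i < n \<Longrightarrow> j < n \<Longrightarrow> co2 i j (comult B \<psi> b) = dco i j b"
proof -
  let ?P = "\<lambda>x. x \<in> carrier (B \<otimes>\<^sub>T B) \<and> (\<forall>z\<in>carrier (B \<otimes>\<^sub>T B).
      cinner (tensor_hilbert (L2 B \<psi>) (L2 B \<psi>)) z x = cinner (L2 B \<psi>) (mult_map B z) b)"
  have c: "carrier (tensor_hilbert (L2 B \<psi>) (L2 B \<psi>)) = carrier (B \<otimes>\<^sub>T B)"
    by (simp add: tensor_hilbert_def)
  have def: "comult B \<psi> b = (THE x. ?P x)"
    using b by (simp add: comult_def adjoint_def c)
  obtain x where x: "x \<in> carrier (B \<otimes>\<^sub>T B)" "\<And>i j. i < n \<Longrightarrow> j < n \<Longrightarrow> co2 i j x = dco i j b"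
    using double_sum_in[of "\<lambda>i j. dco i j b"] co2_double_sum[of _ _ "\<lambda>i j. dco i j b"] that by blast
  have Px: "?P x"
    using x inner_mult_map[OF b] by (simp add: tensor_inner flip: inner_def)
  have uniq: "y = x" if y: "?P y" for y
  proof (rule co2_eqI)
    fix i j assume ij: "i < n" "j < n"
    let ?z = "simple_tensor B B (e i) (e j)"
    have z: "?z \<in> carrier (B \<otimes>\<^sub>T B)" using ij by (intro simple_tensor_in B_space) auto
    have pick: "(\<Sum>k<n. \<Sum>l<n. cnj (co2 k l ?z) * co2 k l w) = co2 i j w" for w
    proof -
      have "cnj (co2 k l ?z) * co2 k l w = (if l = j then if k = i then co2 k l w else 0 else 0)"
        if "k < n" "l < n" for k l
        using that ij by (simp add: co2_simple)
      then have "(\<Sum>k<n. \<Sum>l<n. cnj (co2 k l ?z) * co2 k l w) =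
          (\<Sum>k<n. \<Sum>l<n. if l = j then if k = i then co2 k l w else 0 else 0)"
        by (intro sum.cong) auto
      then show ?thesis using ij by simp
    qed
    have "co2 i j y = cinner (tensor_hilbert (L2 B \<psi>) (L2 B \<psi>)) ?z y"
      using y z pick by (simp add: tensor_inner)
    also have "\<dots> = cinner (tensor_hilbert (L2 B \<psi>) (L2 B \<psi>)) ?z x"
      using y Px z by simp
    also have "\<dots> = co2 i j x" using tensor_inner[OF z x(1)] pick[of x] by simp
    finally show "co2 i j y = co2 i j x" .
  qed (use y x in auto)
  have "comult B \<psi> b = x" unfolding def using Px uniq by (rule the_equality)
  then show "comult B \<psi> b \<in> carrier (B \<otimes>\<^sub>T B)"
    and "i < n \<Longrightarrow> j < n \<Longrightarrow> co2 i j (comult B \<psi> b) = dco i j b"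
    using x by auto
qed

lemma comult_linear: "clinear B (B \<otimes>\<^sub>T B) (comult B \<psi>)"
proof -
  interpret T: complex_space "B \<otimes>\<^sub>T B" by (intro complex_space_tensor B_space)
  show ?thesis
    by (intro clinearI co2_eqI)
      (simp_all add: comult_in co2_comult clinear_add[OF co2_linear] clinear_smult[OF co2_linear]
        clinear_add[OF dco_linear] clinear_smult[OF dco_linear])
qed

end

section \<open>The universal property\<close>

context quantum_graph_basis
begin

text \<open>
  The coefficients \<open>\<rho>\<^sub>l\<close> of the coaction \<open>b \<mapsto> \<Sum>\<^sub>l e\<^sub>l \<otimes> \<rho>\<^sub>l(b)\<close> of a matrix.
\<close>

definition rho :: "'d cstar_algebra \<Rightarrow> (nat \<Rightarrow> nat \<Rightarrow> 'd) \<Rightarrow> nat \<Rightarrow> 'b \<Rightarrow> 'd" where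
  "rho D v l b = (\<Oplus>\<^bsub>D\<^esub>k\<in>{..<n}. co k b \<odot>\<^bsub>D\<^esub> v l k)"

text \<open>The defining relations of \<open>C(Qut(G))\<close>, written slice by slice.\<close>

definition qut_data :: "'d cstar_algebra \<Rightarrow> (nat \<Rightarrow> nat \<Rightarrow> 'd) \<Rightarrow> bool" where
  "qut_data D v \<longleftrightarrow> unitary_matrix D n v \<and> hom_coefficients B D n e co (rho D v) \<and>
     (\<forall>l<n. \<forall>b\<in>carrier B. rho D v l (A b) = (\<Oplus>\<^bsub>D\<^esub>a\<in>{..<n}. co l (A (e a)) \<odot>\<^bsub>D\<^esub> rho D v a b))"

lemma rho_linear:
  assumes "complex_space D" "l < n" "\<And>k. k < n \<Longrightarrow> v l k \<in> carrier D"
  shows "clinear B D (rho D v l)"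
  unfolding rho_def using assms(2,3)
  by (intro clinear_finsum_fun clinear_coeff_smult B_space assms(1) co_linear) auto

lemma rho_in:
  assumes "complex_space D" "\<And>k. k < n \<Longrightarrow> v l k \<in> carrier D"
  shows "rho D v l b \<in> carrier D"
proof -
  interpret D: complex_space D by fact
  show ?thesis unfolding rho_def using assms(2) by (intro D.vsum_closed) auto
qed

lemma rho_e:
  assumes "complex_space D" "\<And>k. k < n \<Longrightarrow> v l k \<in> carrier D" "k < n"
  shows "rho D v l (e k) = v l k"
proof -
  interpret D: complex_space D by fact
  have "rho D v l (e k) = (\<Oplus>\<^bsub>D\<^esub>i\<in>{..<n}. (if i = k then 1 else 0) \<odot>\<^bsub>D\<^esub> v l i)"
    unfolding rho_def using assms by (intro D.vsum_cong) auto
  also have "\<dots> = v l k" using assms by (intro D.finsum_delta) auto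
  finally show ?thesis .
qed

lemma rho_eq:
  assumes "complex_space D" "clinear B D r" "b \<in> carrier B" "\<And>k. k < n \<Longrightarrow> v l k = r (e k)"
  shows "rho D v l b = r b"
proof -
  interpret D: complex_space D by fact
  have "rho D v l b = (\<Oplus>\<^bsub>D\<^esub>i\<in>{..<n}. co i b \<odot>\<^bsub>D\<^esub> r (e i))"
    unfolding rho_def using assms(4) clinear_in[OF assms(2)] by (intro D.vsum_cong) auto
  also have "\<dots> = r b" by (rule clinear_expand[OF coords B_space assms(1,2,3), symmetric])
  finally show ?thesis .
qed

lemma coordinate_tensor_algebra_B:
  "unital_star_algebra D \<Longrightarrow> coordinate_tensor_algebra B D n e co"
  by (intro coordinate_tensor_algebra.intro coordinate_tensor_algebra_axioms.intro
      B.unital_star_algebra_axioms coords)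

lemma coaction_eq:
  assumes D: "unital_star_algebra D" and v: "\<And>k i. k < n \<Longrightarrow> i < n \<Longrightarrow> v k i \<in> carrier D"
  shows "coaction B \<psi> n e D v =
    (\<lambda>b\<in>carrier B. \<Oplus>\<^bsub>B \<otimes>\<^sub>T D\<^esub>k\<in>{..<n}. simple_tensor B D (e k) (rho D v k b))"
proof -
  interpret D: unital_star_algebra D by fact
  note ds = D.complex_space_axioms
  interpret T: complex_space "B \<otimes>\<^sub>T D" by (intro complex_space_tensor B_space ds)
  note st = simple_tensor_in[OF B_space ds] and sl = simple_tensor_linear(1)[OF B_space ds]
  note fin = clinear_finsum[OF ds T.complex_space_axioms sl]
  have "(\<Oplus>\<^bsub>B \<otimes>\<^sub>T D\<^esub>i\<in>{..<n}. cinner (L2 B \<psi>) (e i) b \<odot>\<^bsub>B \<otimes>\<^sub>T D\<^esub>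
        (\<Oplus>\<^bsub>B \<otimes>\<^sub>T D\<^esub>k\<in>{..<n}. simple_tensor B D (e k) (v k i))) =
      (\<Oplus>\<^bsub>B \<otimes>\<^sub>T D\<^esub>k\<in>{..<n}. simple_tensor B D (e k) (rho D v k b))" (is "?L = ?R")
    if "b \<in> carrier B" for b
  proof -
    have "?L = (\<Oplus>\<^bsub>B \<otimes>\<^sub>T D\<^esub>i\<in>{..<n}. \<Oplus>\<^bsub>B \<otimes>\<^sub>T D\<^esub>k\<in>{..<n}.
        simple_tensor B D (e k) (co i b \<odot>\<^bsub>D\<^esub> v k i))"
    proof (rule T.vsum_cong[OF refl])
      fix i assume i: "i \<in> {..<n}"
      have "cinner (L2 B \<psi>) (e i) b \<odot>\<^bsub>B \<otimes>\<^sub>T D\<^esub>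
          (\<Oplus>\<^bsub>B \<otimes>\<^sub>T D\<^esub>k\<in>{..<n}. simple_tensor B D (e k) (v k i)) =
          (\<Oplus>\<^bsub>B \<otimes>\<^sub>T D\<^esub>k\<in>{..<n}. cinner (L2 B \<psi>) (e i) b \<odot>\<^bsub>B \<otimes>\<^sub>T D\<^esub> simple_tensor B D (e k) (v k i))"
        using i v st by (intro T.smult_finsum) auto
      also have "\<dots> = (\<Oplus>\<^bsub>B \<otimes>\<^sub>T D\<^esub>k\<in>{..<n}. simple_tensor B D (e k) (co i b \<odot>\<^bsub>D\<^esub> v k i))"
        using i v st by (intro T.vsum_cong) (auto simp: clinear_smult[OF sl] co_def inner_def)
      finally show "cinner (L2 B \<psi>) (e i) b \<odot>\<^bsub>B \<otimes>\<^sub>T D\<^esub>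
          (\<Oplus>\<^bsub>B \<otimes>\<^sub>T D\<^esub>k\<in>{..<n}. simple_tensor B D (e k) (v k i)) = \<dots>" .
    qed (use v st in \<open>auto intro!: T.vsum_closed\<close>)
    also have "\<dots> = (\<Oplus>\<^bsub>B \<otimes>\<^sub>T D\<^esub>k\<in>{..<n}. \<Oplus>\<^bsub>B \<otimes>\<^sub>T D\<^esub>i\<in>{..<n}.
        simple_tensor B D (e k) (co i b \<odot>\<^bsub>D\<^esub> v k i))"
      using v st by (intro T.finsum_swap) auto
    also have "\<dots> = ?R"
      unfolding rho_def using v st
      by (intro T.vsum_cong fin[symmetric]) (auto intro!: D.vsum_closed st)
    finally show ?thesis .
  qed
  then show ?thesis unfolding coaction_def by (intro restrict_ext) auto
qed

lemma Qut_relations_iff: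
  assumes D: "unital_cstar_algebra D"
  shows "Qut_relations B \<psi> A n e D v \<longleftrightarrow> qut_data D v"
proof (cases "\<forall>k<n. \<forall>i<n. v k i \<in> carrier D")
  case False
  then show ?thesis by (auto simp: Qut_relations_def qut_data_def unitary_matrix_def)
next
  case True
  then have v: "\<And>k i. k < n \<Longrightarrow> i < n \<Longrightarrow> v k i \<in> carrier D" by blast
  interpret D: unital_cstar_algebra D by fact
  note ds = D.complex_space_axioms
  interpret coordinate_tensor_algebra B D n e co
    by (intro coordinate_tensor_algebra_B D.unital_star_algebra_axioms)
  note r = rho_in[OF ds v]
  note c = coaction_eq[OF D.unital_star_algebra_axioms v]
  have 1: "coaction B \<psi> n e D v \<in> star_hom B TA \<longleftrightarrow> hom_coefficients B D n e co (rho D v)"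
    using r by (intro star_hom_finsum_iff c) auto
  have cin: "coaction B \<psi> n e D v b \<in> carrier (B \<otimes>\<^sub>T D)" if "b \<in> carrier B" for b
    using that r by (auto simp: c intro!: T.vsum_closed)
  have sl: "slice l (coaction B \<psi> n e D v b) = rho D v l b" if "l < n" "b \<in> carrier B" for l b
    using that r by (simp add: c slice_coefficients)
  have Ab: "A b \<in> carrier B" if "b \<in> carrier B" for b using clinear_in[OF A_linear that] .
  have "(coaction B \<psi> n e D v (A b) = tensor_map B D A (\<lambda>d. d) (coaction B \<psi> n e D v b)) \<longleftrightarrow>
      (\<forall>l<n. rho D v l (A b) = (\<Oplus>\<^bsub>D\<^esub>a\<in>{..<n}. co l (A (e a)) \<odot>\<^bsub>D\<^esub> rho D v a b))"
    (is "?P \<longleftrightarrow> ?Q") if b: "b \<in> carrier B" for b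
  proof -
    have m: "tensor_map B D A (\<lambda>d. d) (coaction B \<psi> n e D v b) \<in> carrier (B \<otimes>\<^sub>T D)"
      by (intro clinear_in[OF clinear_tensor_map[OF B_space ds B_space ds A_linear clinear_id]] cin b)
    have s: "slice l (tensor_map B D A (\<lambda>d. d) (coaction B \<psi> n e D v b)) =
        (\<Oplus>\<^bsub>D\<^esub>a\<in>{..<n}. co l (A (e a)) \<odot>\<^bsub>D\<^esub> rho D v a b)" if "l < n" for l
    proof -
      have "slice l (tensor_map B D A (\<lambda>d. d) (coaction B \<psi> n e D v b)) =
          (\<Oplus>\<^bsub>D\<^esub>a\<in>{..<n}. co l (A (e a)) \<odot>\<^bsub>D\<^esub> slice a (coaction B \<psi> n e D v b))"
        by (rule slice_tensor_map[OF that A_linear cin[OF b]])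
      also have "\<dots> = (\<Oplus>\<^bsub>D\<^esub>a\<in>{..<n}. co l (A (e a)) \<odot>\<^bsub>D\<^esub> rho D v a b)"
        using b r by (intro D.vsum_cong) (auto simp: sl)
      finally show ?thesis .
    qed
    show ?thesis
    proof
      assume P: ?P
      show ?Q
      proof (intro allI impI)
        fix l assume l: "l < n"
        show "rho D v l (A b) = (\<Oplus>\<^bsub>D\<^esub>a\<in>{..<n}. co l (A (e a)) \<odot>\<^bsub>D\<^esub> rho D v a b)"
          using arg_cong[OF P, of "slice l"] s[OF l] sl[OF l Ab[OF b]] by simp
      qed
    next
      assume ?Q then show ?P using s sl Ab[OF b] cin m by (intro slice_eqI) auto
    qed
  qed
  then show ?thesis using 1 unfolding Qut_relations_def qut_data_def by blast
qed

lemma qut_dataD: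
  assumes "qut_data D v"
  shows "unitary_matrix D n v" "hom_coefficients B D n e co (rho D v)"
    and "l < n \<Longrightarrow> b \<in> carrier B \<Longrightarrow>
      rho D v l (A b) = (\<Oplus>\<^bsub>D\<^esub>a\<in>{..<n}. co l (A (e a)) \<odot>\<^bsub>D\<^esub> rho D v a b)"
    and "k < n \<Longrightarrow> i < n \<Longrightarrow> v k i \<in> carrier D"
  using assms by (auto simp: qut_data_def unitary_matrix_def)

text \<open>Both sides of each defining relation are natural in \<open>D\<close>.\<close>

lemma
  assumes D: "unital_star_algebra D" and D': "unital_star_algebra D'" and \<phi>: "star_morphism D D' \<phi>"
    and v0: "\<forall>k<n. \<forall>i<n. v k i \<in> carrier D"
    and v0': "\<forall>k<n. \<forall>i<n. \<phi> (v k i) = v' k i"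
  shows rho_natural: "l < n \<Longrightarrow> \<phi> (rho D v l x) = rho D' v' l x"
    and mult_natural: "\<phi> (\<Oplus>\<^bsub>D\<^esub>a\<in>{..<n}. \<Oplus>\<^bsub>D\<^esub>b\<in>{..<n}. c a b \<odot>\<^bsub>D\<^esub> (rho D v a x \<otimes>\<^bsub>D\<^esub> rho D v b y)) =
      (\<Oplus>\<^bsub>D'\<^esub>a\<in>{..<n}. \<Oplus>\<^bsub>D'\<^esub>b\<in>{..<n}. c a b \<odot>\<^bsub>D'\<^esub> (rho D' v' a x \<otimes>\<^bsub>D'\<^esub> rho D' v' b y))"
    and star_natural: "\<phi> (\<Oplus>\<^bsub>D\<^esub>a\<in>{..<n}. d a \<odot>\<^bsub>D\<^esub> star D (rho D v a x)) =
      (\<Oplus>\<^bsub>D'\<^esub>a\<in>{..<n}. d a \<odot>\<^bsub>D'\<^esub> star D' (rho D' v' a x))"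
    and lin_natural: "\<phi> (\<Oplus>\<^bsub>D\<^esub>a\<in>{..<n}. d a \<odot>\<^bsub>D\<^esub> rho D v a x) =
      (\<Oplus>\<^bsub>D'\<^esub>a\<in>{..<n}. d a \<odot>\<^bsub>D'\<^esub> rho D' v' a x)"
    and column_natural: "i < n \<Longrightarrow> j < n \<Longrightarrow> \<phi> (\<Oplus>\<^bsub>D\<^esub>k\<in>{..<n}. star D (v k i) \<otimes>\<^bsub>D\<^esub> v k j) =
      (\<Oplus>\<^bsub>D'\<^esub>k\<in>{..<n}. star D' (v' k i) \<otimes>\<^bsub>D'\<^esub> v' k j)"
    and row_natural: "k < n \<Longrightarrow> l < n \<Longrightarrow> \<phi> (\<Oplus>\<^bsub>D\<^esub>i\<in>{..<n}. v k i \<otimes>\<^bsub>D\<^esub> star D (v l i)) =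
      (\<Oplus>\<^bsub>D'\<^esub>i\<in>{..<n}. v' k i \<otimes>\<^bsub>D'\<^esub> star D' (v' l i))"
proof -
  interpret D: unital_star_algebra D by fact
  interpret D': unital_star_algebra D' by fact
  note fs = star_morphism_finsum[OF D.complex_space_axioms D'.complex_space_axioms \<phi>]
  have lin: "clinear D D' \<phi>"
    and m: "\<And>x y. x \<in> carrier D \<Longrightarrow> y \<in> carrier D \<Longrightarrow> \<phi> (x \<otimes>\<^bsub>D\<^esub> y) = \<phi> x \<otimes>\<^bsub>D'\<^esub> \<phi> y"
    and s: "\<And>x. x \<in> carrier D \<Longrightarrow> \<phi> (star D x) = star D' (\<phi> x)"
    using \<phi> by (auto simp: star_morphism_def)
  have v: "k < n \<Longrightarrow> i < n \<Longrightarrow> v k i \<in> carrier D"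
    and v': "k < n \<Longrightarrow> i < n \<Longrightarrow> \<phi> (v k i) = v' k i" for k i
    using v0 v0' by blast+
  note [simp] = m s clinear_smult[OF lin] v v' D.star_closed
  have r [simp]: "l < n \<Longrightarrow> rho D v l x \<in> carrier D" for l x
    by (intro rho_in D.complex_space_axioms) simp
  show r' [simp]: "\<phi> (rho D v l x) = rho D' v' l x" if "l < n" for l x
    unfolding rho_def using that by (intro fs) auto
  show "\<phi> (\<Oplus>\<^bsub>D\<^esub>a\<in>{..<n}. \<Oplus>\<^bsub>D\<^esub>b\<in>{..<n}. c a b \<odot>\<^bsub>D\<^esub> (rho D v a x \<otimes>\<^bsub>D\<^esub> rho D v b y)) =
      (\<Oplus>\<^bsub>D'\<^esub>a\<in>{..<n}. \<Oplus>\<^bsub>D'\<^esub>b\<in>{..<n}. c a b \<odot>\<^bsub>D'\<^esub> (rho D' v' a x \<otimes>\<^bsub>D'\<^esub> rho D' v' b y))"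
    by (intro fs) (auto intro!: D.vsum_closed)
  show "\<phi> (\<Oplus>\<^bsub>D\<^esub>a\<in>{..<n}. d a \<odot>\<^bsub>D\<^esub> star D (rho D v a x)) =
      (\<Oplus>\<^bsub>D'\<^esub>a\<in>{..<n}. d a \<odot>\<^bsub>D'\<^esub> star D' (rho D' v' a x))"
    by (intro fs) auto
  show "\<phi> (\<Oplus>\<^bsub>D\<^esub>a\<in>{..<n}. d a \<odot>\<^bsub>D\<^esub> rho D v a x) = (\<Oplus>\<^bsub>D'\<^esub>a\<in>{..<n}. d a \<odot>\<^bsub>D'\<^esub> rho D' v' a x)"
    by (intro fs) auto
  show "\<phi> (\<Oplus>\<^bsub>D\<^esub>k\<in>{..<n}. star D (v k i) \<otimes>\<^bsub>D\<^esub> v k j) =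
      (\<Oplus>\<^bsub>D'\<^esub>k\<in>{..<n}. star D' (v' k i) \<otimes>\<^bsub>D'\<^esub> v' k j)" if "i < n" "j < n"
    using that by (intro fs) auto
  show "\<phi> (\<Oplus>\<^bsub>D\<^esub>i\<in>{..<n}. v k i \<otimes>\<^bsub>D\<^esub> star D (v l i)) =
      (\<Oplus>\<^bsub>D'\<^esub>i\<in>{..<n}. v' k i \<otimes>\<^bsub>D'\<^esub> star D' (v' l i))" if "k < n" "l < n"
    using that by (intro fs) auto
qed

lemma qut_data_image:
  assumes D: "unital_star_algebra D" and D': "unital_star_algebra D'" and \<phi>: "star_morphism D D' \<phi>"
    and q: "qut_data D v"
  shows "qut_data D' (\<lambda>k i. \<phi> (v k i))"
proof -
  interpret D: unital_star_algebra D by fact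
  interpret D': unital_star_algebra D' by fact
  let ?v = "\<lambda>k i. \<phi> (v k i)"
  have v: "\<forall>k<n. \<forall>i<n. v k i \<in> carrier D" and r: "\<forall>k<n. \<forall>i<n. \<phi> (v k i) = \<phi> (v k i)"
    using qut_dataD(4)[OF q] by auto
  note nat = rho_natural[where v = v and v' = ?v, OF D D' \<phi> v r] mult_natural[where v = v and v' = ?v, OF D D' \<phi> v r]
    star_natural[where v = v and v' = ?v, OF D D' \<phi> v r] lin_natural[where v = v and v' = ?v, OF D D' \<phi> v r]
    column_natural[where v = v and v' = ?v, OF D D' \<phi> v r] row_natural[where v = v and v' = ?v, OF D D' \<phi> v r]
  have lin: "clinear D D' \<phi>" and one: "\<phi> \<one>\<^bsub>D\<^esub> = \<one>\<^bsub>D'\<^esub>"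
    using \<phi> by (auto simp: star_morphism_def)
  have zero: "\<phi> \<zero>\<^bsub>D\<^esub> = \<zero>\<^bsub>D'\<^esub>"
    by (rule clinear_zero[OF D.complex_space_axioms D'.complex_space_axioms lin])
  have v': "?v k i \<in> carrier D'" if "k < n" "i < n" for k i
    using that v clinear_in[OF lin] by blast
  note u0 = qut_dataD(1)[OF q, unfolded unitary_matrix_def]
  have "(\<Oplus>\<^bsub>D'\<^esub>k\<in>{..<n}. star D' (?v k i) \<otimes>\<^bsub>D'\<^esub> ?v k j) = (if i = j then \<one>\<^bsub>D'\<^esub> else \<zero>\<^bsub>D'\<^esub>)"
    if ij: "i < n" "j < n" for i j
    using nat(5)[OF ij] u0 ij one zero by auto
  moreover have "(\<Oplus>\<^bsub>D'\<^esub>i\<in>{..<n}. ?v k i \<otimes>\<^bsub>D'\<^esub> star D' (?v l i)) = (if k = l then \<one>\<^bsub>D'\<^esub> else \<zero>\<^bsub>D'\<^esub>)"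
    if kl: "k < n" "l < n" for k l
    using nat(6)[OF kl] u0 kl one zero by auto
  ultimately have u: "unitary_matrix D' n ?v"
    using v' unfolding unitary_matrix_def by blast
  note h = hom_coefficientsD[OF qut_dataD(2)[OF q]]
  have "rho D' ?v l (x \<otimes>\<^bsub>B\<^esub> y) = (\<Oplus>\<^bsub>D'\<^esub>a\<in>{..<n}. \<Oplus>\<^bsub>D'\<^esub>b\<in>{..<n}.
      co l (e a \<otimes>\<^bsub>B\<^esub> e b) \<odot>\<^bsub>D'\<^esub> (rho D' ?v a x \<otimes>\<^bsub>D'\<^esub> rho D' ?v b y))"
    if "l < n" "x \<in> carrier B" "y \<in> carrier B" for l x y
    using arg_cong[OF h(2)[OF that], of \<phi>] that(1) by (simp add: nat(1,2))
  moreover have "rho D' ?v l \<one>\<^bsub>B\<^esub> = co l \<one>\<^bsub>B\<^esub> \<odot>\<^bsub>D'\<^esub> \<one>\<^bsub>D'\<^esub>" if "l < n" for l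
    using arg_cong[OF h(3)[OF that], of \<phi>] that by (simp add: nat(1) clinear_smult[OF lin] one)
  moreover have "rho D' ?v l (star B x) =
      (\<Oplus>\<^bsub>D'\<^esub>a\<in>{..<n}. co l (star B (e a)) \<odot>\<^bsub>D'\<^esub> star D' (rho D' ?v a x))"
    if "l < n" "x \<in> carrier B" for l x
    using arg_cong[OF h(4)[OF that], of \<phi>] that(1) by (simp add: nat(1,3))
  moreover have "clinear B D' (rho D' ?v l)" if "l < n" for l
    using that v' by (intro rho_linear D'.complex_space_axioms) auto
  moreover have "rho D' ?v l (A b) = (\<Oplus>\<^bsub>D'\<^esub>a\<in>{..<n}. co l (A (e a)) \<odot>\<^bsub>D'\<^esub> rho D' ?v a b)"
    if "l < n" "b \<in> carrier B" for l b
    using arg_cong[OF qut_dataD(3)[OF q that], of \<phi>] that(1) by (simp add: nat(1,4))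
  ultimately show ?thesis
    using u by (auto simp: qut_data_def hom_coefficients_def)
qed

text \<open>
  An element of a subdirect product is determined by its components, where the relations hold.
\<close>

lemma qut_data_subdirect:
  assumes "encoded_subdirect D1 D2 S g" and q1: "qut_data D1 v1" and q2: "qut_data D2 v2"
    and S: "\<And>k i. k < n \<Longrightarrow> i < n \<Longrightarrow> (v1 k i, v2 k i) \<in> S"
  shows "qut_data (encoded_subdirect.E D1 D2 S g) (\<lambda>k i. g (v1 k i, v2 k i))"
proof -
  interpret X: encoded_subdirect D1 D2 S g by fact
  interpret E: unital_star_algebra X.E by (rule X.unital_star_algebra_E)
  let ?v = "\<lambda>k i. g (v1 k i, v2 k i)" and ?p1 = "\<lambda>x. fst (X.dec x)" and ?p2 = "\<lambda>x. snd (X.dec x)"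
  note m1 = X.star_morphism_projections(1) and m2 = X.star_morphism_projections(2)
  have v: "?v k i \<in> carrier X.E" "?p1 (?v k i) = v1 k i" "?p2 (?v k i) = v2 k i"
    if "k < n" "i < n" for k i
    using S[OF that] by (auto simp: inv_into_f_f[OF X.inj])
  then have v0: "\<forall>k<n. \<forall>i<n. ?v k i \<in> carrier X.E" "\<forall>k<n. \<forall>i<n. ?p1 (?v k i) = v1 k i"
      "\<forall>k<n. \<forall>i<n. ?p2 (?v k i) = v2 k i" by blast+
  note as1 = E.unital_star_algebra_axioms X.D1.unital_star_algebra_axioms m1 v0(1) v0(2)
    and as2 = E.unital_star_algebra_axioms X.D2.unital_star_algebra_axioms m2 v0(1) v0(3)
  note n1 = rho_natural[where v = ?v and v' = v1, OF as1] mult_natural[where v = ?v and v' = v1, OF as1] star_natural[where v = ?v and v' = v1, OF as1] lin_natural[where v = ?v and v' = v1, OF as1]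
    column_natural[where v = ?v and v' = v1, OF as1] row_natural[where v = ?v and v' = v1, OF as1]
    and n2 = rho_natural[where v = ?v and v' = v2, OF as2] mult_natural[where v = ?v and v' = v2, OF as2] star_natural[where v = ?v and v' = v2, OF as2] lin_natural[where v = ?v and v' = v2, OF as2]
    column_natural[where v = ?v and v' = v2, OF as2] row_natural[where v = ?v and v' = v2, OF as2]
  have lin: "clinear X.E D1 ?p1" "clinear X.E D2 ?p2"
    and one: "?p1 \<one>\<^bsub>X.E\<^esub> = \<one>\<^bsub>D1\<^esub>" "?p2 \<one>\<^bsub>X.E\<^esub> = \<one>\<^bsub>D2\<^esub>"
    using m1 m2 by (simp_all only: star_morphism_def)
  note zero = clinear_zero[OF E.complex_space_axioms X.D1.complex_space_axioms lin(1)]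
    clinear_zero[OF E.complex_space_axioms X.D2.complex_space_axioms lin(2)]
  have r: "rho X.E ?v l x \<in> carrier X.E" if "l < n" for l x
    using that v(1) by (intro rho_in E.complex_space_axioms) auto
  have eqI: "x = y" if "x \<in> carrier X.E" "y \<in> carrier X.E" "?p1 x = ?p1 y" "?p2 x = ?p2 y" for x y
    using that X.E_eqI by blast
  note h1 = hom_coefficientsD[OF qut_dataD(2)[OF q1]] and h2 = hom_coefficientsD[OF qut_dataD(2)[OF q2]]
  note u1 = qut_dataD(1)[OF q1, unfolded unitary_matrix_def]
    and u2 = qut_dataD(1)[OF q2, unfolded unitary_matrix_def]
  have if_in: "(if P then \<one>\<^bsub>X.E\<^esub> else \<zero>\<^bsub>X.E\<^esub>) \<in> carrier X.E" for P
    using E.unit_in E.zero_in by presburger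
  have "(\<Oplus>\<^bsub>X.E\<^esub>k\<in>{..<n}. star X.E (?v k i) \<otimes>\<^bsub>X.E\<^esub> ?v k j) = (if i = j then \<one>\<^bsub>X.E\<^esub> else \<zero>\<^bsub>X.E\<^esub>)"
    if ij: "i < n" "j < n" for i j
  proof (rule eqI[OF _ if_in])
    show "(\<Oplus>\<^bsub>X.E\<^esub>k\<in>{..<n}. star X.E (?v k i) \<otimes>\<^bsub>X.E\<^esub> ?v k j) \<in> carrier X.E"
      using ij v(1) E.star_closed E.mult_in by (intro E.vsum_closed) (auto simp del: X.E_simps)
  qed (simp_all only: n1(5)[OF ij] n2(5)[OF ij] one zero u1 u2 ij if_distrib[of ?p1] if_distrib[of ?p2])
  moreover have "(\<Oplus>\<^bsub>X.E\<^esub>i\<in>{..<n}. ?v k i \<otimes>\<^bsub>X.E\<^esub> star X.E (?v l i)) = (if k = l then \<one>\<^bsub>X.E\<^esub> else \<zero>\<^bsub>X.E\<^esub>)"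
    if ij: "k < n" "l < n" for k l
  proof (rule eqI[OF _ if_in])
    show "(\<Oplus>\<^bsub>X.E\<^esub>i\<in>{..<n}. ?v k i \<otimes>\<^bsub>X.E\<^esub> star X.E (?v l i)) \<in> carrier X.E"
      using ij v(1) E.star_closed E.mult_in by (intro E.vsum_closed) (auto simp del: X.E_simps)
  qed (simp_all only: n1(6)[OF ij] n2(6)[OF ij] one zero u1 u2 ij if_distrib[of ?p1] if_distrib[of ?p2])
  ultimately have u: "unitary_matrix X.E n ?v"
    using v(1) unfolding unitary_matrix_def by blast
  have f_mult: "rho X.E ?v l (x \<otimes>\<^bsub>B\<^esub> y) = (\<Oplus>\<^bsub>X.E\<^esub>a\<in>{..<n}. \<Oplus>\<^bsub>X.E\<^esub>b\<in>{..<n}.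
      co l (e a \<otimes>\<^bsub>B\<^esub> e b) \<odot>\<^bsub>X.E\<^esub> (rho X.E ?v a x \<otimes>\<^bsub>X.E\<^esub> rho X.E ?v b y))"
    if l: "l < n" and xy: "x \<in> carrier B" "y \<in> carrier B" for l x y
  proof (rule eqI)
    show "(\<Oplus>\<^bsub>X.E\<^esub>a\<in>{..<n}. \<Oplus>\<^bsub>X.E\<^esub>b\<in>{..<n}.
        co l (e a \<otimes>\<^bsub>B\<^esub> e b) \<odot>\<^bsub>X.E\<^esub> (rho X.E ?v a x \<otimes>\<^bsub>X.E\<^esub> rho X.E ?v b y)) \<in> carrier X.E"
      using r E.mult_in E.smult_in
      by (intro E.vsum_closed) (auto simp del: X.E_simps intro!: E.vsum_closed)
  qed (simp_all only: n1(1,2) n2(1,2) l h1(2)[OF l xy] h2(2)[OF l xy] r)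
  have f_one: "rho X.E ?v l \<one>\<^bsub>B\<^esub> = co l \<one>\<^bsub>B\<^esub> \<odot>\<^bsub>X.E\<^esub> \<one>\<^bsub>X.E\<^esub>" if l: "l < n" for l
  proof (rule eqI)
    show "co l \<one>\<^bsub>B\<^esub> \<odot>\<^bsub>X.E\<^esub> \<one>\<^bsub>X.E\<^esub> \<in> carrier X.E" by (rule E.smult_in[OF E.unit_in])
  qed (simp_all only: n1(1) n2(1) l h1(3)[OF l] h2(3)[OF l] r
      clinear_smult[OF lin(1) E.unit_in] clinear_smult[OF lin(2) E.unit_in] one)
  have f_star: "rho X.E ?v l (star B x) =
      (\<Oplus>\<^bsub>X.E\<^esub>a\<in>{..<n}. co l (star B (e a)) \<odot>\<^bsub>X.E\<^esub> star X.E (rho X.E ?v a x))"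
    if l: "l < n" and x: "x \<in> carrier B" for l x
  proof (rule eqI)
    show "(\<Oplus>\<^bsub>X.E\<^esub>a\<in>{..<n}. co l (star B (e a)) \<odot>\<^bsub>X.E\<^esub> star X.E (rho X.E ?v a x)) \<in> carrier X.E"
      by (intro E.vsum_closed Pi_I E.smult_in E.star_closed r) simp
  qed (simp_all only: n1(1,3) n2(1,3) l h1(4)[OF l x] h2(4)[OF l x] r)
  have f_lin: "clinear B X.E (rho X.E ?v l)" if "l < n" for l
    using that v(1) by (intro rho_linear E.complex_space_axioms) auto
  have f_A: "rho X.E ?v l (A b) = (\<Oplus>\<^bsub>X.E\<^esub>a\<in>{..<n}. co l (A (e a)) \<odot>\<^bsub>X.E\<^esub> rho X.E ?v a b)"
    if l: "l < n" and b: "b \<in> carrier B" for l b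
  proof (rule eqI)
    show "(\<Oplus>\<^bsub>X.E\<^esub>a\<in>{..<n}. co l (A (e a)) \<odot>\<^bsub>X.E\<^esub> rho X.E ?v a b) \<in> carrier X.E"
      by (intro E.vsum_closed Pi_I E.smult_in r) simp
  qed (simp_all only: n1(1,4) n2(1,4) l qut_dataD(3)[OF q1 l b] qut_dataD(3)[OF q2 l b] r)
  show ?thesis
    unfolding qut_data_def hom_coefficients_def
    by (intro conjI allI impI ballI u; (rule f_mult f_one f_star f_lin f_A); assumption)
qed

end

section \<open>Unitarity versus counit and comultiplication\<close>

locale quantum_graph_coaction = quantum_graph_basis B \<psi> A n e + D: unital_star_algebra D
  for B :: "'b cstar_algebra" and \<psi> :: "'b \<Rightarrow> complex" and A :: "'b \<Rightarrow> 'b"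
    and n :: nat and e :: "nat \<Rightarrow> 'b" and D :: "'d cstar_algebra" +
  fixes \<rho> :: "nat \<Rightarrow> 'b \<Rightarrow> 'd"
  assumes hom: "hom_coefficients B D n e co \<rho>"
begin

lemmas rho_hom = hom_coefficientsD[OF hom]

lemma rho_mem [simp]: "l < n \<Longrightarrow> x \<in> carrier B \<Longrightarrow> \<rho> l x \<in> carrier D"
  using clinear_in[OF rho_hom(1)] .

lemmas [simp] = B.star_closed D.star_closed

text \<open>
  The \<open>*\<close>-relation, solved for the adjoint. What holds linearly for all coefficients, such as being
  intertwined, thereby holds for their adjoints.
\<close>

lemma star_rho:
  assumes "l < n" "x \<in> carrier B"
  shows "star D (\<rho> l x) = (\<Oplus>\<^bsub>D\<^esub>a\<in>{..<n}. cnj (co l (star B (e a))) \<odot>\<^bsub>D\<^esub> \<rho> a (star B x))"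
proof -
  have "\<rho> l x = (\<Oplus>\<^bsub>D\<^esub>a\<in>{..<n}. co l (star B (e a)) \<odot>\<^bsub>D\<^esub> star D (\<rho> a (star B x)))"
    using rho_hom(4)[OF assms(1), of "star B x"] assms by (simp add: B.star_star)
  then have "star D (\<rho> l x) =
      (\<Oplus>\<^bsub>D\<^esub>a\<in>{..<n}. star D (co l (star B (e a)) \<odot>\<^bsub>D\<^esub> star D (\<rho> a (star B x))))"
    using assms by (simp add: D.star_finsum Pi_def)
  also have "\<dots> = (\<Oplus>\<^bsub>D\<^esub>a\<in>{..<n}. cnj (co l (star B (e a))) \<odot>\<^bsub>D\<^esub> \<rho> a (star B x))"
    using assms by (intro D.vsum_cong) (auto simp: D.star_smult D.star_star)
  finally show ?thesis .
qed

text \<open>The element \<open>(\<psi> \<otimes> id) \<rho>(x)\<close> of \<open>D\<close>.\<close>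

definition counit_part :: "'b \<Rightarrow> 'd" where
  "counit_part x = (\<Oplus>\<^bsub>D\<^esub>l\<in>{..<n}. \<psi> (e l) \<odot>\<^bsub>D\<^esub> \<rho> l x)"

lemma psi_star_e: "a < n \<Longrightarrow> b < n \<Longrightarrow> \<psi> (star B (e a) \<otimes>\<^bsub>B\<^esub> e b) = (if a = b then 1 else 0)"
  using co_e[of a b] by (simp add: co_def inner_def)

text \<open>
  Apply \<open>\<psi> \<otimes> id\<close> to \<open>\<rho>(x\<^sup>* y) = \<rho>(x)\<^sup>* \<rho>(y)\<close> and use \<open>\<psi>(e\<^sub>a\<^sup>* e\<^sub>b) = \<delta>\<^sub>a\<^sub>b\<close>.
\<close>

lemma counit_part_star_mult:
  assumes x: "x \<in> carrier B" and y: "y \<in> carrier B"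
  shows "counit_part (star B x \<otimes>\<^bsub>B\<^esub> y) = (\<Oplus>\<^bsub>D\<^esub>k\<in>{..<n}. star D (\<rho> k x) \<otimes>\<^bsub>D\<^esub> \<rho> k y)"
proof -
  let ?Z = "\<lambda>a b. \<rho> a (star B x) \<otimes>\<^bsub>D\<^esub> \<rho> b y"
  have "counit_part (star B x \<otimes>\<^bsub>B\<^esub> y) = (\<Oplus>\<^bsub>D\<^esub>l\<in>{..<n}. \<psi> (e l) \<odot>\<^bsub>D\<^esub>
      (\<Oplus>\<^bsub>D\<^esub>a\<in>{..<n}. \<Oplus>\<^bsub>D\<^esub>b\<in>{..<n}. co l (e a \<otimes>\<^bsub>B\<^esub> e b) \<odot>\<^bsub>D\<^esub> ?Z a b))"
    unfolding counit_part_def using x y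
    by (intro D.vsum_cong) (auto simp: rho_hom(2) intro!: D.vsum_closed)
  also have "\<dots> = (\<Oplus>\<^bsub>D\<^esub>a\<in>{..<n}. \<Oplus>\<^bsub>D\<^esub>b\<in>{..<n}. (\<Sum>l<n. \<psi> (e l) * co l (e a \<otimes>\<^bsub>B\<^esub> e b)) \<odot>\<^bsub>D\<^esub> ?Z a b)"
    using x y by (intro D.finsum_comb2) auto
  also have "\<dots> = (\<Oplus>\<^bsub>D\<^esub>a\<in>{..<n}. \<Oplus>\<^bsub>D\<^esub>b\<in>{..<n}. \<psi> (e a \<otimes>\<^bsub>B\<^esub> e b) \<odot>\<^bsub>D\<^esub> ?Z a b)"
    using x y by (intro D.vsum_cong) (auto simp: functional_expand[OF psi_linear] intro!: D.vsum_closed)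
  also have "\<dots> = (\<Oplus>\<^bsub>D\<^esub>b\<in>{..<n}. \<Oplus>\<^bsub>D\<^esub>a\<in>{..<n}. \<psi> (e a \<otimes>\<^bsub>B\<^esub> e b) \<odot>\<^bsub>D\<^esub> ?Z a b)"
    using x y by (intro D.finsum_swap) auto
  also have "\<dots> = (\<Oplus>\<^bsub>D\<^esub>b\<in>{..<n}. star D (\<rho> b x) \<otimes>\<^bsub>D\<^esub> \<rho> b y)"
  proof (rule D.vsum_cong[OF refl])
    fix b assume "b \<in> {..<n}"
    then have b: "b < n" by simp
    have \<kappa>: "clinear B complex_module (\<lambda>z. \<psi> (z \<otimes>\<^bsub>B\<^esub> e b))"
      using b by (intro clinear_compose[OF B.mult_linear(2) psi_linear]) auto
    have "(\<Oplus>\<^bsub>D\<^esub>a\<in>{..<n}. \<psi> (e a \<otimes>\<^bsub>B\<^esub> e b) \<odot>\<^bsub>D\<^esub> \<rho> a (star B x)) =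
        (\<Oplus>\<^bsub>D\<^esub>a\<in>{..<n}. \<psi> (e a \<otimes>\<^bsub>B\<^esub> e b) \<odot>\<^bsub>D\<^esub>
          (\<Oplus>\<^bsub>D\<^esub>c\<in>{..<n}. co a (star B (e c)) \<odot>\<^bsub>D\<^esub> star D (\<rho> c x)))"
      using x by (intro D.vsum_cong) (auto simp: rho_hom(4) intro!: D.vsum_closed)
    also have "\<dots> = (\<Oplus>\<^bsub>D\<^esub>c\<in>{..<n}. (\<Sum>a<n. \<psi> (e a \<otimes>\<^bsub>B\<^esub> e b) * co a (star B (e c))) \<odot>\<^bsub>D\<^esub> star D (\<rho> c x))"
      using x by (intro D.finsum_comb) auto
    also have "\<dots> = (\<Oplus>\<^bsub>D\<^esub>c\<in>{..<n}. (if c = b then 1 else 0) \<odot>\<^bsub>D\<^esub> star D (\<rho> c x))"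
      using x b by (intro D.vsum_cong) (auto simp: functional_expand[OF \<kappa>] psi_star_e)
    also have "\<dots> = star D (\<rho> b x)" using x b by (intro D.finsum_delta) auto
    finally have inner: "(\<Oplus>\<^bsub>D\<^esub>a\<in>{..<n}. \<psi> (e a \<otimes>\<^bsub>B\<^esub> e b) \<odot>\<^bsub>D\<^esub> \<rho> a (star B x)) = star D (\<rho> b x)" .
    have "(\<Oplus>\<^bsub>D\<^esub>a\<in>{..<n}. \<psi> (e a \<otimes>\<^bsub>B\<^esub> e b) \<odot>\<^bsub>D\<^esub> ?Z a b) =
        (\<Oplus>\<^bsub>D\<^esub>a\<in>{..<n}. (\<psi> (e a \<otimes>\<^bsub>B\<^esub> e b) \<odot>\<^bsub>D\<^esub> \<rho> a (star B x)) \<otimes>\<^bsub>D\<^esub> \<rho> b y)"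
      using x y b by (intro D.vsum_cong) (auto simp: D.smult_mult_left)
    also have "\<dots> = (\<Oplus>\<^bsub>D\<^esub>a\<in>{..<n}. \<psi> (e a \<otimes>\<^bsub>B\<^esub> e b) \<odot>\<^bsub>D\<^esub> \<rho> a (star B x)) \<otimes>\<^bsub>D\<^esub> \<rho> b y"
      using x y b by (intro D.finsum_mult_left[symmetric]) auto
    finally show "(\<Oplus>\<^bsub>D\<^esub>a\<in>{..<n}. \<psi> (e a \<otimes>\<^bsub>B\<^esub> e b) \<odot>\<^bsub>D\<^esub> ?Z a b) = star D (\<rho> b x) \<otimes>\<^bsub>D\<^esub> \<rho> b y"
      by (simp add: inner)
  qed (use x y in auto)
  finally show ?thesis .
qed

lemma counit_part_linear: "clinear B D counit_part"
  unfolding counit_part_def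
  by (intro clinear_finsum_fun clinear_scaled rho_hom(1) B_space D.complex_space_axioms) simp

definition preserves_psi :: bool where
  "preserves_psi \<longleftrightarrow> (\<forall>x\<in>carrier B. counit_part x = \<psi> x \<odot>\<^bsub>D\<^esub> \<one>\<^bsub>D\<^esub>)"

definition columns :: bool where
  "columns \<longleftrightarrow> (\<forall>i<n. \<forall>j<n. (\<Oplus>\<^bsub>D\<^esub>k\<in>{..<n}. star D (\<rho> k (e i)) \<otimes>\<^bsub>D\<^esub> \<rho> k (e j)) =
     (if i = j then \<one>\<^bsub>D\<^esub> else \<zero>\<^bsub>D\<^esub>))"

definition rows :: bool where
  "rows \<longleftrightarrow> (\<forall>k<n. \<forall>l<n. (\<Oplus>\<^bsub>D\<^esub>i\<in>{..<n}. \<rho> k (e i) \<otimes>\<^bsub>D\<^esub> star D (\<rho> l (e i))) =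
     (if k = l then \<one>\<^bsub>D\<^esub> else \<zero>\<^bsub>D\<^esub>))"

text \<open>
  The coefficients at \<open>e\<^sub>k \<otimes> e\<^sub>l\<close> of the two ways from \<open>B\<close> to \<open>B \<otimes> B \<otimes> D\<close>: first \<open>m\<^sup>\<dagger>\<close> and then \<open>\<rho>\<close> on
  both factors, or first \<open>\<rho>\<close> and then \<open>m\<^sup>\<dagger>\<close>.
\<close>

definition comultiplicative :: bool where
  "comultiplicative \<longleftrightarrow> (\<forall>k<n. \<forall>l<n. \<forall>b\<in>carrier B.
     (\<Oplus>\<^bsub>D\<^esub>i\<in>{..<n}. \<Oplus>\<^bsub>D\<^esub>j\<in>{..<n}. dco i j b \<odot>\<^bsub>D\<^esub> (\<rho> k (e i) \<otimes>\<^bsub>D\<^esub> \<rho> l (e j))) =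
     (\<Oplus>\<^bsub>D\<^esub>m\<in>{..<n}. dco k l (e m) \<odot>\<^bsub>D\<^esub> \<rho> m b))"

lemma columns_if_preserves_psi:
  assumes preserves_psi
  shows columns
  unfolding columns_def
proof (intro allI impI)
  fix i j assume ij: "i < n" "j < n"
  have "(\<Oplus>\<^bsub>D\<^esub>k\<in>{..<n}. star D (\<rho> k (e i)) \<otimes>\<^bsub>D\<^esub> \<rho> k (e j)) = counit_part (star B (e i) \<otimes>\<^bsub>B\<^esub> e j)"
    using ij by (simp add: counit_part_star_mult)
  also have "\<dots> = \<psi> (star B (e i) \<otimes>\<^bsub>B\<^esub> e j) \<odot>\<^bsub>D\<^esub> \<one>\<^bsub>D\<^esub>"
    using assms ij unfolding preserves_psi_def by simp
  finally show "(\<Oplus>\<^bsub>D\<^esub>k\<in>{..<n}. star D (\<rho> k (e i)) \<otimes>\<^bsub>D\<^esub> \<rho> k (e j)) = (if i = j then \<one>\<^bsub>D\<^esub> else \<zero>\<^bsub>D\<^esub>)"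
    using ij by (simp add: psi_star_e)
qed

text \<open>
  The columns give the claim on the products \<open>e\<^sub>i\<^sup>* e\<^sub>j\<close>, and these span \<open>B\<close>.
\<close>

lemma preserves_psi_if_columns:
  assumes columns
  shows preserves_psi
  unfolding preserves_psi_def
proof
  fix x assume x: "x \<in> carrier B"
  have e: "counit_part (star B (e i) \<otimes>\<^bsub>B\<^esub> y) = \<psi> (star B (e i) \<otimes>\<^bsub>B\<^esub> y) \<odot>\<^bsub>D\<^esub> \<one>\<^bsub>D\<^esub>"
    if i: "i < n" and y: "y \<in> carrier B" for i y
  proof -
    note m = B.mult_linear(1)[of "star B (e i)"]
    have l1: "clinear B D (\<lambda>y. counit_part (star B (e i) \<otimes>\<^bsub>B\<^esub> y))"
      using i by (intro clinear_compose[OF m counit_part_linear]) simp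
    have l2: "clinear B D (\<lambda>y. \<psi> (star B (e i) \<otimes>\<^bsub>B\<^esub> y) \<odot>\<^bsub>D\<^esub> \<one>\<^bsub>D\<^esub>)"
      using i by (intro clinear_coeff_smult[OF D.complex_space_axioms] clinear_compose[OF m psi_linear]) auto
    have "counit_part (star B (e i) \<otimes>\<^bsub>B\<^esub> y) =
        (\<Oplus>\<^bsub>D\<^esub>j\<in>{..<n}. co j y \<odot>\<^bsub>D\<^esub> counit_part (star B (e i) \<otimes>\<^bsub>B\<^esub> e j))"
      by (rule clinear_expand[OF coords B_space D.complex_space_axioms l1 y])
    also have "\<dots> = (\<Oplus>\<^bsub>D\<^esub>j\<in>{..<n}. co j y \<odot>\<^bsub>D\<^esub> (\<psi> (star B (e i) \<otimes>\<^bsub>B\<^esub> e j) \<odot>\<^bsub>D\<^esub> \<one>\<^bsub>D\<^esub>))"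
      using assms i unfolding columns_def
      by (intro D.vsum_cong) (auto simp: counit_part_star_mult psi_star_e)
    also have "\<dots> = \<psi> (star B (e i) \<otimes>\<^bsub>B\<^esub> y) \<odot>\<^bsub>D\<^esub> \<one>\<^bsub>D\<^esub>"
      by (rule clinear_expand[OF coords B_space D.complex_space_axioms l2 y, symmetric])
    finally show ?thesis .
  qed
  \<comment> \<open>\<open>1 = (\<Sum>\<^sub>i \<langle>e\<^sub>i, 1\<rangle> e\<^sub>i)\<^sup>*\<close>, so that \<open>x = 1 x\<close> is a combination of the elements \<open>e\<^sub>i\<^sup>* x\<close>.\<close>
  have "\<one>\<^bsub>B\<^esub> = star B (\<Oplus>\<^bsub>B\<^esub>i\<in>{..<n}. co i \<one>\<^bsub>B\<^esub> \<odot>\<^bsub>B\<^esub> e i)"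
    by (simp add: co_expand)
  also have "\<dots> = (\<Oplus>\<^bsub>B\<^esub>i\<in>{..<n}. star B (co i \<one>\<^bsub>B\<^esub> \<odot>\<^bsub>B\<^esub> e i))"
    by (intro B.star_finsum) auto
  also have "\<dots> = (\<Oplus>\<^bsub>B\<^esub>i\<in>{..<n}. cnj (co i \<one>\<^bsub>B\<^esub>) \<odot>\<^bsub>B\<^esub> star B (e i))"
    by (intro B.vsum_cong) (auto simp: B.star_smult)
  finally have one: "\<one>\<^bsub>B\<^esub> = (\<Oplus>\<^bsub>B\<^esub>i\<in>{..<n}. cnj (co i \<one>\<^bsub>B\<^esub>) \<odot>\<^bsub>B\<^esub> star B (e i))" .
  have "x = \<one>\<^bsub>B\<^esub> \<otimes>\<^bsub>B\<^esub> x" using ring.ring_simprules(12)[OF B.ring x] by simp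
  also have "\<dots> = (\<Oplus>\<^bsub>B\<^esub>i\<in>{..<n}. (cnj (co i \<one>\<^bsub>B\<^esub>) \<odot>\<^bsub>B\<^esub> star B (e i)) \<otimes>\<^bsub>B\<^esub> x)"
    using x by (subst one, intro B.finsum_mult_left) auto
  also have "\<dots> = (\<Oplus>\<^bsub>B\<^esub>i\<in>{..<n}. cnj (co i \<one>\<^bsub>B\<^esub>) \<odot>\<^bsub>B\<^esub> (star B (e i) \<otimes>\<^bsub>B\<^esub> x))"
    using x by (intro B.vsum_cong) (auto simp: B.smult_mult_left)
  finally have x_eq: "x = (\<Oplus>\<^bsub>B\<^esub>i\<in>{..<n}. cnj (co i \<one>\<^bsub>B\<^esub>) \<odot>\<^bsub>B\<^esub> (star B (e i) \<otimes>\<^bsub>B\<^esub> x))" .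
  note l2 = clinear_coeff_smult[OF D.complex_space_axioms psi_linear D.unit_in]
  have "counit_part x = (\<Oplus>\<^bsub>D\<^esub>i\<in>{..<n}. counit_part (cnj (co i \<one>\<^bsub>B\<^esub>) \<odot>\<^bsub>B\<^esub> (star B (e i) \<otimes>\<^bsub>B\<^esub> x)))"
    using x by (subst x_eq, intro clinear_finsum[OF B_space D.complex_space_axioms counit_part_linear]) auto
  also have "\<dots> = (\<Oplus>\<^bsub>D\<^esub>i\<in>{..<n}. \<psi> (cnj (co i \<one>\<^bsub>B\<^esub>) \<odot>\<^bsub>B\<^esub> (star B (e i) \<otimes>\<^bsub>B\<^esub> x)) \<odot>\<^bsub>D\<^esub> \<one>\<^bsub>D\<^esub>)"
    using x by (intro D.vsum_cong)
      (auto simp: clinear_smult[OF counit_part_linear] clinear_smult[OF psi_linear] e D.smult_smult)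
  also have "\<dots> = \<psi> x \<odot>\<^bsub>D\<^esub> \<one>\<^bsub>D\<^esub>"
    using x by (subst (2) x_eq, intro clinear_finsum[OF B_space D.complex_space_axioms l2, symmetric]) auto
  finally show "counit_part x = \<psi> x \<odot>\<^bsub>D\<^esub> \<one>\<^bsub>D\<^esub>" .
qed

lemma dco_e: "a < n \<Longrightarrow> c < n \<Longrightarrow> m < n \<Longrightarrow> dco a c (e m) = cnj (co m (e a \<otimes>\<^bsub>B\<^esub> e c))"
proof -
  assume l: "a < n" "c < n" "m < n"
  have "dco a c (e m) = (\<Sum>i<n. cnj (co i (e a \<otimes>\<^bsub>B\<^esub> e c)) * co i (e m))"
    using l by (simp add: dco_def inner_expand)
  also have "\<dots> = (\<Sum>i<n. if i = m then cnj (co i (e a \<otimes>\<^bsub>B\<^esub> e c)) else 0)"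
    using l by (intro sum.cong) auto
  finally show ?thesis using l by simp
qed

lemma dco_one: "i < n \<Longrightarrow> j < n \<Longrightarrow> dco i j \<one>\<^bsub>B\<^esub> = co j (star B (e i))"
  using monoid.r_one[OF ring.axioms(2)[OF B.ring], of "star B (e j) \<otimes>\<^bsub>B\<^esub> star B (e i)"]
  by (simp add: dco_def co_def inner_def B.star_mult)

text \<open>
  The columns give \<open>\<langle>e\<^sub>i e\<^sub>j, b\<rangle> 1 = \<Sum>\<^sub>m \<rho>\<^sub>m(e\<^sub>i e\<^sub>j)\<^sup>* \<rho>\<^sub>m(b)\<close>. Multiply by \<open>\<rho>\<^sub>k(e\<^sub>i) \<rho>\<^sub>l(e\<^sub>j)\<close> from the left
  and sum over \<open>i\<close> and \<open>j\<close>. Multiplicativity expands \<open>\<rho>\<^sub>m(e\<^sub>i e\<^sub>j)\<^sup>*\<close> into products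
  \<open>\<rho>\<^sub>c(e\<^sub>j)\<^sup>* \<rho>\<^sub>a(e\<^sub>i)\<^sup>*\<close>, and the rows collapse first the sum over \<open>j\<close> and then that over \<open>i\<close>.
\<close>

lemma comultiplicative_if_unitary:
  assumes columns rows
  shows comultiplicative
  unfolding comultiplicative_def
proof (intro allI impI ballI)
  fix k l b assume kl: "k < n" "l < n" and b: "b \<in> carrier B"
  have psi: "counit_part x = \<psi> x \<odot>\<^bsub>D\<^esub> \<one>\<^bsub>D\<^esub>" if "x \<in> carrier B" for x
    using preserves_psi_if_columns[OF assms(1)] that by (simp add: preserves_psi_def)
  have rw: "(\<Oplus>\<^bsub>D\<^esub>i\<in>{..<n}. \<rho> k (e i) \<otimes>\<^bsub>D\<^esub> star D (\<rho> l (e i))) = (if k = l then 1 else 0) \<odot>\<^bsub>D\<^esub> \<one>\<^bsub>D\<^esub>"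
    if "k < n" "l < n" for k l using assms(2) that by (simp add: rows_def)
  let ?r = "\<lambda>k i. \<rho> k (e i)"
  have star_prod: "star D (\<rho> m (e i \<otimes>\<^bsub>B\<^esub> e j)) = (\<Oplus>\<^bsub>D\<^esub>a\<in>{..<n}. \<Oplus>\<^bsub>D\<^esub>c\<in>{..<n}.
      dco a c (e m) \<odot>\<^bsub>D\<^esub> (star D (?r c j) \<otimes>\<^bsub>D\<^esub> star D (?r a i)))" if "m < n" "i < n" "j < n" for m i j
  proof -
    have "star D (\<rho> m (e i \<otimes>\<^bsub>B\<^esub> e j)) = (\<Oplus>\<^bsub>D\<^esub>a\<in>{..<n}. star D (\<Oplus>\<^bsub>D\<^esub>c\<in>{..<n}.
        co m (e a \<otimes>\<^bsub>B\<^esub> e c) \<odot>\<^bsub>D\<^esub> (?r a i \<otimes>\<^bsub>D\<^esub> ?r c j)))"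
      using that rho_hom(2)[OF that(1) e_in e_in, OF that(2,3)]
      by (simp only:) (intro D.star_finsum, auto intro!: D.vsum_closed)
    also have "\<dots> = (\<Oplus>\<^bsub>D\<^esub>a\<in>{..<n}. \<Oplus>\<^bsub>D\<^esub>c\<in>{..<n}. star D
        (co m (e a \<otimes>\<^bsub>B\<^esub> e c) \<odot>\<^bsub>D\<^esub> (?r a i \<otimes>\<^bsub>D\<^esub> ?r c j)))"
      using that by (intro D.vsum_cong D.star_finsum) (auto intro!: D.vsum_closed)
    also have "\<dots> = (\<Oplus>\<^bsub>D\<^esub>a\<in>{..<n}. \<Oplus>\<^bsub>D\<^esub>c\<in>{..<n}.
        dco a c (e m) \<odot>\<^bsub>D\<^esub> (star D (?r c j) \<otimes>\<^bsub>D\<^esub> star D (?r a i)))"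
      using that by (intro D.vsum_cong)
        (auto simp: D.star_smult D.star_mult dco_e intro!: D.vsum_closed)
    finally show ?thesis .
  qed
  \<comment> \<open>The sum over \<open>j\<close>: the rows leave only \<open>c = l\<close>.\<close>
  have claim1: "(\<Oplus>\<^bsub>D\<^esub>j\<in>{..<n}. ?r l j \<otimes>\<^bsub>D\<^esub> star D (\<rho> m (e i \<otimes>\<^bsub>B\<^esub> e j))) =
      (\<Oplus>\<^bsub>D\<^esub>a\<in>{..<n}. dco a l (e m) \<odot>\<^bsub>D\<^esub> star D (?r a i))" if "m < n" "i < n" for m i
  proof -
    let ?W = "\<lambda>j a c. (?r l j \<otimes>\<^bsub>D\<^esub> star D (?r c j)) \<otimes>\<^bsub>D\<^esub> star D (?r a i)"
    have "?r l j \<otimes>\<^bsub>D\<^esub> star D (\<rho> m (e i \<otimes>\<^bsub>B\<^esub> e j)) =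
        (\<Oplus>\<^bsub>D\<^esub>a\<in>{..<n}. \<Oplus>\<^bsub>D\<^esub>c\<in>{..<n}. dco a c (e m) \<odot>\<^bsub>D\<^esub> ?W j a c)" if j: "j < n" for j
    proof -
      have "?r l j \<otimes>\<^bsub>D\<^esub> star D (\<rho> m (e i \<otimes>\<^bsub>B\<^esub> e j)) = (\<Oplus>\<^bsub>D\<^esub>a\<in>{..<n}. ?r l j \<otimes>\<^bsub>D\<^esub> (\<Oplus>\<^bsub>D\<^esub>c\<in>{..<n}.
          dco a c (e m) \<odot>\<^bsub>D\<^esub> (star D (?r c j) \<otimes>\<^bsub>D\<^esub> star D (?r a i))))"
        unfolding star_prod[OF \<open>m < n\<close> \<open>i < n\<close> j] using j kl \<open>i < n\<close>
        by (intro D.finsum_mult_right) (auto intro!: D.vsum_closed)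
      also have "\<dots> = (\<Oplus>\<^bsub>D\<^esub>a\<in>{..<n}. \<Oplus>\<^bsub>D\<^esub>c\<in>{..<n}. ?r l j \<otimes>\<^bsub>D\<^esub>
          (dco a c (e m) \<odot>\<^bsub>D\<^esub> (star D (?r c j) \<otimes>\<^bsub>D\<^esub> star D (?r a i))))"
        using j kl \<open>i < n\<close> by (intro D.vsum_cong D.finsum_mult_right) (auto intro!: D.vsum_closed)
      also have "\<dots> = (\<Oplus>\<^bsub>D\<^esub>a\<in>{..<n}. \<Oplus>\<^bsub>D\<^esub>c\<in>{..<n}. dco a c (e m) \<odot>\<^bsub>D\<^esub> ?W j a c)"
        using j kl \<open>i < n\<close> by (intro D.vsum_cong)
          (auto simp: D.smult_mult_right D.mult_assoc intro!: D.vsum_closed)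
      finally show ?thesis .
    qed
    then have "(\<Oplus>\<^bsub>D\<^esub>j\<in>{..<n}. ?r l j \<otimes>\<^bsub>D\<^esub> star D (\<rho> m (e i \<otimes>\<^bsub>B\<^esub> e j))) =
        (\<Oplus>\<^bsub>D\<^esub>j\<in>{..<n}. \<Oplus>\<^bsub>D\<^esub>a\<in>{..<n}. \<Oplus>\<^bsub>D\<^esub>c\<in>{..<n}. dco a c (e m) \<odot>\<^bsub>D\<^esub> ?W j a c)"
      using kl that by (intro D.vsum_cong) (auto intro!: D.vsum_closed)
    also have "\<dots> = (\<Oplus>\<^bsub>D\<^esub>a\<in>{..<n}. \<Oplus>\<^bsub>D\<^esub>j\<in>{..<n}. \<Oplus>\<^bsub>D\<^esub>c\<in>{..<n}. dco a c (e m) \<odot>\<^bsub>D\<^esub> ?W j a c)"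
      using kl that by (intro D.finsum_swap) (auto intro!: D.vsum_closed)
    also have "\<dots> = (\<Oplus>\<^bsub>D\<^esub>a\<in>{..<n}. dco a l (e m) \<odot>\<^bsub>D\<^esub> star D (?r a i))"
    proof (rule D.vsum_cong[OF refl])
      fix a assume "a \<in> {..<n}"
      then have a: "a < n" by simp
      have "(\<Oplus>\<^bsub>D\<^esub>j\<in>{..<n}. \<Oplus>\<^bsub>D\<^esub>c\<in>{..<n}. dco a c (e m) \<odot>\<^bsub>D\<^esub> ?W j a c) =
          (\<Oplus>\<^bsub>D\<^esub>c\<in>{..<n}. \<Oplus>\<^bsub>D\<^esub>j\<in>{..<n}. dco a c (e m) \<odot>\<^bsub>D\<^esub> ?W j a c)"
        using kl that a by (intro D.finsum_swap) auto
      also have "\<dots> = (\<Oplus>\<^bsub>D\<^esub>c\<in>{..<n}. (if c = l then 1 else 0) \<odot>\<^bsub>D\<^esub> (dco a c (e m) \<odot>\<^bsub>D\<^esub> star D (?r a i)))"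
      proof (rule D.vsum_cong[OF refl])
        fix c assume "c \<in> {..<n}"
        then have c: "c < n" by simp
        have "(\<Oplus>\<^bsub>D\<^esub>j\<in>{..<n}. dco a c (e m) \<odot>\<^bsub>D\<^esub> ?W j a c) = dco a c (e m) \<odot>\<^bsub>D\<^esub> (\<Oplus>\<^bsub>D\<^esub>j\<in>{..<n}. ?W j a c)"
          using kl that a c by (intro D.smult_finsum[symmetric]) auto
        also have "(\<Oplus>\<^bsub>D\<^esub>j\<in>{..<n}. ?W j a c) = (\<Oplus>\<^bsub>D\<^esub>j\<in>{..<n}. ?r l j \<otimes>\<^bsub>D\<^esub> star D (?r c j)) \<otimes>\<^bsub>D\<^esub> star D (?r a i)"
          using kl that a c by (intro D.finsum_mult_left[symmetric]) auto
        also have "\<dots> = (if l = c then 1 else 0) \<odot>\<^bsub>D\<^esub> star D (?r a i)"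
          using that a ring.ring_simprules(12)[OF D.ring, of "star D (?r a i)"]
          by (simp add: rw[OF kl(2) c] D.smult_mult_left)
        finally show "(\<Oplus>\<^bsub>D\<^esub>j\<in>{..<n}. dco a c (e m) \<odot>\<^bsub>D\<^esub> ?W j a c) =
            (if c = l then 1 else 0) \<odot>\<^bsub>D\<^esub> (dco a c (e m) \<odot>\<^bsub>D\<^esub> star D (?r a i))"
          using that a by (auto simp: D.smult_smult)
      qed (use that a in auto)
      also have "\<dots> = dco a l (e m) \<odot>\<^bsub>D\<^esub> star D (?r a i)"
        using kl that a by (intro D.finsum_delta) auto
      finally show "(\<Oplus>\<^bsub>D\<^esub>j\<in>{..<n}. \<Oplus>\<^bsub>D\<^esub>c\<in>{..<n}. dco a c (e m) \<odot>\<^bsub>D\<^esub> ?W j a c) =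
          dco a l (e m) \<odot>\<^bsub>D\<^esub> star D (?r a i)" .
    qed (use that in auto)
    finally show ?thesis .
  qed
  \<comment> \<open>The sum over \<open>i\<close>: the rows leave only \<open>a = k\<close>.\<close>
  have claim2: "(\<Oplus>\<^bsub>D\<^esub>i\<in>{..<n}. \<Oplus>\<^bsub>D\<^esub>j\<in>{..<n}. (?r k i \<otimes>\<^bsub>D\<^esub> ?r l j) \<otimes>\<^bsub>D\<^esub> star D (\<rho> m (e i \<otimes>\<^bsub>B\<^esub> e j))) =
      dco k l (e m) \<odot>\<^bsub>D\<^esub> \<one>\<^bsub>D\<^esub>" if m: "m < n" for m
  proof -
    have "(\<Oplus>\<^bsub>D\<^esub>i\<in>{..<n}. \<Oplus>\<^bsub>D\<^esub>j\<in>{..<n}. (?r k i \<otimes>\<^bsub>D\<^esub> ?r l j) \<otimes>\<^bsub>D\<^esub> star D (\<rho> m (e i \<otimes>\<^bsub>B\<^esub> e j))) =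
        (\<Oplus>\<^bsub>D\<^esub>i\<in>{..<n}. \<Oplus>\<^bsub>D\<^esub>a\<in>{..<n}. dco a l (e m) \<odot>\<^bsub>D\<^esub> (?r k i \<otimes>\<^bsub>D\<^esub> star D (?r a i)))"
    proof (rule D.vsum_cong[OF refl])
      fix i assume "i \<in> {..<n}"
      then have i: "i < n" by simp
      have "(\<Oplus>\<^bsub>D\<^esub>j\<in>{..<n}. (?r k i \<otimes>\<^bsub>D\<^esub> ?r l j) \<otimes>\<^bsub>D\<^esub> star D (\<rho> m (e i \<otimes>\<^bsub>B\<^esub> e j))) =
          (\<Oplus>\<^bsub>D\<^esub>j\<in>{..<n}. ?r k i \<otimes>\<^bsub>D\<^esub> (?r l j \<otimes>\<^bsub>D\<^esub> star D (\<rho> m (e i \<otimes>\<^bsub>B\<^esub> e j))))"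
        using kl m i by (intro D.vsum_cong) (auto simp: D.mult_assoc)
      also have "\<dots> = ?r k i \<otimes>\<^bsub>D\<^esub> (\<Oplus>\<^bsub>D\<^esub>j\<in>{..<n}. ?r l j \<otimes>\<^bsub>D\<^esub> star D (\<rho> m (e i \<otimes>\<^bsub>B\<^esub> e j)))"
        using kl m i by (intro D.finsum_mult_right[symmetric]) auto
      also have "\<dots> = (\<Oplus>\<^bsub>D\<^esub>a\<in>{..<n}. ?r k i \<otimes>\<^bsub>D\<^esub> (dco a l (e m) \<odot>\<^bsub>D\<^esub> star D (?r a i)))"
        unfolding claim1[OF m i] using kl m i by (intro D.finsum_mult_right) auto
      also have "\<dots> = (\<Oplus>\<^bsub>D\<^esub>a\<in>{..<n}. dco a l (e m) \<odot>\<^bsub>D\<^esub> (?r k i \<otimes>\<^bsub>D\<^esub> star D (?r a i)))"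
        using kl m i by (intro D.vsum_cong) (auto simp: D.smult_mult_right)
      finally show "(\<Oplus>\<^bsub>D\<^esub>j\<in>{..<n}. (?r k i \<otimes>\<^bsub>D\<^esub> ?r l j) \<otimes>\<^bsub>D\<^esub> star D (\<rho> m (e i \<otimes>\<^bsub>B\<^esub> e j))) = \<dots>" .
    qed (use kl m in \<open>auto intro!: D.vsum_closed\<close>)
    also have "\<dots> = (\<Oplus>\<^bsub>D\<^esub>a\<in>{..<n}. \<Oplus>\<^bsub>D\<^esub>i\<in>{..<n}. dco a l (e m) \<odot>\<^bsub>D\<^esub> (?r k i \<otimes>\<^bsub>D\<^esub> star D (?r a i)))"
      using kl m by (intro D.finsum_swap) auto
    also have "\<dots> = (\<Oplus>\<^bsub>D\<^esub>a\<in>{..<n}. dco a l (e m) \<odot>\<^bsub>D\<^esub> ((if k = a then 1 else 0) \<odot>\<^bsub>D\<^esub> \<one>\<^bsub>D\<^esub>))"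
    proof (rule D.vsum_cong[OF refl])
      fix a assume "a \<in> {..<n}"
      then have a: "a < n" by simp
      have "(\<Oplus>\<^bsub>D\<^esub>i\<in>{..<n}. dco a l (e m) \<odot>\<^bsub>D\<^esub> (?r k i \<otimes>\<^bsub>D\<^esub> star D (?r a i))) =
          dco a l (e m) \<odot>\<^bsub>D\<^esub> (\<Oplus>\<^bsub>D\<^esub>i\<in>{..<n}. ?r k i \<otimes>\<^bsub>D\<^esub> star D (?r a i))"
        using kl a by (intro D.smult_finsum[symmetric]) auto
      then show "(\<Oplus>\<^bsub>D\<^esub>i\<in>{..<n}. dco a l (e m) \<odot>\<^bsub>D\<^esub> (?r k i \<otimes>\<^bsub>D\<^esub> star D (?r a i))) =
          dco a l (e m) \<odot>\<^bsub>D\<^esub> ((if k = a then 1 else 0) \<odot>\<^bsub>D\<^esub> \<one>\<^bsub>D\<^esub>)"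
        by (simp only: rw[OF kl(1) a])
    qed auto
    also have "\<dots> = (\<Oplus>\<^bsub>D\<^esub>a\<in>{..<n}. (if a = k then 1 else 0) \<odot>\<^bsub>D\<^esub> (dco a l (e m) \<odot>\<^bsub>D\<^esub> \<one>\<^bsub>D\<^esub>))"
      by (intro D.vsum_cong) auto
    also have "\<dots> = dco k l (e m) \<odot>\<^bsub>D\<^esub> \<one>\<^bsub>D\<^esub>" using kl by (intro D.finsum_delta) auto
    finally show ?thesis .
  qed
  let ?R = "\<lambda>i j. ?r k i \<otimes>\<^bsub>D\<^esub> ?r l j" and ?S = "\<lambda>m i j. star D (\<rho> m (e i \<otimes>\<^bsub>B\<^esub> e j))"
  have "dco i j b \<odot>\<^bsub>D\<^esub> ?R i j = (\<Oplus>\<^bsub>D\<^esub>m\<in>{..<n}. (?R i j \<otimes>\<^bsub>D\<^esub> ?S m i j) \<otimes>\<^bsub>D\<^esub> \<rho> m b)"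
    if ij: "i < n" "j < n" for i j
  proof -
    have "dco i j b \<odot>\<^bsub>D\<^esub> ?R i j = ?R i j \<otimes>\<^bsub>D\<^esub> (\<psi> (star B (e i \<otimes>\<^bsub>B\<^esub> e j) \<otimes>\<^bsub>B\<^esub> b) \<odot>\<^bsub>D\<^esub> \<one>\<^bsub>D\<^esub>)"
      using ij kl monoid.r_one[OF ring.axioms(2)[OF D.ring], of "?R i j"]
      by (simp add: dco_def inner_def D.smult_mult_right)
    also have "\<psi> (star B (e i \<otimes>\<^bsub>B\<^esub> e j) \<otimes>\<^bsub>B\<^esub> b) \<odot>\<^bsub>D\<^esub> \<one>\<^bsub>D\<^esub> =
        (\<Oplus>\<^bsub>D\<^esub>m\<in>{..<n}. ?S m i j \<otimes>\<^bsub>D\<^esub> \<rho> m b)"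
      using ij b by (simp add: psi[symmetric] counit_part_star_mult)
    also have "?R i j \<otimes>\<^bsub>D\<^esub> \<dots> = (\<Oplus>\<^bsub>D\<^esub>m\<in>{..<n}. ?R i j \<otimes>\<^bsub>D\<^esub> (?S m i j \<otimes>\<^bsub>D\<^esub> \<rho> m b))"
      using ij kl b by (intro D.finsum_mult_right) auto
    also have "\<dots> = (\<Oplus>\<^bsub>D\<^esub>m\<in>{..<n}. (?R i j \<otimes>\<^bsub>D\<^esub> ?S m i j) \<otimes>\<^bsub>D\<^esub> \<rho> m b)"
      using ij kl b by (intro D.vsum_cong) (auto simp: D.mult_assoc)
    finally show ?thesis .
  qed
  then have "(\<Oplus>\<^bsub>D\<^esub>i\<in>{..<n}. \<Oplus>\<^bsub>D\<^esub>j\<in>{..<n}. dco i j b \<odot>\<^bsub>D\<^esub> ?R i j) =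
      (\<Oplus>\<^bsub>D\<^esub>i\<in>{..<n}. \<Oplus>\<^bsub>D\<^esub>j\<in>{..<n}. \<Oplus>\<^bsub>D\<^esub>m\<in>{..<n}. (?R i j \<otimes>\<^bsub>D\<^esub> ?S m i j) \<otimes>\<^bsub>D\<^esub> \<rho> m b)"
    using kl b by (intro D.vsum_cong) (auto intro!: D.vsum_closed)
  also have "\<dots> = (\<Oplus>\<^bsub>D\<^esub>i\<in>{..<n}. \<Oplus>\<^bsub>D\<^esub>m\<in>{..<n}. \<Oplus>\<^bsub>D\<^esub>j\<in>{..<n}. (?R i j \<otimes>\<^bsub>D\<^esub> ?S m i j) \<otimes>\<^bsub>D\<^esub> \<rho> m b)"
    using kl b by (intro D.vsum_cong D.finsum_swap) (auto intro!: D.vsum_closed)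
  also have "\<dots> = (\<Oplus>\<^bsub>D\<^esub>m\<in>{..<n}. \<Oplus>\<^bsub>D\<^esub>i\<in>{..<n}. \<Oplus>\<^bsub>D\<^esub>j\<in>{..<n}. (?R i j \<otimes>\<^bsub>D\<^esub> ?S m i j) \<otimes>\<^bsub>D\<^esub> \<rho> m b)"
    using kl b by (intro D.finsum_swap) (auto intro!: D.vsum_closed)
  also have "\<dots> = (\<Oplus>\<^bsub>D\<^esub>m\<in>{..<n}. dco k l (e m) \<odot>\<^bsub>D\<^esub> \<rho> m b)"
  proof (rule D.vsum_cong[OF refl])
    fix m assume "m \<in> {..<n}"
    then have m: "m < n" by simp
    have "(\<Oplus>\<^bsub>D\<^esub>i\<in>{..<n}. \<Oplus>\<^bsub>D\<^esub>j\<in>{..<n}. (?R i j \<otimes>\<^bsub>D\<^esub> ?S m i j) \<otimes>\<^bsub>D\<^esub> \<rho> m b) =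
        (\<Oplus>\<^bsub>D\<^esub>i\<in>{..<n}. (\<Oplus>\<^bsub>D\<^esub>j\<in>{..<n}. ?R i j \<otimes>\<^bsub>D\<^esub> ?S m i j) \<otimes>\<^bsub>D\<^esub> \<rho> m b)"
      using kl b m by (intro D.vsum_cong D.finsum_mult_left[symmetric]) (auto intro!: D.vsum_closed)
    also have "\<dots> = (\<Oplus>\<^bsub>D\<^esub>i\<in>{..<n}. \<Oplus>\<^bsub>D\<^esub>j\<in>{..<n}. ?R i j \<otimes>\<^bsub>D\<^esub> ?S m i j) \<otimes>\<^bsub>D\<^esub> \<rho> m b"
      using kl b m by (intro D.finsum_mult_left[symmetric]) (auto intro!: D.vsum_closed)
    also have "\<dots> = dco k l (e m) \<odot>\<^bsub>D\<^esub> \<rho> m b"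
      using m b ring.ring_simprules(12)[OF D.ring, of "\<rho> m b"]
      by (simp add: claim2[OF m] D.smult_mult_left)
    finally show "(\<Oplus>\<^bsub>D\<^esub>i\<in>{..<n}. \<Oplus>\<^bsub>D\<^esub>j\<in>{..<n}. (?R i j \<otimes>\<^bsub>D\<^esub> ?S m i j) \<otimes>\<^bsub>D\<^esub> \<rho> m b) =
        dco k l (e m) \<odot>\<^bsub>D\<^esub> \<rho> m b" .
  qed (use b in auto)
  finally show "(\<Oplus>\<^bsub>D\<^esub>i\<in>{..<n}. \<Oplus>\<^bsub>D\<^esub>j\<in>{..<n}. dco i j b \<odot>\<^bsub>D\<^esub> ?R i j) =
      (\<Oplus>\<^bsub>D\<^esub>m\<in>{..<n}. dco k l (e m) \<odot>\<^bsub>D\<^esub> \<rho> m b)" .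
qed

text \<open>
  The involution is antilinear with square the identity: its matrix times the conjugate matrix is \<open>1\<close>.
\<close>

lemma star_matrix_inverse:
  assumes "a < n" "m < n"
  shows "(\<Sum>l<n. co l (star B (e a)) * cnj (co m (star B (e l)))) = (if a = m then 1 else 0)"
proof -
  have "star B (star B (e a)) = star B (\<Oplus>\<^bsub>B\<^esub>l\<in>{..<n}. co l (star B (e a)) \<odot>\<^bsub>B\<^esub> e l)"
    using assms by (simp add: co_expand)
  also have "\<dots> = (\<Oplus>\<^bsub>B\<^esub>l\<in>{..<n}. star B (co l (star B (e a)) \<odot>\<^bsub>B\<^esub> e l))"
    by (intro B.star_finsum) auto
  also have "\<dots> = (\<Oplus>\<^bsub>B\<^esub>l\<in>{..<n}. cnj (co l (star B (e a))) \<odot>\<^bsub>B\<^esub> star B (e l))"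
    by (intro B.vsum_cong) (auto simp: B.star_smult)
  finally have "e a = (\<Oplus>\<^bsub>B\<^esub>l\<in>{..<n}. cnj (co l (star B (e a))) \<odot>\<^bsub>B\<^esub> star B (e l))"
    using assms by (simp add: B.star_star)
  then have "co m (e a) = co m (\<Oplus>\<^bsub>B\<^esub>l\<in>{..<n}. cnj (co l (star B (e a))) \<odot>\<^bsub>B\<^esub> star B (e l))"
    by simp
  also have "\<dots> = (\<Sum>l<n. cnj (co l (star B (e a))) * co m (star B (e l)))"
    using assms
    by (subst clinear_finsum[OF B_space complex_space_complex_module co_linear])
      (auto simp: clinear_smult[OF co_linear])
  finally have "cnj (co m (e a)) = (\<Sum>l<n. co l (star B (e a)) * cnj (co m (star B (e l))))"
    by simp
  then show ?thesis using assms by (cases "a = m") simp_all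
qed

text \<open>
  At \<open>b = 1\<close>, where \<open>\<langle>e\<^sub>i e\<^sub>j, 1\<rangle> = \<langle>e\<^sub>j, e\<^sub>i\<^sup>*\<rangle>\<close>, the hypothesis reads
  \<open>\<Sum>\<^sub>i \<rho>\<^sub>k(e\<^sub>i) \<rho>\<^sub>l(e\<^sub>i\<^sup>*) = \<langle>e\<^sub>l, e\<^sub>k\<^sup>*\<rangle> 1\<close>. Expressing \<open>\<rho>\<^sub>l(e\<^sub>i\<^sup>*)\<close> through the \<open>\<rho>\<^sub>a(e\<^sub>i)\<^sup>*\<close> gives the
  orthonormality of the rows, multiplied by the invertible matrix of the involution.
\<close>

lemma rows_if_comultiplicative:
  assumes comultiplicative
  shows rows
  unfolding rows_def
proof (intro allI impI)
  fix k m assume k: "k < n" and m: "m < n"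
  define X where "X a = (\<Oplus>\<^bsub>D\<^esub>i\<in>{..<n}. \<rho> k (e i) \<otimes>\<^bsub>D\<^esub> star D (\<rho> a (e i)))" for a
  have X: "a < n \<Longrightarrow> X a \<in> carrier D" for a unfolding X_def using k by (intro D.vsum_closed) auto
  have eq: "(\<Oplus>\<^bsub>D\<^esub>a\<in>{..<n}. co l (star B (e a)) \<odot>\<^bsub>D\<^esub> X a) = co l (star B (e k)) \<odot>\<^bsub>D\<^esub> \<one>\<^bsub>D\<^esub>"
    if l: "l < n" for l
  proof -
    have "co l (star B (e k)) \<odot>\<^bsub>D\<^esub> \<one>\<^bsub>D\<^esub> = dco k l \<one>\<^bsub>B\<^esub> \<odot>\<^bsub>D\<^esub> \<one>\<^bsub>D\<^esub>"
      using k l by (simp add: dco_one)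
    also have "\<dots> = (\<Oplus>\<^bsub>D\<^esub>i\<in>{..<n}. (co i \<one>\<^bsub>B\<^esub> * dco k l (e i)) \<odot>\<^bsub>D\<^esub> \<one>\<^bsub>D\<^esub>)"
      using functional_expand[OF dco_linear[OF k l] B.unit_in]
      by (simp add: D.sum_smult[symmetric] mult.commute)
    also have "\<dots> = (\<Oplus>\<^bsub>D\<^esub>i\<in>{..<n}. dco k l (e i) \<odot>\<^bsub>D\<^esub> \<rho> i \<one>\<^bsub>B\<^esub>)"
      using k l by (intro D.vsum_cong) (auto simp: rho_hom(3) D.smult_smult mult.commute)
    also have "\<dots> = (\<Oplus>\<^bsub>D\<^esub>i\<in>{..<n}. \<Oplus>\<^bsub>D\<^esub>j\<in>{..<n}. dco i j \<one>\<^bsub>B\<^esub> \<odot>\<^bsub>D\<^esub> (\<rho> k (e i) \<otimes>\<^bsub>D\<^esub> \<rho> l (e j)))"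
      using assms k l B.unit_in unfolding comultiplicative_def by simp
    also have "\<dots> = (\<Oplus>\<^bsub>D\<^esub>i\<in>{..<n}. \<rho> k (e i) \<otimes>\<^bsub>D\<^esub> \<rho> l (star B (e i)))"
    proof (rule D.vsum_cong[OF refl])
      fix i assume "i \<in> {..<n}"
      then have i: "i < n" by simp
      have "(\<Oplus>\<^bsub>D\<^esub>j\<in>{..<n}. dco i j \<one>\<^bsub>B\<^esub> \<odot>\<^bsub>D\<^esub> (\<rho> k (e i) \<otimes>\<^bsub>D\<^esub> \<rho> l (e j))) =
          (\<Oplus>\<^bsub>D\<^esub>j\<in>{..<n}. \<rho> k (e i) \<otimes>\<^bsub>D\<^esub> (co j (star B (e i)) \<odot>\<^bsub>D\<^esub> \<rho> l (e j)))"
        using k l i by (intro D.vsum_cong) (auto simp: dco_one D.smult_mult_right)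
      also have "\<dots> = \<rho> k (e i) \<otimes>\<^bsub>D\<^esub> (\<Oplus>\<^bsub>D\<^esub>j\<in>{..<n}. co j (star B (e i)) \<odot>\<^bsub>D\<^esub> \<rho> l (e j))"
        using k l i by (intro D.finsum_mult_right[symmetric]) auto
      also have "\<dots> = \<rho> k (e i) \<otimes>\<^bsub>D\<^esub> \<rho> l (star B (e i))"
        using i clinear_expand[OF coords B_space D.complex_space_axioms rho_hom(1)[OF l],
            of "star B (e i)"] by simp
      finally show "(\<Oplus>\<^bsub>D\<^esub>j\<in>{..<n}. dco i j \<one>\<^bsub>B\<^esub> \<odot>\<^bsub>D\<^esub> (\<rho> k (e i) \<otimes>\<^bsub>D\<^esub> \<rho> l (e j))) = \<dots>" .
    qed (use k l in auto)
    also have "\<dots> = (\<Oplus>\<^bsub>D\<^esub>i\<in>{..<n}. \<Oplus>\<^bsub>D\<^esub>a\<in>{..<n}.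
        co l (star B (e a)) \<odot>\<^bsub>D\<^esub> (\<rho> k (e i) \<otimes>\<^bsub>D\<^esub> star D (\<rho> a (e i))))"
    proof (rule D.vsum_cong[OF refl])
      fix i assume "i \<in> {..<n}"
      then have i: "i < n" by simp
      have "\<rho> k (e i) \<otimes>\<^bsub>D\<^esub> \<rho> l (star B (e i)) =
          (\<Oplus>\<^bsub>D\<^esub>a\<in>{..<n}. \<rho> k (e i) \<otimes>\<^bsub>D\<^esub> (co l (star B (e a)) \<odot>\<^bsub>D\<^esub> star D (\<rho> a (e i))))"
        unfolding rho_hom(4)[OF l e_in[OF i]] using k l i by (intro D.finsum_mult_right) auto
      also have "\<dots> = (\<Oplus>\<^bsub>D\<^esub>a\<in>{..<n}. co l (star B (e a)) \<odot>\<^bsub>D\<^esub> (\<rho> k (e i) \<otimes>\<^bsub>D\<^esub> star D (\<rho> a (e i))))"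
        using k l i by (intro D.vsum_cong) (auto simp: D.smult_mult_right)
      finally show "\<rho> k (e i) \<otimes>\<^bsub>D\<^esub> \<rho> l (star B (e i)) = \<dots>" .
    qed (use k in \<open>auto intro!: D.vsum_closed\<close>)
    also have "\<dots> = (\<Oplus>\<^bsub>D\<^esub>a\<in>{..<n}. \<Oplus>\<^bsub>D\<^esub>i\<in>{..<n}.
        co l (star B (e a)) \<odot>\<^bsub>D\<^esub> (\<rho> k (e i) \<otimes>\<^bsub>D\<^esub> star D (\<rho> a (e i))))"
      using k by (intro D.finsum_swap) auto
    also have "\<dots> = (\<Oplus>\<^bsub>D\<^esub>a\<in>{..<n}. co l (star B (e a)) \<odot>\<^bsub>D\<^esub> X a)"
      unfolding X_def using k
      by (intro D.vsum_cong D.smult_finsum[symmetric]) (auto intro!: D.vsum_closed)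
    finally show ?thesis by simp
  qed
  have "(\<Oplus>\<^bsub>D\<^esub>l\<in>{..<n}. cnj (co m (star B (e l))) \<odot>\<^bsub>D\<^esub> (\<Oplus>\<^bsub>D\<^esub>a\<in>{..<n}. co l (star B (e a)) \<odot>\<^bsub>D\<^esub> X a)) =
      (\<Oplus>\<^bsub>D\<^esub>a\<in>{..<n}. (\<Sum>l<n. cnj (co m (star B (e l))) * co l (star B (e a))) \<odot>\<^bsub>D\<^esub> X a)"
    using X by (intro D.finsum_comb) auto
  also have "\<dots> = (\<Oplus>\<^bsub>D\<^esub>a\<in>{..<n}. (if a = m then 1 else 0) \<odot>\<^bsub>D\<^esub> X a)"
    using X m star_matrix_inverse by (intro D.vsum_cong) (auto simp: mult.commute)
  also have "\<dots> = X m" using X m by (intro D.finsum_delta) auto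
  finally have "X m = (\<Oplus>\<^bsub>D\<^esub>l\<in>{..<n}. cnj (co m (star B (e l))) \<odot>\<^bsub>D\<^esub>
      (\<Oplus>\<^bsub>D\<^esub>a\<in>{..<n}. co l (star B (e a)) \<odot>\<^bsub>D\<^esub> X a))" by simp
  also have "\<dots> = (\<Oplus>\<^bsub>D\<^esub>l\<in>{..<n}. (co l (star B (e k)) * cnj (co m (star B (e l)))) \<odot>\<^bsub>D\<^esub> \<one>\<^bsub>D\<^esub>)"
    by (intro D.vsum_cong) (auto simp: eq D.smult_smult mult.commute)
  also have "\<dots> = (if k = m then 1 else 0) \<odot>\<^bsub>D\<^esub> \<one>\<^bsub>D\<^esub>"
    using star_matrix_inverse[OF k m] by (simp add: D.sum_smult[symmetric])
  finally show "(\<Oplus>\<^bsub>D\<^esub>i\<in>{..<n}. \<rho> k (e i) \<otimes>\<^bsub>D\<^esub> star D (\<rho> m (e i))) = (if k = m then \<one>\<^bsub>D\<^esub> else \<zero>\<^bsub>D\<^esub>)"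
    by (auto simp: X_def)
qed

theorem unitary_iff: "columns \<and> rows \<longleftrightarrow> preserves_psi \<and> comultiplicative"
  using columns_if_preserves_psi preserves_psi_if_columns comultiplicative_if_unitary
    rows_if_comultiplicative by blast

end

section \<open>Representations of the universal algebra\<close>

context quantum_graph_basis
begin

text \<open>
  The universal property gives a homomorphism into the encoded algebra; its two components are the
  required maps.
\<close>

lemma universal_pair:
  fixes C :: "'c cstar_algebra" and g :: "'d1 \<times> 'd2 \<Rightarrow> nat \<Rightarrow> complex"
  assumes Q: "is_Qut_algebra B \<psi> A n e C u" and X: "encoded_subdirect D1 D2 S g"
    and q: "qut_data D1 v1" "qut_data D2 v2"
    and S: "\<And>k i. k < n \<Longrightarrow> i < n \<Longrightarrow> (v1 k i, v2 k i) \<in> S"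
  shows "\<exists>\<phi>1\<in>star_hom C D1. \<exists>\<phi>2\<in>star_hom C D2. (\<forall>c\<in>carrier C. (\<phi>1 c, \<phi>2 c) \<in> S) \<and>
    (\<forall>k<n. \<forall>i<n. \<phi>1 (u k i) = v1 k i \<and> \<phi>2 (u k i) = v2 k i)"
proof -
  interpret X: encoded_subdirect D1 D2 S g by (rule X)
  interpret C: unital_cstar_algebra C using Q by (simp add: is_Qut_algebra_def)
  let ?w = "\<lambda>k i. g (v1 k i, v2 k i)"
  have "Qut_relations B \<psi> A n e X.E ?w"
    using qut_data_subdirect[OF X q S] Qut_relations_iff[OF X.unital_cstar_algebra_E] by simp
  then obtain \<phi> where \<phi>: "\<phi> \<in> star_hom C X.E" and \<phi>u: "\<And>k i. k < n \<Longrightarrow> i < n \<Longrightarrow> \<phi> (u k i) = ?w k i"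
    using Q X.unital_cstar_algebra_E unfolding is_Qut_algebra_def by blast
  have u: "u k i \<in> carrier C" if "k < n" "i < n" for k i
    using Q that by (auto simp: is_Qut_algebra_def Qut_relations_def unitary_matrix_def)
  have m: "star_morphism C X.E \<phi>" using \<phi> by (simp add: star_hom_iff)
  let ?\<phi>1 = "\<lambda>c\<in>carrier C. fst (X.dec (\<phi> c))" and ?\<phi>2 = "\<lambda>c\<in>carrier C. snd (X.dec (\<phi> c))"
  have "?\<phi>1 \<in> star_hom C D1" "?\<phi>2 \<in> star_hom C D2"
    by (intro star_morphism_restrict C.unital_star_algebra_axioms
        star_morphism_compose[OF m X.star_morphism_projections(1)]
        star_morphism_compose[OF m X.star_morphism_projections(2)])+
  moreover have "(?\<phi>1 c, ?\<phi>2 c) \<in> S" if "c \<in> carrier C" for c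
  proof -
    have "clinear C X.E \<phi>" using m by (simp only: star_morphism_def)
    then have "\<phi> c \<in> carrier X.E" using that by (rule clinear_in)
    from X.dec_mem[OF this] show ?thesis using that by simp
  qed
  moreover have "?\<phi>1 (u k i) = v1 k i \<and> ?\<phi>2 (u k i) = v2 k i" if "k < n" "i < n" for k i
    using that u \<phi>u S inv_into_f_f[OF X.inj] by simp
  ultimately show ?thesis by blast
qed

text \<open>Pairs of equal operators form a copy of the algebra of operators.\<close>

lemma encoded_diagonal:
  fixes H :: "'h hilbert"
  assumes H: "fd_hilbert_space H"
  obtains g :: "('h \<Rightarrow> 'h) \<times> ('h \<Rightarrow> 'h) \<Rightarrow> nat \<Rightarrow> complex"
  where "encoded_subdirect (operators H) (operators H) (intertwining_pairs H H (\<lambda>x. x)) g"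
proof -
  interpret H: fd_hilbert_space H by fact
  obtain g0 :: "('h \<Rightarrow> 'h) \<Rightarrow> nat \<Rightarrow> complex" where "inj_on g0 (carrier (operators H))"
    using H.operators_embed by blast
  with pair_embed[OF this this] that encoded_subdirect_intertwining[OF H H clinear_id]
  show ?thesis by blast
qed

lemma diagonal_pairs:
  "T \<in> linear_maps H H \<Longrightarrow> (T, T) \<in> intertwining_pairs H H (\<lambda>x. x)"
  by (auto simp: intertwining_pairs_def)

lemma representation_exists:
  fixes C :: "'c cstar_algebra" and H :: "'h hilbert"
  assumes Q: "is_Qut_algebra B \<psi> A n e C u" and H: "fd_hilbert_space H"
    and q: "qut_data (operators H) v"
  shows "\<exists>\<pi>\<in>star_hom C (operators H). \<forall>k<n. \<forall>i<n. \<pi> (u k i) = v k i"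
proof -
  obtain g :: "('h \<Rightarrow> 'h) \<times> ('h \<Rightarrow> 'h) \<Rightarrow> nat \<Rightarrow> complex"
    where X: "encoded_subdirect (operators H) (operators H) (intertwining_pairs H H (\<lambda>x. x)) g"
    using encoded_diagonal[OF H] .
  have "(v k i, v k i) \<in> intertwining_pairs H H (\<lambda>x. x)" if "k < n" "i < n" for k i
    using diagonal_pairs qut_dataD(4)[OF q that] by simp
  from universal_pair[OF Q X q q this] show ?thesis by blast
qed

text \<open>
  Both representations give homomorphisms \<open>c \<mapsto> (\<pi>(c), \<pi>(c))\<close> into the encoded diagonal, where the
  uniqueness part of the universal property applies.
\<close>

lemma representation_unique:
  fixes C :: "'c cstar_algebra" and H :: "'h hilbert"
  assumes Q: "is_Qut_algebra B \<psi> A n e C u" and H: "fd_hilbert_space H"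
    and \<pi>: "\<pi> \<in> star_hom C (operators H)" "\<pi>' \<in> star_hom C (operators H)"
    and eq: "\<And>k i. k < n \<Longrightarrow> i < n \<Longrightarrow> \<pi> (u k i) = \<pi>' (u k i)"
  shows "\<pi> = \<pi>'"
proof -
  interpret H: fd_hilbert_space H by fact
  interpret OH: unital_cstar_algebra "operators H" by (rule H.unital_cstar_algebra_operators)
  interpret C: unital_cstar_algebra C using Q by (simp add: is_Qut_algebra_def)
  obtain g :: "('h \<Rightarrow> 'h) \<times> ('h \<Rightarrow> 'h) \<Rightarrow> nat \<Rightarrow> complex"
    where X: "encoded_subdirect (operators H) (operators H) (intertwining_pairs H H (\<lambda>x. x)) g"
    using encoded_diagonal[OF H] .
  interpret X: encoded_subdirect "operators H" "operators H" "intertwining_pairs H H (\<lambda>x. x)" g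
    by (rule X)
  have qC: "qut_data C u" and u: "\<And>k i. k < n \<Longrightarrow> i < n \<Longrightarrow> u k i \<in> carrier C"
    using Q Qut_relations_iff[OF C.unital_cstar_algebra_axioms, of u]
    by (auto simp: is_Qut_algebra_def Qut_relations_def unitary_matrix_def)
  have mem: "\<sigma> c \<in> linear_maps H H" if "\<sigma> \<in> star_hom C (operators H)" "c \<in> carrier C" for \<sigma> c
    using that by (auto simp: star_hom_iff star_morphism_def dest: clinear_in)
  let ?w = "\<lambda>k i. g (\<pi> (u k i), \<pi> (u k i))"
  have "qut_data (operators H) (\<lambda>k i. \<pi> (u k i))"
    using \<pi>(1) by (intro qut_data_image[OF C.unital_star_algebra_axioms OH.unital_star_algebra_axioms _ qC])
      (simp add: star_hom_iff)
  then have "qut_data X.E ?w"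
    by (rule qut_data_subdirect[OF X])
      (use diagonal_pairs[OF mem[OF \<pi>(1) u]] \<open>qut_data (operators H) _\<close> in auto)
  then have ex1: "\<exists>!\<phi>. \<phi> \<in> star_hom C X.E \<and> (\<forall>k<n. \<forall>i<n. \<phi> (u k i) = ?w k i)"
    using Q X.unital_cstar_algebra_E Qut_relations_iff[OF X.unital_cstar_algebra_E]
    unfolding is_Qut_algebra_def by blast
  let ?G = "\<lambda>\<sigma>. \<lambda>c\<in>carrier C. g (\<sigma> c, \<sigma> c)"
  have "?G \<sigma> \<in> star_hom C X.E" if "\<sigma> \<in> star_hom C (operators H)" for \<sigma>
    by (rule X.pair_star_hom[OF C.unital_star_algebra_axioms that that diagonal_pairs[OF mem[OF that]]])
  then have G: "?G \<pi> \<in> star_hom C X.E \<and> (\<forall>k<n. \<forall>i<n. ?G \<pi> (u k i) = ?w k i)"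
    "?G \<pi>' \<in> star_hom C X.E \<and> (\<forall>k<n. \<forall>i<n. ?G \<pi>' (u k i) = ?w k i)"
    using \<pi> u eq by simp_all
  obtain \<phi>0 where uniq: "\<And>\<phi>. \<phi> \<in> star_hom C X.E \<and> (\<forall>k<n. \<forall>i<n. \<phi> (u k i) = ?w k i) \<Longrightarrow> \<phi> = \<phi>0"
    using ex1 by (elim ex1E) blast
  have e: "?G \<pi> = ?G \<pi>'" by (rule trans[OF uniq[OF G(1)] uniq[OF G(2), symmetric]])
  have "\<pi> c = \<pi>' c" if c: "c \<in> carrier C" for c
  proof -
    have "g (\<pi> c, \<pi> c) = g (\<pi>' c, \<pi>' c)" using fun_cong[OF e, of c] c by simp
    then show ?thesis
      using X.g_eq[OF diagonal_pairs[OF mem[OF \<pi>(1) c]] diagonal_pairs[OF mem[OF \<pi>(2) c]]] by simp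
  qed
  then show ?thesis
    using \<pi> by (intro extensionalityI[of \<pi> "carrier C" \<pi>']) (simp_all add: star_hom_iff)
qed

lemma rho_apply:
  assumes H: "fd_hilbert_space H" and v: "\<And>k. k < n \<Longrightarrow> v l k \<in> linear_maps H H" and x: "x \<in> carrier H"
  shows "rho (operators H) v l b x = (\<Oplus>\<^bsub>H\<^esub>k\<in>{..<n}. co k b \<odot>\<^bsub>H\<^esub> v l k x)"
proof -
  interpret H: fd_hilbert_space H by fact
  have "rho (operators H) v l b x = (\<Oplus>\<^bsub>H\<^esub>k\<in>{..<n}. (co k b \<odot>\<^bsub>operators H\<^esub> v l k) x)"
    unfolding rho_def using v H.op_smult_in x by (intro H.finsum_operators_apply) auto
  also have "\<dots> = (\<Oplus>\<^bsub>H\<^esub>k\<in>{..<n}. co k b \<odot>\<^bsub>H\<^esub> v l k x)"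
    using linear_mapsD(2)[OF v x] x by (intro H.vsum_cong) auto
  finally show ?thesis .
qed

lemma intertwines_rho:
  assumes H: "fd_hilbert_space H" and K: "fd_hilbert_space K" and f: "clinear H K f"
    and v: "\<And>k. k < n \<Longrightarrow> v l k \<in> linear_maps H H" and w: "\<And>k. k < n \<Longrightarrow> w l k \<in> linear_maps K K"
    and tw: "\<And>k x. k < n \<Longrightarrow> x \<in> carrier H \<Longrightarrow> f (v l k x) = w l k (f x)" and x: "x \<in> carrier H"
  shows "f (rho (operators H) v l b x) = rho (operators K) w l b (f x)"
proof -
  interpret H: fd_hilbert_space H by fact
  interpret K: fd_hilbert_space K by fact
  have fx: "f x \<in> carrier K" using clinear_in[OF f x] .
  have "f (rho (operators H) v l b x) = f (\<Oplus>\<^bsub>H\<^esub>k\<in>{..<n}. co k b \<odot>\<^bsub>H\<^esub> v l k x)"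
    by (simp only: rho_apply[where v = v, OF H v x])
  also have "\<dots> = (\<Oplus>\<^bsub>K\<^esub>k\<in>{..<n}. f (co k b \<odot>\<^bsub>H\<^esub> v l k x))"
    using linear_mapsD(2)[OF v x]
    by (intro clinear_finsum[OF H.complex_space_axioms K.complex_space_axioms f]) auto
  also have "\<dots> = (\<Oplus>\<^bsub>K\<^esub>k\<in>{..<n}. co k b \<odot>\<^bsub>K\<^esub> w l k (f x))"
    using linear_mapsD(2)[OF v x] linear_mapsD(2)[OF w fx] x
    by (intro K.vsum_cong) (auto simp: clinear_smult[OF f] tw)
  also have "\<dots> = rho (operators K) w l b (f x)"
    by (simp only: rho_apply[where v = w, OF K w fx])
  finally show ?thesis .
qed

text \<open>
  An intertwiner of the generating matrices intertwines their adjoints as well, because the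
  \<open>*\<close>-relations express \<open>(u\<^sub>i\<^sup>k)\<^sup>*\<close> linearly through the \<open>u\<^sub>j\<^sup>l\<close>. So the pair of representations maps
  the generators into the \<open>C\<^sup>*\<close>-algebra of intertwining pairs, and by the universal property it maps
  all of \<open>C\<close> there.
\<close>

lemma intertwines_all:
  fixes C :: "'c cstar_algebra" and H K :: "'h hilbert"
  assumes Q: "is_Qut_algebra B \<psi> A n e C u" and H: "fd_hilbert_space H" and K: "fd_hilbert_space K"
    and \<pi>: "\<pi> \<in> star_hom C (operators H)" and \<pi>': "\<pi>' \<in> star_hom C (operators K)"
    and f: "clinear H K f"
    and tw: "\<And>k i x. k < n \<Longrightarrow> i < n \<Longrightarrow> x \<in> carrier H \<Longrightarrow> f (\<pi> (u k i) x) = \<pi>' (u k i) (f x)"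
    and c: "c \<in> carrier C" and x: "x \<in> carrier H"
  shows "f (\<pi> c x) = \<pi>' c (f x)"
proof -
  interpret H: fd_hilbert_space H by fact
  interpret K: fd_hilbert_space K by fact
  interpret C: unital_cstar_algebra C using Q by (simp add: is_Qut_algebra_def)
  note OH = H.unital_star_algebra_operators and OK = K.unital_star_algebra_operators
  have qC: "qut_data C u"
    using Q Qut_relations_iff[OF C.unital_cstar_algebra_axioms, of u] by (simp add: is_Qut_algebra_def)
  let ?v = "\<lambda>k i. \<pi> (u k i)" and ?w = "\<lambda>k i. \<pi>' (u k i)"
  have qv: "qut_data (operators H) ?v" and qw: "qut_data (operators K) ?w"
    using \<pi> \<pi>' by (auto simp: star_hom_iff intro!: qut_data_image[OF C.unital_star_algebra_axioms _ _ qC] OH OK)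
  have v: "k < n \<Longrightarrow> i < n \<Longrightarrow> ?v k i \<in> linear_maps H H"
    and w: "k < n \<Longrightarrow> i < n \<Longrightarrow> ?w k i \<in> linear_maps K K" for k i
    using qut_dataD(4)[OF qv] qut_dataD(4)[OF qw] by simp_all
  interpret RH: quantum_graph_coaction B \<psi> A n e "operators H" "rho (operators H) ?v"
    by (intro quantum_graph_coaction.intro quantum_graph_basis_axioms OH
        quantum_graph_coaction_axioms.intro qut_dataD(2)[OF qv])
  interpret RK: quantum_graph_coaction B \<psi> A n e "operators K" "rho (operators K) ?w"
    by (intro quantum_graph_coaction.intro quantum_graph_basis_axioms OK
        quantum_graph_coaction_axioms.intro qut_dataD(2)[OF qw])
  have S: "(?v k i, ?w k i) \<in> intertwining_pairs H K f" if ki: "k < n" "i < n" for k i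
  proof -
    have "f (adjoint H H (?v k i) y) = adjoint K K (?w k i) (f y)" if y: "y \<in> carrier H" for y
    proof -
      note fy = clinear_in[OF f y]
      let ?c = "\<lambda>a. cnj (co k (star B (e a)))" and ?z = "star B (e i)"
      have rH: "rho (operators H) ?v a ?z \<in> linear_maps H H" if "a < n" for a
        using RH.rho_mem[OF that, of ?z] ki by (simp add: B.star_closed)
      have rK: "rho (operators K) ?w a ?z \<in> linear_maps K K" if "a < n" for a
        using RK.rho_mem[OF that, of ?z] ki by (simp add: B.star_closed)
      have aH: "adjoint H H (?v k i) = (\<Oplus>\<^bsub>operators H\<^esub>a\<in>{..<n}. ?c a \<odot>\<^bsub>operators H\<^esub> rho (operators H) ?v a ?z)"
        using RH.star_rho[OF ki(1) e_in[OF ki(2)]] rho_e[OF RH.D.complex_space_axioms, where v = ?v and l = k and k = i] v ki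
        by simp
      have aK: "adjoint K K (?w k i) = (\<Oplus>\<^bsub>operators K\<^esub>a\<in>{..<n}. ?c a \<odot>\<^bsub>operators K\<^esub> rho (operators K) ?w a ?z)"
        using RK.star_rho[OF ki(1) e_in[OF ki(2)]] rho_e[OF RK.D.complex_space_axioms, where v = ?w and l = k and k = i] w ki
        by simp
      have "f (adjoint H H (?v k i) y) = f (\<Oplus>\<^bsub>H\<^esub>a\<in>{..<n}. (?c a \<odot>\<^bsub>operators H\<^esub> rho (operators H) ?v a ?z) y)"
        unfolding aH using rH H.op_smult_in y by (subst H.finsum_operators_apply) auto
      also have "\<dots> = (\<Oplus>\<^bsub>K\<^esub>a\<in>{..<n}. f ((?c a \<odot>\<^bsub>operators H\<^esub> rho (operators H) ?v a ?z) y))"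
        using linear_mapsD(2)[OF rH y] y
        by (intro clinear_finsum[OF H.complex_space_axioms K.complex_space_axioms f]) auto
      also have "\<dots> = (\<Oplus>\<^bsub>K\<^esub>a\<in>{..<n}. (?c a \<odot>\<^bsub>operators K\<^esub> rho (operators K) ?w a ?z) (f y))"
      proof (rule K.vsum_cong[OF refl])
        fix a assume "a \<in> {..<n}"
        then have a: "a < n" by simp
        have "f (rho (operators H) ?v a ?z y) = rho (operators K) ?w a ?z (f y)"
          using a v w tw by (intro intertwines_rho[OF H K f _ _ _ y]) auto
        then show "f ((?c a \<odot>\<^bsub>operators H\<^esub> rho (operators H) ?v a ?z) y) =
            (?c a \<odot>\<^bsub>operators K\<^esub> rho (operators K) ?w a ?z) (f y)"
          using y fy linear_mapsD(2)[OF rH[OF a] y] by (simp add: clinear_smult[OF f])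
      qed (use linear_mapsD(2)[OF rK fy] fy in auto)
      also have "\<dots> = adjoint K K (?w k i) (f y)"
        unfolding aK using rK K.op_smult_in fy by (subst K.finsum_operators_apply) auto
      finally show ?thesis .
    qed
    then show ?thesis using v w tw ki by (auto simp: intertwining_pairs_def)
  qed
  obtain gH :: "('h \<Rightarrow> 'h) \<Rightarrow> nat \<Rightarrow> complex" where gH: "inj_on gH (carrier (operators H))"
    using H.operators_embed by blast
  obtain gK :: "('h \<Rightarrow> 'h) \<Rightarrow> nat \<Rightarrow> complex" where gK: "inj_on gK (carrier (operators K))"
    using K.operators_embed by blast
  obtain g :: "('h \<Rightarrow> 'h) \<times> ('h \<Rightarrow> 'h) \<Rightarrow> nat \<Rightarrow> complex"
    where g: "inj_on g (carrier (operators H) \<times> carrier (operators K))"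
    using pair_embed[OF gH gK] by blast
  obtain \<phi>1 \<phi>2 where \<phi>: "\<phi>1 \<in> star_hom C (operators H)" "\<phi>2 \<in> star_hom C (operators K)"
    and pair: "\<And>c. c \<in> carrier C \<Longrightarrow> (\<phi>1 c, \<phi>2 c) \<in> intertwining_pairs H K f"
    and gen: "\<And>k i. k < n \<Longrightarrow> i < n \<Longrightarrow> \<phi>1 (u k i) = ?v k i \<and> \<phi>2 (u k i) = ?w k i"
    using universal_pair[OF Q encoded_subdirect_intertwining[OF H K f g] qv qw S] by blast
  have "\<phi>1 = \<pi>" "\<phi>2 = \<pi>'"
    using gen by (auto intro!: representation_unique[OF Q H \<phi>(1) \<pi>] representation_unique[OF Q K \<phi>(2) \<pi>'])
  then show ?thesis using pair[OF c] x by (auto simp: intertwining_pairs_def)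
qed

end

section \<open>Quantum automorphisms in coordinates\<close>

text \<open>The coefficient \<open>P\<^sup>k(b)\<close> of \<open>P (b \<otimes> h) = \<Sum>\<^sub>k P\<^sup>k(b) h \<otimes> e\<^sub>k\<close>.\<close>

definition (in quantum_graph_basis) action_coeff ::
  "'h hilbert \<Rightarrow> (('b, 'h) tens \<Rightarrow> ('h, 'b) tens) \<Rightarrow> nat \<Rightarrow> 'b \<Rightarrow> 'h \<Rightarrow> 'h" where
  "action_coeff H P k b = (\<lambda>h\<in>carrier H. rslice H (co k) (P (simple_tensor B H b h)))"

locale quantum_graph_action = quantum_graph_basis B \<psi> A n e + H: fd_hilbert_space H
  for B :: "'b cstar_algebra" and \<psi> :: "'b \<Rightarrow> complex" and A :: "'b \<Rightarrow> 'b"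
    and n :: nat and e :: "nat \<Rightarrow> 'b" and H :: "'h hilbert" +
  fixes P :: "('b, 'h) tens \<Rightarrow> ('h, 'b) tens"
  assumes P: "P \<in> linear_maps (B \<otimes>\<^sub>T H) (H \<otimes>\<^sub>T B)"
begin

lemmas H_space = H.complex_space_axioms

sublocale BH: tensor_factors B H ..
sublocale HB: tensor_factors H B ..
sublocale OH: unital_star_algebra "operators H" by (rule H.unital_star_algebra_operators)

lemmas P_linear = linear_mapsD(1)[OF P]

abbreviation p where "p \<equiv> action_coeff H P"

lemma p_apply: "h \<in> carrier H \<Longrightarrow> p k b h = rslice H (co k) (P (simple_tensor B H b h))"
  by (simp add: action_coeff_def)

lemma P_simple_in: "b \<in> carrier B \<Longrightarrow> h \<in> carrier H \<Longrightarrow> P (simple_tensor B H b h) \<in> carrier (H \<otimes>\<^sub>T B)"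
  by (intro clinear_in[OF P_linear]) auto

lemma rslice_P_linear: "clinear B complex_module \<kappa> \<Longrightarrow> clinear (B \<otimes>\<^sub>T H) H (\<lambda>t. rslice H \<kappa> (P t))"
  by (intro clinear_compose[OF P_linear clinear_rslice[OF H_space B_space]])

lemma p_in: "k < n \<Longrightarrow> b \<in> carrier B \<Longrightarrow> p k b \<in> linear_maps H H"
  unfolding action_coeff_def
  by (intro linear_maps_restrict H_space clinear_compose[OF BH.simple_tensor_linear(1) rslice_P_linear]
      co_linear)

lemma p_app_in [simp]: "k < n \<Longrightarrow> b \<in> carrier B \<Longrightarrow> h \<in> carrier H \<Longrightarrow> p k b h \<in> carrier H"
  using linear_mapsD(2)[OF p_in] .

lemma p_linear_left: "k < n \<Longrightarrow> h \<in> carrier H \<Longrightarrow> clinear B H (\<lambda>b. p k b h)"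
  by (simp only: p_apply) (intro clinear_compose[OF BH.simple_tensor_linear(2) rslice_P_linear] co_linear)

lemma p_linear: "k < n \<Longrightarrow> clinear B (operators H) (p k)"
proof (rule clinearI)
  assume k: "k < n"
  fix x y c assume x: "x \<in> carrier B"
  show "p k x \<in> carrier (operators H)" using p_in[OF k x] by simp
  have "p k (c \<odot>\<^bsub>B\<^esub> x) \<in> linear_maps H H" using p_in[OF k] x by simp
  moreover have "c \<odot>\<^bsub>operators H\<^esub> p k x \<in> linear_maps H H" using H.op_smult_in[OF p_in[OF k x]] by simp
  ultimately show "p k (c \<odot>\<^bsub>B\<^esub> x) = c \<odot>\<^bsub>operators H\<^esub> p k x"
    by (rule linear_maps_eqI) (use x k in \<open>simp add: clinear_smult[OF p_linear_left]\<close>)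
  assume y: "y \<in> carrier B"
  have "x \<oplus>\<^bsub>B\<^esub> y \<in> carrier B" using x y by (rule ring.ring_simprules(1)[OF B.ring])
  then have "p k (x \<oplus>\<^bsub>B\<^esub> y) \<in> linear_maps H H" using p_in[OF k] by simp
  moreover have "p k x \<oplus>\<^bsub>operators H\<^esub> p k y \<in> linear_maps H H"
    using H.op_add_in[OF p_in[OF k x] p_in[OF k y]] by simp
  ultimately show "p k (x \<oplus>\<^bsub>B\<^esub> y) = p k x \<oplus>\<^bsub>operators H\<^esub> p k y"
    by (rule linear_maps_eqI) (use x y k in \<open>simp add: clinear_add[OF p_linear_left]\<close>)
qed

lemma P_simple:
  assumes "b \<in> carrier B" "h \<in> carrier H"
  shows "P (simple_tensor B H b h) = (\<Oplus>\<^bsub>H \<otimes>\<^sub>T B\<^esub>k\<in>{..<n}. simple_tensor H B (p k b h) (e k))"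
  using rslice_expand[OF H_space B_space coords P_simple_in[OF assms]] assms by (simp add: p_apply)

lemma rslice_P_simple:
  assumes \<kappa>: "clinear B complex_module \<kappa>" and b: "b \<in> carrier B" and h: "h \<in> carrier H"
  shows "rslice H \<kappa> (P (simple_tensor B H b h)) = (\<Oplus>\<^bsub>H\<^esub>k\<in>{..<n}. \<kappa> (e k) \<odot>\<^bsub>H\<^esub> p k b h)"
  unfolding P_simple[OF b h] using b h by (intro rslice_finsum_simple H_space B_space \<kappa>) auto

lemma combination_apply:
  assumes "\<And>i. i < m \<Longrightarrow> T i \<in> linear_maps H H" "h \<in> carrier H"
  shows "(\<Oplus>\<^bsub>operators H\<^esub>i\<in>{..<m::nat}. c i \<odot>\<^bsub>operators H\<^esub> T i) h = (\<Oplus>\<^bsub>H\<^esub>i\<in>{..<m}. c i \<odot>\<^bsub>H\<^esub> T i h)"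
proof -
  have "(\<Oplus>\<^bsub>operators H\<^esub>i\<in>{..<m}. c i \<odot>\<^bsub>operators H\<^esub> T i) h =
      (\<Oplus>\<^bsub>H\<^esub>i\<in>{..<m}. (c i \<odot>\<^bsub>operators H\<^esub> T i) h)"
    using assms H.op_smult_in by (intro H.finsum_operators_apply) auto
  also have "\<dots> = (\<Oplus>\<^bsub>H\<^esub>i\<in>{..<m}. c i \<odot>\<^bsub>H\<^esub> T i h)"
    using assms linear_mapsD(2)[OF assms(1)] by (intro H.vsum_cong) auto
  finally show ?thesis .
qed

lemma combination_in:
  assumes "\<And>i. i < m \<Longrightarrow> T i \<in> linear_maps H H"
  shows "(\<Oplus>\<^bsub>operators H\<^esub>i\<in>{..<m::nat}. c i \<odot>\<^bsub>operators H\<^esub> T i) \<in> linear_maps H H"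
proof -
  have "(\<Oplus>\<^bsub>operators H\<^esub>i\<in>{..<m}. c i \<odot>\<^bsub>operators H\<^esub> T i) \<in> carrier (operators H)"
    using assms by (intro OH.vsum_closed Pi_I OH.smult_in) simp
  then show ?thesis by simp
qed

text \<open>
  The definition allows any basis \<open>e'\<close>, but the slices of the homomorphism along \<open>e\<close> are always the
  coefficients \<open>p\<close>.
\<close>

lemma quantum_function_iff:
  "quantum_function B H P \<longleftrightarrow> hom_coefficients B (operators H) n e co p"
proof
  interpret X: coordinate_tensor_algebra B "operators H" n e co
    by (intro coordinate_tensor_algebra_B OH.unital_star_algebra_axioms)
  assume "quantum_function B H P"
  then obtain n' e' and p' :: "nat \<Rightarrow> 'b \<Rightarrow> 'h \<Rightarrow> 'h" where basis: "vector_basis B n' e'"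
    and p0: "\<forall>k<n'. \<forall>b\<in>carrier B. p' k b \<in> linear_maps H H"
    and P0: "\<forall>b\<in>carrier B. \<forall>h\<in>carrier H. P (simple_tensor B H b h) =
      (\<Oplus>\<^bsub>H \<otimes>\<^sub>T B\<^esub>k\<in>{..<n'}. simple_tensor H B (p' k b h) (e' k))"
    and hom: "(\<lambda>b\<in>carrier B. \<Oplus>\<^bsub>B \<otimes>\<^sub>T operators H\<^esub>k\<in>{..<n'}.
      simple_tensor B (operators H) (e' k) (p' k b)) \<in> star_hom B (tensor_algebra B (operators H))"
    (is "?r \<in> _")
    unfolding quantum_function_def operators_simps(1) by (elim exE conjE)
  have p': "k < n' \<Longrightarrow> b \<in> carrier B \<Longrightarrow> p' k b \<in> linear_maps H H"
    and P': "b \<in> carrier B \<Longrightarrow> h \<in> carrier H \<Longrightarrow> P (simple_tensor B H b h) =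
      (\<Oplus>\<^bsub>H \<otimes>\<^sub>T B\<^esub>k\<in>{..<n'}. simple_tensor H B (p' k b h) (e' k))" for k b h
    using p0 P0 by blast+
  have e': "e' k \<in> carrier B" if "k < n'" for k
    using basis that by (simp add: vector_basis_def)
  have r_in: "?r b \<in> carrier (B \<otimes>\<^sub>T operators H)" if "b \<in> carrier B" for b
    using that e' p' by (auto intro!: X.T.vsum_closed)
  have h: "hom_coefficients B (operators H) n e co (\<lambda>l b. X.slice l (?r b))"
    using hom r_in by (subst X.star_hom_iff_slices[symmetric]) auto
  have "p l b = X.slice l (?r b)" if l: "l < n" and b: "b \<in> carrier B" for l b
  proof (rule linear_maps_eqI[OF p_in[OF l b]])
    have s: "X.slice l (?r b) = (\<Oplus>\<^bsub>operators H\<^esub>k\<in>{..<n'}. co l (e' k) \<odot>\<^bsub>operators H\<^esub> p' k b)"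
      using l b e' p' by (simp add: X.slice_finsum_simple)
    then show "X.slice l (?r b) \<in> linear_maps H H"
      using combination_in[of n' "\<lambda>k. p' k b"] p' b by simp
    fix h assume hh: "h \<in> carrier H"
    have "p l b h = (\<Oplus>\<^bsub>H\<^esub>k\<in>{..<n'}. co l (e' k) \<odot>\<^bsub>H\<^esub> p' k b h)"
      using hh b e' linear_mapsD(2)[OF p' hh] unfolding p_apply[OF hh] P'[OF b hh]
      by (intro rslice_finsum_simple H_space B_space co_linear[OF l]) auto
    also have "\<dots> = X.slice l (?r b) h"
      unfolding s using p' b hh by (intro combination_apply[symmetric]) auto
    finally show "p l b h = X.slice l (?r b) h" .
  qed
  then show "hom_coefficients B (operators H) n e co p"
    by (intro X.hom_coefficients_cong[OF h])
next
  interpret X: coordinate_tensor_algebra B "operators H" n e co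
    by (intro coordinate_tensor_algebra_B OH.unital_star_algebra_axioms)
  assume h: "hom_coefficients B (operators H) n e co p"
  have "vector_basis B n e"
    using onb by (simp add: orthonormal_basis_def vector_basis_def)
  moreover have "(\<lambda>b\<in>carrier B. \<Oplus>\<^bsub>B \<otimes>\<^sub>T operators H\<^esub>k\<in>{..<n}.
      simple_tensor B (operators H) (e k) (p k b)) \<in> star_hom B (tensor_algebra B (operators H))"
    using p_in h by (subst X.star_hom_finsum_iff[of p]) auto
  ultimately show "quantum_function B H P"
    unfolding quantum_function_def using p_in P_simple
    by (intro exI[of _ n] exI[of _ e] exI[of _ p]) auto
qed

lemma preserves_counit_iff:
  "preserves_counit B \<psi> H P \<longleftrightarrow>
    (\<forall>b\<in>carrier B. \<forall>h\<in>carrier H. (\<Oplus>\<^bsub>H\<^esub>k\<in>{..<n}. \<psi> (e k) \<odot>\<^bsub>H\<^esub> p k b h) = \<psi> b \<odot>\<^bsub>H\<^esub> h)"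
    (is "_ \<longleftrightarrow> ?R")
proof -
  have "preserves_counit B \<psi> H P \<longleftrightarrow>
      (\<forall>t\<in>carrier (B \<otimes>\<^sub>T H). rslice H \<psi> (P t) = lslice H \<psi> t)"
    by (simp add: preserves_counit_def rslice_def lslice_def)
  also have "\<dots> \<longleftrightarrow> (\<forall>b\<in>carrier B. \<forall>h\<in>carrier H.
      rslice H \<psi> (P (simple_tensor B H b h)) = lslice H \<psi> (simple_tensor B H b h))"
    using clinear_tensor_eqI[OF B_space H_space rslice_P_linear[OF psi_linear]
        clinear_lslice[OF B_space H_space psi_linear]] BH.simple_tensor_in by blast
  also have "\<dots> \<longleftrightarrow> ?R"
    by (simp add: rslice_P_simple[OF psi_linear] lslice_simple[OF B_space H_space psi_linear])
  finally show ?thesis .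
qed

lemma commutes_with_A_iff:
  "(\<forall>t\<in>carrier (B \<otimes>\<^sub>T H). P (tensor_map B H A (\<lambda>h. h) t) = tensor_map H B (\<lambda>h. h) A (P t)) \<longleftrightarrow>
    (\<forall>l<n. \<forall>b\<in>carrier B. \<forall>h\<in>carrier H. p l (A b) h = (\<Oplus>\<^bsub>H\<^esub>a\<in>{..<n}. co l (A (e a)) \<odot>\<^bsub>H\<^esub> p a b h))"
    (is "?L \<longleftrightarrow> ?R")
proof -
  note m1 = B_space H_space B_space H_space A_linear clinear_id
    and m2 = H_space B_space H_space B_space clinear_id A_linear
  note Ain = clinear_in[OF A_linear]
  note l1 = clinear_compose[OF clinear_tensor_map[OF m1] P_linear]
    and l2 = clinear_compose[OF P_linear clinear_tensor_map[OF m2]]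
  have coA: "clinear B complex_module (\<lambda>c. co l (A c))" if "l < n" for l
    by (intro clinear_compose[OF A_linear co_linear] that)
  have s: "rslice H (co l) (tensor_map H B (\<lambda>h. h) A t) = rslice H (\<lambda>c. co l (A c)) t"
    if l: "l < n" and t: "t \<in> carrier (H \<otimes>\<^sub>T B)" for l t
  proof (rule clinear_tensor_eqI[OF H_space B_space _ _ t])
    show "clinear (H \<otimes>\<^sub>T B) H (\<lambda>t. rslice H (co l) (tensor_map H B (\<lambda>h. h) A t))"
      by (intro clinear_compose[OF clinear_tensor_map[OF m2] clinear_rslice[OF H_space B_space]] co_linear l)
    show "clinear (H \<otimes>\<^sub>T B) H (rslice H (\<lambda>c. co l (A c)))"
      by (intro clinear_rslice[OF H_space B_space] coA l)
  qed (simp add: tensor_map_simple[OF m2] rslice_simple[OF H_space B_space] co_linear coA l Ain)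
  have "?L \<longleftrightarrow> (\<forall>b\<in>carrier B. \<forall>h\<in>carrier H. P (tensor_map B H A (\<lambda>h. h) (simple_tensor B H b h)) =
      tensor_map H B (\<lambda>h. h) A (P (simple_tensor B H b h)))"
    using clinear_tensor_eqI[OF B_space H_space l1 l2] BH.simple_tensor_in by blast
  also have "\<dots> \<longleftrightarrow> (\<forall>b\<in>carrier B. \<forall>h\<in>carrier H. \<forall>l<n.
      p l (A b) h = (\<Oplus>\<^bsub>H\<^esub>a\<in>{..<n}. co l (A (e a)) \<odot>\<^bsub>H\<^esub> p a b h))"
  proof (intro ball_cong refl)
    fix b h assume b: "b \<in> carrier B" and h: "h \<in> carrier H"
    note Pin = P_simple_in[OF b h] and PAin = P_simple_in[OF Ain[OF b] h]
    have tin: "tensor_map H B (\<lambda>h. h) A (P (simple_tensor B H b h)) \<in> carrier (H \<otimes>\<^sub>T B)"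
      by (intro clinear_in[OF clinear_tensor_map[OF m2]] Pin)
    have sl: "rslice H (co l) (tensor_map H B (\<lambda>h. h) A (P (simple_tensor B H b h))) =
        (\<Oplus>\<^bsub>H\<^esub>a\<in>{..<n}. co l (A (e a)) \<odot>\<^bsub>H\<^esub> p a b h)" if "l < n" for l
      using s[OF that Pin] rslice_P_simple[OF coA[OF that] b h] by simp
    have "P (simple_tensor B H (A b) h) = tensor_map H B (\<lambda>h. h) A (P (simple_tensor B H b h)) \<longleftrightarrow>
        (\<forall>l<n. rslice H (co l) (P (simple_tensor B H (A b) h)) =
          rslice H (co l) (tensor_map H B (\<lambda>h. h) A (P (simple_tensor B H b h))))"
      using rslice_eqI[OF H_space B_space coords PAin tin] by auto
    then show "P (tensor_map B H A (\<lambda>h. h) (simple_tensor B H b h)) =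
          tensor_map H B (\<lambda>h. h) A (P (simple_tensor B H b h)) \<longleftrightarrow>
        (\<forall>l<n. p l (A b) h = (\<Oplus>\<^bsub>H\<^esub>a\<in>{..<n}. co l (A (e a)) \<odot>\<^bsub>H\<^esub> p a b h))"
      using b h by (simp add: tensor_map_simple[OF m1] p_apply sl)
  qed
  finally show ?thesis by blast
qed

lemma BB_space: "complex_space (B \<otimes>\<^sub>T B)"
  by (intro complex_space_tensor B_space)

text \<open>
  By \<open>co2_expand\<close>, the slices along the basis \<open>e\<^sub>k \<otimes> e\<^sub>l\<close> recover a tensor in \<open>H \<otimes> (B \<otimes> B)\<close>.
\<close>

lemma double_rslice_eqI:
  assumes s: "s \<in> carrier (H \<otimes>\<^sub>T (B \<otimes>\<^sub>T B))" and t: "t \<in> carrier (H \<otimes>\<^sub>T (B \<otimes>\<^sub>T B))"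
    and eq: "\<And>k l. k < n \<Longrightarrow> l < n \<Longrightarrow> rslice H (co2 k l) s = rslice H (co2 k l) t"
  shows "s = t"
proof -
  interpret BB: complex_space "B \<otimes>\<^sub>T B" by (rule BB_space)
  interpret X: tensor_factors H "B \<otimes>\<^sub>T B" ..
  note st = simple_tensor_in[OF B_space B_space]
  let ?e = "\<lambda>k l. simple_tensor B B (e k) (e l)"
  let ?E = "\<lambda>t. \<Oplus>\<^bsub>H \<otimes>\<^sub>T (B \<otimes>\<^sub>T B)\<^esub>k\<in>{..<n}. \<Oplus>\<^bsub>H \<otimes>\<^sub>T (B \<otimes>\<^sub>T B)\<^esub>l\<in>{..<n}.
      simple_tensor H (B \<otimes>\<^sub>T B) (rslice H (co2 k l) t) (?e k l)"
  note sl = clinear_rslice[OF H_space BB_space co2_linear]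
  have lin: "clinear (H \<otimes>\<^sub>T (B \<otimes>\<^sub>T B)) (H \<otimes>\<^sub>T (B \<otimes>\<^sub>T B)) ?E"
    using st by (intro clinear_finsum_fun X.T.complex_space_axioms
        clinear_compose[OF sl X.simple_tensor_linear(2)]) auto
  have expand: "r = ?E r" if r: "r \<in> carrier (H \<otimes>\<^sub>T (B \<otimes>\<^sub>T B))" for r
  proof (rule clinear_tensor_eqI[OF H_space BB_space clinear_id lin r])
    fix h z assume h: "h \<in> carrier H" and z: "z \<in> carrier (B \<otimes>\<^sub>T B)"
    note sx = X.simple_tensor_linear(1)[OF h]
    note fin = clinear_finsum[OF BB_space X.T.complex_space_axioms sx]
    have inn: "(\<Oplus>\<^bsub>B \<otimes>\<^sub>T B\<^esub>l\<in>{..<n}. co2 k l z \<odot>\<^bsub>B \<otimes>\<^sub>T B\<^esub> ?e k l) \<in> carrier (B \<otimes>\<^sub>T B)"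
      if "k < n" for k using that st by (intro BB.vsum_closed) auto
    have "simple_tensor H (B \<otimes>\<^sub>T B) h z = simple_tensor H (B \<otimes>\<^sub>T B) h
        (\<Oplus>\<^bsub>B \<otimes>\<^sub>T B\<^esub>k\<in>{..<n}. \<Oplus>\<^bsub>B \<otimes>\<^sub>T B\<^esub>l\<in>{..<n}. co2 k l z \<odot>\<^bsub>B \<otimes>\<^sub>T B\<^esub> ?e k l)"
      using co2_expand[OF z] by simp
    also have "\<dots> = (\<Oplus>\<^bsub>H \<otimes>\<^sub>T (B \<otimes>\<^sub>T B)\<^esub>k\<in>{..<n}. simple_tensor H (B \<otimes>\<^sub>T B) h
        (\<Oplus>\<^bsub>B \<otimes>\<^sub>T B\<^esub>l\<in>{..<n}. co2 k l z \<odot>\<^bsub>B \<otimes>\<^sub>T B\<^esub> ?e k l))"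
      using inn by (intro fin) auto
    also have "\<dots> = (\<Oplus>\<^bsub>H \<otimes>\<^sub>T (B \<otimes>\<^sub>T B)\<^esub>k\<in>{..<n}. \<Oplus>\<^bsub>H \<otimes>\<^sub>T (B \<otimes>\<^sub>T B)\<^esub>l\<in>{..<n}.
        simple_tensor H (B \<otimes>\<^sub>T B) h (co2 k l z \<odot>\<^bsub>B \<otimes>\<^sub>T B\<^esub> ?e k l))"
      using st h by (intro X.T.vsum_cong fin) (auto intro!: X.T.vsum_closed)
    also have "\<dots> = ?E (simple_tensor H (B \<otimes>\<^sub>T B) h z)"
      using st h z by (intro X.T.vsum_cong)
        (auto simp: rslice_simple[OF H_space BB_space co2_linear] clinear_smult[OF sx]
          clinear_smult[OF X.simple_tensor_linear(2)] intro!: X.T.vsum_closed)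
    finally show "simple_tensor H (B \<otimes>\<^sub>T B) h z = ?E (simple_tensor H (B \<otimes>\<^sub>T B) h z)" .
  qed
  have sE: "rslice H (co2 k l) r \<in> carrier H" if "k < n" "l < n" "r \<in> carrier (H \<otimes>\<^sub>T (B \<otimes>\<^sub>T B))" for k l r
    using clinear_in[OF sl] that by simp
  have "?E s = ?E t"
    using sE t st by (intro X.T.vsum_cong) (auto simp: eq intro!: X.T.vsum_closed)
  then show ?thesis
    by (rule box_equals[OF _ expand[OF s, symmetric] expand[OF t, symmetric]])
qed

text \<open>The composite \<open>(P \<otimes> id) (id \<otimes> P)\<close> on \<open>(B \<otimes> B) \<otimes> H\<close>, with values in \<open>H \<otimes> (B \<otimes> B)\<close>.\<close>

definition double_P :: "(('b, 'b) tens, 'h) tens \<Rightarrow> ('h, ('b, 'b) tens) tens" where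
  "double_P r = tensor_assoc H B B
     (tensor_map (H \<otimes>\<^sub>T B) B P (\<lambda>b. b)
       (tensor_assoc_inv B H B
         (tensor_map B (H \<otimes>\<^sub>T B) (\<lambda>b. b) P
           (tensor_assoc B B H r))))"

lemmas HB_space = HB.T.complex_space_axioms and BH_space = BH.T.complex_space_axioms

lemmas assoc_steps =
  clinear_tensor_assoc[OF B_space B_space H_space]
  clinear_tensor_map[OF B_space BH_space B_space HB_space clinear_id P_linear]
  clinear_tensor_assoc_inv[OF B_space H_space B_space]
  clinear_tensor_map[OF BH_space B_space HB_space B_space P_linear clinear_id]
  clinear_tensor_assoc[OF H_space B_space B_space]

lemma double_P_linear: "clinear ((B \<otimes>\<^sub>T B) \<otimes>\<^sub>T H) (H \<otimes>\<^sub>T (B \<otimes>\<^sub>T B)) double_P"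
  unfolding double_P_def
  by (rule clinear_compose[OF clinear_compose[OF clinear_compose[OF clinear_compose[OF
        assoc_steps(1) assoc_steps(2)] assoc_steps(3)] assoc_steps(4)] assoc_steps(5)])

text \<open>
  \<open>P\<close> acts on \<open>y \<otimes> h\<close> first and contributes \<open>p\<^sub>l(y) h \<otimes> e\<^sub>l\<close>; then it acts on \<open>x \<otimes> p\<^sub>l(y) h\<close>. Since \<open>P\<close> is
  applied to tensors that are not simple, each stage is first evaluated on arbitrary tensors.
\<close>

lemma double_P_simple:
  assumes kl: "k < n" "l < n" and x: "x \<in> carrier B" and y: "y \<in> carrier B" and h: "h \<in> carrier H"
  shows "rslice H (co2 k l) (double_P (simple_tensor (B \<otimes>\<^sub>T B) H (simple_tensor B B x y) h)) =
    p k x (p l y h)"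
proof -
  interpret BB: complex_space "B \<otimes>\<^sub>T B" by (rule BB_space)
  note co2' = clinear_rslice[OF H_space BB_space co2_linear[OF kl]]
  let ?L3 = "\<lambda>r c. rslice H (co2 k l) (tensor_assoc H B B (simple_tensor (H \<otimes>\<^sub>T B) B r c))"
  have L3: "?L3 r c = co l c \<odot>\<^bsub>H\<^esub> rslice H (co k) r"
    if c: "c \<in> carrier B" and r: "r \<in> carrier (H \<otimes>\<^sub>T B)" for r c
  proof (rule clinear_tensor_eqI[OF H_space B_space _ _ r])
    show "clinear (H \<otimes>\<^sub>T B) H (\<lambda>r. ?L3 r c)"
      by (rule clinear_compose[OF clinear_compose[OF simple_tensor_linear(2)[OF HB_space B_space c]
            assoc_steps(5)] co2'])
    show "clinear (H \<otimes>\<^sub>T B) H (\<lambda>r. co l c \<odot>\<^bsub>H\<^esub> rslice H (co k) r)"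
      by (intro clinear_scaled H_space clinear_rslice B_space co_linear kl)
    fix h' c' assume "h' \<in> carrier H" "c' \<in> carrier B"
    then show "?L3 (simple_tensor H B h' c') c = co l c \<odot>\<^bsub>H\<^esub> rslice H (co k) (simple_tensor H B h' c')"
      using c kl by (simp add: tensor_assoc_simple[OF H_space B_space B_space]
          rslice_simple[OF H_space BB_space co2_linear] rslice_simple[OF H_space B_space co_linear]
          simple_tensor_in[OF B_space B_space] co2_simple H.smult_smult mult.commute)
  qed
  let ?L2 = "\<lambda>r. rslice H (co2 k l) (tensor_assoc H B B (tensor_map (H \<otimes>\<^sub>T B) B P (\<lambda>b. b)
      (tensor_assoc_inv B H B (simple_tensor B (H \<otimes>\<^sub>T B) x r))))"
  have L2: "?L2 r = p k x (rslice H (co l) r)" if r: "r \<in> carrier (H \<otimes>\<^sub>T B)" for r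
  proof (rule clinear_tensor_eqI[OF H_space B_space _ _ r])
    show "clinear (H \<otimes>\<^sub>T B) H ?L2"
      by (rule clinear_compose[OF clinear_compose[OF clinear_compose[OF clinear_compose[OF
            simple_tensor_linear(1)[OF B_space HB_space x] assoc_steps(3)] assoc_steps(4)]
            assoc_steps(5)] co2'])
    show "clinear (H \<otimes>\<^sub>T B) H (\<lambda>r. p k x (rslice H (co l) r))"
      by (rule clinear_compose[OF clinear_rslice[OF H_space B_space co_linear[OF kl(2)]]
            linear_mapsD(1)[OF p_in[OF kl(1) x]]])
    fix h' c' assume h': "h' \<in> carrier H" and c': "c' \<in> carrier B"
    then have "?L2 (simple_tensor H B h' c') = ?L3 (P (simple_tensor B H x h')) c'"
      using x by (simp add: tensor_assoc_inv_simple[OF B_space H_space B_space]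
          tensor_map_simple[OF BH_space B_space HB_space B_space P_linear clinear_id] BH.simple_tensor_in)
    also have "\<dots> = p k x (co l c' \<odot>\<^bsub>H\<^esub> h')"
      using L3[OF c' P_simple_in[OF x h']] h' x kl
      by (simp add: p_apply[symmetric] clinear_smult[OF linear_mapsD(1)[OF p_in]])
    finally show "?L2 (simple_tensor H B h' c') = p k x (rslice H (co l) (simple_tensor H B h' c'))"
      using h' c' kl by (simp add: rslice_simple[OF H_space B_space co_linear])
  qed
  have "rslice H (co2 k l) (double_P (simple_tensor (B \<otimes>\<^sub>T B) H (simple_tensor B B x y) h)) =
      ?L2 (P (simple_tensor B H y h))"
    unfolding double_P_def using x y h
    by (simp add: tensor_assoc_simple[OF B_space B_space H_space] BH.simple_tensor_in
        tensor_map_simple[OF B_space BH_space B_space HB_space clinear_id P_linear])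
  also have "\<dots> = p k x (p l y h)"
    using L2[OF P_simple_in[OF y h]] h by (simp add: p_apply)
  finally show ?thesis .
qed

lemma double_P_slice:
  assumes kl: "k < n" "l < n" and r: "r \<in> carrier (B \<otimes>\<^sub>T B)" and h: "h \<in> carrier H"
  shows "rslice H (co2 k l) (double_P (simple_tensor (B \<otimes>\<^sub>T B) H r h)) =
    (\<Oplus>\<^bsub>H\<^esub>i\<in>{..<n}. \<Oplus>\<^bsub>H\<^esub>j\<in>{..<n}. co2 i j r \<odot>\<^bsub>H\<^esub> p k (e i) (p l (e j) h))"
proof (rule clinear_tensor_eqI[OF B_space B_space _ _ r])
  show "clinear (B \<otimes>\<^sub>T B) H (\<lambda>r. rslice H (co2 k l) (double_P (simple_tensor (B \<otimes>\<^sub>T B) H r h)))"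
    by (rule clinear_compose[OF clinear_compose[OF simple_tensor_linear(2)[OF BB_space H_space h]
          double_P_linear] clinear_rslice[OF H_space BB_space co2_linear[OF kl]]])
  show "clinear (B \<otimes>\<^sub>T B) H
      (\<lambda>r. \<Oplus>\<^bsub>H\<^esub>i\<in>{..<n}. \<Oplus>\<^bsub>H\<^esub>j\<in>{..<n}. co2 i j r \<odot>\<^bsub>H\<^esub> p k (e i) (p l (e j) h))"
    using kl h by (intro clinear_finsum_fun clinear_coeff_smult H_space BB_space co2_linear) auto
  fix x y assume x: "x \<in> carrier B" and y: "y \<in> carrier B"
  note pk = linear_mapsD(1)[OF p_in[OF kl(1)]]
  have "p k x (p l y h) = (\<Oplus>\<^bsub>H\<^esub>i\<in>{..<n}. co i x \<odot>\<^bsub>H\<^esub> p k (e i) (p l y h))"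
    using kl y h by (intro clinear_expand[OF coords B_space H_space p_linear_left x]) auto
  also have "\<dots> = (\<Oplus>\<^bsub>H\<^esub>i\<in>{..<n}. \<Oplus>\<^bsub>H\<^esub>j\<in>{..<n}. (co i x * co j y) \<odot>\<^bsub>H\<^esub> p k (e i) (p l (e j) h))"
  proof (rule H.vsum_cong[OF refl])
    fix i assume "i \<in> {..<n}"
    then have i: "i < n" by simp
    have "p k (e i) (p l y h) = (\<Oplus>\<^bsub>H\<^esub>j\<in>{..<n}. co j y \<odot>\<^bsub>H\<^esub> p k (e i) (p l (e j) h))"
      by (rule clinear_expand[OF coords B_space H_space
            clinear_compose[OF p_linear_left[OF kl(2) h] pk[OF e_in[OF i]]] y])
    then show "co i x \<odot>\<^bsub>H\<^esub> p k (e i) (p l y h) =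
        (\<Oplus>\<^bsub>H\<^esub>j\<in>{..<n}. (co i x * co j y) \<odot>\<^bsub>H\<^esub> p k (e i) (p l (e j) h))"
      using i kl h by (simp add: H.smult_finsum Pi_def) (intro H.vsum_cong, auto simp: H.smult_smult)
  qed (use kl h in \<open>auto intro!: H.vsum_closed\<close>)
  also have "\<dots> = (\<Oplus>\<^bsub>H\<^esub>i\<in>{..<n}. \<Oplus>\<^bsub>H\<^esub>j\<in>{..<n}.
      co2 i j (simple_tensor B B x y) \<odot>\<^bsub>H\<^esub> p k (e i) (p l (e j) h))"
    using kl h x y by (intro H.vsum_cong) (auto simp: co2_simple intro!: H.vsum_closed)
  finally show "rslice H (co2 k l) (double_P (simple_tensor (B \<otimes>\<^sub>T B) H (simple_tensor B B x y) h)) =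
      (\<Oplus>\<^bsub>H\<^esub>i\<in>{..<n}. \<Oplus>\<^bsub>H\<^esub>j\<in>{..<n}.
        co2 i j (simple_tensor B B x y) \<odot>\<^bsub>H\<^esub> p k (e i) (p l (e j) h))"
    by (simp add: double_P_simple[OF kl x y h])
qed

text \<open>
  Slicing \<open>(id \<otimes> m\<^sup>\<dagger>) P\<close> at \<open>e\<^sub>k \<otimes> e\<^sub>l\<close> amounts to slicing \<open>P\<close> along the functional \<open>\<langle>e\<^sub>k e\<^sub>l, _\<rangle>\<close>.
\<close>

lemma preserves_comult_iff:
  "preserves_comult B \<psi> H P \<longleftrightarrow> (\<forall>k<n. \<forall>l<n. \<forall>b\<in>carrier B. \<forall>h\<in>carrier H.
    (\<Oplus>\<^bsub>H\<^esub>i\<in>{..<n}. \<Oplus>\<^bsub>H\<^esub>j\<in>{..<n}. dco i j b \<odot>\<^bsub>H\<^esub> p k (e i) (p l (e j) h)) =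
    (\<Oplus>\<^bsub>H\<^esub>m\<in>{..<n}. dco k l (e m) \<odot>\<^bsub>H\<^esub> p m b h))"
proof -
  let ?\<Delta> = "comult B \<psi>"
  note m1 = B_space H_space BB_space H_space comult_linear clinear_id
    and m2 = H_space B_space H_space BB_space clinear_id comult_linear
  let ?L = "\<lambda>t. double_P (tensor_map (B \<otimes>\<^sub>T B) H ?\<Delta> (\<lambda>h. h) t)"
    and ?R = "\<lambda>t. tensor_map H (B \<otimes>\<^sub>T B) (\<lambda>h. h) ?\<Delta> (P t)"
  have lL: "clinear (B \<otimes>\<^sub>T H) (H \<otimes>\<^sub>T (B \<otimes>\<^sub>T B)) ?L"
    by (rule clinear_compose[OF clinear_tensor_map[OF m1] double_P_linear])
  have lR: "clinear (B \<otimes>\<^sub>T H) (H \<otimes>\<^sub>T (B \<otimes>\<^sub>T B)) ?R"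
    by (rule clinear_compose[OF P_linear clinear_tensor_map[OF m2]])
  have L: "rslice H (co2 k l) (?L (simple_tensor B H b h)) =
      (\<Oplus>\<^bsub>H\<^esub>i\<in>{..<n}. \<Oplus>\<^bsub>H\<^esub>j\<in>{..<n}. dco i j b \<odot>\<^bsub>H\<^esub> p k (e i) (p l (e j) h))"
    if kl: "k < n" "l < n" and b: "b \<in> carrier B" and h: "h \<in> carrier H" for k l b h
  proof -
    have "rslice H (co2 k l) (?L (simple_tensor B H b h)) =
        (\<Oplus>\<^bsub>H\<^esub>i\<in>{..<n}. \<Oplus>\<^bsub>H\<^esub>j\<in>{..<n}. co2 i j (?\<Delta> b) \<odot>\<^bsub>H\<^esub> p k (e i) (p l (e j) h))"
      using double_P_slice[OF kl comult_in[OF b] h] b h by (simp add: tensor_map_simple[OF m1])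
    also have "\<dots> = (\<Oplus>\<^bsub>H\<^esub>i\<in>{..<n}. \<Oplus>\<^bsub>H\<^esub>j\<in>{..<n}. dco i j b \<odot>\<^bsub>H\<^esub> p k (e i) (p l (e j) h))"
      using kl b h by (intro H.vsum_cong) (auto simp: co2_comult intro!: H.vsum_closed)
    finally show ?thesis .
  qed
  have R: "rslice H (co2 k l) (?R (simple_tensor B H b h)) =
      (\<Oplus>\<^bsub>H\<^esub>m\<in>{..<n}. dco k l (e m) \<odot>\<^bsub>H\<^esub> p m b h)"
    if kl: "k < n" "l < n" and b: "b \<in> carrier B" and h: "h \<in> carrier H" for k l b h
  proof -
    have "rslice H (co2 k l) (tensor_map H (B \<otimes>\<^sub>T B) (\<lambda>h. h) ?\<Delta> t) = rslice H (dco k l) t"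
      if t: "t \<in> carrier (H \<otimes>\<^sub>T B)" for t
    proof (rule clinear_tensor_eqI[OF H_space B_space _ _ t])
      show "clinear (H \<otimes>\<^sub>T B) H (\<lambda>t. rslice H (co2 k l) (tensor_map H (B \<otimes>\<^sub>T B) (\<lambda>h. h) ?\<Delta> t))"
        by (rule clinear_compose[OF clinear_tensor_map[OF m2]
              clinear_rslice[OF H_space BB_space co2_linear[OF kl]]])
      show "clinear (H \<otimes>\<^sub>T B) H (rslice H (dco k l))"
        by (intro clinear_rslice H_space B_space dco_linear kl)
    qed (simp add: tensor_map_simple[OF m2] rslice_simple[OF H_space BB_space co2_linear[OF kl]]
        rslice_simple[OF H_space B_space dco_linear[OF kl]] comult_in co2_comult kl)
    then show ?thesis
      using rslice_P_simple[OF dco_linear[OF kl] b h] P_simple_in[OF b h] by simp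
  qed
  have "preserves_comult B \<psi> H P \<longleftrightarrow> (\<forall>t\<in>carrier (B \<otimes>\<^sub>T H). ?L t = ?R t)"
    by (simp add: preserves_comult_def double_P_def)
  also have "\<dots> \<longleftrightarrow> (\<forall>b\<in>carrier B. \<forall>h\<in>carrier H. ?L (simple_tensor B H b h) = ?R (simple_tensor B H b h))"
    using clinear_tensor_eqI[OF B_space H_space lL lR] BH.simple_tensor_in by blast
  also have "\<dots> \<longleftrightarrow> (\<forall>b\<in>carrier B. \<forall>h\<in>carrier H. \<forall>k<n. \<forall>l<n.
      rslice H (co2 k l) (?L (simple_tensor B H b h)) = rslice H (co2 k l) (?R (simple_tensor B H b h)))"
  proof (intro ball_cong refl)
    fix b h assume b: "b \<in> carrier B" and h: "h \<in> carrier H"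
    note bh = BH.simple_tensor_in[OF b h]
    from double_rslice_eqI[OF clinear_in[OF lL bh] clinear_in[OF lR bh]]
    show "?L (simple_tensor B H b h) = ?R (simple_tensor B H b h) \<longleftrightarrow> (\<forall>k<n. \<forall>l<n.
      rslice H (co2 k l) (?L (simple_tensor B H b h)) = rslice H (co2 k l) (?R (simple_tensor B H b h)))"
      by auto
  qed
  also have "\<dots> \<longleftrightarrow> (\<forall>k<n. \<forall>l<n. \<forall>b\<in>carrier B. \<forall>h\<in>carrier H.
    (\<Oplus>\<^bsub>H\<^esub>i\<in>{..<n}. \<Oplus>\<^bsub>H\<^esub>j\<in>{..<n}. dco i j b \<odot>\<^bsub>H\<^esub> p k (e i) (p l (e j) h)) =
    (\<Oplus>\<^bsub>H\<^esub>m\<in>{..<n}. dco k l (e m) \<odot>\<^bsub>H\<^esub> p m b h))"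
    by (auto simp: L R)
  finally show ?thesis .
qed

end

section \<open>The isomorphism of categories\<close>

context quantum_graph_action
begin

lemma preserves_psi_iff:
  assumes "quantum_graph_coaction B \<psi> A n e (operators H) p"
  shows "quantum_graph_coaction.preserves_psi B \<psi> n e (operators H) p \<longleftrightarrow> preserves_counit B \<psi> H P"
proof -
  interpret R: quantum_graph_coaction B \<psi> A n e "operators H" p by fact
  have "R.counit_part b = \<psi> b \<odot>\<^bsub>operators H\<^esub> \<one>\<^bsub>operators H\<^esub> \<longleftrightarrow>
      (\<forall>h\<in>carrier H. (\<Oplus>\<^bsub>H\<^esub>k\<in>{..<n}. \<psi> (e k) \<odot>\<^bsub>H\<^esub> p k b h) = \<psi> b \<odot>\<^bsub>H\<^esub> h)"
    if b: "b \<in> carrier B" for b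
  proof -
    have l: "R.counit_part b \<in> linear_maps H H" and r: "\<psi> b \<odot>\<^bsub>operators H\<^esub> \<one>\<^bsub>operators H\<^esub> \<in> linear_maps H H"
      using clinear_in[OF R.counit_part_linear b] OH.smult_in[OF OH.unit_in] by simp_all
    have "R.counit_part b h = (\<Oplus>\<^bsub>H\<^esub>k\<in>{..<n}. \<psi> (e k) \<odot>\<^bsub>H\<^esub> p k b h)" if "h \<in> carrier H" for h
      unfolding R.counit_part_def using p_in b that by (intro combination_apply) auto
    then show ?thesis using linear_maps_eq_iff[OF l r] by simp
  qed
  then show ?thesis by (simp add: R.preserves_psi_def preserves_counit_iff)
qed

lemma comultiplicative_iff:
  assumes "quantum_graph_coaction B \<psi> A n e (operators H) p"
  shows "quantum_graph_coaction.comultiplicative B \<psi> n e (operators H) p \<longleftrightarrow> preserves_comult B \<psi> H P"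
proof -
  interpret R: quantum_graph_coaction B \<psi> A n e "operators H" p by fact
  have "(\<Oplus>\<^bsub>operators H\<^esub>i\<in>{..<n}. \<Oplus>\<^bsub>operators H\<^esub>j\<in>{..<n}.
        dco i j b \<odot>\<^bsub>operators H\<^esub> (p k (e i) \<otimes>\<^bsub>operators H\<^esub> p l (e j))) =
      (\<Oplus>\<^bsub>operators H\<^esub>m\<in>{..<n}. dco k l (e m) \<odot>\<^bsub>operators H\<^esub> p m b) \<longleftrightarrow>
      (\<forall>h\<in>carrier H. (\<Oplus>\<^bsub>H\<^esub>i\<in>{..<n}. \<Oplus>\<^bsub>H\<^esub>j\<in>{..<n}. dco i j b \<odot>\<^bsub>H\<^esub> p k (e i) (p l (e j) h)) =
        (\<Oplus>\<^bsub>H\<^esub>m\<in>{..<n}. dco k l (e m) \<odot>\<^bsub>H\<^esub> p m b h))"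
    (is "?L = ?R \<longleftrightarrow> _") if kl: "k < n" "l < n" and b: "b \<in> carrier B" for k l b
  proof -
    let ?T = "\<lambda>i j. p k (e i) \<otimes>\<^bsub>operators H\<^esub> p l (e j)"
    have T: "?T i j \<in> linear_maps H H" if "i < n" "j < n" for i j
      using H.op_compose_in[OF p_in[OF kl(1)] p_in[OF kl(2)]] that by simp
    have inn: "(\<Oplus>\<^bsub>operators H\<^esub>j\<in>{..<n}. dco i j b \<odot>\<^bsub>operators H\<^esub> ?T i j) \<in> linear_maps H H"
      if "i < n" for i by (intro combination_in T that)
    have l: "?L \<in> linear_maps H H"
      using OH.vsum_closed[of "\<lambda>i. \<Oplus>\<^bsub>operators H\<^esub>j\<in>{..<n}. dco i j b \<odot>\<^bsub>operators H\<^esub> ?T i j" "{..<n}"] inn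
      by (simp only: operators_simps(1)) auto
    have r: "?R \<in> linear_maps H H" by (intro combination_in p_in b)
    have "?L h = (\<Oplus>\<^bsub>H\<^esub>i\<in>{..<n}. \<Oplus>\<^bsub>H\<^esub>j\<in>{..<n}. dco i j b \<odot>\<^bsub>H\<^esub> p k (e i) (p l (e j) h))"
      if h: "h \<in> carrier H" for h
    proof -
      have "?L h = (\<Oplus>\<^bsub>H\<^esub>i\<in>{..<n}. (\<Oplus>\<^bsub>operators H\<^esub>j\<in>{..<n}. dco i j b \<odot>\<^bsub>operators H\<^esub> ?T i j) h)"
        using inn by (intro H.finsum_operators_apply Pi_I h) simp
      also have "\<dots> = (\<Oplus>\<^bsub>H\<^esub>i\<in>{..<n}. \<Oplus>\<^bsub>H\<^esub>j\<in>{..<n}. dco i j b \<odot>\<^bsub>H\<^esub> p k (e i) (p l (e j) h))"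
      proof (rule H.vsum_cong[OF refl])
        fix i assume "i \<in> {..<n}"
        then have i: "i < n" by simp
        have "(\<Oplus>\<^bsub>operators H\<^esub>j\<in>{..<n}. dco i j b \<odot>\<^bsub>operators H\<^esub> ?T i j) h =
            (\<Oplus>\<^bsub>H\<^esub>j\<in>{..<n}. dco i j b \<odot>\<^bsub>H\<^esub> ?T i j h)"
          by (intro combination_apply T i h)
        then show "(\<Oplus>\<^bsub>operators H\<^esub>j\<in>{..<n}. dco i j b \<odot>\<^bsub>operators H\<^esub> ?T i j) h =
            (\<Oplus>\<^bsub>H\<^esub>j\<in>{..<n}. dco i j b \<odot>\<^bsub>H\<^esub> p k (e i) (p l (e j) h))"
          using h by (simp add: compose_eq)
      qed (use kl h in \<open>auto intro!: H.vsum_closed\<close>)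
      finally show ?thesis .
    qed
    moreover have "?R h = (\<Oplus>\<^bsub>H\<^esub>m\<in>{..<n}. dco k l (e m) \<odot>\<^bsub>H\<^esub> p m b h)" if h: "h \<in> carrier H" for h
      by (intro combination_apply p_in b h)
    ultimately show ?thesis using linear_maps_eq_iff[OF l r] by simp
  qed
  then show ?thesis by (simp add: R.comultiplicative_def preserves_comult_iff)
qed

text \<open>
  The homomorphism property and the compatibility with \<open>A\<close> agree coefficient by coefficient; the rest is
  \<open>unitary_iff\<close> in the algebra of operators.
\<close>

lemma quantum_automorphism_iff:
  assumes v: "\<And>k i. k < n \<Longrightarrow> i < n \<Longrightarrow> v k i = p k (e i)"
  shows "quantum_automorphism B \<psi> A H P \<longleftrightarrow> qut_data (operators H) v"
proof -
  interpret X: coordinate_tensor_algebra B "operators H" n e co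
    by (intro coordinate_tensor_algebra_B OH.unital_star_algebra_axioms)
  have rho: "rho (operators H) v l b = p l b" if "l < n" "b \<in> carrier B" for l b
    using that v by (intro rho_eq OH.complex_space_axioms p_linear) auto
  have hom: "hom_coefficients B (operators H) n e co (rho (operators H) v) \<longleftrightarrow>
      hom_coefficients B (operators H) n e co p"
    using X.hom_coefficients_cong[of p "rho (operators H) v"]
      X.hom_coefficients_cong[of "rho (operators H) v" p] rho by auto
  have A: "(\<forall>l<n. \<forall>b\<in>carrier B. rho (operators H) v l (A b) =
        (\<Oplus>\<^bsub>operators H\<^esub>a\<in>{..<n}. co l (A (e a)) \<odot>\<^bsub>operators H\<^esub> rho (operators H) v a b)) \<longleftrightarrow>
      (\<forall>t\<in>carrier (B \<otimes>\<^sub>T H). P (tensor_map B H A (\<lambda>h. h) t) = tensor_map H B (\<lambda>h. h) A (P t))"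
  proof -
    have "rho (operators H) v l (A b) =
        (\<Oplus>\<^bsub>operators H\<^esub>a\<in>{..<n}. co l (A (e a)) \<odot>\<^bsub>operators H\<^esub> rho (operators H) v a b) \<longleftrightarrow>
        (\<forall>h\<in>carrier H. p l (A b) h = (\<Oplus>\<^bsub>H\<^esub>a\<in>{..<n}. co l (A (e a)) \<odot>\<^bsub>H\<^esub> p a b h))"
      if l: "l < n" and b: "b \<in> carrier B" for l b
    proof -
      have Ab: "A b \<in> carrier B" using clinear_in[OF A_linear b] .
      have eq: "(\<Oplus>\<^bsub>operators H\<^esub>a\<in>{..<n}. co l (A (e a)) \<odot>\<^bsub>operators H\<^esub> rho (operators H) v a b) =
          (\<Oplus>\<^bsub>operators H\<^esub>a\<in>{..<n}. co l (A (e a)) \<odot>\<^bsub>operators H\<^esub> p a b)"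
        using p_in[OF _ b] H.op_smult_in[OF p_in[OF _ b]] b by (intro OH.vsum_cong) (auto simp: rho)
      have in2: "(\<Oplus>\<^bsub>operators H\<^esub>a\<in>{..<n}. co l (A (e a)) \<odot>\<^bsub>operators H\<^esub> p a b) \<in> linear_maps H H"
        by (intro combination_in p_in b)
      have "(\<Oplus>\<^bsub>operators H\<^esub>a\<in>{..<n}. co l (A (e a)) \<odot>\<^bsub>operators H\<^esub> p a b) h =
          (\<Oplus>\<^bsub>H\<^esub>a\<in>{..<n}. co l (A (e a)) \<odot>\<^bsub>H\<^esub> p a b h)" if "h \<in> carrier H" for h
        by (intro combination_apply p_in b that)
      then show ?thesis
        using linear_maps_eq_iff[OF p_in[OF l Ab] in2] by (simp only: eq rho[OF l Ab]) simp
    qed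
    then show ?thesis by (simp add: commutes_with_A_iff)
  qed
  have U: "unitary_matrix (operators H) n v \<longleftrightarrow> preserves_counit B \<psi> H P \<and> preserves_comult B \<psi> H P"
    if h: "hom_coefficients B (operators H) n e co p"
  proof -
    have co: "quantum_graph_coaction B \<psi> A n e (operators H) p"
      by (intro quantum_graph_coaction.intro quantum_graph_basis_axioms OH.unital_star_algebra_axioms
          quantum_graph_coaction_axioms.intro h)
    interpret R: quantum_graph_coaction B \<psi> A n e "operators H" p by (rule co)
    have "unitary_matrix (operators H) n v \<longleftrightarrow> R.columns \<and> R.rows"
    proof -
      have vin: "v k i \<in> carrier (operators H)" if "k < n" "i < n" for k i
        using that p_in by (simp add: v)
      have "(\<Oplus>\<^bsub>operators H\<^esub>k\<in>{..<n}. star (operators H) (v k i) \<otimes>\<^bsub>operators H\<^esub> v k j) =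
          (\<Oplus>\<^bsub>operators H\<^esub>k\<in>{..<n}. star (operators H) (p k (e i)) \<otimes>\<^bsub>operators H\<^esub> p k (e j))"
        if "i < n" "j < n" for i j
        using that vin R.rho_mem by (intro OH.vsum_cong Pi_I OH.mult_in OH.star_closed) (simp_all only: v lessThan_iff e_in)
      moreover have "(\<Oplus>\<^bsub>operators H\<^esub>i\<in>{..<n}. v k i \<otimes>\<^bsub>operators H\<^esub> star (operators H) (v l i)) =
          (\<Oplus>\<^bsub>operators H\<^esub>i\<in>{..<n}. p k (e i) \<otimes>\<^bsub>operators H\<^esub> star (operators H) (p l (e i)))"
        if "k < n" "l < n" for k l
        using that vin R.rho_mem by (intro OH.vsum_cong Pi_I OH.mult_in OH.star_closed) (simp_all only: v lessThan_iff e_in)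
      ultimately show ?thesis
        using vin unfolding unitary_matrix_def R.columns_def R.rows_def by simp
    qed
    then show ?thesis
      using R.unitary_iff preserves_psi_iff[OF co] comultiplicative_iff[OF co] by blast
  qed
  show ?thesis
    unfolding quantum_automorphism_def qut_data_def quantum_function_iff hom A
    using U P H.fd_hilbert_space_axioms by blast
qed

end

text \<open>The map \<open>b \<otimes> h \<mapsto> \<Sum>\<^sub>k \<rho>\<^sub>k(b) h \<otimes> e\<^sub>k\<close> attached to a matrix of operators.\<close>

definition (in quantum_graph_basis) matrix_action ::
  "'h hilbert \<Rightarrow> (nat \<Rightarrow> nat \<Rightarrow> 'h \<Rightarrow> 'h) \<Rightarrow> ('b, 'h) tens \<Rightarrow> ('h, 'b) tens" where
  "matrix_action H v = (\<lambda>t\<in>carrier (B \<otimes>\<^sub>T H). tensor_lift (H \<otimes>\<^sub>T B)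
     (\<lambda>b h. \<Oplus>\<^bsub>H \<otimes>\<^sub>T B\<^esub>k\<in>{..<n}. simple_tensor H B (rho (operators H) v k b h) (e k)) t)"

context quantum_graph_basis
begin

lemma
  fixes H :: "'h hilbert"
  assumes H: "fd_hilbert_space H" and v: "\<And>k i. k < n \<Longrightarrow> i < n \<Longrightarrow> v k i \<in> linear_maps H H"
  shows matrix_action_linear: "matrix_action H v \<in> linear_maps (B \<otimes>\<^sub>T H) (H \<otimes>\<^sub>T B)"
    and action_coeff_matrix_action: "k < n \<Longrightarrow> b \<in> carrier B \<Longrightarrow> action_coeff H (matrix_action H v) k b = rho (operators H) v k b"
proof -
  interpret H: fd_hilbert_space H by fact
  interpret OH: unital_star_algebra "operators H" by (rule H.unital_star_algebra_operators)
  note hs = H.complex_space_axioms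
  interpret HB: tensor_factors H B by (intro tensor_factors.intro hs B_space)
  have r: "rho (operators H) v k b \<in> linear_maps H H" if "k < n" for k b
    using rho_in[OF OH.complex_space_axioms, of v k b] v that by simp
  note rl = rho_linear[OF OH.complex_space_axioms]
  have left: "clinear B H (\<lambda>b. rho (operators H) v k b h)" if k: "k < n" and h: "h \<in> carrier H" for k h
  proof (rule clinear_compose[of B "operators H" "rho (operators H) v k" H "\<lambda>T. T h"])
    show "clinear B (operators H) (rho (operators H) v k)" using v k by (intro rl) auto
    show "clinear (operators H) H (\<lambda>T. T h)" using h linear_mapsD(2) by (intro clinearI) auto
  qed
  let ?\<beta> = "\<lambda>b h. \<Oplus>\<^bsub>H \<otimes>\<^sub>T B\<^esub>k\<in>{..<n}. simple_tensor H B (rho (operators H) v k b h) (e k)"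
  have b: "cbilinear B H (H \<otimes>\<^sub>T B) ?\<beta>"
    using r left by (intro cbilinearI clinear_finsum_fun hs B_space HB.T.complex_space_axioms
        clinear_compose[OF linear_mapsD(1)[OF r] HB.simple_tensor_linear(2)]
        clinear_compose[OF left HB.simple_tensor_linear(2)]) auto
  note lift = clinear_tensor_lift[OF B_space hs HB.T.complex_space_axioms b]
    and lift_simple = tensor_lift_simple[OF B_space hs HB.T.complex_space_axioms b]
  show P: "matrix_action H v \<in> linear_maps (B \<otimes>\<^sub>T H) (H \<otimes>\<^sub>T B)"
    unfolding matrix_action_def by (intro linear_maps_restrict lift complex_space_tensor B_space hs)
  interpret Q: quantum_graph_action B \<psi> A n e H "matrix_action H v"
    by (intro quantum_graph_action.intro quantum_graph_basis_axioms H quantum_graph_action_axioms.intro P)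
  show "action_coeff H (matrix_action H v) k b = rho (operators H) v k b" if k: "k < n" and bb: "b \<in> carrier B"
  proof (rule linear_maps_eqI[OF Q.p_in[OF k bb] r[OF k]])
    fix h assume h: "h \<in> carrier H"
    have "action_coeff H (matrix_action H v) k b h = rslice H (co k) (?\<beta> b h)"
      unfolding Q.p_apply[OF h] using h bb
      by (simp add: matrix_action_def lift_simple Q.BH.simple_tensor_in)
    also have "\<dots> = (\<Oplus>\<^bsub>H\<^esub>m\<in>{..<n}. co k (e m) \<odot>\<^bsub>H\<^esub> rho (operators H) v m b h)"
      using linear_mapsD(2)[OF r h] by (intro rslice_finsum_simple hs B_space co_linear k) auto
    also have "\<dots> = (\<Oplus>\<^bsub>H\<^esub>m\<in>{..<n}. (if k = m then 1 else 0) \<odot>\<^bsub>H\<^esub> rho (operators H) v m b h)"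
      using linear_mapsD(2)[OF r h] k by (intro H.vsum_cong) auto
    also have "\<dots> = rho (operators H) v k b h"
      using linear_mapsD(2)[OF r h] k by (intro H.finsum_delta') auto
    finally show "action_coeff H (matrix_action H v) k b h = rho (operators H) v k b h" .
  qed
qed

lemma action_eqI:
  fixes H :: "'h hilbert"
  assumes "quantum_graph_action B \<psi> A n e H P" "quantum_graph_action B \<psi> A n e H P'"
    and eq: "\<And>k b. k < n \<Longrightarrow> b \<in> carrier B \<Longrightarrow> action_coeff H P k b = action_coeff H P' k b"
  shows "P = P'"
proof -
  interpret P: quantum_graph_action B \<psi> A n e H P by fact
  interpret P': quantum_graph_action B \<psi> A n e H P' by fact
  show ?thesis
  proof (rule linear_maps_eqI[OF P.P P'.P])
    fix t assume t: "t \<in> carrier (B \<otimes>\<^sub>T H)"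
    show "P t = P' t"
    proof (rule clinear_tensor_eqI[OF B_space P.H_space P.P_linear P'.P_linear t])
      fix b h assume b: "b \<in> carrier B" and h: "h \<in> carrier H"
      show "P (simple_tensor B H b h) = P' (simple_tensor B H b h)"
        unfolding P.P_simple[OF b h] P'.P_simple[OF b h] using b h eq
        by (intro P.HB.T.vsum_cong) auto
    qed
  qed
qed

text \<open>Both sides are compared through their slices at \<open>e\<^sub>k\<close>.\<close>

lemma action_intertwiner_iff:
  fixes H K :: "'h hilbert"
  assumes "quantum_graph_action B \<psi> A n e H P" "quantum_graph_action B \<psi> A n e K P'"
    and f: "clinear H K f"
  shows "(\<forall>t\<in>carrier (B \<otimes>\<^sub>T H). tensor_map K B f (\<lambda>b. b) (P t) = P' (tensor_map B K (\<lambda>b. b) f t)) \<longleftrightarrow>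
    (\<forall>k<n. \<forall>b\<in>carrier B. \<forall>h\<in>carrier H. f (action_coeff H P k b h) = action_coeff K P' k b (f h))"
    (is "?L \<longleftrightarrow> ?R")
proof -
  interpret P: quantum_graph_action B \<psi> A n e H P by fact
  interpret P': quantum_graph_action B \<psi> A n e K P' by fact
  note m1 = P.H_space B_space P'.H_space B_space f clinear_id
    and m2 = B_space P.H_space B_space P'.H_space clinear_id f
  note fin = clinear_in[OF f]
  note l1 = clinear_compose[OF P.P_linear clinear_tensor_map[OF m1]]
    and l2 = clinear_compose[OF clinear_tensor_map[OF m2] P'.P_linear]
  have s: "rslice K (co k) (tensor_map K B f (\<lambda>b. b) t) = f (rslice H (co k) t)"
    if k: "k < n" and t: "t \<in> carrier (H \<otimes>\<^sub>T B)" for k t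
  proof (rule clinear_tensor_eqI[OF P.H_space B_space _ _ t])
    show "clinear (H \<otimes>\<^sub>T B) K (\<lambda>t. rslice K (co k) (tensor_map K B f (\<lambda>b. b) t))"
      by (rule clinear_compose[OF clinear_tensor_map[OF m1]
            clinear_rslice[OF P'.H_space B_space co_linear[OF k]]])
    show "clinear (H \<otimes>\<^sub>T B) K (\<lambda>t. f (rslice H (co k) t))"
      by (rule clinear_compose[OF clinear_rslice[OF P.H_space B_space co_linear[OF k]] f])
  qed (simp add: tensor_map_simple[OF m1] rslice_simple[OF P.H_space B_space co_linear[OF k]]
      rslice_simple[OF P'.H_space B_space co_linear[OF k]] fin clinear_smult[OF f])
  have "?L \<longleftrightarrow> (\<forall>b\<in>carrier B. \<forall>h\<in>carrier H. tensor_map K B f (\<lambda>b. b) (P (simple_tensor B H b h)) =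
      P' (tensor_map B K (\<lambda>b. b) f (simple_tensor B H b h)))"
    using clinear_tensor_eqI[OF B_space P.H_space l1 l2] P.BH.simple_tensor_in by blast
  also have "\<dots> \<longleftrightarrow> (\<forall>b\<in>carrier B. \<forall>h\<in>carrier H. \<forall>k<n. f (action_coeff H P k b h) = action_coeff K P' k b (f h))"
  proof (intro ball_cong refl)
    fix b h assume b: "b \<in> carrier B" and h: "h \<in> carrier H"
    note Pin = P.P_simple_in[OF b h] and P'in = P'.P_simple_in[OF b fin[OF h]]
    have tin: "tensor_map K B f (\<lambda>b. b) (P (simple_tensor B H b h)) \<in> carrier (K \<otimes>\<^sub>T B)"
      by (intro clinear_in[OF clinear_tensor_map[OF m1]] Pin)
    have "tensor_map K B f (\<lambda>b. b) (P (simple_tensor B H b h)) = P' (simple_tensor B K b (f h)) \<longleftrightarrow>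
        (\<forall>k<n. rslice K (co k) (tensor_map K B f (\<lambda>b. b) (P (simple_tensor B H b h))) =
          rslice K (co k) (P' (simple_tensor B K b (f h))))"
      using rslice_eqI[OF P'.H_space B_space coords tin P'in] by auto
    then show "tensor_map K B f (\<lambda>b. b) (P (simple_tensor B H b h)) =
          P' (tensor_map B K (\<lambda>b. b) f (simple_tensor B H b h)) \<longleftrightarrow>
        (\<forall>k<n. f (action_coeff H P k b h) = action_coeff K P' k b (f h))"
      using b h fin by (simp add: tensor_map_simple[OF m2] s Pin P.p_apply P'.p_apply)
  qed
  finally show ?thesis by blast
qed

end

lemma is_category_Rep_fin:
  fixes C :: "'c cstar_algebra"
  shows "is_category (Rep_fin C :: ('h hilbert \<times> ('c \<Rightarrow> 'h \<Rightarrow> 'h), 'h \<Rightarrow> 'h) category)"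
proof -
  have comp: "compose (carrier H) g f \<in> linear_maps H L"
    if "complex_space H" "f \<in> linear_maps H K" "g \<in> linear_maps K L" for H K L :: "'h hilbert" and f g
    unfolding compose_def using that
    by (intro linear_maps_restrict[OF clinear_compose[of H K f L g]]) (auto dest: linear_mapsD(1))
  have ident: "(\<lambda>x\<in>carrier H. x) \<in> linear_maps H H" if "complex_space H" for H :: "'h hilbert"
    using linear_maps_restrict[OF clinear_id that] .
  have unit: "compose (carrier H) f (\<lambda>x\<in>carrier H. x) = f" "compose (carrier H) (\<lambda>x\<in>carrier K. x) f = f"
    if "f \<in> linear_maps H K" for H K :: "'h hilbert" and f
    using that linear_mapsD(2)[OF that] by (auto simp: linear_maps_def compose_def extensional_def fun_eq_iff)
  have assoc: "compose (carrier W) (compose (carrier X) h g) f = compose (carrier W) h (compose (carrier W) g f)"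
    if "f \<in> linear_maps W X" for W X :: "'h hilbert" and f g h
    using linear_mapsD(2)[OF that] by (auto simp: compose_def fun_eq_iff)
  have op: "\<pi> c x \<in> carrier H" if "\<pi> \<in> star_hom C (operators H)" "c \<in> carrier C" "x \<in> carrier H"
    for H :: "'h hilbert" and \<pi> c x
  proof -
    have "\<pi> c \<in> linear_maps H H"
      using that(1,2) by (auto simp: star_hom_iff star_morphism_def dest: clinear_in)
    then show ?thesis using that(3) by (rule linear_mapsD(2))
  qed
  show ?thesis
    unfolding is_category_def Rep_fin_def
    using comp ident unit assoc op
    by (auto simp: compose_eq linear_mapsD(2) fd_hilbert_space_complex_space)
qed

text \<open>A bijection on objects that preserves the sets of arrows transports the category structure.\<close>

lemma isomorphic_categories_if_same_arrows:
  assumes C: "is_category C" and F: "bij_betw F (Obj C) (Obj D)"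
    and Arr: "\<And>X Y. X \<in> Obj C \<Longrightarrow> Y \<in> Obj C \<Longrightarrow> Arr D (F X) (F Y) = Arr C X Y"
    and Comp: "\<And>X Y Z. X \<in> Obj C \<Longrightarrow> Y \<in> Obj C \<Longrightarrow> Z \<in> Obj C \<Longrightarrow>
      Comp D (F X) (F Y) (F Z) = Comp C X Y Z"
    and Ident: "\<And>X. X \<in> Obj C \<Longrightarrow> Ident D (F X) = Ident C X"
  shows "isomorphic_categories C D"
proof -
  have D: "Obj D = F ` Obj C" using F by (simp add: bij_betw_def)
  have "is_category D"
    using C unfolding is_category_def D by (simp add: Arr Comp Ident)
  moreover have "is_functor C D F (\<lambda>X Y f. f)"
    by (auto simp: is_functor_def D Arr Comp Ident)
  moreover have "\<forall>X\<in>Obj C. \<forall>Y\<in>Obj C. bij_betw (\<lambda>f. f) (Arr C X Y) (Arr D (F X) (F Y))"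
    by (simp add: Arr bij_betw_def inj_on_def)
  ultimately show ?thesis
    using C F unfolding isomorphic_categories_def by blast
qed

theorem theorem2p43:
  fixes B :: "'b cstar_algebra" and \<psi> :: "'b \<Rightarrow> complex" and A :: "'b \<Rightarrow> 'b"
    and n :: nat and e :: "nat \<Rightarrow> 'b"
    and C :: "'c cstar_algebra" and u :: "nat \<Rightarrow> nat \<Rightarrow> 'c"
  assumes "quantum_graph B \<psi> A"
    and "orthonormal_basis (L2 B \<psi>) n e"
    and "is_Qut_algebra B \<psi> A n e C u"
  shows "isomorphic_categories
    (Rep_fin C :: ('h hilbert \<times> ('c \<Rightarrow> 'h \<Rightarrow> 'h), 'h \<Rightarrow> 'h) category)
    (QAut B \<psi> A :: ('h hilbert \<times> (('b, 'h) tens \<Rightarrow> ('h, 'b) tens), 'h \<Rightarrow> 'h) category)"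
proof -
  interpret quantum_graph_basis B \<psi> A n e by standard fact+
  note Q = assms(3)
  interpret C: unital_cstar_algebra C using Q by (simp add: is_Qut_algebra_def)
  have qC: "qut_data C u"
    using Q Qut_relations_iff[OF C.unital_cstar_algebra_axioms, of u] by (simp add: is_Qut_algebra_def)
  note u = qut_dataD(4)[OF qC]
  let ?v = "\<lambda>(\<pi> :: 'c \<Rightarrow> 'h \<Rightarrow> 'h) k i. \<pi> (u k i)"
  \<comment> \<open>The functor on objects; a representation enters only through the images of the generators.\<close>
  define F where "F X = (fst X, matrix_action (fst X) (?v (snd X)))" for X :: "'h hilbert \<times> ('c \<Rightarrow> 'h \<Rightarrow> 'h)"
  let ?Rep = "Rep_fin C :: ('h hilbert \<times> ('c \<Rightarrow> 'h \<Rightarrow> 'h), 'h \<Rightarrow> 'h) category"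
  let ?QAut = "QAut B \<psi> A :: ('h hilbert \<times> (('b, 'h) tens \<Rightarrow> ('h, 'b) tens), 'h \<Rightarrow> 'h) category"
  have rep: "fd_hilbert_space (fst X)" "snd X \<in> star_hom C (operators (fst X))" if "X \<in> Obj ?Rep" for X
    using that by (auto simp: Rep_fin_def)
  have qv: "qut_data (operators (fst X)) (?v (snd X))" if "X \<in> Obj ?Rep" for X
    using rep[OF that]
    by (intro qut_data_image[OF C.unital_star_algebra_axioms _ _ qC]
        fd_hilbert_space.unital_star_algebra_operators) (simp_all add: star_hom_iff)
  have v: "k < n \<Longrightarrow> i < n \<Longrightarrow> ?v (snd X) k i \<in> linear_maps (fst X) (fst X)" if "X \<in> Obj ?Rep" for X k i
    using qut_dataD(4)[OF qv[OF that]] by simp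
  have act: "quantum_graph_action B \<psi> A n e (fst X) (snd (F X))" if "X \<in> Obj ?Rep" for X
    unfolding F_def snd_conv
    by (intro quantum_graph_action.intro quantum_graph_basis_axioms rep(1)[OF that]
        quantum_graph_action_axioms.intro matrix_action_linear[OF rep(1)[OF that]] v[OF that])
  have action_coeff: "action_coeff (fst X) (snd (F X)) k b = rho (operators (fst X)) (?v (snd X)) k b"
    if "X \<in> Obj ?Rep" "k < n" "b \<in> carrier B" for X k b
    unfolding F_def snd_conv by (rule action_coeff_matrix_action[OF rep(1)[OF that(1)] v[OF that(1)] that(2,3)])
  have action_coeff_e: "action_coeff (fst X) (snd (F X)) k (e i) = snd X (u k i)" if X: "X \<in> Obj ?Rep" and ki: "k < n" "i < n"
    for X k i
  proof -
    interpret H: fd_hilbert_space "fst X" by (rule rep(1)[OF X])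
    interpret O: unital_star_algebra "operators (fst X)" by (rule H.unital_star_algebra_operators)
    show ?thesis
      using action_coeff[OF X ki(1) e_in[OF ki(2)]] rho_e[OF O.complex_space_axioms, of "?v (snd X)" k i] v[OF X] ki
      by simp
  qed
  have bij: "bij_betw F (Obj ?Rep) (Obj ?QAut)"
  proof (rule bij_betw_imageI)
    show "inj_on F (Obj ?Rep)"
    proof (rule inj_onI)
      fix X Y assume X: "X \<in> Obj ?Rep" and Y: "Y \<in> Obj ?Rep" and eq: "F X = F Y"
      have H: "fst X = fst Y" using eq by (simp add: F_def)
      have "snd X (u k i) = snd Y (u k i)" if "k < n" "i < n" for k i
        using action_coeff_e[OF X that] action_coeff_e[OF Y that] eq H by simp
      then have "snd X = snd Y"
        using representation_unique[OF Q rep(1)[OF X], of "snd X" "snd Y"] rep(2)[OF X] rep(2)[OF Y] H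
        by simp
      with H show "X = Y" by (simp add: prod_eq_iff)
    qed
    show "F ` Obj ?Rep = Obj ?QAut"
    proof (intro equalityI subsetI)
      fix Z assume "Z \<in> F ` Obj ?Rep"
      then obtain X where X: "X \<in> Obj ?Rep" "Z = F X" by blast
      interpret P: quantum_graph_action B \<psi> A n e "fst X" "snd (F X)" by (rule act[OF X(1)])
      have "quantum_automorphism B \<psi> A (fst X) (snd (F X))"
        using P.quantum_automorphism_iff[of "?v (snd X)"] action_coeff_e[OF X(1)] qv[OF X(1)] by simp
      then show "Z \<in> Obj ?QAut" by (simp add: X(2) QAut_def F_def)
    next
      fix Z assume "Z \<in> Obj ?QAut"
      then obtain H P where Z: "Z = (H, P)" and aut: "quantum_automorphism B \<psi> A H P"
        by (auto simp: QAut_def)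
      have H: "fd_hilbert_space H" and "P \<in> linear_maps (B \<otimes>\<^sub>T H) (H \<otimes>\<^sub>T B)"
        using aut by (auto simp: quantum_automorphism_def)
      then have actP: "quantum_graph_action B \<psi> A n e H P"
        by (intro quantum_graph_action.intro quantum_graph_basis_axioms quantum_graph_action_axioms.intro)
      interpret P: quantum_graph_action B \<psi> A n e H P by (rule actP)
      let ?w = "\<lambda>k i. action_coeff H P k (e i)"
      have "qut_data (operators H) ?w" using P.quantum_automorphism_iff[of ?w] aut by simp
      then obtain \<pi> where \<pi>: "\<pi> \<in> star_hom C (operators H)"
        and \<pi>u: "\<And>k i. k < n \<Longrightarrow> i < n \<Longrightarrow> \<pi> (u k i) = ?w k i"
        using representation_exists[OF Q H, of ?w] by blast
      have X: "(H, \<pi>) \<in> Obj ?Rep" using H \<pi> by (simp add: Rep_fin_def)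
      have "snd (F (H, \<pi>)) = P"
      proof (rule action_eqI)
        show "quantum_graph_action B \<psi> A n e H (snd (F (H, \<pi>)))" using act[OF X] by simp
        show "quantum_graph_action B \<psi> A n e H P" by (rule actP)
        fix k b assume k: "k < n" and b: "b \<in> carrier B"
        have "action_coeff H (snd (F (H, \<pi>))) k b = rho (operators H) (?v \<pi>) k b"
          using action_coeff[OF X k b] by simp
        also have "\<dots> = action_coeff H P k b"
          using \<pi>u k b by (intro rho_eq P.OH.complex_space_axioms P.p_linear) auto
        finally show "action_coeff H (snd (F (H, \<pi>))) k b = action_coeff H P k b" .
      qed
      then have "F (H, \<pi>) = Z" by (simp add: Z F_def)
      with X show "Z \<in> F ` Obj ?Rep" by blast
    qed
  qed
  have arr: "Arr ?QAut (F X) (F Y) = Arr ?Rep X Y" if X: "X \<in> Obj ?Rep" and Y: "Y \<in> Obj ?Rep" for X Y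
  proof -
    obtain H \<pi> where XX: "X = (H, \<pi>)" by (cases X)
    obtain K \<pi>' where YY: "Y = (K, \<pi>')" by (cases Y)
    have H: "fd_hilbert_space H" and K: "fd_hilbert_space K" and \<pi>: "\<pi> \<in> star_hom C (operators H)"
      and \<pi>': "\<pi>' \<in> star_hom C (operators K)"
      using rep[OF X] rep[OF Y] by (simp_all add: XX YY)
    let ?P = "snd (F X)" and ?P' = "snd (F Y)"
    have actX: "quantum_graph_action B \<psi> A n e H ?P" and actY: "quantum_graph_action B \<psi> A n e K ?P'"
      using act[OF X] act[OF Y] by (simp_all add: XX YY)
    have "(\<forall>t\<in>carrier (B \<otimes>\<^sub>T H). tensor_map K B f (\<lambda>b. b) (?P t) = ?P' (tensor_map B K (\<lambda>b. b) f t)) \<longleftrightarrow>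
        (\<forall>c\<in>carrier C. \<forall>h\<in>carrier H. f (\<pi> c h) = \<pi>' c (f h))" if f: "f \<in> linear_maps H K" for f
    proof -
      note fl = linear_mapsD(1)[OF f]
      have "(\<forall>k<n. \<forall>b\<in>carrier B. \<forall>h\<in>carrier H. f (action_coeff H ?P k b h) = action_coeff K ?P' k b (f h)) \<longleftrightarrow>
          (\<forall>c\<in>carrier C. \<forall>h\<in>carrier H. f (\<pi> c h) = \<pi>' c (f h))" (is "?L \<longleftrightarrow> ?R")
      proof
        assume L: ?L
        have "f (\<pi> (u k i) h) = \<pi>' (u k i) (f h)" if "k < n" "i < n" "h \<in> carrier H" for k i h
        proof -
          have "f (action_coeff H ?P k (e i) h) = action_coeff K ?P' k (e i) (f h)" using L that e_in by blast
          moreover have "action_coeff H ?P k (e i) = \<pi> (u k i)" "action_coeff K ?P' k (e i) = \<pi>' (u k i)"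
            using that action_coeff_e[OF X, of k i] action_coeff_e[OF Y, of k i] by (simp_all add: XX YY)
          ultimately show ?thesis by (simp only:)
        qed
        then show ?R
          using intertwines_all[OF Q H K \<pi> \<pi>' fl] by blast
      next
        assume R: ?R
        show ?L
        proof (intro allI impI ballI)
          fix k b h assume k: "k < n" and b: "b \<in> carrier B" and h: "h \<in> carrier H"
          have "f (rho (operators H) (?v \<pi>) k b h) = rho (operators K) (?v \<pi>') k b (f h)"
            using R u[OF k] v[OF X k] v[OF Y k] by (intro intertwines_rho[OF H K fl _ _ _ h]) (auto simp: XX YY)
          then show "f (action_coeff H ?P k b h) = action_coeff K ?P' k b (f h)"
            using action_coeff[OF X k b] action_coeff[OF Y k b] by (simp add: XX YY)
        qed
      qed
      then show ?thesis using action_intertwiner_iff[OF actX actY fl] by simp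
    qed
    then show ?thesis
      by (auto simp: Rep_fin_def QAut_def XX YY F_def)
  qed
  show ?thesis
  proof (rule isomorphic_categories_if_same_arrows[OF is_category_Rep_fin bij arr])
    show "Comp ?QAut (F X) (F Y) (F Z) = Comp ?Rep X Y Z" for X Y Z
      by (simp add: Rep_fin_def QAut_def F_def)
    show "Ident ?QAut (F X) = Ident ?Rep X" for X
      by (simp add: Rep_fin_def QAut_def F_def)
  qed
qed

end
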